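(* Let $(\mathbf{M}^n,g)$ be an $n$-dimensional complete Riemannian manifold, $V$ a $C^1$ vector field, and suppose $Ric_V^m\ge0$ for some $m>n$. Let $N$ be a natural number, $p_1<\dots<p_N$ real numbers with $p_i\le1$ and $a_1,\dots,a_N$ real numbers with $a_i\ge0$ for $i=1,\dots,N$. Let $u(x,t)$ be a smooth positive solution of $$\partial_t u=\Delta_V u+\sum_{i=1}^Na_iu^{p_i}$$ on $\mathbf{M}^n\times(0,\infty)$ and put $f:=\ln u$. Suppose that one of the following holds: (i) $\mathbf{M}^n$ is complete (without boundary); (ii) $\mathbf{M}^n$ is compact with convex boundary and $u$ satisfies the Neumann condition $\frac{\partial u}{\partial\mathbf{n}}=0$ on $\partial\mathbf{M}^n$, where $\mathbf{n}$ is the unit outer normal. Then $$\Delta_Vf+\frac{m}{2t}\ge0\qquad\text{on }\mathbf{M}^n\times(0,\infty).$$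
   Context: Notation: $\Delta_V u:=\Delta u+\langle V,\nabla u\rangle$; $Ric_V:=Ric-\frac12 L_Vg$ and, for $m>n$, $Ric_V^m:=Ric_V-\frac{1}{m-n}V^\flat\otimes V^\flat$, where $L_Vg$ is the Lie derivative of the metric and $V^\flat$ is the $1$-form dual to $V$. *)

theory Defs
  imports "HOL-Analysis.Analysis"
begin

section \<open>Differentiability of class C-k on subsets of Euclidean space\<close>

text \<open>Below, \<open>S\<close> is always a relatively open subset of a Euclidean space, of a closed half-space,
  or of the product of such a set with an open interval.  The derivative within such a set is unique, so
  the definition is the usual one in the interior and uses one-sided derivatives at the boundary.\<close>

primrec Ck_on :: "nat \<Rightarrow> 'e::euclidean_space set \<Rightarrow> ('e \<Rightarrow> 'f::real_normed_vector) \<Rightarrow> bool" where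
  "Ck_on 0 S f \<longleftrightarrow> continuous_on S f"
| "Ck_on (Suc k) S f \<longleftrightarrow> f differentiable_on S \<and>
     (\<forall>e\<in>Basis. Ck_on k S (\<lambda>x. frechet_derivative f (at x within S) e))"

definition smooth_on :: "'e::euclidean_space set \<Rightarrow> ('e \<Rightarrow> 'f::real_normed_vector) \<Rightarrow> bool" where
  "smooth_on S f \<longleftrightarrow> (\<forall>k. Ck_on k S f)"

definition pd :: "(real^'n) set \<Rightarrow> 'n::finite \<Rightarrow> (real^'n \<Rightarrow> real) \<Rightarrow> real^'n \<Rightarrow> real" where
  "pd S i f y = frechet_derivative f (at y within S) (axis i 1)"


section \<open>Smooth manifolds with (possibly empty) boundary\<close>

text \<open>The underlying space of the manifold is the type \<open>'a\<close>, a Hausdorff second countable space;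
  its dimension is \<open>CARD('n)\<close>.  The coordinate \<open>b\<close> is the one that is nonnegative in the model
  half-space.\<close>

record ('a, 'n) chart =
  cdom :: "'a set"
  cmap :: "'a \<Rightarrow> real^'n"

definition cimg :: "('a, 'n::finite) chart \<Rightarrow> (real^'n) set" where
  "cimg c = cmap c ` cdom c"

definition cinv :: "('a, 'n::finite) chart \<Rightarrow> real^'n \<Rightarrow> 'a" where
  "cinv c = inv_into (cdom c) (cmap c)"

definition half_space :: "'n::finite \<Rightarrow> (real^'n) set" where
  "half_space b = {y. 0 \<le> y $ b}"

definition is_chart :: "'n::finite \<Rightarrow> ('a::topological_space, 'n) chart \<Rightarrow> bool" where
  "is_chart b c \<longleftrightarrow> open (cdom c) \<and> homeomorphism (cdom c) (cimg c) (cmap c) (cinv c) \<and>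
     (open (cimg c) \<or> openin (top_of_set (half_space b)) (cimg c))"

definition overlap :: "('a, 'n::finite) chart \<Rightarrow> ('a, 'n) chart \<Rightarrow> (real^'n) set" where
  "overlap c d = cmap c ` (cdom c \<inter> cdom d)"

definition transition :: "('a, 'n::finite) chart \<Rightarrow> ('a, 'n) chart \<Rightarrow> real^'n \<Rightarrow> real^'n" where
  "transition c d = cmap d \<circ> cinv c"

definition jacobian_cd :: "('a, 'n::finite) chart \<Rightarrow> ('a, 'n) chart \<Rightarrow> real^'n \<Rightarrow> real^'n^'n" where
  "jacobian_cd c d y = matrix (frechet_derivative (transition c d) (at y within overlap c d))"

definition smooth_atlas :: "'n::finite \<Rightarrow> ('a::topological_space, 'n) chart set \<Rightarrow> bool" where
  "smooth_atlas b A \<longleftrightarrow> (\<forall>c\<in>A. is_chart b c) \<and> (\<Union>c\<in>A. cdom c) = UNIV \<and>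
     (\<forall>c\<in>A. \<forall>d\<in>A. smooth_on (overlap c d) (transition c d))"

definition charts_at :: "('a, 'n::finite) chart set \<Rightarrow> 'a \<Rightarrow> ('a, 'n) chart set" where
  "charts_at A x = {c\<in>A. x \<in> cdom c}"

definition mfd_boundary :: "('a, 'n::finite) chart set \<Rightarrow> 'a set" where
  "mfd_boundary A = {x. \<exists>c\<in>charts_at A x. cmap c x \<notin> interior (cimg c)}"


section \<open>Tensor fields and Riemannian metrics\<close>

text \<open>A tensor field is given by its components in each chart of the atlas, as functions of the
  coordinates of that chart, subject to the transformation law.\<close>

type_synonym ('a, 'n) vfield = "('a, 'n) chart \<Rightarrow> real^'n \<Rightarrow> real^'n"
type_synonym ('a, 'n) tensor2 = "('a, 'n) chart \<Rightarrow> real^'n \<Rightarrow> real^'n^'n"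

definition C1_vector_field :: "('a, 'n::finite) chart set \<Rightarrow> ('a, 'n) vfield \<Rightarrow> bool" where
  "C1_vector_field A V \<longleftrightarrow> (\<forall>c\<in>A. Ck_on 1 (cimg c) (V c)) \<and>
     (\<forall>c\<in>A. \<forall>d\<in>A. \<forall>y\<in>overlap c d. V d (transition c d y) = jacobian_cd c d y *v V c y)"

definition riemannian_metric :: "('a, 'n::finite) chart set \<Rightarrow> ('a, 'n) tensor2 \<Rightarrow> bool" where
  "riemannian_metric A g \<longleftrightarrow>
     (\<forall>c\<in>A. smooth_on (cimg c) (g c)) \<and>
     (\<forall>c\<in>A. \<forall>y\<in>cimg c. transpose (g c y) = g c y \<and> (\<forall>v. v \<noteq> 0 \<longrightarrow> 0 < v \<bullet> (g c y *v v))) \<and>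
     (\<forall>c\<in>A. \<forall>d\<in>A. \<forall>y\<in>overlap c d.
        g c y = transpose (jacobian_cd c d y) ** g d (transition c d y) ** jacobian_cd c d y)"

definition riemannian_manifold ::
    "'n::finite \<Rightarrow> ('a::{t2_space,second_countable_topology}, 'n) chart set \<Rightarrow> ('a, 'n) tensor2 \<Rightarrow> bool"
  where
  "riemannian_manifold b A g \<longleftrightarrow> smooth_atlas b A \<and> riemannian_metric A g"


section \<open>Riemannian distance and completeness\<close>

definition piecewise_C1_curve :: "('a::topological_space, 'n::finite) chart set \<Rightarrow> (real \<Rightarrow> 'a) \<Rightarrow> bool" where
  "piecewise_C1_curve A \<gamma> \<longleftrightarrow> continuous_on {0..1} \<gamma> \<and>
     (\<exists>F. finite F \<and>
        (\<forall>c\<in>A. (cmap c \<circ> \<gamma>) C1_differentiable_on {s. s \<in> {0<..<1} - F \<and> \<gamma> s \<in> cdom c}))"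

text \<open>The speed does not depend on the chart chosen at \<open>\<gamma> s\<close>, by the transformation law of \<open>g\<close>.\<close>

definition speed :: "('a, 'n::finite) chart set \<Rightarrow> ('a, 'n) tensor2 \<Rightarrow> (real \<Rightarrow> 'a) \<Rightarrow> real \<Rightarrow> real" where
  "speed A g \<gamma> s =
     (let c = (SOME c. c \<in> charts_at A (\<gamma> s)); v = vector_derivative (cmap c \<circ> \<gamma>) (at s)
      in sqrt (v \<bullet> (g c (cmap c (\<gamma> s)) *v v)))"

definition curve_length :: "('a, 'n::finite) chart set \<Rightarrow> ('a, 'n) tensor2 \<Rightarrow> (real \<Rightarrow> 'a) \<Rightarrow> ennreal" where
  "curve_length A g \<gamma> = (\<integral>\<^sup>+ s \<in> {0..1}. ennreal (speed A g \<gamma> s) \<partial>lborel)"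

text \<open>Points in different components have distance \<open>\<infinity>\<close>, the infimum of the empty set.\<close>

definition riem_dist ::
    "('a::topological_space, 'n::finite) chart set \<Rightarrow> ('a, 'n) tensor2 \<Rightarrow> 'a \<Rightarrow> 'a \<Rightarrow> ennreal" where
  "riem_dist A g x y =
     Inf (curve_length A g ` {\<gamma>. piecewise_C1_curve A \<gamma> \<and> \<gamma> 0 = x \<and> \<gamma> 1 = y})"

definition riem_complete :: "('a::topological_space, 'n::finite) chart set \<Rightarrow> ('a, 'n) tensor2 \<Rightarrow> bool" where
  "riem_complete A g \<longleftrightarrow>
     (\<forall>X :: nat \<Rightarrow> 'a.
        (\<forall>e>0. \<exists>K. \<forall>i\<ge>K. \<forall>j\<ge>K. riem_dist A g (X i) (X j) < ennreal e) \<longrightarrow>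
        (\<exists>x. (\<lambda>i. riem_dist A g (X i) x) \<longlonglongrightarrow> 0))"


section \<open>Tensor calculus in coordinates\<close>

text \<open>Here \<open>S\<close> is the image of a chart and \<open>G\<close>, \<open>W\<close>, \<open>h\<close> are the coordinate expressions of the
  metric, of a vector field and of a function.\<close>

definition christoffel ::
    "(real^'n) set \<Rightarrow> (real^'n \<Rightarrow> real^'n^'n) \<Rightarrow> 'n::finite \<Rightarrow> 'n \<Rightarrow> 'n \<Rightarrow> real^'n \<Rightarrow> real" where
  "christoffel S G k i j y =
     (\<Sum>l\<in>UNIV. matrix_inv (G y) $ k $ l *
        (pd S i (\<lambda>z. G z $ j $ l) y + pd S j (\<lambda>z. G z $ i $ l) y - pd S l (\<lambda>z. G z $ i $ j) y)) / 2"

text \<open>\<open>riemann S G l k i j\<close> is the \<open>l\<close>-th component of \<open>R(\<partial>\<^sub>i,\<partial>\<^sub>j)\<partial>\<^sub>k\<close>, where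
  \<open>R(X,Y)Z = \<nabla>\<^sub>X\<nabla>\<^sub>YZ - \<nabla>\<^sub>Y\<nabla>\<^sub>XZ - \<nabla>\<^bsub>[X,Y]\<^esub>Z\<close>; the Ricci tensor \<open>Ric(Y,Z)\<close> is the trace of
  \<open>X \<mapsto> R(X,Y)Z\<close>, so that round spheres have positive Ricci curvature.\<close>

definition riemann ::
    "(real^'n) set \<Rightarrow> (real^'n \<Rightarrow> real^'n^'n) \<Rightarrow> 'n::finite \<Rightarrow> 'n \<Rightarrow> 'n \<Rightarrow> 'n \<Rightarrow> real^'n \<Rightarrow> real" where
  "riemann S G l k i j y =
     pd S i (christoffel S G l j k) y - pd S j (christoffel S G l i k) y +
     (\<Sum>r\<in>UNIV. christoffel S G l i r y * christoffel S G r j k y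
             - christoffel S G l j r y * christoffel S G r i k y)"

definition ricci ::
    "(real^'n) set \<Rightarrow> (real^'n \<Rightarrow> real^'n^'n) \<Rightarrow> real^'n \<Rightarrow> real^'n^('n::finite)" where
  "ricci S G y = (\<chi> j k. \<Sum>i\<in>UNIV. riemann S G i k i j y)"

definition lie_metric ::
    "(real^'n) set \<Rightarrow> (real^'n \<Rightarrow> real^'n^'n) \<Rightarrow> (real^'n \<Rightarrow> real^'n) \<Rightarrow> real^'n \<Rightarrow> real^'n^('n::finite)" where
  "lie_metric S G W y = (\<chi> i j. \<Sum>k\<in>UNIV.
     W y $ k * pd S k (\<lambda>z. G z $ i $ j) y
     + G y $ k $ j * pd S i (\<lambda>z. W z $ k) y + G y $ i $ k * pd S j (\<lambda>z. W z $ k) y)"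

definition flat :: "(real^'n \<Rightarrow> real^'n^'n) \<Rightarrow> (real^'n \<Rightarrow> real^'n) \<Rightarrow> real^'n \<Rightarrow> real^('n::finite)" where
  "flat G W y = G y *v W y"

definition ricci_V ::
    "(real^'n) set \<Rightarrow> (real^'n \<Rightarrow> real^'n^'n) \<Rightarrow> (real^'n \<Rightarrow> real^'n) \<Rightarrow> real^'n \<Rightarrow> real^'n^('n::finite)" where
  "ricci_V S G W y = ricci S G y - (1/2) *\<^sub>R lie_metric S G W y"

definition ricci_V_m ::
    "real \<Rightarrow> (real^'n) set \<Rightarrow> (real^'n \<Rightarrow> real^'n^'n) \<Rightarrow> (real^'n \<Rightarrow> real^'n) \<Rightarrow> real^'n \<Rightarrow> real^'n^('n::finite)"
  where
  "ricci_V_m m S G W y =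
     ricci_V S G W y
     - (1 / (m - real CARD('n))) *\<^sub>R (\<chi> i j. flat G W y $ i * flat G W y $ j)"

definition gradient ::
    "(real^'n) set \<Rightarrow> (real^'n \<Rightarrow> real^'n^'n) \<Rightarrow> (real^'n \<Rightarrow> real) \<Rightarrow> real^'n \<Rightarrow> real^('n::finite)" where
  "gradient S G h y = matrix_inv (G y) *v (\<chi> i. pd S i h y)"

definition hessian ::
    "(real^'n) set \<Rightarrow> (real^'n \<Rightarrow> real^'n^'n) \<Rightarrow> (real^'n \<Rightarrow> real) \<Rightarrow> real^'n \<Rightarrow> real^'n^('n::finite)" where
  "hessian S G h y =
     (\<chi> i j. pd S i (pd S j h) y - (\<Sum>k\<in>UNIV. christoffel S G k i j y * pd S k h y))"

definition laplacian ::
    "(real^'n) set \<Rightarrow> (real^'n \<Rightarrow> real^'n^'n) \<Rightarrow> (real^'n \<Rightarrow> real) \<Rightarrow> real^('n::finite) \<Rightarrow> real" where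
  "laplacian S G h y = (\<Sum>i\<in>UNIV. \<Sum>j\<in>UNIV. matrix_inv (G y) $ i $ j * hessian S G h y $ i $ j)"

definition laplacian_V ::
    "(real^'n) set \<Rightarrow> (real^'n \<Rightarrow> real^'n^'n) \<Rightarrow> (real^'n \<Rightarrow> real^'n) \<Rightarrow> (real^'n \<Rightarrow> real)
     \<Rightarrow> real^('n::finite) \<Rightarrow> real" where
  "laplacian_V S G W h y = laplacian S G h y + W y \<bullet> (G y *v gradient S G h y)"

text \<open>\<open>outer_normal b G\<close> is \<open>- \<nabla>y\<^sub>b / |\<nabla>y\<^sub>b|\<close>.  At points with \<open>y\<^sub>b = 0\<close> of a chart with values in the
  half-space \<open>y\<^sub>b \<ge> 0\<close> it is the unit outer normal; elsewhere it merely extends it, and the second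
  fundamental form on vectors with vanishing \<open>b\<close>-component does not depend on the extension.\<close>

definition outer_normal :: "'n::finite \<Rightarrow> (real^'n \<Rightarrow> real^'n^'n) \<Rightarrow> real^'n \<Rightarrow> real^'n" where
  "outer_normal b G y = (\<chi> i. - matrix_inv (G y) $ i $ b / sqrt (matrix_inv (G y) $ b $ b))"

definition cov_deriv ::
    "(real^'n) set \<Rightarrow> (real^'n \<Rightarrow> real^'n^'n) \<Rightarrow> real^'n \<Rightarrow> (real^'n \<Rightarrow> real^'n) \<Rightarrow> real^'n \<Rightarrow> real^('n::finite)" where
  "cov_deriv S G \<xi> W y = (\<chi> i. \<Sum>j\<in>UNIV. \<xi> $ j *
     (pd S j (\<lambda>z. W z $ i) y + (\<Sum>l\<in>UNIV. christoffel S G i j l y * W y $ l)))"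

definition second_ff ::
    "'n::finite \<Rightarrow> (real^'n) set \<Rightarrow> (real^'n \<Rightarrow> real^'n^'n) \<Rightarrow> real^'n \<Rightarrow> real^'n \<Rightarrow> real^'n \<Rightarrow> real" where
  "second_ff b S G y \<xi> \<eta> = cov_deriv S G \<xi> (outer_normal b G) y \<bullet> (G y *v \<eta>)"


section \<open>Notions on the manifold\<close>

text \<open>All quantities below are chart independent; conditions on them are imposed in every chart.\<close>

definition nonneg_ricci_V_m ::
    "real \<Rightarrow> ('a, 'n::finite) chart set \<Rightarrow> ('a, 'n) tensor2 \<Rightarrow> ('a, 'n) vfield \<Rightarrow> bool" where
  "nonneg_ricci_V_m m A g V \<longleftrightarrow>
     (\<forall>c\<in>A. \<forall>y\<in>cimg c. \<forall>\<xi>. 0 \<le> \<xi> \<bullet> (ricci_V_m m (cimg c) (g c) (V c) y *v \<xi>))"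

definition Delta_V ::
    "('a, 'n) tensor2 \<Rightarrow> ('a, 'n) vfield \<Rightarrow> ('a, 'n::finite) chart \<Rightarrow> ('a \<Rightarrow> real) \<Rightarrow> 'a \<Rightarrow> real" where
  "Delta_V g V c f x = laplacian_V (cimg c) (g c) (V c) (f \<circ> cinv c) (cmap c x)"

definition normal_deriv ::
    "'n::finite \<Rightarrow> ('a, 'n) tensor2 \<Rightarrow> ('a, 'n) chart \<Rightarrow> ('a \<Rightarrow> real) \<Rightarrow> 'a \<Rightarrow> real" where
  "normal_deriv b g c f x =
     (\<Sum>i\<in>UNIV. outer_normal b (g c) (cmap c x) $ i * pd (cimg c) i (f \<circ> cinv c) (cmap c x))"

definition convex_boundary ::
    "'n::finite \<Rightarrow> ('a, 'n) chart set \<Rightarrow> ('a, 'n) tensor2 \<Rightarrow> bool" where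
  "convex_boundary b A g \<longleftrightarrow>
     (\<forall>x\<in>mfd_boundary A. \<forall>c\<in>charts_at A x. \<forall>\<xi>. \<xi> $ b = 0 \<longrightarrow>
        0 \<le> second_ff b (cimg c) (g c) (cmap c x) \<xi> \<xi>)"

definition neumann ::
    "'n::finite \<Rightarrow> ('a, 'n) chart set \<Rightarrow> ('a, 'n) tensor2 \<Rightarrow> ('a \<Rightarrow> real) \<Rightarrow> bool" where
  "neumann b A g f \<longleftrightarrow> (\<forall>x\<in>mfd_boundary A. \<forall>c\<in>charts_at A x. normal_deriv b g c f x = 0)"

definition smooth_in_space_time :: "('a, 'n::finite) chart set \<Rightarrow> ('a \<Rightarrow> real \<Rightarrow> real) \<Rightarrow> bool" where
  "smooth_in_space_time A u \<longleftrightarrow>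
     (\<forall>c\<in>A. smooth_on (cimg c \<times> {0<..}) (\<lambda>(y, t). u (cinv c y) t))"

end

theory Submission
 imports Defs
begin

text \<open>Write \<open>f = ln u\<close>, \<open>w = |\<nabla>f|\<^sup>2\<close> and \<open>h = \<Sum>\<^sub>i a\<^sub>i exp ((p\<^sub>i - 1) f)\<close>, so that
  \<open>\<Delta>\<^sub>V f = \<partial>\<^sub>t f - w - h\<close>. For small \<open>\<beta> > 0\<close> the function \<open>Q = - \<Delta>\<^sub>V f - \<beta> w\<close> satisfies, wherever it is positive,
  \<open>\<Delta>\<^sub>V Q + 2 \<langle>\<nabla>f, \<nabla>Q\<rangle> - \<partial>\<^sub>t Q \<ge> c (Q + \<beta> w)\<^sup>2\<close> with \<open>c = 2 (1 - \<beta>) / m\<close>, by the Bochner formula and the curvature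
  condition; the term \<open>h\<close> contributes with the right sign because \<open>\<beta> \<le> 1 - p\<^sub>i\<close> or \<open>p\<^sub>i = 1\<close>.
  The maximum principle compares \<open>Q\<close> with the barrier \<open>1 / (c (t - \<epsilon>)) + k R\<^sup>2 / (R\<^sup>2 - \<rho>)\<^sup>2\<close>, where \<open>\<rho>\<close> is the squared
  distance to a point, and one lets \<open>R \<rightarrow> \<infinity>\<close>, \<open>\<epsilon> \<rightarrow> 0\<close>, \<open>\<beta> \<rightarrow> 0\<close>. Cut points are harmless: at every point \<open>\<rho>\<close>
  has an upper second order jet with \<open>|q|\<^sup>2 = 4 \<rho>\<close> and \<open>\<Delta>\<^sub>V \<rho> \<le> 2 m\<close>, built by induction along a chain of short geodesics
  from the second variation of energy. In the compact case the second term of the barrier is a constant; at a boundary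
  maximum, the Neumann condition and convexity give \<open>\<partial>Q/\<partial>n \<le> 0\<close>, so the whole gradient of \<open>Q\<close> vanishes there and
  the interior argument applies.\<close>

section \<open>Calculus on sets with unique derivatives\<close>

text \<open>The share \<open>be\<close> of the squared gradient in Q is what makes localisation
  possible. A cutoff creates a term linear in grad f, for which no a priori bound exists; the cross
  term 2 c be b |grad f|^2 in the expanded square absorbs it. The price is the factor 1 - be in c
  and an error be |grad f|^2 at the fixed point, both gone in the limit. Only positive values of Q
  matter, because there Delta_V f < - be |grad f|^2, which is what the reaction term needs.

  The squared distance enters the barrier monotonically, so upper bounds of it suffice and one-sided
  jets can replace derivatives. The inequality (a + b)^2 <= (s'/s) a^2 + (s'/h) b^2, an equality
  along a minimizing chain, carries a jet from one node of the chain to the next. The drift V enters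
  through the derivative of mu^2 <T, V>, where T is the velocity and mu the linear weight on the
  parallel fields; completing a square against Ric_V^m turns n into m. Squares are used because they
  are smooth at the centre and their second order bound 2 m is reproduced at each node.\<close>

definition thick :: "'e::euclidean_space set => bool" where
 "thick S \<longleftrightarrow> (ALL x:S. ALL e:Basis. ALL eps>0. EX d. 0 < \<bar>d\<bar> & \<bar>d\<bar> < eps & x + d *\<^sub>R e : S)"

definition dd :: "'e::euclidean_space set => 'e => ('e => 'f::real_normed_vector) => 'e => 'f" where
 "dd S e f x = frechet_derivative f (at x within S) e"

lemma thick_open: "open S ==> thick S" unfolding thick_def
proof (intro ballI allI impI)
 fix x e :: 'a and eps :: real assume "open S" "x : S" "e : Basis" "eps > 0"
 then obtain r where r: "r > 0" "ball x r \<subseteq> S" by (meson openE)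
 let ?d = "min r eps / 2"
 have "x + ?d *\<^sub>R e : ball x r" using r \<open>eps > 0\<close> \<open>e : Basis\<close> by (auto simp: dist_norm)
 thus "EX d. 0 < \<bar>d\<bar> & \<bar>d\<bar> < eps & x + d *\<^sub>R e : S" using r \<open>eps > 0\<close> by (intro exI[of _ ?d]) auto
qed

lemma thick_openin_half_space:
 assumes "openin (top_of_set (half_space b)) S" shows "thick S" unfolding thick_def
proof (intro ballI allI impI)
 fix x e :: "real^'a" and eps :: real assume x: "x : S" and e: "e : Basis" and "eps > 0"
 from assms obtain U where U: "open U" "S = half_space b \<inter> U" by (auto simp: openin_open)
 then obtain r where r: "r > 0" "ball x r \<subseteq> U" using x by (meson IntD2 openE)
 let ?d = "min r eps / 2"
 from e obtain i where i: "e = axis i 1" by (auto simp: Basis_vec_def)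
 have "x + ?d *\<^sub>R e : ball x r" using r \<open>eps > 0\<close> e by (auto simp: dist_norm)
 moreover have "x + ?d *\<^sub>R e : half_space b" using x U r \<open>eps > 0\<close> by (auto simp: half_space_def i axis_def)
 ultimately show "EX d. 0 < \<bar>d\<bar> & \<bar>d\<bar> < eps & x + d *\<^sub>R e : S"
  using r U \<open>eps > 0\<close> by (intro exI[of _ ?d]) auto
qed

lemma thick_openin:
 assumes "thick S" "openin (top_of_set S) T" shows "thick T" unfolding thick_def
proof (intro ballI allI impI)
 fix x e :: 'a and eps :: real assume x: "x : T" and e: "e : Basis" and "eps > 0"
 from assms obtain U where U: "open U" "T = S \<inter> U" by (auto simp: openin_open)
 then obtain r where r: "r > 0" "ball x r \<subseteq> U" using x by (meson IntD2 openE)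
 obtain d where d: "0 < \<bar>d\<bar>" "\<bar>d\<bar> < min r eps" "x + d *\<^sub>R e : S"
  using assms(1) x e U r \<open>eps > 0\<close> unfolding thick_def by (metis IntD1 min_less_iff_conj)
 hence "x + d *\<^sub>R e : ball x r" using e by (auto simp: dist_norm)
 thus "EX d. 0 < \<bar>d\<bar> & \<bar>d\<bar> < eps & x + d *\<^sub>R e : T" using d r U by (intro exI[of _ d]) auto
qed

lemma thick_Times:
 assumes "thick S" "thick T" shows "thick (S \<times> T)" unfolding thick_def
proof (intro ballI allI impI)
 fix x e :: "'a \<times> 'b" and eps :: real assume x: "x : S \<times> T" and e: "e : Basis" and ep: "eps > 0"
 from e consider b where "b : Basis" "e = (b, 0)" | b where "b : Basis" "e = (0, b)" by (auto simp: Basis_prod_def)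
 thus "EX d. 0 < \<bar>d\<bar> & \<bar>d\<bar> < eps & x + d *\<^sub>R e : S \<times> T"
 proof cases
  case 1
  thus ?thesis using assms(1) x ep unfolding thick_def by (cases x) (force)
 next
  case 2
  thus ?thesis using assms(2) x ep unfolding thick_def by (cases x) (force)
 qed
qed

lemma dd_has_derivative:
 assumes "f differentiable (at x within S)" shows "(f has_derivative (%e. dd S e f x)) (at x within S)"
 unfolding dd_def using assms frechet_derivative_works by (metis (no_types, lifting) ext)

text \<open>\<open>thick\<close> is the condition under which the Frechet derivative within a set is
  unique: from each point, arbitrarily small steps along every axis, in at least one of the two
  senses, stay in the set. Half-spaces, relatively open subsets and products with intervals qualify,
  so boundary charts need no calculus of their own.\<close>

lemma dd_eq:
 assumes "thick S" "x : S" "(f has_derivative D) (at x within S)" shows "dd S e f x = D e"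
proof -
 have "(f has_derivative (%e. dd S e f x)) (at x within S)" using assms(3) by (intro dd_has_derivative) (auto simp: differentiable_def)
 from frechet_derivative_unique_within[OF this assms(3)] assms(1,2)
 have "(%e. dd S e f x) = D" unfolding thick_def by blast
 thus ?thesis by metis
qed

lemma dd_cong:
 assumes "!!y. y : S ==> f y = g y" "x : S" shows "dd S e f x = dd S e g x"
proof -
 have "(f has_derivative D) (at x within S) \<longleftrightarrow> (g has_derivative D) (at x within S)" for D
  using assms by (metis has_derivative_transform)
 thus ?thesis unfolding dd_def frechet_derivative_def by simp
qed

text \<open>At a point of a relatively open subset the filters \<open>at x within _\<close>
  coincide. This moves derivatives between the image of a chart and its overlap with another
  chart.\<close>

lemma dd_openin:
 assumes "openin (top_of_set S) T" "x : T"
 shows "dd T e f x = dd S e f x" "(f has_derivative D) (at x within T) \<longleftrightarrow> (f has_derivative D) (at x within S)"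
proof -
 from assms obtain U where U: "open U" "T = S \<inter> U" by (auto simp: openin_open)
 have "at x within T = at x within S" by (rule at_within_nhd[of _ U]) (use U assms in auto)
 thus "dd T e f x = dd S e f x" "(f has_derivative D) (at x within T) \<longleftrightarrow> (f has_derivative D) (at x within S)"
  unfolding dd_def by simp_all
qed

lemma Ck_on_Suc_dd: "Ck_on (Suc k) S f \<longleftrightarrow> f differentiable_on S & (ALL e:Basis. Ck_on k S (dd S e f))"
proof -
 have "dd S e f = (%x. frechet_derivative f (at x within S) e)" for e by (auto simp: dd_def)
 thus ?thesis by simp
qed

declare Ck_on.simps(2) [simp del]

section \<open>Closure properties of the classes C-k\<close>

lemma Ck_on_cong:
 assumes "!!y. y : S ==> f y = g y" "Ck_on k S f" shows "Ck_on k S g" using assms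
proof (induction k arbitrary: f g)
 case 0
 thus ?case by (simp cong: continuous_on_cong)
next
 case (Suc k)
 have "g differentiable_on S" using Suc.prems unfolding Ck_on_Suc_dd differentiable_on_def by (metis differentiable_transform_within zero_less_one)
 moreover have "Ck_on k S (dd S e g)" if "e : Basis" for e using Suc.IH[of "dd S e f" "dd S e g"] Suc.prems that dd_cong[of S f g]
  unfolding Ck_on_Suc_dd by blast
 ultimately show ?case unfolding Ck_on_Suc_dd by blast
qed

lemma Ck_on_continuous: "Ck_on k S f ==> continuous_on S f" by (cases k) (auto simp: Ck_on_Suc_dd differentiable_imp_continuous_on)

lemma Ck_on_SucD: "Ck_on (Suc k) S f ==> Ck_on k S f"
proof (induction k arbitrary: f)
 case 0 thus ?case by (simp add: Ck_on_Suc_dd differentiable_imp_continuous_on)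
next
 case (Suc k) thus ?case by (meson Ck_on_Suc_dd)
qed

lemma Ck_on_deriv:
 assumes "Ck_on (Suc k) S f" "x : S" shows "(f has_derivative (%e. dd S e f x)) (at x within S)"
 using assms by (intro dd_has_derivative) (auto simp: Ck_on_Suc_dd differentiable_on_def)

text \<open>By uniqueness of the derivative, any family \<open>D\<close> of directional derivatives
  may stand in for \<open>dd S e f\<close>. The closure properties below are inductions on k through
  this rule.\<close>

lemma Ck_on_SucI:
 assumes "thick S" "!!x. x : S ==> (f has_derivative (%e. D e x)) (at x within S)" "!!e. e : Basis ==> Ck_on k S (D e)" shows "Ck_on (Suc k) S f"
 unfolding Ck_on_Suc_dd
proof
 show "f differentiable_on S" using assms(2) by (auto simp: differentiable_on_def differentiable_def)
 show "ALL e:Basis. Ck_on k S (dd S e f)"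
 proof
  fix e :: 'a assume "e : Basis"
  show "Ck_on k S (dd S e f)" by (rule Ck_on_cong[OF _ assms(3)[OF \<open>e : Basis\<close>]]) (simp add: dd_eq[OF assms(1) _ assms(2)])
 qed
qed

lemma Ck_on_const: "thick S ==> Ck_on k S (%x. c)"
proof (induction k arbitrary: c)
 case (Suc k)
 show ?case by (rule Ck_on_SucI[where D="%e x. 0"]) (use Suc in auto)
qed auto

lemma Ck_on_bounded_linear:
 assumes "bounded_linear L" "thick S" "Ck_on k S f" shows "Ck_on k S (%x. L (f x))" using assms(3)
proof (induction k arbitrary: f)
 case 0
 thus ?case using bounded_linear.continuous_on[OF assms(1)] by simp
next
 case (Suc k)
 show ?case by (rule Ck_on_SucI[where D="%e x. L (dd S e f x)", OF assms(2)])
   (use Suc bounded_linear.has_derivative[OF assms(1) Ck_on_deriv[OF Suc.prems]] in \<open>auto simp: Ck_on_Suc_dd\<close>)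
qed

lemma Ck_on_add:
 assumes "thick S" "Ck_on k S f" "Ck_on k S g" shows "Ck_on k S (%x. f x + g x)" using assms(2,3)
proof (induction k arbitrary: f g)
 case 0
 thus ?case by (auto intro: continuous_on_add)
next
 case (Suc k)
 show ?case by (rule Ck_on_SucI[where D="%e x. dd S e f x + dd S e g x", OF assms(1)])
   (use Suc has_derivative_add[OF Ck_on_deriv[OF Suc.prems(1)] Ck_on_deriv[OF Suc.prems(2)]] in \<open>auto simp: Ck_on_Suc_dd\<close>)
qed

lemma Ck_on_sum:
 assumes "thick S" "!!i. i : I ==> Ck_on k S (f i)" shows "Ck_on k S (%x. SUM i:I. f i x)" using assms(2)
proof (induction I rule: infinite_finite_induct)
 case (insert i I)
 thus ?case using Ck_on_add[OF assms(1), of k "f i" "%x. SUM i:I. f i x"] by auto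
qed (auto simp: Ck_on_const[OF assms(1)])

text \<open>One induction covers products, inner products and matrix-vector products. Both factors
  stay arbitrary, since the Leibniz rule pairs each of them with a derivative of the other.\<close>

lemma Ck_on_bilinear:
 fixes f :: "'e::euclidean_space => 'f::real_normed_vector"
 assumes "bounded_bilinear B" "thick S" "Ck_on k S f" "Ck_on k S g" shows "Ck_on k S (%x. B (f x) (g x))" using assms(3,4)
proof (induction k arbitrary: f g)
 case 0
 thus ?case using bounded_bilinear.continuous_on[OF assms(1)] by simp
next
 case (Suc k)
 show ?case
 proof (rule Ck_on_SucI[where D="%e x. B (f x) (dd S e g x) + B (dd S e f x) (g x)", OF assms(2)])
  fix x assume "x : S"
  thus "((%x. B (f x) (g x)) has_derivative (%e. B (f x) (dd S e g x) + B (dd S e f x) (g x))) (at x within S)"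
   by (intro bounded_bilinear.FDERIV[OF assms(1)] Ck_on_deriv[OF Suc.prems(1)] Ck_on_deriv[OF Suc.prems(2)])
 next
  fix e :: 'e assume "e : Basis"
  thus "Ck_on k S (%x. B (f x) (dd S e g x) + B (dd S e f x) (g x))"
   using Suc.prems by (intro Ck_on_add[OF assms(2)] Suc.IH) (auto simp: Ck_on_Suc_dd intro: Ck_on_SucD[OF Suc.prems(1)] Ck_on_SucD[OF Suc.prems(2)])
 qed
qed

lemma dd_Basis_sum:
 assumes "f differentiable (at x within S)" shows "dd S e f x = (SUM b:Basis. (e \<bullet> b) *\<^sub>R dd S b f x)"
proof -
 interpret linear "%e. dd S e f x" using dd_has_derivative[OF assms] has_derivative_linear by blast
 have "dd S e f x = dd S (SUM b:Basis. (e \<bullet> b) *\<^sub>R b) f x" by (simp add: euclidean_representation)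
 thus ?thesis by (simp add: sum scale)
qed

text \<open>\<open>Ck_on\<close> constrains only derivatives along basis vectors; linearity of the
  derivative in its direction extends this to every \<open>e\<close>.\<close>

lemma Ck_on_dd:
 assumes "thick S" "Ck_on (Suc k) S f" shows "Ck_on k S (dd S e f)"
proof -
 have "Ck_on k S (%x. SUM b:Basis. (e \<bullet> b) *\<^sub>R dd S b f x)"
  using assms by (intro Ck_on_sum Ck_on_bounded_linear[OF bounded_linear_scaleR_right]) (auto simp: Ck_on_Suc_dd)
 thus ?thesis by (rule Ck_on_cong[rotated]) (metis assms(2) dd_Basis_sum Ck_on_Suc_dd differentiable_on_def)
qed

lemma dd_linear:
 assumes "Ck_on (Suc k) S f" "x : S" shows "linear (%e. dd S e f x)" using Ck_on_deriv[OF assms] has_derivative_linear by blast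

lemma Ck_on_openin:
 assumes "thick S" "openin (top_of_set S) T" "Ck_on k S f" shows "Ck_on k T f" using assms(3)
proof (induction k arbitrary: f)
 case 0
 thus ?case using continuous_on_subset openin_imp_subset[OF assms(2)] by auto
next
 case (Suc k)
 show ?case
 proof (rule Ck_on_SucI[where D="%e x. dd S e f x"])
  show "thick T" using assms thick_openin by blast
  fix x assume "x : T"
  thus "(f has_derivative (%e. dd S e f x)) (at x within T)"
   using Ck_on_deriv[OF Suc.prems] dd_openin(2)[OF assms(2)] openin_imp_subset[OF assms(2)] by blast
 next
  fix e :: 'a assume "e : Basis"
  thus "Ck_on k T (%x. dd S e f x)" using Suc by (auto simp: Ck_on_Suc_dd)
 qed
qed

text \<open>The whole sequence of outer derivatives is carried along, because the inductive step for
  \<open>ph j\<close> needs the claim for \<open>ph (Suc j)\<close>. Inverse, logarithm and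
  exponential follow by writing down their k-th derivatives.\<close>

lemma Ck_on_compose_real:
 fixes ph :: "nat => real => real"
 assumes "thick S" "!!k z. z : T ==> (ph k has_real_derivative ph (Suc k) z) (at z)" "Ck_on n S u" "u ` S \<subseteq> T"
 shows "Ck_on n S (%x. ph j (u x))" using assms(3)
proof (induction n arbitrary: j)
 case 0
 have "continuous_on T (ph j)" by (meson DERIV_isCont assms(2) continuous_at_imp_continuous_on)
 thus ?case using 0 assms(4) continuous_on_compose2 by fastforce
next
 case (Suc n)
 show ?case
 proof (rule Ck_on_SucI[where D="%e x. ph (Suc j) (u x) * dd S e u x", OF assms(1)])
  fix x assume x: "x : S"
  have "(ph j has_derivative (*) (ph (Suc j) (u x))) (at (u x))" using assms(2)[of "u x" j] assms(4) x unfolding has_field_derivative_def by blast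
  from has_derivative_compose[OF Ck_on_deriv[OF Suc.prems x] this]
  show "((%x. ph j (u x)) has_derivative (%e. ph (Suc j) (u x) * dd S e u x)) (at x within S)" .
 next
  fix e :: 'a assume e: "e : Basis"
  show "Ck_on n S (%x. ph (Suc j) (u x) * dd S e u x)"
   by (intro Ck_on_bilinear[OF bounded_bilinear_mult assms(1)] Suc.IH Ck_on_SucD[OF Suc.prems] Ck_on_dd[OF assms(1) Suc.prems])
 qed
qed

section \<open>Smooth functions: algebra, composition and matrix inverses\<close>

lemma smooth_onD: "smooth_on S f ==> Ck_on k S f" by (simp add: smooth_on_def)

lemma smooth_on_cong: "(!!y. y : S ==> f y = g y) ==> smooth_on S f ==> smooth_on S g" unfolding smooth_on_def using Ck_on_cong by blast

lemma smooth_on_const: "thick S ==> smooth_on S (%x. c)" by (simp add: smooth_on_def Ck_on_const)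

lemma smooth_on_add: "thick S ==> smooth_on S f ==> smooth_on S g ==> smooth_on S (%x. f x + g x)" by (simp add: smooth_on_def Ck_on_add)

lemma smooth_on_sum: "thick S ==> (!!i. i : I ==> smooth_on S (f i)) ==> smooth_on S (%x. SUM i:I. f i x)" by (simp add: smooth_on_def Ck_on_sum)

lemma smooth_on_bounded_linear: "bounded_linear L ==> thick S ==> smooth_on S f ==> smooth_on S (%x. L (f x))"
 by (simp add: smooth_on_def Ck_on_bounded_linear)

lemma smooth_on_bilinear:
 "bounded_bilinear B ==> thick S ==> smooth_on S f ==> smooth_on S g ==> smooth_on S (%x. B (f x) (g x))" by (simp add: smooth_on_def Ck_on_bilinear)

lemmas smooth_on_mult = smooth_on_bilinear[OF bounded_bilinear_mult]
lemmas Ck_on_mult = Ck_on_bilinear[OF bounded_bilinear_mult]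

lemma smooth_on_prod:
 fixes f :: "'i => 'e::euclidean_space => real"
 assumes "thick S" "!!i. i : I ==> smooth_on S (f i)" shows "smooth_on S (%x. \<Prod>i\<in>I. f i x)" using assms(2)
proof (induction I rule: infinite_finite_induct)
 case (insert i I)
 thus ?case using smooth_on_mult[OF assms(1), of "f i" "%x. \<Prod>i\<in>I. f i x"] by auto
qed (auto simp: smooth_on_const[OF assms(1)])

lemma smooth_on_dd: "thick S ==> smooth_on S f ==> smooth_on S (dd S e f)" by (simp add: smooth_on_def Ck_on_dd)

lemma smooth_on_deriv:
 "smooth_on S f ==> x : S ==> (f has_derivative (%e. dd S e f x)) (at x within S)" using Ck_on_deriv smooth_on_def by blast

lemma smooth_on_openin: "thick S ==> openin (top_of_set S) T ==> smooth_on S f ==> smooth_on T f" unfolding smooth_on_def using Ck_on_openin by blast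

lemma smooth_on_compose_real:
 fixes ph :: "nat => real => real"
 assumes "thick S" "!!k z. z : T ==> (ph k has_real_derivative ph (Suc k) z) (at z)" "smooth_on S u" "u ` S \<subseteq> T"
 shows "smooth_on S (%x. ph j (u x))" using Ck_on_compose_real[where T=T and ph=ph, OF assms(1,2)] assms(3,4) by (auto simp: smooth_on_def)

lemma DERIV_inverse_power_Suc:
 fixes z :: real assumes "z ~= 0"
 shows "((%z. inverse z ^ Suc l) has_real_derivative - real (Suc l) * inverse z ^ Suc (Suc l)) (at z)"
proof -
 have "(inverse has_real_derivative - (inverse z ^ Suc (Suc 0))) (at z)" by (rule DERIV_inverse[OF assms])
 from DERIV_power_Suc[OF this, of l] show ?thesis by (simp add: algebra_simps)
qed

lemma smooth_on_inverse:
 fixes u :: "'e::euclidean_space => real"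
 assumes "thick S" "smooth_on S u" "!!x. x : S ==> u x ~= 0" shows "smooth_on S (%x. inverse (u x))"
proof -
 define ph :: "nat => real => real" where "ph = (%k z. (-1)^k * fact k * inverse z ^ Suc k)"
 have "(ph k has_real_derivative ph (Suc k) z) (at z)" if "z : -{0}" for k z
  using DERIV_cmult[OF DERIV_inverse_power_Suc[of z k], of "(-1)^k * fact k"] that unfolding ph_def by (simp add: algebra_simps)
 from smooth_on_compose_real[where ph=ph and T="-{0}", OF assms(1) this assms(2), of 0] assms(3)
 show ?thesis by (force simp: ph_def)
qed

lemma smooth_on_ln:
 fixes u :: "'e::euclidean_space => real"
 assumes "thick S" "smooth_on S u" "!!x. x : S ==> u x > 0" shows "smooth_on S (%x. ln (u x))"
proof -
 define ph :: "nat => real => real"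
  where "ph = (%k z. if k = 0 then ln z else (-1)^(k-1) * fact (k-1) * inverse z ^ k)"
 have "(ph k has_real_derivative ph (Suc k) z) (at z)" if "z : {0<..}" for k z
 proof (cases k)
  case 0
  thus ?thesis using that by (auto simp: ph_def intro!: derivative_eq_intros simp: field_simps)
 next
  case (Suc l)
  have "((%z. (-1)^l * fact l * inverse z ^ Suc l) has_real_derivative (-1)^Suc l * fact (Suc l) * inverse z ^ Suc (Suc l)) (at z)"
   using DERIV_cmult[OF DERIV_inverse_power_Suc[of z l], of "(-1)^l * fact l"] that by (simp add: algebra_simps)
  thus ?thesis by (simp add: ph_def Suc)
 qed
 from smooth_on_compose_real[where ph=ph and T="{0<..}", OF assms(1) this assms(2), of 0] assms(3)
 show ?thesis by (auto simp: ph_def)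
qed

lemma smooth_on_exp:
 fixes u :: "'e::euclidean_space => real"
 assumes "thick S" "smooth_on S u" shows "smooth_on S (%x. exp (c * u x))"
proof -
 define ph :: "nat => real => real" where "ph = (%k z. c^k * exp (c * z))"
 have "(ph k has_real_derivative ph (Suc k) z) (at z)" if "z : UNIV" for k z unfolding ph_def by (auto intro!: derivative_eq_intros)
 from smooth_on_compose_real[where ph=ph and T=UNIV, OF assms(1) this assms(2), of 0]
 show ?thesis by (auto simp: ph_def)
qed

lemma smooth_on_vec_nth:
 "thick S ==> smooth_on S f ==> smooth_on S (%x. f x $ i)" by (rule smooth_on_bounded_linear[OF bounded_linear_vec_nth])

lemma bounded_linear_axis: "bounded_linear (axis i :: real => real^'n)" unfolding axis_def by (rule bounded_linearI') (auto simp: vec_eq_iff axis_def)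

lemma bounded_linear_axis_vec: "bounded_linear (axis i :: real^'m => real^'m^'n)" unfolding axis_def
 by (rule bounded_linearI') (auto simp: vec_eq_iff axis_def)

lemma vec_sum_axis: "(v :: 'b::real_normed_vector^'n) = (SUM i:UNIV. axis i (v $ i))" by (simp add: vec_eq_iff axis_def)

lemma Ck_on_vec:
 fixes f :: "'e::euclidean_space => real^'n"
 assumes "thick S" "!!i. Ck_on k S (%x. f x $ i)" shows "Ck_on k S f"
proof -
 have "Ck_on k S (%x. SUM i:UNIV. axis i (f x $ i))" using assms by (intro Ck_on_sum Ck_on_bounded_linear[OF bounded_linear_axis]) auto
 thus ?thesis by (simp flip: vec_sum_axis)
qed

lemma smooth_on_vec:
 fixes f :: "'e::euclidean_space => real^'n"
 assumes "thick S" "!!i. smooth_on S (%x. f x $ i)" shows "smooth_on S f" using Ck_on_vec assms unfolding smooth_on_def by blast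

lemma smooth_on_mat:
 fixes f :: "'e::euclidean_space => real^'m^'n"
 assumes "thick S" "!!i j. smooth_on S (%x. f x $ i $ j)" shows "smooth_on S f"
proof -
 have "smooth_on S (%x. SUM i:UNIV. axis i (f x $ i))"
  using assms by (intro smooth_on_sum smooth_on_bounded_linear[OF bounded_linear_axis_vec] smooth_on_vec) auto
 thus ?thesis by (simp flip: vec_sum_axis)
qed

lemma smooth_on_det:
 fixes f :: "'e::euclidean_space => real^'n^'n"
 assumes "thick S" "!!i j. smooth_on S (%x. f x $ i $ j)" shows "smooth_on S (%x. det (f x))" unfolding det_def using assms
 by (intro smooth_on_sum smooth_on_mult smooth_on_prod smooth_on_const) auto

lemma matrix_inv_mult:
 fixes A :: "real^'n^'n" assumes "invertible A"
 shows "A ** matrix_inv A = mat 1" "matrix_inv A ** A = mat 1"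
proof -
 have "EX B. A ** B = mat 1 & B ** A = mat 1" using assms by (simp add: invertible_def)
 from someI_ex[OF this] show "A ** matrix_inv A = mat 1" "matrix_inv A ** A = mat 1" unfolding matrix_inv_def by auto
qed

text \<open>Cramer's rule: the entries of the inverse are quotients of determinants, and
  determinants are polynomials in the entries.\<close>

lemma smooth_on_matrix_inv:
 fixes G :: "'e::euclidean_space => real^'n^'n"
 assumes S: "thick S" and G: "smooth_on S G" and inv: "!!x. x : S ==> invertible (G x)" shows "smooth_on S (%x. matrix_inv (G x))"
proof (rule smooth_on_mat[OF S])
 fix i j
 have Gij: "smooth_on S (%x. G x $ k $ l)" for k l by (intro smooth_on_vec_nth[OF S] G)
 \<comment> \<open>\<open>G x\<close> with column i replaced by the j-th unit vector; its
   determinant divided by that of \<open>G x\<close> is the entry (i, j) of the inverse.\<close>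
 let ?M = "%x. (\<chi> k l. if l = i then axis j 1 $ k else G x $ k $ l) :: real^'n^'n"
 have M: "smooth_on S (%x. ?M x $ k $ l)" for k l using Gij smooth_on_const[OF S] by (cases "l = i") auto
 have "smooth_on S (%x. det (?M x) * inverse (det (G x)))" using inv invertible_det_nz
  by (intro smooth_on_mult[OF S] smooth_on_inverse[OF S] smooth_on_det[OF S] M Gij) auto
 moreover have "matrix_inv (G x) $ i $ j = det (?M x) * inverse (det (G x))" if "x : S" for x
 proof -
  have "G x *v (matrix_inv (G x) *v axis j 1) = axis j 1" using matrix_inv_mult(1)[OF inv[OF that]] by (simp add: matrix_vector_mul_assoc)
  hence "matrix_inv (G x) *v axis j 1 = (\<chi> k. det(\<chi> i l. if l=k then axis j 1 $ i else G x $ i $ l) / det (G x))"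
   using cramer[of "G x" "matrix_inv (G x) *v axis j 1" "axis j 1"] inv[OF that] invertible_det_nz by blast
  hence "(matrix_inv (G x) *v axis j 1) $ i = det (?M x) / det (G x)" by simp
  thus ?thesis by (simp add: matrix_vector_mult_basis column_def divide_inverse)
 qed
 ultimately show "smooth_on S (%x. matrix_inv (G x) $ i $ j)" using smooth_on_cong[of S "%x. det (?M x) * inverse (det (G x))"] by auto
qed

subsection \<open>Symmetry of second derivatives\<close>

lemma line_derivative:
 fixes f :: "'e::euclidean_space => real"
 assumes "Ck_on (Suc k) S f" "p + ta *\<^sub>R a : interior S"
 shows "((%ta. f (p + ta *\<^sub>R a)) has_real_derivative dd S a f (p + ta *\<^sub>R a)) (at ta)"
proof -
 let ?x = "p + ta *\<^sub>R a"
 have "(f has_derivative (%e. dd S e f ?x)) (at ?x)"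
  using Ck_on_deriv[OF assms(1), of ?x] assms(2) interior_subset at_within_interior[OF assms(2)] by fastforce
 moreover have "((%ta. p + ta *\<^sub>R a) has_derivative (%h. h *\<^sub>R a)) (at ta)" by (auto intro!: derivative_eq_intros)
 ultimately have "((%ta. f (p + ta *\<^sub>R a)) has_derivative (%h. dd S (h *\<^sub>R a) f ?x)) (at ta)" using has_derivative_compose by blast
 moreover have "(%h. dd S (h *\<^sub>R a) f ?x) = (*) (dd S a f ?x)"
  using linear_cmul[OF dd_linear[OF assms(1), of ?x]] assms(2) interior_subset by (auto simp: mult.commute fun_eq_iff)
 ultimately show ?thesis by (simp add: has_field_derivative_def)
qed

text \<open>The mean value theorem twice: in direction a for the difference of f along two parallel
  segments, then in direction b for its derivative. The left side is symmetric in a and b and the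
  right side is not, which is the source of the symmetry of second derivatives.\<close>

lemma second_difference:
 fixes f :: "'e::euclidean_space => real"
 assumes S: "thick S" and f: "Ck_on 2 S f" and ball: "ball x r \<subseteq> interior S" and s: "s > 0" "s * (norm a + norm b) < r"
 shows "EX y:ball x r. f (x + s *\<^sub>R a + s *\<^sub>R b) - f (x + s *\<^sub>R a) - f (x + s *\<^sub>R b) + f x = s^2 * dd S b (dd S a f) y"
proof -
 have f2: "Ck_on (Suc (Suc 0)) S f" using f by (simp add: numeral_2_eq_2)
 have inb: "x + z *\<^sub>R a + z' *\<^sub>R b : ball x r" if "0 <= z" "z <= s" "0 <= z'" "z' <= s" for z z'
 proof -
  have "norm (z *\<^sub>R a + z' *\<^sub>R b) <= z * norm a + z' * norm b"
   using that norm_triangle_ineq[of "z *\<^sub>R a" "z' *\<^sub>R b"] by simp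
  also have "... <= s * norm a + s * norm b" using that by (intro add_mono mult_right_mono) auto
  also have "... < r" using s by (simp add: algebra_simps)
  finally show ?thesis by (simp add: mem_ball dist_norm norm_minus_commute algebra_simps)
 qed
 have "((%ta. f ((x + s *\<^sub>R b) + ta *\<^sub>R a) - f (x + ta *\<^sub>R a)) has_real_derivative
   dd S a f ((x + s *\<^sub>R b) + z *\<^sub>R a) - dd S a f (x + z *\<^sub>R a)) (at z)" if "0 <= z" "z <= s" for z
  using inb[of z s] inb[of z 0] that s ball by (intro DERIV_diff line_derivative[OF f2]) (auto simp: algebra_simps)
 from MVT2[OF s(1) this] obtain z where z: "0 < z" "z < s"
  and eq1: "f ((x + s *\<^sub>R b) + s *\<^sub>R a) - f (x + s *\<^sub>R a) - (f (x + s *\<^sub>R b) - f x)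
   = s * (dd S a f ((x + s *\<^sub>R b) + z *\<^sub>R a) - dd S a f (x + z *\<^sub>R a))" by auto
 have Daf: "Ck_on (Suc 0) S (dd S a f)" using Ck_on_dd[OF S f2] .
 have "((%ta. dd S a f ((x + z *\<^sub>R a) + ta *\<^sub>R b)) has_real_derivative
   dd S b (dd S a f) ((x + z *\<^sub>R a) + z' *\<^sub>R b)) (at z')" if "0 <= z'" "z' <= s" for z'
  using inb[of z z'] that z ball by (intro line_derivative[OF Daf]) auto
 from MVT2[OF s(1) this] obtain z' where z': "0 < z'" "z' < s"
  and eq2: "dd S a f ((x + z *\<^sub>R a) + s *\<^sub>R b) - dd S a f (x + z *\<^sub>R a) = s * dd S b (dd S a f) ((x + z *\<^sub>R a) + z' *\<^sub>R b)"
  by auto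
 show ?thesis
 proof (rule bexI[of _ "(x + z *\<^sub>R a) + z' *\<^sub>R b"])
  show "(x + z *\<^sub>R a) + z' *\<^sub>R b : ball x r" using inb[of z z'] z z' by simp
  have "x + s *\<^sub>R b + s *\<^sub>R a = x + s *\<^sub>R a + s *\<^sub>R b" "x + s *\<^sub>R b + z *\<^sub>R a = x + z *\<^sub>R a + s *\<^sub>R b"
   by (simp_all add: algebra_simps)
  thus "f (x + s *\<^sub>R a + s *\<^sub>R b) - f (x + s *\<^sub>R a) - f (x + s *\<^sub>R b) + f x =
    s^2 * dd S b (dd S a f) ((x + z *\<^sub>R a) + z' *\<^sub>R b)" using eq1 eq2 by (simp add: power2_eq_square algebra_simps)
 qed
qed

lemma dd_commute_interior:
 fixes f :: "'e::euclidean_space => real"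
 assumes S: "thick S" and f: "Ck_on 2 S f" and x: "x : interior S" shows "dd S a (dd S b f) x = dd S b (dd S a f) x"
proof (rule ccontr)
 let ?A = "dd S a (dd S b f)" and ?B = "dd S b (dd S a f)"
 assume ne: "?A x ~= ?B x"
 define eps where "eps = \<bar>?A x - ?B x\<bar> / 2"
 have "eps > 0" using ne by (simp add: eps_def)
 have f2: "Ck_on (Suc (Suc 0)) S f" using f by (simp add: numeral_2_eq_2)
 have "continuous_on S ?A" "continuous_on S ?B" using Ck_on_continuous Ck_on_dd[OF S Ck_on_dd[OF S f2]] by blast+
 hence cA: "isCont ?A x" and cB: "isCont ?B x" using x continuous_on_interior by blast+
 obtain d1 where d1: "d1 > 0" "!!y. dist y x < d1 ==> dist (?A y) (?A x) < eps"
  using cA \<open>eps > 0\<close> unfolding continuous_at_eps_delta by blast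
 obtain d2 where d2: "d2 > 0" "!!y. dist y x < d2 ==> dist (?B y) (?B x) < eps"
  using cB \<open>eps > 0\<close> unfolding continuous_at_eps_delta by blast
 obtain r0 where r0: "r0 > 0" "ball x r0 \<subseteq> interior S" using x by (meson open_interior openE)
 define r where "r = min r0 (min d1 d2)"
 have r: "r > 0" "ball x r \<subseteq> interior S" using r0 d1 d2 by (auto simp: r_def)
 define s where "s = r / (2 * (norm a + norm b + 1))"
 have pos: "norm a + norm b + 1 > 0" by (smt (verit) norm_ge_zero)
 have s: "s > 0" using r pos by (simp add: s_def)
 have "s * (norm a + norm b) < s * (2 * (norm a + norm b + 1))" using s by (intro mult_strict_left_mono) (smt (verit) norm_ge_zero)+
 also have "... = r" using pos by (simp add: s_def)
 finally have sr: "s * (norm a + norm b) < r" .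
 obtain y1 where y1: "y1 : ball x r" "f (x + s *\<^sub>R a + s *\<^sub>R b) - f (x + s *\<^sub>R a) - f (x + s *\<^sub>R b) + f x = s^2 * ?B y1"
  using second_difference[OF S f r(2) s sr] by blast
 obtain y2 where y2: "y2 : ball x r" "f (x + s *\<^sub>R b + s *\<^sub>R a) - f (x + s *\<^sub>R b) - f (x + s *\<^sub>R a) + f x = s^2 * ?A y2"
  using second_difference[OF S f r(2) s, of b a] sr by (auto simp: add.commute)
 have "x + s *\<^sub>R b + s *\<^sub>R a = x + s *\<^sub>R a + s *\<^sub>R b" by (simp add: algebra_simps)
 hence "s^2 * ?B y1 = s^2 * ?A y2" using y1(2) y2(2)[unfolded \<open>x + s *\<^sub>R b + s *\<^sub>R a = x + s *\<^sub>R a + s *\<^sub>R b\<close>] by linarith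
 hence "?B y1 = ?A y2" using s by simp
 moreover have "dist (?B y1) (?B x) < eps" using d2(2)[of y1] y1(1) by (auto simp: r_def dist_commute)
 moreover have "dist (?A y2) (?A x) < eps" using d1(2)[of y2] y2(1) by (auto simp: r_def dist_commute)
 ultimately show False unfolding eps_def dist_real_def by (smt (verit) field_sum_of_halves)
qed

lemma continuous_zero_closure:
 fixes h :: "'a::metric_space => real"
 assumes "continuous_on S h" "!!y. y : I ==> h y = 0" "I \<subseteq> S" "x : S" "x : closure I" shows "h x = 0"
proof -
 obtain X where X: "!!n. X n : I" "X \<longlonglongrightarrow> x" using assms(5) unfolding closure_sequential by blast
 have "(h \<circ> X) \<longlonglongrightarrow> h x" using assms(1,3,4) X unfolding continuous_on_sequentially by blast
 moreover have "h \<circ> X = (%n. 0)" using X assms(2) by auto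
 ultimately show ?thesis using LIMSEQ_unique[OF _ tendsto_const] by fastforce
qed

lemma dd_inner:
 fixes f :: "'e::euclidean_space => 'f::euclidean_space"
 assumes "thick S" "Ck_on (Suc k) S f" "x : S" shows "dd S e (%y. f y \<bullet> c) x = dd S e f x \<bullet> c"
 by (rule dd_eq[OF assms(1,3)]) (auto intro!: derivative_eq_intros Ck_on_deriv[OF assms(2,3)])

text \<open>Boundary points are reached from the dense interior, as both mixed derivatives are
  continuous on all of \<open>S\<close>. Vector values are reduced to scalar ones by pairing with
  basis vectors.\<close>

lemma dd_commute:
 fixes f :: "'e::euclidean_space => 'f::euclidean_space"
 assumes S: "thick S" "S \<subseteq> closure (interior S)" and f: "Ck_on 2 S f" and x: "x : S" shows "dd S a (dd S b f) x = dd S b (dd S a f) x"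
proof (rule euclidean_eqI)
 fix c :: 'f assume "c : Basis"
 have f2: "Ck_on (Suc (Suc 0)) S f" using f by (simp add: numeral_2_eq_2)
 let ?h = "%x. f x \<bullet> c"
 have h: "Ck_on 2 S ?h" by (rule Ck_on_bounded_linear[OF bounded_linear_inner_left S(1) f])
 have h2: "Ck_on (Suc (Suc 0)) S ?h" using h by (simp add: numeral_2_eq_2)
 have eq: "dd S a (dd S b f) y \<bullet> c = dd S a (dd S b ?h) y" if "y : S" for a b y
 proof -
  have "dd S a (dd S b f) y \<bullet> c = dd S a (%y. dd S b f y \<bullet> c) y" using dd_inner[OF S(1) Ck_on_dd[OF S(1) f2] that] by simp
  also have "... = dd S a (dd S b ?h) y" using dd_inner[OF S(1) f2] by (intro dd_cong[OF _ that]) simp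
  finally show ?thesis .
 qed
 have "dd S a (dd S b ?h) x - dd S b (dd S a ?h) x = 0"
 proof (rule continuous_zero_closure[where I="interior S" and h="%x. dd S a (dd S b ?h) x - dd S b (dd S a ?h) x"])
  show "continuous_on S (%x. dd S a (dd S b ?h) x - dd S b (dd S a ?h) x)"
   using Ck_on_continuous Ck_on_dd[OF S(1) Ck_on_dd[OF S(1) h2]] by (intro continuous_on_diff) blast+
 qed (use dd_commute_interior[OF S(1) h] interior_subset[of S] S x in auto)
 thus "dd S a (dd S b f) x \<bullet> c = dd S b (dd S a f) x \<bullet> c" using eq[OF x] by simp
qed

subsection \<open>Slices of functions on a product\<close>

lemma slice_derivative:
 fixes F :: "'e::euclidean_space \<times> real => 'f::real_normed_vector"
 assumes "Ck_on (Suc k) (S \<times> T) F" "y : S" "t : T"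
 shows "((%y. F (y, t)) has_derivative (%e. dd (S \<times> T) (e, 0) F (y, t))) (at y within S)"
proof -
 have "(F has_derivative (%e. dd (S \<times> T) e F (y, t))) (at (y, t) within S \<times> T)" using Ck_on_deriv[OF assms(1)] assms by auto
 hence "(F has_derivative (%e. dd (S \<times> T) e F (y, t))) (at (y, t) within (%y. (y, t)) ` S)"
  by (rule has_derivative_subset) (use assms in auto)
 moreover have "((%y. (y, t)) has_derivative (%e. (e, 0))) (at y within S)" by (intro has_derivative_Pair has_derivative_ident has_derivative_const)
 ultimately show ?thesis using has_derivative_in_compose by blast
qed

lemma dd_slice:
 fixes F :: "'e::euclidean_space \<times> real => 'f::real_normed_vector"
 assumes "thick S" "Ck_on (Suc k) (S \<times> T) F" "y : S" "t : T" shows "dd S e (%y. F (y, t)) y = dd (S \<times> T) (e, 0) F (y, t)"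
 by (rule dd_eq[OF assms(1,3) slice_derivative[OF assms(2-4)]])

lemma Ck_on_slice:
 fixes F :: "'e::euclidean_space \<times> real => 'f::real_normed_vector"
 assumes "thick S" "open T" "Ck_on k (S \<times> T) F" "t : T" shows "Ck_on k S (%y. F (y, t))" using assms(3)
proof (induction k arbitrary: F)
 case 0
 thus ?case using assms(4) by (auto intro!: continuous_on_compose2[where f="%y. (y, t)" and g=F] continuous_intros)
next
 case (Suc k)
 show ?case
 proof (rule Ck_on_SucI[where D="%e y. dd (S \<times> T) (e, 0) F (y, t)", OF assms(1)])
  show "((%y. F (y, t)) has_derivative (%e. dd (S \<times> T) (e, 0) F (y, t))) (at y within S)" if "y : S" for y
   using slice_derivative[OF Suc.prems that assms(4)] .
  show "Ck_on k S (%y. dd (S \<times> T) (e, 0) F (y, t))" if "e : Basis" for e :: 'e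
   by (rule Suc.IH) (rule Ck_on_dd[OF thick_Times[OF assms(1) thick_open[OF assms(2)]] Suc.prems])
 qed
qed

lemma smooth_on_slice:
 fixes F :: "'e::euclidean_space \<times> real => 'f::real_normed_vector"
 assumes "thick S" "open T" "smooth_on (S \<times> T) F" "t : T" shows "smooth_on S (%y. F (y, t))"
 using Ck_on_slice[OF assms(1,2) _ assms(4)] assms(3) by (auto simp: smooth_on_def)

lemma time_derivative:
 fixes F :: "'e::euclidean_space \<times> real => real"
 assumes "Ck_on (Suc k) (S \<times> T) F" "y : S" "t : T" "open T"
 shows "((%s. F (y, s)) has_real_derivative dd (S \<times> T) (0, 1) F (y, t)) (at t)"
proof -
 have "(F has_derivative (%e. dd (S \<times> T) e F (y, t))) (at (y, t) within S \<times> T)" using Ck_on_deriv[OF assms(1)] assms by auto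
 hence "(F has_derivative (%e. dd (S \<times> T) e F (y, t))) (at (y, t) within (%s. (y, s)) ` T)"
  by (rule has_derivative_subset) (use assms in auto)
 moreover have "((%s. (y, s)) has_derivative (%h. (0, h))) (at t within T)" by (intro has_derivative_Pair has_derivative_ident has_derivative_const)
 ultimately have "((%s. F (y, s)) has_derivative (%h. dd (S \<times> T) (0, h) F (y, t))) (at t within T)" using has_derivative_in_compose by blast
 moreover have "(%h. dd (S \<times> T) (0, h) F (y, t)) = (*) (dd (S \<times> T) (0, 1) F (y, t))"
 proof
  fix h
  show "dd (S \<times> T) (0, h) F (y, t) = dd (S \<times> T) (0, 1) F (y, t) * h"
   using linear_cmul[OF dd_linear[OF assms(1), of "(y, t)"], of h "(0, 1)"] assms by (auto simp: mult.commute)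
 qed
 ultimately show ?thesis using at_within_open[OF assms(3,4)] by (simp add: has_field_derivative_def)
qed

lemma closure_interior_Times:
 assumes "S \<subseteq> closure (interior S)" "open T" shows "S \<times> T \<subseteq> closure (interior (S \<times> T))"
proof -
 have "interior (S \<times> T) = interior S \<times> T" using assms(2) by (simp add: interior_Times interior_open)
 thus ?thesis using Sigma_mono[OF assms(1) closure_subset[of T]] by (simp add: closure_Times)
qed

lemma closure_interior_openin:
 assumes "S \<subseteq> closure (interior S)" "openin (top_of_set S) T" shows "T \<subseteq> closure (interior T)"
proof
 fix x assume x: "x : T"
 from assms obtain U where U: "open U" "T = S \<inter> U" by (auto simp: openin_open)
 have "interior T = interior S \<inter> U" using U by (simp add: interior_open)
 moreover have "x : closure (interior S \<inter> U)" using open_Int_closure_subset[OF U(1), of "interior S"] x U assms(1) by (auto simp: Int_commute)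
 ultimately show "x : closure (interior T)" by simp
qed

lemma closure_interior_half_space: "half_space b \<subseteq> closure (interior (half_space (b::'n::finite)))"
proof
 fix x :: "real^'n" assume x: "x : half_space b"
 show "x : closure (interior (half_space b))" unfolding closure_approachable
 proof (intro allI impI)
  fix e :: real assume e: "e > 0"
  let ?y = "x + (e/2) *\<^sub>R axis b 1"
  have "open {y::real^'n. 0 < y $ b}" by (intro open_Collect_less continuous_intros)
  moreover have "{y::real^'n. 0 < y $ b} \<subseteq> half_space b" by (auto simp: half_space_def)
  moreover have "?y : {y. 0 < y $ b}" using x e by (auto simp: half_space_def)
  ultimately have "?y : interior (half_space b)" using interiorI by blast
  moreover have "dist ?y x < e" using e by (simp add: dist_norm)
  ultimately show "EX y:interior (half_space b). dist y x < e" by blast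
 qed
qed

section \<open>Riemannian geometry in a coordinate domain\<close>

lemma linear_matrix_vector_left: "linear (%A::real^'m^'n. A *v v)"
 by (rule linearI) (auto simp: matrix_vector_mult_def vec_eq_iff sum.distrib sum_distrib_left algebra_simps)

lemma bounded_bilinear_matrix_vector: "bounded_bilinear ((*v) :: real^'m^'n => _)"
proof -
 have "bilinear ((*v) :: real^'m^'n => _)" unfolding bilinear_def using linear_matrix_vector_left matrix_vector_mul_linear by blast
 thus ?thesis by (simp add: bilinear_conv_bounded_bilinear)
qed

definition trc :: "(real^'n => real^'n) => real" where
 "trc L = (SUM i:UNIV. L (axis i 1) $ i)"

lemma vec_basis_expansion: "(v :: real^'n) = (SUM i:UNIV. v $ i *\<^sub>R axis i 1)" by (simp add: vec_eq_iff axis_def if_distrib cong: if_cong)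

lemma linear_basis_expansion:
 assumes "linear (L :: real^'n => 'b::real_vector)" shows "L v = (SUM i:UNIV. v $ i *\<^sub>R L (axis i 1))"
proof -
 have "L v = L (SUM i:UNIV. v $ i *\<^sub>R axis i 1)" by (simp flip: vec_basis_expansion)
 thus ?thesis using assms by (simp add: linear_sum linear_cmul)
qed

lemma trc_add: "trc (%u. L u + M u) = trc L + trc M" by (simp add: trc_def sum.distrib)

lemma trc_diff: "trc (%u. L u - M u) = trc L - trc M" by (simp add: trc_def sum_subtractf)

lemma trc_commute:
 fixes L M :: "real^'n => real^'n"
 assumes "linear L" "linear M" shows "trc (%u. L (M u)) = trc (%u. M (L u))"
proof -
 have e: "trc (%u. L (M u)) = (SUM i:UNIV. SUM j:UNIV. M (axis i 1) $ j * L (axis j 1) $ i)" if "linear L" for L M :: "real^'n => real^'n"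
  unfolding trc_def by (subst linear_basis_expansion[OF that]) (simp add: sum_component)
 show ?thesis unfolding e[OF assms(1)] e[OF assms(2)] by (subst sum.swap) (simp add: mult.commute)
qed

text \<open>All local geometry takes place in one chart image. \<open>thick\<close> gives unique
  derivatives and \<open>fat\<close> gives commuting ones; together they replace openness, so that
  images touching the boundary of the half-space are included.\<close>

locale coord_metric =
 fixes S :: "(real^'n::finite) set" and G :: "real^'n => real^'n^'n"
 assumes thick: "thick S" and fat: "S \<subseteq> closure (interior S)" and smooth: "smooth_on S G" and sym: "!!y. y : S ==> transpose (G y) = G y"
  and pos: "!!y v. y : S ==> v ~= 0 ==> 0 < v \<bullet> (G y *v v)"
begin

definition ip :: "real^'n => real^'n => real^'n => real" where
 "ip y u v = u \<bullet> (G y *v v)"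

definition dG :: "real^'n => real^'n => real^'n => real^'n => real" where
 "dG y w u v = u \<bullet> (dd S w G y *v v)"

text \<open>The Christoffel symbols as a vector-valued bilinear map at \<open>y\<close>, which keeps
  covariant derivatives and curvature free of indices.\<close>

definition Gam :: "real^'n => real^'n => real^'n => real^'n" where
 "Gam y u v = (\<chi> k. SUM i:UNIV. SUM j:UNIV. christoffel S G k i j y * (u $ i * v $ j))"

definition DGam :: "real^'n => real^'n => real^'n => real^'n => real^'n" where
 "DGam y w u v = dd S w (%y. Gam y u v) y"

lemma ip_simps:
 "ip y (u + u') v = ip y u v + ip y u' v" "ip y u (v + v') = ip y u v + ip y u v'"
 "ip y (u - u') v = ip y u v - ip y u' v" "ip y u (v - v') = ip y u v - ip y u v'"
 "ip y (c *\<^sub>R u) v = c * ip y u v" "ip y u (c *\<^sub>R v) = c * ip y u v"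
 "ip y (- u) v = - ip y u v" "ip y u (- v) = - ip y u v" "ip y 0 v = 0" "ip y u 0 = 0" unfolding ip_def
 by (simp_all add: inner_add_left inner_add_right inner_diff_left inner_diff_right matrix_vector_right_distrib
   matrix_vector_mult_diff_distrib scaleR_matrix_vector_assoc[symmetric] matrix_vector_mult_scaleR
   linear_neg[OF matrix_vector_mul_linear])

lemma ip_sym: assumes "y : S" shows "ip y u v = ip y v u"
proof -
 have "u \<bullet> (G y *v v) = (transpose (G y) *v u) \<bullet> v" by (simp add: dot_lmul_matrix transpose_matrix_vector)
 thus ?thesis using sym[OF assms] by (simp add: ip_def inner_commute)
qed

lemma ip_pos: "y : S ==> v ~= 0 ==> ip y v v > 0" using pos by (simp add: ip_def)

lemma ip_nonneg: "y : S ==> ip y v v >= 0" using ip_pos[of y v] ip_simps(9) by (cases "v = 0") force+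

lemma ip_eq_zero: assumes "y : S" "!!v. ip y u v = 0" shows "u = 0" using assms ip_pos by force

lemma ip_eqI: assumes "y : S" "!!v. ip y u v = ip y u' v" shows "u = u'" using ip_eq_zero[of y "u - u'"] assms by (simp add: ip_simps)

lemma ip_CS: assumes "y : S" shows "(ip y u v)^2 <= ip y u u * ip y v v"
proof (cases "v = 0")
 case False
 let ?a = "ip y v v" and ?b = "ip y u v"
 have a: "?a > 0" using ip_pos[OF assms False] .
 have "0 <= ip y (?a *\<^sub>R u - ?b *\<^sub>R v) (?a *\<^sub>R u - ?b *\<^sub>R v)" using ip_nonneg[OF assms] .
 also have "... = ?a * (?a * ip y u u - ?b\<^sup>2)" using ip_sym[OF assms, of v u] by (simp add: ip_simps algebra_simps power2_eq_square)
 finally show ?thesis using a by (simp add: zero_le_mult_iff mult.commute)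
qed (simp add: ip_simps)

lemma invertible_G: assumes "y : S" shows "invertible (G y)"
proof -
 have "inj ((*v) (G y))"
 proof (rule linear_injective_0[THEN iffD2, rule_format, OF matrix_vector_mul_linear])
  fix x assume "G y *v x = 0"
  hence "ip y x x = 0" by (simp add: ip_def)
  thus "x = 0" using ip_pos[OF assms, of x] by force
 qed
 thus ?thesis by (metis invertible_left_inverse matrix_left_invertible_injective)
qed

lemma G_inv: assumes "y : S" shows "G y *v (matrix_inv (G y) *v v) = v" "matrix_inv (G y) *v (G y *v v) = v"
 using matrix_inv_mult[OF invertible_G[OF assms]] by (simp_all add: matrix_vector_mul_assoc)

lemma ip_inv: assumes "y : S" shows "ip y (matrix_inv (G y) *v a) v = a \<bullet> v"
proof -
 have "ip y (matrix_inv (G y) *v a) v = ip y v (matrix_inv (G y) *v a)" by (rule ip_sym[OF assms])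
 also have "... = a \<bullet> v" by (simp add: ip_def G_inv(1)[OF assms] inner_commute)
 finally show ?thesis .
qed

lemma smooth_inv: "smooth_on S (%y. matrix_inv (G y))" using smooth_on_matrix_inv[OF thick smooth] invertible_G by blast

lemma pd_dd: "pd S i f = dd S (axis i 1) f" by (auto simp: pd_def dd_def)

lemma smooth_pd: "smooth_on S f ==> smooth_on S (pd S i f)" by (simp add: pd_dd smooth_on_dd thick)

lemma smooth_Gij: "smooth_on S (%y. G y $ i $ j)" by (intro smooth_on_vec_nth[OF thick] smooth)

lemma smooth_diff: "smooth_on S f ==> smooth_on S g ==> smooth_on S (%x. f x - g x)" for f g :: "_ => 'z::real_normed_vector"
 using smooth_on_add[OF thick, of f "%x. - g x"] smooth_on_bounded_linear[OF bounded_linear_minus[OF bounded_linear_ident] thick, of g] by simp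

lemma smooth_christoffel: "smooth_on S (christoffel S G k i j)"
proof -
 have "smooth_on S (%y. (SUM l:UNIV. matrix_inv (G y) $ k $ l *
    (pd S i (%z. G z $ j $ l) y + pd S j (%z. G z $ i $ l) y - pd S l (%z. G z $ i $ j) y)) * (1/2))"
  by (intro smooth_on_mult[OF thick] smooth_on_sum[OF thick] smooth_on_vec_nth[OF thick] smooth_inv
    smooth_on_add[OF thick] smooth_diff smooth_pd smooth_Gij smooth_on_const[OF thick])
 thus ?thesis unfolding christoffel_def[abs_def] by simp
qed

lemma dd_component:
 assumes "smooth_on S f" "y : S" shows "dd S w (%z. f z $ i) y = dd S w f y $ i"
 by (rule dd_eq[OF thick assms(2)]) (intro bounded_linear.has_derivative[OF bounded_linear_vec_nth] smooth_on_deriv assms)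

lemma dd_Gij: assumes "y : S" shows "dd S w (%z. G z $ i $ j) y = dd S w G y $ i $ j"
proof -
 have "dd S w (%z. G z $ i $ j) y = dd S w (%z. G z $ i) y $ j" by (rule dd_component[OF _ assms]) (intro smooth_on_vec_nth[OF thick] smooth)
 thus ?thesis using dd_component[OF smooth assms, of w i] by simp
qed

lemma dG_linear1: assumes "y : S"
 shows "dG y (w + w') u v = dG y w u v + dG y w' u v" "dG y (c *\<^sub>R w) u v = c * dG y w u v"
 using linear_add[OF dd_linear[OF smooth_onD[OF smooth] assms]] linear_cmul[OF dd_linear[OF smooth_onD[OF smooth] assms]]
 by (simp_all add: dG_def matrix_vector_mult_add_rdistrib inner_add_right scaleR_matrix_vector_assoc[symmetric])

lemma dG_simps:
 "dG y w (u + u') v = dG y w u v + dG y w u' v" "dG y w u (v + v') = dG y w u v + dG y w u v'"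
 "dG y w (c *\<^sub>R u) v = c * dG y w u v" "dG y w u (c *\<^sub>R v) = c * dG y w u v" unfolding dG_def
 by (simp_all add: inner_add_left inner_add_right matrix_vector_right_distrib matrix_vector_mult_scaleR)

lemma dG_sym: assumes "y : S" shows "dG y w u v = dG y w v u"
proof -
 have "dd S w G y $ i $ j = dd S w G y $ j $ i" for i j
 proof -
  have "dd S w (%z. G z $ i $ j) y = dd S w (%z. G z $ j $ i) y"
  proof (rule dd_cong[OF _ assms])
   fix z assume "z : S"
   have "transpose (G z) $ i $ j = G z $ i $ j" using sym[OF \<open>z : S\<close>] by simp
   thus "G z $ i $ j = G z $ j $ i" by (simp add: transpose_def)
  qed
  thus ?thesis using dd_Gij[OF assms] by simp
 qed
 hence "transpose (dd S w G y) = dd S w G y" by (simp add: transpose_def vec_eq_iff)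
 moreover have "u \<bullet> (dd S w G y *v v) = (transpose (dd S w G y) *v u) \<bullet> v" by (simp add: dot_lmul_matrix transpose_matrix_vector)
 ultimately have "u \<bullet> (dd S w G y *v v) = (dd S w G y *v u) \<bullet> v" by simp
 thus ?thesis by (simp add: dG_def inner_commute)
qed

lemma dG_expand: assumes "y : S"
 shows "dG y w u v = (SUM i:UNIV. SUM j:UNIV. SUM l:UNIV. (w $ i * (u $ j * v $ l)) * pd S i (%z. G z $ j $ l) y)"
proof -
 have "dG y w u v = (SUM i:UNIV. w $ i * dG y (axis i 1) u v)" unfolding dG_def
  by (subst linear_basis_expansion[OF dd_linear[OF smooth_onD[OF smooth] assms]])
   (simp add: linear_sum[OF linear_matrix_vector_left] scaleR_matrix_vector_assoc[symmetric] inner_sum_right)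
 moreover have "dG y (axis i 1) u v = (SUM j:UNIV. SUM l:UNIV. u $ j * v $ l * pd S i (%z. G z $ j $ l) y)" for i
  by (simp add: dG_def inner_vec_def matrix_vector_mult_def pd_dd dd_Gij[OF assms] sum_distrib_left algebra_simps)
 ultimately show ?thesis by (simp add: sum_distrib_left algebra_simps)
qed

text \<open>Pairing with \<open>w\<close> cancels the inverse matrix in the Christoffel symbols. As
  \<open>ip\<close> is nondegenerate, symmetry and metric compatibility of \<open>Gam\<close> follow
  from this formula alone.\<close>

lemma koszul: assumes "y : S"
 shows "2 * ip y (Gam y u v) w = dG y u v w + dG y v u w - dG y w u v"
proof -
 \<comment> \<open>Twice the Christoffel symbol with its upper index lowered.\<close>
 define C where "C = (%i j. (\<chi> l. pd S i (%z. G z $ j $ l) y + pd S j (%z. G z $ i $ l) y - pd S l (%z. G z $ i $ j) y) :: real^'n)"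
 have ch: "christoffel S G k i j y = (1/2) * (matrix_inv (G y) *v C i j) $ k" for k i j by (simp add: christoffel_def C_def matrix_vector_mult_def)
 have "Gam y u v = (SUM i:UNIV. SUM j:UNIV. (u $ i * v $ j / 2) *\<^sub>R (matrix_inv (G y) *v C i j))"
  by (simp add: Gam_def vec_eq_iff ch sum_component algebra_simps)
 also have "... = matrix_inv (G y) *v (SUM i:UNIV. SUM j:UNIV. (u $ i * v $ j / 2) *\<^sub>R C i j)"
  by (simp add: linear_sum[OF matrix_vector_mul_linear] matrix_vector_mult_scaleR)
 finally have "ip y (Gam y u v) w = (SUM i:UNIV. SUM j:UNIV. (u $ i * v $ j / 2) *\<^sub>R C i j) \<bullet> w" using ip_inv[OF assms] by simp
 also have "... = (SUM i:UNIV. SUM j:UNIV. (u $ i * v $ j / 2) * (C i j \<bullet> w))" by (simp add: inner_sum_left)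
 also have "... = (SUM i:UNIV. SUM j:UNIV. SUM l:UNIV. (u $ i * v $ j / 2) * (C i j $ l * w $ l))" by (simp add: inner_vec_def sum_distrib_left)
 finally have "2 * ip y (Gam y u v) w = (SUM i:UNIV. SUM j:UNIV. SUM l:UNIV. u $ i * v $ j * w $ l * C i j $ l)"
  by (simp add: sum_distrib_left algebra_simps)
 also have "... = (SUM i:UNIV. SUM j:UNIV. SUM l:UNIV. (u $ i * (v $ j * w $ l)) * pd S i (%z. G z $ j $ l) y)
   + (SUM i:UNIV. SUM j:UNIV. SUM l:UNIV. (v $ j * (u $ i * w $ l)) * pd S j (%z. G z $ i $ l) y)
   - (SUM i:UNIV. SUM j:UNIV. SUM l:UNIV. (w $ l * (u $ i * v $ j)) * pd S l (%z. G z $ i $ j) y)"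
  by (simp add: C_def algebra_simps sum.distrib sum_subtractf)
 also have "(SUM i:UNIV. SUM j:UNIV. SUM l:UNIV. (v $ j * (u $ i * w $ l)) * pd S j (%z. G z $ i $ l) y) = dG y v u w"
  unfolding dG_expand[OF assms] by (rule sum.swap)
 also have "(SUM i:UNIV. SUM j:UNIV. SUM l:UNIV. (w $ l * (u $ i * v $ j)) * pd S l (%z. G z $ i $ j) y)
   = (SUM i:UNIV. SUM l:UNIV. SUM j:UNIV. (w $ l * (u $ i * v $ j)) * pd S l (%z. G z $ i $ j) y)" by (rule sum.cong[OF refl], rule sum.swap)
 also have "... = dG y w u v" unfolding dG_expand[OF assms] by (rule sum.swap)
 finally show ?thesis by (simp add: dG_expand[OF assms])
qed

lemma Gam_linear1: "linear (%u. Gam y u v)" by (rule linearI) (simp_all add: Gam_def vec_eq_iff sum.distrib sum_distrib_left algebra_simps)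

lemma Gam_linear2: "linear (%v. Gam y u v)" by (rule linearI) (simp_all add: Gam_def vec_eq_iff sum.distrib sum_distrib_left algebra_simps)

lemmas Gam_simps = linear_add[OF Gam_linear1] linear_add[OF Gam_linear2] linear_cmul[OF Gam_linear1]
 linear_cmul[OF Gam_linear2] linear_diff[OF Gam_linear1] linear_diff[OF Gam_linear2]
 linear_0[OF Gam_linear1] linear_0[OF Gam_linear2] linear_neg[OF Gam_linear1] linear_neg[OF Gam_linear2]

lemma Gam_sym: assumes "y : S" shows "Gam y u v = Gam y v u"
proof (rule ip_eqI[OF assms])
 fix w
 show "ip y (Gam y u v) w = ip y (Gam y v u) w" using koszul[OF assms, of u v w] koszul[OF assms, of v u w] dG_sym[OF assms, of w u v] by simp
qed

lemma metric_compat: assumes "y : S"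
 shows "dG y w u v = ip y (Gam y w u) v + ip y u (Gam y w v)"
 using koszul[OF assms, of w u v] koszul[OF assms, of w v u] dG_sym[OF assms] ip_sym[OF assms, of u] by simp

lemma ip_derivative:
 assumes "y : S" "(P has_derivative P') (at y within S)" "(Q has_derivative Q') (at y within S)" shows "((%y. ip y (P y) (Q y)) has_derivative
   (%w. dG y w (P y) (Q y) + ip y (P' w) (Q y) + ip y (P y) (Q' w))) (at y within S)"
proof -
 have "((%y. G y *v Q y) has_derivative (%w. G y *v Q' w + dd S w G y *v Q y)) (at y within S)"
  by (rule bounded_bilinear.FDERIV[OF bounded_bilinear_matrix_vector smooth_on_deriv[OF smooth assms(1)] assms(3)])
 from has_derivative_inner[OF assms(2) this] show ?thesis by (simp add: ip_def dG_def inner_add_right algebra_simps)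
qed

lemma ip_smooth: assumes "Ck_on k S P" "Ck_on k S Q" shows "Ck_on k S (%y. ip y (P y) (Q y))" unfolding ip_def
 by (intro Ck_on_bilinear[OF bounded_bilinear_inner thick] Ck_on_bilinear[OF bounded_bilinear_matrix_vector thick] assms smooth_onD[OF smooth])

lemma smooth_Gam: "smooth_on S (%y. Gam y u v)" by (rule smooth_on_vec[OF thick])
  (simp add: Gam_def, intro smooth_on_sum[OF thick] smooth_on_mult[OF thick] smooth_christoffel smooth_on_const[OF thick])

lemma Gam_expand: "Gam y u v = (SUM i:UNIV. SUM j:UNIV. (u $ i * v $ j) *\<^sub>R Gam y (axis i 1) (axis j 1))"
 by (subst linear_basis_expansion[OF Gam_linear1], subst linear_basis_expansion[OF Gam_linear2]) (simp add: scaleR_sum_right)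

lemma DGam_expand: assumes "y : S"
 shows "DGam y w u v = (SUM i:UNIV. SUM j:UNIV. (u $ i * v $ j) *\<^sub>R DGam y w (axis i 1) (axis j 1))" unfolding DGam_def
proof (rule dd_eq[OF thick assms])
 show "((%y. Gam y u v) has_derivative
   (%w. SUM i:UNIV. SUM j:UNIV. (u $ i * v $ j) *\<^sub>R dd S w (%y. Gam y (axis i 1) (axis j 1)) y)) (at y within S)" by (subst Gam_expand)
   (intro has_derivative_sum has_derivative_scaleR_right smooth_on_deriv[OF smooth_Gam assms])
qed

lemma Gam_derivative:
 assumes y: "y : S" and P: "(P has_derivative P') (at y within S)" and Q: "(Q has_derivative Q') (at y within S)"
 shows "((%y. Gam y (P y) (Q y)) has_derivative
   (%w. DGam y w (P y) (Q y) + Gam y (P' w) (Q y) + Gam y (P y) (Q' w))) (at y within S)"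
proof -
 have "((%y. Gam y (P y) (Q y)) has_derivative
   (%w. SUM i:UNIV. SUM j:UNIV. (P y $ i * Q y $ j) *\<^sub>R DGam y w (axis i 1) (axis j 1)
    + (P y $ i * Q' w $ j + P' w $ i * Q y $ j) *\<^sub>R Gam y (axis i 1) (axis j 1))) (at y within S)" unfolding DGam_def by (subst Gam_expand)
   (intro has_derivative_sum has_derivative_scaleR has_derivative_mult
    bounded_linear.has_derivative[OF bounded_linear_vec_nth] P Q smooth_on_deriv[OF smooth_Gam y])
 also have "(%w. SUM i:UNIV. SUM j:UNIV. (P y $ i * Q y $ j) *\<^sub>R DGam y w (axis i 1) (axis j 1)
    + (P y $ i * Q' w $ j + P' w $ i * Q y $ j) *\<^sub>R Gam y (axis i 1) (axis j 1))
   = (%w. DGam y w (P y) (Q y) + Gam y (P' w) (Q y) + Gam y (P y) (Q' w))"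
  by (simp add: fun_eq_iff DGam_expand[OF y, of _ "P y"] Gam_expand[of y "P' _"] Gam_expand[of y "P y"]
    sum.distrib algebra_simps)
 finally show ?thesis .
qed

lemma DGam_linear: assumes "y : S"
 shows "linear (%w. DGam y w u v)" "linear (%u. DGam y w u v)" "linear (%v. DGam y w u v)"
proof -
 show "linear (%w. DGam y w u v)" unfolding DGam_def by (rule dd_linear[OF smooth_onD[OF smooth_Gam] assms])
 have e: "DGam y w u v = (SUM i:UNIV. SUM j:UNIV. (u $ i * v $ j) *\<^sub>R DGam y w (axis i 1) (axis j 1))" for u v by (rule DGam_expand[OF assms])
 show "linear (%u. DGam y w u v)"
 proof (rule linearI)
  show "DGam y w (u + u') v = DGam y w u v + DGam y w u' v" for u u' unfolding e[of _ v] by (simp add: sum.distrib algebra_simps)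
  show "DGam y w (c *\<^sub>R u) v = c *\<^sub>R DGam y w u v" for c u unfolding e[of _ v] by (simp add: scaleR_sum_right algebra_simps)
 qed
 show "linear (%v. DGam y w u v)"
 proof (rule linearI)
  show "DGam y w u (v + v') = DGam y w u v + DGam y w u v'" for v v' unfolding e[of u] by (simp add: sum.distrib algebra_simps)
  show "DGam y w u (c *\<^sub>R v) = c *\<^sub>R DGam y w u v" for c v unfolding e[of u] by (simp add: scaleR_sum_right algebra_simps)
 qed
qed

text \<open>The curvature R(u,v)w, computed with vector fields of constant components, so that no
  Lie bracket appears.\<close>

definition Rm :: "real^'n => real^'n => real^'n => real^'n => real^'n" where
 "Rm y u v w = DGam y u v w - DGam y v u w + Gam y u (Gam y v w) - Gam y v (Gam y u w)"

lemma DGam_nth: assumes "y : S"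
 shows "DGam y w u v $ l = (SUM i:UNIV. SUM j:UNIV. u $ i * v $ j * dd S w (christoffel S G l i j) y)"
proof -
 have "dd S w (%z. Gam z u v $ l) y = (SUM i:UNIV. SUM j:UNIV. u $ i * v $ j * dd S w (christoffel S G l i j) y)"
  by (rule dd_eq[OF thick assms], simp add: Gam_def)
   (auto intro!: derivative_eq_intros smooth_on_deriv[OF smooth_christoffel assms] simp: algebra_simps)
 thus ?thesis using dd_component[OF smooth_Gam assms] by (simp add: DGam_def)
qed

text \<open>The bridge to the index definition of curvature. From here on the Ricci form is handled
  as a trace over the first slot of \<open>Rm\<close>.\<close>

lemma Rm_ricci: assumes "y : S"
 shows "trc (%u. Rm y u v v) = v \<bullet> (ricci S G y *v v)"
proof -
 have ax: "(SUM i:UNIV. SUM j:UNIV. c i j * (axis k 1 $ i * d i j)) = (SUM j:UNIV. c k j * d k j)" for c d :: "'n => 'n => real" and k :: 'n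
 proof -
  have "(SUM i:UNIV. SUM j:UNIV. c i j * (axis k 1 $ i * d i j)) = (SUM i:UNIV. if i = k then SUM j:UNIV. c k j * d k j else 0)"
   by (rule sum.cong) (auto simp: axis_def)
  thus ?thesis by simp
 qed
 have G1: "Gam y (axis i 1) w $ l = (SUM r:UNIV. christoffel S G l i r y * w $ r)" for i l w
  unfolding Gam_def using ax[where k=i and c="%i j. christoffel S G l i j y" and d="%i j. w $ j"] by simp
 have GG: "Gam y v v $ r = (SUM j:UNIV. SUM k:UNIV. christoffel S G r j k y * (v $ j * v $ k))" for r by (simp add: Gam_def)
 have D1: "DGam y (axis i 1) v v $ i = (SUM j:UNIV. SUM k:UNIV. v $ j * v $ k * pd S i (christoffel S G i j k) y)" for i
  by (simp add: DGam_nth[OF assms] pd_dd)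
 have D2: "DGam y v (axis i 1) v $ i = (SUM j:UNIV. SUM k:UNIV. v $ j * v $ k * pd S j (christoffel S G i i k) y)" for i
 proof -
  have "DGam y v (axis i 1) v $ i = (SUM j:UNIV. v $ j * DGam y (axis j 1) (axis i 1) v $ i)"
   by (subst linear_basis_expansion[OF DGam_linear(1)[OF assms]]) (simp add: sum_component)
  moreover have "DGam y (axis j 1) (axis i 1) v $ i = (SUM k:UNIV. v $ k * pd S j (christoffel S G i i k) y)" for j
   using ax[where k=i and c="%a k. 1" and d="%a k. v $ k * dd S (axis j 1) (christoffel S G i a k) y"]
   by (simp add: DGam_nth[OF assms] pd_dd algebra_simps)
  ultimately show ?thesis by (simp add: sum_distrib_left algebra_simps)
 qed
 have E1: "Gam y (axis i 1) (Gam y v v) $ i = (SUM j:UNIV. SUM k:UNIV. v $ j * v $ k * (SUM r:UNIV. christoffel S G i i r y * christoffel S G r j k y))" for i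
 proof -
  have "Gam y (axis i 1) (Gam y v v) $ i = (SUM r:UNIV. SUM j:UNIV. SUM k:UNIV. v $ j * v $ k * (christoffel S G i i r y * christoffel S G r j k y))"
   by (simp add: G1 GG sum_distrib_left algebra_simps)
  also have "... = (SUM j:UNIV. SUM r:UNIV. SUM k:UNIV. v $ j * v $ k * (christoffel S G i i r y * christoffel S G r j k y))" by (rule sum.swap)
  also have "... = (SUM j:UNIV. SUM k:UNIV. SUM r:UNIV. v $ j * v $ k * (christoffel S G i i r y * christoffel S G r j k y))"
   by (rule sum.cong[OF refl], rule sum.swap)
  finally show ?thesis by (simp add: sum_distrib_left)
 qed
 have E2: "Gam y v (Gam y (axis i 1) v) $ i = (SUM j:UNIV. SUM k:UNIV. v $ j * v $ k * (SUM r:UNIV. christoffel S G i j r y * christoffel S G r i k y))" for i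
 proof -
  have "Gam y v (Gam y (axis i 1) v) $ i = (SUM j:UNIV. SUM r:UNIV. christoffel S G i j r y * (v $ j * Gam y (axis i 1) v $ r))"
   by (simp add: Gam_def)
  also have "... = (SUM j:UNIV. SUM r:UNIV. SUM k:UNIV. v $ j * v $ k * (christoffel S G i j r y * christoffel S G r i k y))"
   by (simp add: G1 sum_distrib_left algebra_simps)
  also have "... = (SUM j:UNIV. SUM k:UNIV. SUM r:UNIV. v $ j * v $ k * (christoffel S G i j r y * christoffel S G r i k y))"
   by (rule sum.cong[OF refl], rule sum.swap)
  finally show ?thesis by (simp add: sum_distrib_left)
 qed
 have "trc (%u. Rm y u v v) = (SUM i:UNIV. SUM j:UNIV. SUM k:UNIV. v $ j * v $ k * riemann S G i k i j y)" unfolding trc_def Rm_def riemann_def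
  by (simp add: D1 D2 E1 E2 sum.distrib sum_subtractf distrib_left right_diff_distrib)
 also have "... = (SUM j:UNIV. SUM i:UNIV. SUM k:UNIV. v $ j * v $ k * riemann S G i k i j y)" by (rule sum.swap)
 also have "... = (SUM j:UNIV. SUM k:UNIV. SUM i:UNIV. v $ j * v $ k * riemann S G i k i j y)" by (rule sum.cong[OF refl], rule sum.swap)
 also have "... = v \<bullet> (ricci S G y *v v)"
  by (simp add: inner_vec_def matrix_vector_mult_def ricci_def sum_distrib_left sum_distrib_right algebra_simps)
 finally show ?thesis .
qed

end

lemma trc_scaleR: "trc (%u. c *\<^sub>R L u) = c * trc L" by (simp add: trc_def sum_distrib_left)

context coord_metric begin

subsection \<open>Orthonormal frames\<close>

definition onb :: "real^'n => ('n => real^'n) => bool" where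
 "onb y e \<longleftrightarrow> (ALL i j. ip y (e i) (e j) = (if i = j then 1 else 0))"

lemma linear_ip1: "linear (%u. ip y u v)" by (rule linearI) (simp_all add: ip_simps)
lemma linear_ip2: "linear (%v. ip y u v)" by (rule linearI) (simp_all add: ip_simps)

text \<open>Gram-Schmidt, one vector at a time: while k is below the dimension the span is proper,
  and the residue of an outside vector is nonzero.\<close>

lemma orthonormal_set_exists:
 assumes y: "y : S" shows "k <= CARD('n) ==> EX L. finite L & card L = k & (ALL u:L. ALL v:L. ip y u v = (if u = v then 1 else 0))"
proof (induction k)
 case 0 thus ?case by (intro exI[of _ "{}"]) auto
next
 case (Suc k)
 then obtain L where L: "finite L" "card L = k" "!!u v. u : L ==> v : L ==> ip y u v = (if u = v then 1 else 0)" by auto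
 have "dim L <= k" using dim_le_card'[OF L(1)] L(2) by simp
 hence "span L ~= UNIV" using Suc.prems by (metis DIM_cart DIM_real dim_UNIV dim_span mult.right_neutral not_less_eq_eq)
 then obtain v where v: "v ~: span L" by auto
 define w where "w = v - (SUM u:L. ip y v u *\<^sub>R u)"
 have "w ~= 0"
 proof
  assume "w = 0"
  hence "v = (SUM u:L. ip y v u *\<^sub>R u)" by (simp add: w_def)
  also have "... : span L" by (intro span_sum span_scale span_base)
  finally show False using v by simp
 qed
 hence ww: "ip y w w > 0" using ip_pos[OF y] by blast
 have wu: "ip y w u = 0" if "u : L" for u
 proof -
  have "(SUM x:L. ip y v x * ip y x u) = (SUM x:L. if x = u then ip y v x else 0)" by (rule sum.cong[OF refl]) (use L(3) that in auto)
  thus ?thesis using that L(1) by (simp add: w_def ip_simps linear_sum[OF linear_ip1])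
 qed
 define e where "e = (1 / sqrt (ip y w w)) *\<^sub>R w"
 have ee: "ip y e e = 1" using ww by (simp add: e_def ip_simps field_simps)
 have eu: "ip y e u = 0" "ip y u e = 0" if "u : L" for u using wu[OF that] ip_sym[OF y] by (simp_all add: e_def ip_simps)
 have "e ~: L" using eu(1) ee by force
 thus ?case using L ee eu by (intro exI[of _ "insert e L"]) auto
qed

lemma onb_exists: assumes y: "y : S" shows "EX e. onb y e"
proof -
 obtain L where L: "finite L" "card L = CARD('n)" "!!u v. u : L ==> v : L ==> ip y u v = (if u = v then 1 else 0)"
  using orthonormal_set_exists[OF y, of "CARD('n)"] by auto
 obtain h where h: "bij_betw h (UNIV :: 'n set) L" using finite_same_card_bij[of "UNIV :: 'n set" L] L by auto
 have "ip y (h i) (h j) = (if i = j then 1 else 0)" for i j using L(3)[of "h i" "h j"] h by (auto simp: bij_betw_def inj_on_def)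
 thus ?thesis unfolding onb_def by blast
qed

lemma onb_expand:
 assumes y: "y : S" and e: "onb y e" shows "v = (SUM i:UNIV. ip y v (e i) *\<^sub>R e i)"
proof -
 define T where "T = (%c :: real^'n. SUM i:UNIV. c $ i *\<^sub>R e i)"
 have lin: "linear T" by (rule linearI) (simp_all add: T_def algebra_simps sum.distrib scaleR_sum_right)
 have co: "ip y (T c) (e j) = c $ j" for c j
 proof -
  have "ip y (T c) (e j) = (SUM i:UNIV. c $ i * ip y (e i) (e j))" by (simp add: T_def linear_sum[OF linear_ip1] ip_simps)
  also have "... = (SUM i:UNIV. if i = j then c $ i else 0)" by (rule sum.cong[OF refl]) (use e in \<open>simp add: onb_def\<close>)
  finally show ?thesis by simp
 qed
 have "inj T" using co by (intro injI) (metis vec_eq_iff)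
 hence "surj T" using linear_injective_imp_surjective[OF lin] by blast
 then obtain c where c: "v = T c" by (metis surjD)
 thus ?thesis using co[of c] by (simp add: T_def)
qed

lemma trc_onb:
 assumes y: "y : S" and e: "onb y e" and L: "linear L" shows "trc L = (SUM i:UNIV. ip y (L (e i)) (e i))"
proof -
 have "trc L = (SUM k:UNIV. SUM i:UNIV. ip y (L (axis k 1)) (e i) * e i $ k)"
  unfolding trc_def by (rule sum.cong[OF refl], subst onb_expand[OF y e]) (simp add: sum_component)
 also have "... = (SUM i:UNIV. SUM k:UNIV. e i $ k * ip y (L (axis k 1)) (e i))" by (subst sum.swap) (simp add: mult.commute)
 also have "... = (SUM i:UNIV. ip y (L (e i)) (e i))"
  by (rule sum.cong[OF refl], subst (2) linear_basis_expansion[OF L]) (simp add: linear_sum[OF linear_ip1] ip_simps)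
 finally show ?thesis .
qed

text \<open>Contraction of a bilinear form with the inverse metric. By contrast, \<open>trc\<close>
  traces an endomorphism and involves no metric.\<close>

definition gtr :: "real^'n => (real^'n => real^'n => real) => real" where
 "gtr y B = (SUM i:UNIV. SUM j:UNIV. matrix_inv (G y) $ i $ j * B (axis i 1) (axis j 1))"

text \<open>Expand the inverse matrix applied to a unit vector in the frame: its product with
  \<open>e a\<close> is just a component of \<open>e a\<close>. This completeness relation makes
  \<open>gtr\<close> a sum over any orthonormal frame.\<close>

lemma inv_onb:
 assumes y: "y : S" and e: "onb y e" shows "matrix_inv (G y) $ i $ j = (SUM a:UNIV. e a $ i * e a $ j)"
proof -
 have "matrix_inv (G y) *v axis j 1 = (SUM a:UNIV. (axis j 1 \<bullet> e a) *\<^sub>R e a)" by (subst onb_expand[OF y e]) (simp add: ip_inv[OF y])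
 hence "(matrix_inv (G y) *v axis j 1) $ i = (SUM a:UNIV. e a $ j * e a $ i)" by (simp add: sum_component inner_axis' )
 thus ?thesis by (simp add: matrix_vector_mult_basis column_def mult.commute)
qed

lemma gtr_onb:
 assumes y: "y : S" and e: "onb y e" and B: "!!v. linear (%u. B u v)" "!!u. linear (B u)" shows "gtr y B = (SUM a:UNIV. B (e a) (e a))"
proof -
 have ex: "B (e a) (e a) = (SUM i:UNIV. SUM j:UNIV. (e a $ i * e a $ j) * B (axis i 1) (axis j 1))" for a
  by (subst linear_basis_expansion[OF B(1)], subst linear_basis_expansion[OF B(2)]) (simp add: sum_distrib_left mult.assoc)
 have "gtr y B = (SUM i:UNIV. SUM j:UNIV. SUM a:UNIV. (e a $ i * e a $ j) * B (axis i 1) (axis j 1))"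
  by (simp add: gtr_def inv_onb[OF y e] sum_distrib_right)
 also have "... = (SUM i:UNIV. SUM a:UNIV. SUM j:UNIV. (e a $ i * e a $ j) * B (axis i 1) (axis j 1))" by (rule sum.cong[OF refl], rule sum.swap)
 also have "... = (SUM a:UNIV. SUM i:UNIV. SUM j:UNIV. (e a $ i * e a $ j) * B (axis i 1) (axis j 1))" by (rule sum.swap)
 finally show ?thesis by (simp add: ex)
qed

subsection \<open>Gradient, Hessian and Laplacian\<close>

lemma dd_expand:
 assumes "Ck_on (Suc k) S f" "y : S" shows "dd S v f y = (SUM i:UNIV. v $ i *\<^sub>R dd S (axis i 1) f y)"
 by (rule linear_basis_expansion[OF dd_linear[OF assms]])

lemma ip_gradient:
 assumes "Ck_on (Suc k) S f" "y : S" shows "ip y (gradient S G f y) v = dd S v f y" "ip y v (gradient S G f y) = dd S v f y"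
proof -
 show "ip y (gradient S G f y) v = dd S v f y" unfolding gradient_def ip_inv[OF assms(2)] dd_expand[OF assms, of v]
  by (simp add: inner_vec_def pd_dd mult.commute)
 thus "ip y v (gradient S G f y) = dd S v f y" using ip_sym[OF assms(2)] by simp
qed

lemma Ck_gradient:
 assumes "Ck_on (Suc k) S f" shows "Ck_on k S (gradient S G f)"
proof -
 have "Ck_on k S (%y. matrix_inv (G y) *v (\<chi> i. pd S i f y))"
  by (intro Ck_on_bilinear[OF bounded_bilinear_matrix_vector thick] smooth_onD[OF smooth_inv] Ck_on_vec[OF thick])
   (simp add: pd_dd Ck_on_dd[OF thick assms])
 thus ?thesis by (simp add: gradient_def[abs_def])
qed

text \<open>The covariant derivative of \<open>X\<close> in direction \<open>u\<close>; for a field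
  with constant components only the \<open>Gam\<close> term remains.\<close>

definition nab :: "(real^'n => real^'n) => real^'n => real^'n => real^'n" where
 "nab X y u = dd S u X y + Gam y u (X y)"

lemma nab_linear: assumes "Ck_on (Suc k) S X" "y : S" shows "linear (nab X y)"
 unfolding nab_def[abs_def] using linear_compose_add[OF dd_linear[OF assms] Gam_linear1] by simp

lemma ip_nab:
 assumes X: "Ck_on (Suc k) S X" and Y: "Ck_on (Suc l) S Y" and y: "y : S"
 shows "dd S u (%z. ip z (X z) (Y z)) y = ip y (nab X y u) (Y y) + ip y (X y) (nab Y y u)"
proof -
 have "dd S u (%z. ip z (X z) (Y z)) y = dG y u (X y) (Y y) + ip y (dd S u X y) (Y y) + ip y (X y) (dd S u Y y)"
  by (rule dd_eq[OF thick y ip_derivative[OF y Ck_on_deriv[OF X y] Ck_on_deriv[OF Y y]]])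
 thus ?thesis by (simp add: metric_compat[OF y] nab_def ip_simps)
qed

text \<open>Differentiate the pairing of the gradient with the constant field v, whose covariant
  derivative is \<open>Gam y u v\<close>.\<close>

lemma hess_gradient:
 assumes f: "Ck_on (Suc (Suc k)) S f" and y: "y : S" shows "ip y (nab (gradient S G f) y u) v = dd S u (dd S v f) y - dd S (Gam y u v) f y"
proof -
 have "dd S u (dd S v f) y = dd S u (%z. ip z (gradient S G f z) v) y" by (rule dd_cong[OF _ y]) (simp add: ip_gradient[OF f])
 also have "... = ip y (nab (gradient S G f) y u) v + ip y (gradient S G f y) (nab (%z. v) y u)"
  by (rule ip_nab[OF Ck_gradient[OF f] Ck_on_const[OF thick] y])
 also have "nab (%z. v) y u = Gam y u v" unfolding nab_def by (subst dd_eq[OF thick y has_derivative_const]) simp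
 finally show ?thesis using ip_gradient[OF f y] by simp
qed

lemma nab_gradient_selfadjoint:
 assumes f: "Ck_on (Suc (Suc k)) S f" and y: "y : S" shows "ip y (nab (gradient S G f) y u) v = ip y u (nab (gradient S G f) y v)"
proof -
 have f2: "Ck_on 2 S f" using f by (induction k) (auto simp: numeral_2_eq_2 dest: Ck_on_SucD)
 show ?thesis using hess_gradient[OF f y, of u v] hess_gradient[OF f y, of v u] Gam_sym[OF y, of u v]
   dd_commute[OF thick fat f2 y, of u v] ip_sym[OF y, of u] by simp
qed

lemma Gam_axis: "Gam y (axis i 1) (axis j 1) $ k = christoffel S G k i j y"
proof -
 have "Gam y (axis i 1) (axis j 1) $ k = (SUM a:UNIV. if a = i then (SUM b:UNIV. if b = j then christoffel S G k a b y else 0) else 0)"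
  unfolding Gam_def vec_lambda_beta by (intro sum.cong refl) (auto simp: axis_def if_distrib[of "%x. _ * x"] cong: if_cong)
 thus ?thesis by simp
qed

lemma hessian_nth:
 assumes f: "Ck_on (Suc (Suc k)) S f" and y: "y : S"
 shows "hessian S G f y $ i $ j = dd S (axis i 1) (dd S (axis j 1) f) y - dd S (Gam y (axis i 1) (axis j 1)) f y"
 by (simp add: hessian_def pd_dd dd_expand[OF f y, of "Gam y _ _"] Gam_axis)

lemma laplacian_gtr:
 assumes f: "Ck_on (Suc (Suc k)) S f" and y: "y : S" shows "laplacian S G f y = gtr y (%u v. dd S u (dd S v f) y - dd S (Gam y u v) f y)"
 by (simp add: laplacian_def gtr_def hessian_nth[OF f y])

lemma laplacian_trc:
 assumes f: "Ck_on (Suc (Suc k)) S f" and y: "y : S" shows "laplacian S G f y = trc (nab (gradient S G f) y)"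
proof -
 let ?N = "nab (gradient S G f) y"
 have "ip y (?N (axis i 1)) (axis j 1) = (G y *v ?N (axis i 1)) $ j" for i j by (subst ip_sym[OF y]) (simp add: ip_def inner_axis')
 hence "laplacian S G f y = (SUM i:UNIV. (matrix_inv (G y) *v (G y *v ?N (axis i 1))) $ i)"
  unfolding laplacian_gtr[OF f y] gtr_def hess_gradient[OF f y, symmetric] by (simp add: matrix_vector_mult_def[of "matrix_inv (G y)"])
 thus ?thesis by (simp add: G_inv[OF y] trc_def)
qed

subsection \<open>The Bochner formula\<close>

text \<open>Base point and direction both move, so a second derivative appears together with a term
  for the change of direction. This is what fields such as \<open>nab X z (X z)\<close> and
  functions such as the derivative of f along \<open>W\<close> require.\<close>

lemma dd_apply_derivative:
 fixes F :: "real^'n => 'z::real_normed_vector"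
 assumes F: "Ck_on (Suc (Suc k)) S F" and y: "y : S" and P: "(P has_derivative P') (at y within S)"
 shows "((%z. dd S (P z) F z) has_derivative (%u. dd S u (dd S (P y) F) y + dd S (P' u) F y)) (at y within S)"
proof -
 have 1: "((%z. SUM i:UNIV. P z $ i *\<^sub>R dd S (axis i 1) F z) has_derivative
   (%u. SUM i:UNIV. P y $ i *\<^sub>R dd S u (dd S (axis i 1) F) y + P' u $ i *\<^sub>R dd S (axis i 1) F y)) (at y within S)"
  by (intro has_derivative_sum has_derivative_scaleR bounded_linear.has_derivative[OF bounded_linear_vec_nth] P
    Ck_on_deriv[OF Ck_on_dd[OF thick F] y])
 have 2: "dd S u (dd S v F) y = (SUM i:UNIV. v $ i *\<^sub>R dd S u (dd S (axis i 1) F) y)" for u v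
 proof -
  have "dd S u (dd S v F) y = dd S u (%z. SUM i:UNIV. v $ i *\<^sub>R dd S (axis i 1) F z) y" by (rule dd_cong[OF _ y]) (rule dd_expand[OF F])
  also have "... = (SUM i:UNIV. v $ i *\<^sub>R dd S u (dd S (axis i 1) F) y)"
   by (rule dd_eq[OF thick y]) (intro has_derivative_sum has_derivative_scaleR_right Ck_on_deriv[OF Ck_on_dd[OF thick F] y])
  finally show ?thesis .
 qed
 have "((%z. SUM i:UNIV. P z $ i *\<^sub>R dd S (axis i 1) F z) has_derivative (%u. dd S u (dd S (P y) F) y + dd S (P' u) F y)) (at y within S)"
  using 1 by (simp only: 2[of _ "P y"] sum.distrib dd_expand[OF F y, of "P' _"])
 thus ?thesis by (rule has_derivative_transform[OF y, rotated]) (rule dd_expand[OF F])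
qed

text \<open>The Bochner identity before a gradient is inserted: div(nabla_X X) = tr((nabla X)^2) +
  X(div X) + Ric(X, X), for any C2 field. Interchanging derivatives costs a curvature term, whose
  trace is Ricci.\<close>

lemma divergence_identity:
 assumes X: "Ck_on 2 S X" and y: "y : S"
 defines "Y \<equiv> %z. nab X z (X z)"
 shows "trc (nab Y y) = trc (%u. nab X y (nab X y u)) + dd S (X y) (%z. trc (nab X z)) y
  + X y \<bullet> (ricci S G y *v X y)"
proof -
 have X2: "Ck_on (Suc (Suc 0)) S X" using X by (simp add: numeral_2_eq_2)
 let ?D = "%u. dd S u X y" and ?x = "X y"
 have dX: "(X has_derivative ?D) (at y within S)" by (rule Ck_on_deriv[OF X2 y])
 have linD: "linear ?D" by (rule dd_linear[OF X2 y])
 have dY: "dd S u Y y = dd S u (dd S ?x X) y + ?D (?D u) + (DGam y u ?x ?x + Gam y (?D u) ?x + Gam y ?x (?D u))" for u unfolding Y_def nab_def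
  by (rule dd_eq[OF thick y]) (rule has_derivative_add[OF dd_apply_derivative[OF X2 y dX] Gam_derivative[OF y dX dX]])
 have dtr: "dd S w (%z. trc (nab X z)) y = trc (%u. dd S w (dd S u X) y + (DGam y w u ?x + Gam y u (?D w)))" for w
 proof -
  have "((%z. trc (nab X z)) has_derivative (%w. SUM i:UNIV. (dd S w (dd S (axis i 1) X) y +
    (DGam y w (axis i 1) ?x + Gam y 0 ?x + Gam y (axis i 1) (?D w))) $ i)) (at y within S)" unfolding trc_def nab_def
   by (intro has_derivative_sum bounded_linear.has_derivative[OF bounded_linear_vec_nth]
     has_derivative_add Ck_on_deriv[OF Ck_on_dd[OF thick X2] y] Gam_derivative[OF y has_derivative_const dX])
  from dd_eq[OF thick y this] show ?thesis by (simp add: trc_def Gam_simps)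
 qed
 have comm: "dd S u (dd S ?x X) y = dd S ?x (dd S u X) y" for u by (rule dd_commute[OF thick fat X y])
 \<comment> \<open>Before traces are taken, the two sides differ by curvature and by the commutator
   of \<open>Gam y (X y)\<close> with the derivative of X. A commutator has trace zero.\<close>
 have "nab Y y u - nab X y (nab X y u) - (dd S ?x (dd S u X) y + (DGam y ?x u ?x + Gam y u (?D ?x)))
   = Rm y u ?x ?x + (Gam y ?x (?D u) - ?D (Gam y ?x u))" for u unfolding nab_def[of Y] dY unfolding Y_def nab_def Rm_def
  by (simp add: comm Gam_simps linear_add[OF linD] Gam_sym[OF y, of ?x u] Gam_sym[OF y, of "Gam y u ?x"])
 hence "trc (%u. nab Y y u - nab X y (nab X y u) - (dd S ?x (dd S u X) y + (DGam y ?x u ?x + Gam y u (?D ?x))))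
   = trc (%u. Rm y u ?x ?x + (Gam y ?x (?D u) - ?D (Gam y ?x u)))" by simp
 moreover have "trc (%u. Gam y ?x (?D u)) = trc (%u. ?D (Gam y ?x u))" by (rule trc_commute[OF Gam_linear2 linD])
 moreover have "trc (nab Y y) = trc (%u. nab Y y u)" by simp
 ultimately show ?thesis by (simp only: trc_add trc_diff dtr Rm_ricci[OF y])
qed

lemma gradient_eqI:
 assumes "Ck_on (Suc k) S f" "y : S" "!!v. dd S v f y = ip y a v" shows "gradient S G f y = a"
 by (rule ip_eqI[OF assms(2)]) (simp add: ip_gradient[OF assms(1,2)] assms(3))

definition nsq :: "(real^'n => real) => real^'n => real" where
 "nsq f y = ip y (gradient S G f y) (gradient S G f y)"

lemma Ck_nsq: "Ck_on (Suc k) S f ==> Ck_on k S (nsq f)" unfolding nsq_def[abs_def] by (intro ip_smooth Ck_gradient)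

lemma dd_nsq:
 assumes f: "Ck_on (Suc (Suc k)) S f" and y: "y : S" shows "dd S v (nsq f) y = 2 * ip y (nab (gradient S G f) y v) (gradient S G f y)"
 using ip_nab[OF Ck_gradient[OF f] Ck_gradient[OF f] y, of v] ip_sym[OF y] by (simp add: nsq_def[abs_def])

text \<open>For X = grad f the Hessian is self-adjoint, hence the gradient of |X|^2 is 2 nabla_X X,
  and its divergence is given by the divergence identity.\<close>

lemma bochner:
 assumes f: "Ck_on 3 S f" and y: "y : S"
 defines "X \<equiv> gradient S G f"
 shows "laplacian S G (nsq f) y = 2 * (trc (%u. nab X y (nab X y u)) + dd S (X y) (laplacian S G f) y
   + X y \<bullet> (ricci S G y *v X y))"
proof -
 have f3: "Ck_on (Suc (Suc (Suc 0))) S f" using f by (simp add: numeral_3_eq_3)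
 have X2: "Ck_on (Suc (Suc 0)) S X" unfolding X_def by (rule Ck_gradient[OF f3])
 have n2: "Ck_on (Suc (Suc 0)) S (nsq f)" by (rule Ck_nsq[OF f3])
 define Y where "Y = (%z. nab X z (X z))"
 have gw: "gradient S G (nsq f) z = 2 *\<^sub>R Y z" if z: "z : S" for z
 proof (rule gradient_eqI[OF n2 z])
  fix v show "dd S v (nsq f) z = ip z (2 *\<^sub>R Y z) v" unfolding dd_nsq[OF f3 z] Y_def X_def[symmetric]
   using nab_gradient_selfadjoint[OF f3 z, of v "X z"] ip_sym[OF z, of v] by (simp add: ip_simps X_def)
 qed
 have Y1: "Ck_on (Suc 0) S Y"
 proof (rule Ck_on_cong)
  show "Ck_on (Suc 0) S (%z. (1/2) *\<^sub>R gradient S G (nsq f) z)"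
   by (rule Ck_on_bounded_linear[OF bounded_linear_scaleR_right thick Ck_gradient[OF n2]])
 qed (simp add: gw)
 have "dd S u (gradient S G (nsq f)) y = 2 *\<^sub>R dd S u Y y" for u
 proof -
  have "dd S u (gradient S G (nsq f)) y = dd S u (%z. 2 *\<^sub>R Y z) y" by (rule dd_cong[OF _ y]) (rule gw)
  also have "... = 2 *\<^sub>R dd S u Y y" by (rule dd_eq[OF thick y]) (intro has_derivative_scaleR_right Ck_on_deriv[OF Y1 y])
  finally show ?thesis .
 qed
 hence "nab (gradient S G (nsq f)) y = (%u. 2 *\<^sub>R nab Y y u)"
  unfolding nab_def gw[OF y] linear_cmul[OF Gam_linear2] by (simp only: scaleR_right_distrib)
 hence lw: "laplacian S G (nsq f) y = 2 * trc (nab Y y)" unfolding laplacian_trc[OF n2 y] by (simp only: trc_scaleR)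
 have "dd S (X y) (%z. trc (nab X z)) y = dd S (X y) (laplacian S G f) y" by (rule dd_cong[OF _ y]) (simp add: laplacian_trc[OF f3] X_def)
 hence "trc (nab Y y) = trc (%u. nab X y (nab X y u)) + dd S (X y) (laplacian S G f) y + X y \<bullet> (ricci S G y *v X y)"
  using divergence_identity[of X y] X2 y unfolding Y_def by (simp add: numeral_2_eq_2)
 thus ?thesis using lw by simp
qed

text \<open>On the diagonal the two terms of the Lie derivative with derivatives of W coincide. By
  metric compatibility the right side is twice <nabla_x W, x>, the form in which it meets the
  Bochner formula.\<close>

lemma lie_quadratic:
 assumes W: "Ck_on (Suc 0) S W" and y: "y : S" shows "x \<bullet> (lie_metric S G W y *v x) = dG y (W y) x x + 2 * ip y (dd S x W y) x"
proof -
 have W1: "dd S w (%z. W z $ k) y = dd S w W y $ k" for w k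
  by (rule dd_eq[OF thick y]) (intro bounded_linear.has_derivative[OF bounded_linear_vec_nth] Ck_on_deriv[OF W y])
 have Gs: "G y $ i $ k = G y $ k $ i" for i k
 proof -
  have "transpose (G y) $ i $ k = G y $ i $ k" using sym[OF y] by simp
  thus ?thesis by (simp add: transpose_def)
 qed
 have ipx: "ip y (dd S x W y) x = (SUM i:UNIV. SUM j:UNIV. SUM k:UNIV. x $ i * x $ j * (G y $ k $ j * pd S i (%z. W z $ k) y))"
 proof -
  have "ip y (dd S x W y) x = (SUM i:UNIV. x $ i * ip y (dd S (axis i 1) W y) x)"
   by (subst dd_expand[OF W y]) (simp add: linear_sum[OF linear_ip1] ip_simps)
  also have "... = (SUM i:UNIV. SUM k:UNIV. SUM j:UNIV. x $ i * x $ j * (G y $ k $ j * pd S i (%z. W z $ k) y))"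
   by (simp add: ip_def inner_vec_def matrix_vector_mult_def sum_distrib_left W1 pd_dd mult_ac)
  also have "... = (SUM i:UNIV. SUM j:UNIV. SUM k:UNIV. x $ i * x $ j * (G y $ k $ j * pd S i (%z. W z $ k) y))"
   by (rule sum.cong[OF refl], rule sum.swap)
  finally show ?thesis .
 qed
 have dGx: "dG y (W y) x x = (SUM i:UNIV. SUM j:UNIV. SUM k:UNIV. x $ i * x $ j * (W y $ k * pd S k (%z. G z $ i $ j) y))"
 proof -
  have "dG y (W y) x x = (SUM k:UNIV. SUM i:UNIV. SUM j:UNIV. x $ i * x $ j * (W y $ k * pd S k (%z. G z $ i $ j) y))"
   by (simp add: dG_expand[OF y] mult_ac)
  also have "... = (SUM i:UNIV. SUM k:UNIV. SUM j:UNIV. x $ i * x $ j * (W y $ k * pd S k (%z. G z $ i $ j) y))" by (rule sum.swap)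
  also have "... = (SUM i:UNIV. SUM j:UNIV. SUM k:UNIV. x $ i * x $ j * (W y $ k * pd S k (%z. G z $ i $ j) y))"
   by (rule sum.cong[OF refl], rule sum.swap)
  finally show ?thesis .
 qed
 have "x \<bullet> (lie_metric S G W y *v x) = (SUM i:UNIV. SUM j:UNIV. SUM k:UNIV. x $ i * x $ j * (W y $ k * pd S k (%z. G z $ i $ j) y))
  + (SUM i:UNIV. SUM j:UNIV. SUM k:UNIV. x $ i * x $ j * (G y $ k $ j * pd S i (%z. W z $ k) y))
  + (SUM i:UNIV. SUM j:UNIV. SUM k:UNIV. x $ i * x $ j * (G y $ i $ k * pd S j (%z. W z $ k) y))"
  by (simp add: inner_vec_def matrix_vector_mult_def lie_metric_def sum_distrib_left distrib_left sum.distrib mult_ac)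
 also have "(SUM i:UNIV. SUM j:UNIV. SUM k:UNIV. x $ i * x $ j * (G y $ i $ k * pd S j (%z. W z $ k) y)) = ip y (dd S x W y) x"
  unfolding ipx by (subst sum.swap) (simp add: Gs mult_ac)
 finally show ?thesis by (simp add: dGx ipx)
qed

lemma laplacian_V_eq:
 assumes f: "Ck_on (Suc k) S f" and y: "y : S" shows "laplacian_V S G W f y = laplacian S G f y + dd S (W y) f y"
 using ip_gradient(2)[OF assms, of "W y"] by (simp add: laplacian_V_def ip_def)

lemma laplacian_deriv:
 assumes f: "Ck_on 3 S f" and y: "y : S" shows "(laplacian S G f has_derivative (%e. dd S e (laplacian S G f) y)) (at y within S)"
proof -
 have f3: "Ck_on (Suc (Suc (Suc 0))) S f" using f by (simp add: numeral_3_eq_3)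
 have X: "Ck_on (Suc (Suc 0)) S (gradient S G f)" by (rule Ck_gradient[OF f3])
 have "((%z. trc (nab (gradient S G f) z)) has_derivative (%w. SUM i:UNIV. (dd S w (dd S (axis i 1) (gradient S G f)) y +
    (DGam y w (axis i 1) (gradient S G f y) + Gam y 0 (gradient S G f y) + Gam y (axis i 1) (dd S w (gradient S G f) y))) $ i)) (at y within S)"
  unfolding trc_def nab_def by (intro has_derivative_sum bounded_linear.has_derivative[OF bounded_linear_vec_nth]
     has_derivative_add Ck_on_deriv[OF Ck_on_dd[OF thick X] y] Gam_derivative[OF y has_derivative_const Ck_on_deriv[OF X y]])
 hence "(laplacian S G f has_derivative (%w. SUM i:UNIV. (dd S w (dd S (axis i 1) (gradient S G f)) y +
    (DGam y w (axis i 1) (gradient S G f y) + Gam y 0 (gradient S G f y) + Gam y (axis i 1) (dd S w (gradient S G f) y))) $ i)) (at y within S)"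
  by (rule has_derivative_transform[OF y, rotated]) (simp add: laplacian_trc[OF f3])
 thus ?thesis by (intro dd_has_derivative) (auto simp: differentiable_def)
qed

text \<open>Half of the drift term on the left and the drift part of X(Delta_V f) differ by -
  <nabla_X W, X>, which is minus half the Lie derivative of the metric; this turns Ric into
  Ric_V.\<close>

lemma bochner_V:
 assumes f: "Ck_on 3 S f" and W: "Ck_on (Suc 0) S W" and y: "y : S"
 defines "X \<equiv> gradient S G f"
 shows "laplacian_V S G W (nsq f) y = 2 * (trc (%u. nab X y (nab X y u)) + dd S (X y) (laplacian_V S G W f) y
   + X y \<bullet> (ricci_V S G W y *v X y))"
proof -
 have f3: "Ck_on (Suc (Suc (Suc 0))) S f" using f by (simp add: numeral_3_eq_3)
 have f2: "Ck_on 2 S f" using Ck_on_SucD[OF f3] by (simp add: numeral_2_eq_2)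
 have n1: "Ck_on (Suc 0) S (nsq f)" using Ck_nsq[OF f3] Ck_on_SucD by blast
 let ?x = "X y" and ?w = "W y"
 have 1: "dd S ?x (laplacian_V S G W f) y = dd S ?x (laplacian S G f) y + (dd S ?x (dd S ?w f) y + dd S (dd S ?x W y) f y)"
 proof -
  have "dd S ?x (laplacian_V S G W f) y = dd S ?x (%z. laplacian S G f z + dd S (W z) f z) y" by (rule dd_cong[OF _ y]) (rule laplacian_V_eq[OF f3])
  also have "... = dd S ?x (laplacian S G f) y + (dd S ?x (dd S ?w f) y + dd S (dd S ?x W y) f y)"
   by (rule dd_eq[OF thick y]) (intro has_derivative_add laplacian_deriv[OF f y] dd_apply_derivative[OF f3 y Ck_on_deriv[OF W y]])
  finally show ?thesis .
 qed
 have 2: "dd S ?w (nsq f) y = 2 * (dd S ?w (dd S ?x f) y - dd S (Gam y ?w ?x) f y)" unfolding dd_nsq[OF f3 y] hess_gradient[OF f3 y] X_def ..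
 have 3: "?x \<bullet> (ricci_V S G W y *v ?x) = ?x \<bullet> (ricci S G y *v ?x) - (dd S (Gam y ?w ?x) f y + dd S (dd S ?x W y) f y)"
 proof -
  have "?x \<bullet> (ricci_V S G W y *v ?x) = ?x \<bullet> (ricci S G y *v ?x) - (1/2) * (?x \<bullet> (lie_metric S G W y *v ?x))"
   by (simp add: ricci_V_def matrix_vector_mult_diff_rdistrib inner_diff_right scaleR_matrix_vector_assoc[symmetric])
  also have "?x \<bullet> (lie_metric S G W y *v ?x) = 2 * (dd S (Gam y ?w ?x) f y + dd S (dd S ?x W y) f y)"
   unfolding lie_quadratic[OF W y] metric_compat[OF y] using ip_gradient[OF f3 y] by (simp add: X_def)
  finally show ?thesis by argo
 qed
 have "laplacian_V S G W (nsq f) y = laplacian S G (nsq f) y + dd S ?w (nsq f) y" by (rule laplacian_V_eq[OF n1 y])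
 thus ?thesis unfolding bochner[OF f y] 1 2 3 X_def[symmetric] using dd_commute[OF thick fat f2 y, of ?x ?w] by (simp add: algebra_simps)
qed

text \<open>The trace-free part \<open>M\<close> of \<open>L\<close> is again self-adjoint, so the
  trace of its square is a sum of squared lengths over an orthonormal frame.\<close>

lemma trc_square_ge:
 assumes y: "y : S" and L: "linear L" and sa: "!!u v. ip y (L u) v = ip y u (L v)" shows "(trc L)^2 <= real CARD('n) * trc (%u. L (L u))"
proof -
 obtain e where e: "onb y e" using onb_exists[OF y] by blast
 define t where "t = trc L / real CARD('n)"
 have n: "real CARD('n) > 0" by simp
 define M where "M = (%u. L u - t *\<^sub>R u)"
 have linM: "linear M" unfolding M_def by (rule linearI) (simp_all add: linear_add[OF L] linear_cmul[OF L] algebra_simps)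
 have MM: "linear (%u. M (M u))" using linear_compose[OF linM linM] by (simp add: o_def)
 have "0 <= (SUM i:UNIV. ip y (M (e i)) (M (e i)))" by (intro sum_nonneg ip_nonneg[OF y])
 also have "... = (SUM i:UNIV. ip y (M (M (e i))) (e i))" using sa by (intro sum.cong refl) (simp add: M_def ip_simps)
 also have "... = trc (%u. M (M u))" by (rule trc_onb[OF y e MM, symmetric])
 also have "(%u. M (M u)) = (%u. L (L u) - (t *\<^sub>R L u + t *\<^sub>R (L u - t *\<^sub>R u)))"
  by (simp add: M_def fun_eq_iff linear_diff[OF L] linear_cmul[OF L] algebra_simps)
 also have "trc ... = trc (%u. L (L u)) - (t * trc L + t * (trc L - t * real CARD('n)))"
  by (simp add: trc_def sum_subtractf sum.distrib sum_distrib_left axis_def algebra_simps)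
 also have "t * real CARD('n) = trc L" by (simp add: t_def)
 finally have "t * trc L <= trc (%u. L (L u))" by simp
 thus ?thesis using n by (simp add: t_def power2_eq_square field_simps)
qed

text \<open>The difference is ((m - n) a - n b)^2 / (n (m - n) m). This is how the dimension n of
  the manifold and the excess m - n of the drift combine to m.\<close>

lemma weighted_square_ineq:
 fixes a b n m :: real
 assumes "0 < n" "n < m" shows "(a + b)^2 / m <= a\<^sup>2 / n + b\<^sup>2 / (m - n)"
proof -
 have "a\<^sup>2 / n + b\<^sup>2 / (m - n) - (a + b)\<^sup>2 / m = ((m - n) * a - n * b)^2 / (n * (m - n) * m)"
  using assms by (simp add: field_simps power2_eq_square)
 moreover have "... >= 0" using assms by (intro divide_nonneg_pos) auto
 ultimately show ?thesis by linarith
qed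

text \<open>The curvature-dimension inequality. In Delta_V f = Delta f + V f the first part is
  bounded by the trace of the squared Hessian, with constant n; the second, with constant m - n, is
  exactly the term that Ric_V^m subtracts from Ric_V.\<close>

lemma bochner_lower_bound:
 assumes f: "Ck_on 3 S f" and W: "Ck_on (Suc 0) S W" and y: "y : S" and m: "m > real CARD('n)"
  and ric: "!!\<xi>. 0 <= \<xi> \<bullet> (ricci_V_m m S G W y *v \<xi>)"
 defines "X \<equiv> gradient S G f"
 shows "(laplacian_V S G W f y)^2 / m <= trc (%u. nab X y (nab X y u)) + X y \<bullet> (ricci_V S G W y *v X y)"
proof -
 have f3: "Ck_on (Suc (Suc (Suc 0))) S f" using f by (simp add: numeral_3_eq_3)
 have n: "real CARD('n) > 0" by simp
 have "(laplacian_V S G W f y)^2 / m = (trc (nab X y) + dd S (W y) f y)^2 / m" by (simp add: laplacian_V_eq[OF f3 y] laplacian_trc[OF f3 y] X_def)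
 also have "... <= (trc (nab X y))^2 / real CARD('n) + (dd S (W y) f y)^2 / (m - real CARD('n))" by (rule weighted_square_ineq[OF n m])
 also have "(trc (nab X y))^2 / real CARD('n) <= trc (%u. nab X y (nab X y u))"
  using trc_square_ge[OF y nab_linear[OF Ck_gradient[OF f3] y] nab_gradient_selfadjoint[OF f3 y]] n by (simp add: X_def field_simps)
 also have "(dd S (W y) f y)^2 / (m - real CARD('n)) <= X y \<bullet> (ricci_V S G W y *v X y)"
 proof -
  have "X y \<bullet> ((\<chi> i j. flat G W y $ i * flat G W y $ j) *v X y) = (X y \<bullet> flat G W y)^2"
   by (simp add: inner_vec_def matrix_vector_mult_def power2_eq_square sum_product sum_distrib_left mult_ac)
  also have "X y \<bullet> flat G W y = dd S (W y) f y" using ip_gradient(1)[OF f3 y, of "W y"] by (simp add: flat_def ip_def X_def)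
  finally have "X y \<bullet> (ricci_V_m m S G W y *v X y) = X y \<bullet> (ricci_V S G W y *v X y) - (dd S (W y) f y)\<^sup>2 / (m - real CARD('n))"
   by (simp add: ricci_V_m_def matrix_vector_mult_diff_rdistrib inner_diff_right scaleR_matrix_vector_assoc[symmetric])
  thus ?thesis using ric[of "X y"] by linarith
 qed
 finally show ?thesis by simp
qed

lemma laplacian_V_chain:
 assumes f: "Ck_on 2 S f" and y: "y : S" and ph: "!!z. (ph has_real_derivative ph' z) (at z)" "!!z. (ph' has_real_derivative ph'' z) (at z)"
  and c: "Ck_on 2 S (%y. ph (f y))" shows "laplacian_V S G W (%y. ph (f y)) y = ph' (f y) * laplacian_V S G W f y + ph'' (f y) * nsq f y"
  "!!v. dd S v (%y. ph (f y)) y = ph' (f y) * dd S v f y"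
proof -
 have f2: "Ck_on (Suc (Suc 0)) S f" and c2: "Ck_on (Suc (Suc 0)) S (%y. ph (f y))" using f c by (simp_all add: numeral_2_eq_2)
 have comp: "((%y. ps (f y)) has_derivative (%v. ps' (f z) * dd S v f z)) (at z within S)"
  if "!!z. (ps has_real_derivative ps' z) (at z)" "z : S" for ps ps' z
  using has_derivative_compose[OF Ck_on_deriv[OF f2 that(2)], of ps "(*) (ps' (f z))"] that(1)[of "f z"] by (simp add: has_field_derivative_def)
 have d: "dd S v (%y. ph (f y)) z = ph' (f z) * dd S v f z" if "z : S" for v z by (rule dd_eq[OF thick that comp[OF ph(1) that]])
 thus "!!v. dd S v (%y. ph (f y)) y = ph' (f y) * dd S v f y" using y by blast
 let ?X = "gradient S G f"
 have g: "gradient S G (%y. ph (f y)) z = ph' (f z) *\<^sub>R ?X z" if "z : S" for z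
  by (rule gradient_eqI[OF c2 that]) (simp add: d[OF that] ip_simps ip_gradient[OF f2 that])
 have "dd S u (gradient S G (%y. ph (f y))) y = dd S u (%z. ph' (f z) *\<^sub>R ?X z) y" for u by (rule dd_cong[OF g y])
 moreover have "dd S u (%z. ph' (f z) *\<^sub>R ?X z) y = ph' (f y) *\<^sub>R dd S u ?X y + (ph'' (f y) * dd S u f y) *\<^sub>R ?X y" for u
  by (rule dd_eq[OF thick y has_derivative_scaleR[OF comp[OF ph(2) y] Ck_on_deriv[OF Ck_gradient[OF f2] y]]])
 ultimately have "nab (gradient S G (%y. ph (f y))) y u = ph' (f y) *\<^sub>R nab ?X y u + (ph'' (f y) * dd S u f y) *\<^sub>R ?X y" for u
  by (simp add: nab_def g[OF y] Gam_simps algebra_simps)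
 hence "laplacian S G (%y. ph (f y)) y = trc (%u. ph' (f y) *\<^sub>R nab ?X y u + (ph'' (f y) * dd S u f y) *\<^sub>R ?X y)"
  unfolding laplacian_trc[OF c2 y] by (simp add: trc_def)
 also have "... = ph' (f y) * trc (nab ?X y) + ph'' (f y) * (SUM i:UNIV. ?X y $ i * dd S (axis i 1) f y)"
  by (simp add: trc_def sum.distrib sum_distrib_left mult_ac)
 also have "(SUM i:UNIV. ?X y $ i * dd S (axis i 1) f y) = nsq f y"
  using dd_expand[OF f2 y, of "?X y"] ip_gradient(1)[OF f2 y] by (simp add: nsq_def)
 finally show "laplacian_V S G W (%y. ph (f y)) y = ph' (f y) * laplacian_V S G W f y + ph'' (f y) * nsq f y"
  by (simp add: laplacian_V_eq[OF f2 y] laplacian_V_eq[OF c2 y] laplacian_trc[OF f2 y] d[OF y] algebra_simps)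
qed

end

section \<open>Linearity of the V-Laplacian and traces of products of differentials\<close>

context coord_metric begin

lemma laplacian_V_gtr:
 assumes f: "Ck_on (Suc (Suc k)) S f" and y: "y : S"
 shows "laplacian_V S G W f y = gtr y (%u v. dd S u (dd S v f) y - dd S (Gam y u v) f y) + dd S (W y) f y"
 by (simp add: laplacian_V_eq[OF f y] laplacian_gtr[OF f y])

lemma gtr_lin:
 "gtr y (%u v. B u v + C u v) = gtr y B + gtr y C" "gtr y (%u v. B u v - C u v) = gtr y B - gtr y C" "gtr y (%u v. c * B u v) = c * gtr y B"
 by (simp_all add: gtr_def algebra_simps sum.distrib sum_subtractf sum_distrib_left)

lemma dd_add:
 fixes f g :: "real^'n => real"
 assumes "Ck_on (Suc k) S f" "Ck_on (Suc l) S g" "y : S" shows "dd S v (%y. f y + g y) y = dd S v f y + dd S v g y"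
 by (rule dd_eq[OF thick assms(3)]) (intro has_derivative_add Ck_on_deriv[OF assms(1,3)] Ck_on_deriv[OF assms(2,3)])

lemma dd_cmult:
 fixes f :: "real^'n => real"
 assumes "Ck_on (Suc k) S f" "y : S" shows "dd S v (%y. c * f y) y = c * dd S v f y"
 by (rule dd_eq[OF thick assms(2)]) (intro has_derivative_mult_right Ck_on_deriv[OF assms])

lemma laplacian_V_add:
 assumes f: "Ck_on 2 S f" and h: "Ck_on 2 S h" and y: "y : S"
 shows "laplacian_V S G W (%y. f y + h y) y = laplacian_V S G W f y + laplacian_V S G W h y"
proof -
 have f2: "Ck_on (Suc (Suc 0)) S f" and h2: "Ck_on (Suc (Suc 0)) S h" using f h by (simp_all add: numeral_2_eq_2)
 have "dd S u (dd S v (%y. f y + h y)) y = dd S u (dd S v f) y + dd S u (dd S v h) y" for u v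
 proof -
  have "dd S u (dd S v (%y. f y + h y)) y = dd S u (%y. dd S v f y + dd S v h y) y" by (rule dd_cong[OF _ y]) (rule dd_add[OF f2 h2])
  thus ?thesis by (simp add: dd_add[OF Ck_on_dd[OF thick f2] Ck_on_dd[OF thick h2] y])
 qed
 thus ?thesis unfolding laplacian_V_gtr[OF Ck_on_add[OF thick f2 h2] y] laplacian_V_gtr[OF f2 y] laplacian_V_gtr[OF h2 y]
  by (simp add: dd_add[OF f2 h2 y] gtr_lin)
qed

lemma laplacian_V_cmult:
 assumes f: "Ck_on 2 S f" and y: "y : S" shows "laplacian_V S G W (%y. c * f y) y = c * laplacian_V S G W f y"
proof -
 have f2: "Ck_on (Suc (Suc 0)) S f" using f by (simp_all add: numeral_2_eq_2)
 have c2: "Ck_on (Suc (Suc 0)) S (%y. c * f y)" by (rule Ck_on_bounded_linear[OF bounded_linear_mult_right thick f2])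
 have "dd S u (dd S v (%y. c * f y)) y = c * dd S u (dd S v f) y" for u v
 proof -
  have "dd S u (dd S v (%y. c * f y)) y = dd S u (%y. c * dd S v f y) y" by (rule dd_cong[OF _ y]) (rule dd_cmult[OF f2])
  thus ?thesis by (simp add: dd_cmult[OF Ck_on_dd[OF thick f2] y])
 qed
 thus ?thesis unfolding laplacian_V_gtr[OF c2 y] laplacian_V_gtr[OF f2 y] by (simp add: dd_cmult[OF f2 y] gtr_lin algebra_simps)
qed

lemma gtr_product:
 assumes f: "Ck_on (Suc k) S f" and h: "Ck_on (Suc l) S h" and y: "y : S" shows "gtr y (%u v. dd S u h y * dd S v f y) = dd S (gradient S G f y) h y"
proof -
 have "gtr y (%u v. dd S u h y * dd S v f y) = (SUM i:UNIV. dd S (axis i 1) h y * gradient S G f y $ i)"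
  by (simp add: gtr_def gradient_def matrix_vector_mult_def pd_dd sum_distrib_left mult_ac)
 thus ?thesis by (simp add: dd_expand[OF h y, of "gradient S G f y"] mult.commute)
qed

lemma dd_gradient_commute:
 assumes f: "Ck_on (Suc k) S f" and h: "Ck_on (Suc l) S h" and y: "y : S" shows "dd S (gradient S G f y) h y = dd S (gradient S G h y) f y"
 using ip_gradient(1)[OF h y, of "gradient S G f y"] ip_gradient(2)[OF f y, of "gradient S G h y"] by simp

end

subsection \<open>The equation for the logarithm of a solution\<close>

lemma DERIV_eventually:
 assumes "(f has_real_derivative D) (at t)" "\<forall>\<^sub>F s in nhds t. f s = g s" shows "(g has_real_derivative D) (at t)"
 using DERIV_cong_ev[OF refl assms(2) refl] assms(1) by blast

text \<open>The alternative in \<open>p\<close> lets a single positive \<open>be\<close> serve all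
  exponents below 1, while exponents equal to 1 contribute 0 to the derivatives of the reaction
  term.\<close>

locale heat_chart = coord_metric S G for S :: "(real^'n::finite) set" and G +
 fixes W :: "real^'n => real^'n" and f :: "(real^'n) \<times> real => real" and m be :: real
  and N :: nat and a p :: "nat => real"
 assumes W: "Ck_on (Suc 0) S W" and f_smooth: "smooth_on (S \<times> {0<..}) f" and m: "m > real CARD('n)"
  and ric: "!!y \<xi>. y : S ==> 0 <= \<xi> \<bullet> (ricci_V_m m S G W y *v \<xi>)" and a: "!!i. i : {1..N} ==> 0 <= a i"
  and p: "!!i. i : {1..N} ==> p i = 1 \<or> be <= 1 - p i" and be: "0 < be" "be < 1"
  and pde: "!!y t. y : S ==> 0 < t ==> dd (S \<times> {0<..}) (0, 1) f (y, t) =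
    laplacian_V S G W (%y. f (y, t)) y + nsq (%y. f (y, t)) y + (SUM i=1..N. a i * exp ((p i - 1) * f (y, t)))"
begin

abbreviation "ST \<equiv> S \<times> {0::real<..}"
abbreviation "lapV \<equiv> laplacian_V S G W"

definition hh :: "real => real" where "hh z = (SUM i=1..N. a i * exp ((p i - 1) * z))"
definition hh' :: "real => real" where "hh' z = (SUM i=1..N. a i * (p i - 1) * exp ((p i - 1) * z))"
definition hh'' :: "real => real" where "hh'' z = (SUM i=1..N. a i * (p i - 1)^2 * exp ((p i - 1) * z))"

definition ft :: "(real^'n) \<times> real => real" where "ft = dd ST (0, 1) f"

text \<open>By the equation this is - Delta_V f - be |grad f|^2, see \<open>Q_eq\<close>. The form
  chosen contains only first derivatives of f, so its continuity and its independence of the chart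
  can be read off.\<close>

definition Q :: "real => real^'n => real" where
 "Q t y = - ft (y, t) + (1 - be) * nsq (%y. f (y, t)) y + hh (f (y, t))"

lemma thick_ST: "thick ST" by (intro thick_Times thick thick_open open_greaterThan)
lemma fat_ST: "ST \<subseteq> closure (interior ST)" by (intro closure_interior_Times fat open_greaterThan)

lemma smooth_ft: "smooth_on ST ft" unfolding ft_def by (rule smooth_on_dd[OF thick_ST f_smooth])

lemma slice_smooth: "smooth_on ST F ==> 0 < t ==> smooth_on S (%y. F (y, t))" for F :: "_ => real"
 by (rule smooth_on_slice[OF thick open_greaterThan]) auto

lemma f_Ck: "0 < t ==> Ck_on k S (%y. f (y, t))" by (rule smooth_onD[OF slice_smooth[OF f_smooth]])

lemma ft_Ck: "0 < t ==> Ck_on k S (%y. ft (y, t))" by (rule smooth_onD[OF slice_smooth[OF smooth_ft]])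

lemma hh_deriv: "(hh has_real_derivative hh' z) (at z)" "(hh' has_real_derivative hh'' z) (at z)" unfolding hh_def[abs_def] hh'_def[abs_def] hh''_def
 by (auto intro!: derivative_eq_intros sum.cong simp: power2_eq_square algebra_simps)

lemma hh_Ck: assumes "0 < t" shows "Ck_on k S (%y. hh (f (y, t)))" unfolding hh_def
 by (intro Ck_on_sum[OF thick] Ck_on_mult[OF thick] Ck_on_const[OF thick] smooth_onD[OF smooth_on_exp[OF thick]] slice_smooth f_smooth assms)

lemma Q_Ck: assumes "0 < t" shows "Ck_on k S (Q t)"
proof -
 have e: "Q t = (%y. (-1) * ft (y, t) + ((1 - be) * nsq (%y. f (y, t)) y + hh (f (y, t))))" by (simp add: Q_def fun_eq_iff)
 have "Ck_on k S (%y. (-1) * ft (y, t) + ((1 - be) * nsq (%y. f (y, t)) y + hh (f (y, t))))"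
  by (intro Ck_on_add[OF thick] Ck_on_mult[OF thick] Ck_on_const[OF thick] ft_Ck Ck_nsq[OF f_Ck] hh_Ck assms)
 thus ?thesis unfolding e .
qed

text \<open>Symmetry of second derivatives on the product of \<open>S\<close> with the time axis,
  translated to slices. It holds up to the boundary of \<open>S\<close> because
  \<open>dd_commute\<close> does.\<close>

lemma time_dd:
 assumes F: "smooth_on ST F" and y: "y : S" and t: "0 < t"
 shows "((%s. dd S v (%y. F (y, s)) y) has_real_derivative dd S v (%y. dd ST (0, 1) F (y, t)) y) (at t)"
proof -
 have yt: "(y, t) : ST" using y t by simp
 have D: "smooth_on ST (dd ST (v, 0) F)" by (rule smooth_on_dd[OF thick_ST F])
 have T: "smooth_on ST (dd ST (0, 1) F)" by (rule smooth_on_dd[OF thick_ST F])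
 have "((%s. dd ST (v, 0) F (y, s)) has_real_derivative dd ST (0, 1) (dd ST (v, 0) F) (y, t)) (at t)"
  using time_derivative[OF smooth_onD[OF D] y] t by simp
 moreover have "dd ST (0, 1) (dd ST (v, 0) F) (y, t) = dd S v (%y. dd ST (0, 1) F (y, t)) y"
  using dd_commute[OF thick_ST fat_ST smooth_onD[OF F] yt] dd_slice[OF thick smooth_onD[OF T] y, of t] t by simp
 moreover have "\<forall>\<^sub>F s in nhds t. dd ST (v, 0) F (y, s) = dd S v (%y. F (y, s)) y"
  by (rule eventually_mono[OF eventually_nhds_in_open[OF open_greaterThan[of 0]]]) (use t dd_slice[OF thick smooth_onD[OF F] y] in auto)
 ultimately show ?thesis using DERIV_eventually by fastforce
qed

lemma time_dd2:
 assumes y: "y : S" and t: "0 < t" shows "((%s. dd S u (dd S v (%y. f (y, s))) y) has_real_derivative dd S u (dd S v (%y. ft (y, t))) y) (at t)"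
proof -
 have D: "smooth_on ST (dd ST (v, 0) f)" by (rule smooth_on_dd[OF thick_ST f_smooth])
 have "((%s. dd S u (%y. dd ST (v, 0) f (y, s)) y) has_real_derivative dd S u (%y. dd ST (0, 1) (dd ST (v, 0) f) (y, t)) y) (at t)"
  by (rule time_dd[OF D y t])
 moreover have "dd S u (%y. dd ST (0, 1) (dd ST (v, 0) f) (y, t)) y = dd S u (dd S v (%y. ft (y, t))) y"
 proof (rule dd_cong[OF _ y])
  fix z assume z: "z : S"
  hence "(z, t) : ST" using t by simp
  from dd_commute[OF thick_ST fat_ST smooth_onD[OF f_smooth] this]
  show "dd ST (0, 1) (dd ST (v, 0) f) (z, t) = dd S v (%y. ft (y, t)) z"
   using dd_slice[OF thick smooth_onD[OF smooth_ft] z, of t] t by (simp add: ft_def)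
 qed
 moreover have "\<forall>\<^sub>F s in nhds t. dd S u (%y. dd ST (v, 0) f (y, s)) y = dd S u (dd S v (%y. f (y, s))) y"
  by (rule eventually_mono[OF eventually_nhds_in_open[OF open_greaterThan[of 0]]])
   (use t dd_slice[OF thick smooth_onD[OF f_smooth]] in \<open>auto intro!: dd_cong[OF _ y]\<close>)
 ultimately show ?thesis using DERIV_eventually by fastforce
qed

lemma time_lapV:
 assumes y: "y : S" and t: "0 < t" shows "((%s. lapV (%y. f (y, s)) y) has_real_derivative lapV (%y. ft (y, t)) y) (at t)"
proof -
 have "((%s. gtr y (%u v. dd S u (dd S v (%y. f (y, s))) y - dd S (Gam y u v) (%y. f (y, s)) y) + dd S (W y) (%y. f (y, s)) y)
  has_real_derivative gtr y (%u v. dd S u (dd S v (%y. ft (y, t))) y - dd S (Gam y u v) (%y. ft (y, t)) y) + dd S (W y) (%y. ft (y, t)) y) (at t)"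
  unfolding gtr_def using time_dd[OF f_smooth y t] by (intro DERIV_add DERIV_sum DERIV_cmult DERIV_diff time_dd2[OF y t]) (simp_all add: ft_def)
 moreover have "\<forall>\<^sub>F s in nhds t. gtr y (%u v. dd S u (dd S v (%y. f (y, s))) y - dd S (Gam y u v) (%y. f (y, s)) y) + dd S (W y) (%y. f (y, s)) y
   = lapV (%y. f (y, s)) y" by (rule eventually_mono[OF eventually_nhds_in_open[OF open_greaterThan[of 0]]])
   (use t laplacian_V_gtr[OF f_Ck y] in auto)
 ultimately show ?thesis unfolding laplacian_V_gtr[OF ft_Ck[OF t] y] using DERIV_eventually by fastforce
qed

lemma nsq_gtr: "0 < s ==> y : S ==> nsq (%y. f (y, s)) y = gtr y (%u v. dd S u (%y. f (y, s)) y * dd S v (%y. f (y, s)) y)"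
 unfolding gtr_product[OF f_Ck f_Ck] nsq_def using ip_gradient(1)[OF f_Ck] by simp

lemma time_nsq:
 assumes y: "y : S" and t: "0 < t"
 shows "((%s. nsq (%y. f (y, s)) y) has_real_derivative 2 * dd S (gradient S G (%y. f (y, t)) y) (%y. ft (y, t)) y) (at t)"
proof -
 note d = time_dd[OF f_smooth y t, folded ft_def]
 have "((%s. gtr y (%u v. dd S u (%y. f (y, s)) y * dd S v (%y. f (y, s)) y)) has_real_derivative
   gtr y (%u v. dd S u (%y. ft (y, t)) y * dd S v (%y. f (y, t)) y + dd S v (%y. ft (y, t)) y * dd S u (%y. f (y, t)) y)) (at t)"
  unfolding gtr_def by (intro DERIV_sum DERIV_cmult DERIV_mult d)
 also have "gtr y (%u v. dd S u (%y. ft (y, t)) y * dd S v (%y. f (y, t)) y + dd S v (%y. ft (y, t)) y * dd S u (%y. f (y, t)) y)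
   = gtr y (%u v. dd S u (%y. ft (y, t)) y * dd S v (%y. f (y, t)) y) + gtr y (%u v. dd S u (%y. f (y, t)) y * dd S v (%y. ft (y, t)) y)"
  by (simp add: gtr_lin mult.commute)
 also have "... = 2 * dd S (gradient S G (%y. f (y, t)) y) (%y. ft (y, t)) y"
  unfolding gtr_product[OF f_Ck[OF t] ft_Ck[OF t] y] gtr_product[OF ft_Ck[OF t] f_Ck[OF t] y]
  using dd_gradient_commute[OF f_Ck[OF t] ft_Ck[OF t] y] by simp
 finally have "((%s. gtr y (%u v. dd S u (%y. f (y, s)) y * dd S v (%y. f (y, s)) y)) has_real_derivative
   2 * dd S (gradient S G (%y. f (y, t)) y) (%y. ft (y, t)) y) (at t)" .
 moreover have "\<forall>\<^sub>F s in nhds t. gtr y (%u v. dd S u (%y. f (y, s)) y * dd S v (%y. f (y, s)) y) = nsq (%y. f (y, s)) y"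
  by (rule eventually_mono[OF eventually_nhds_in_open[OF open_greaterThan[of 0]]]) (use t nsq_gtr y in auto)
 ultimately show ?thesis using DERIV_eventually by fastforce
qed

lemma time_f: assumes "y : S" "0 < t" shows "((%s. f (y, s)) has_real_derivative ft (y, t)) (at t)"
 unfolding ft_def using time_derivative[OF smooth_onD[OF f_smooth] assms(1)] assms(2) by simp

lemma time_hh: assumes "y : S" "0 < t" shows "((%s. hh (f (y, s))) has_real_derivative hh' (f (y, t)) * ft (y, t)) (at t)"
 using DERIV_chain2[OF hh_deriv(1) time_f[OF assms]] .

text \<open>The equation expresses \<open>ft\<close> near time t by space derivatives of f;
  differentiating that expression gives the linearised equation.\<close>

lemma time_ft:
 assumes y: "y : S" and t: "0 < t"
 defines "X \<equiv> gradient S G (%y. f (y, t)) y"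
 shows "((%s. ft (y, s)) has_real_derivative lapV (%y. ft (y, t)) y + 2 * dd S X (%y. ft (y, t)) y + hh' (f (y, t)) * ft (y, t)) (at t)"
proof -
 have "((%s. lapV (%y. f (y, s)) y + nsq (%y. f (y, s)) y + hh (f (y, s))) has_real_derivative
   lapV (%y. ft (y, t)) y + 2 * dd S X (%y. ft (y, t)) y + hh' (f (y, t)) * ft (y, t)) (at t)"
  unfolding X_def by (intro DERIV_add time_lapV time_nsq time_hh y t)
 moreover have "\<forall>\<^sub>F s in nhds t. lapV (%y. f (y, s)) y + nsq (%y. f (y, s)) y + hh (f (y, s)) = ft (y, s)"
  by (rule eventually_mono[OF eventually_nhds_in_open[OF open_greaterThan[of 0]]]) (use t y pde in \<open>auto simp: ft_def hh_def\<close>)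
 ultimately show ?thesis using DERIV_eventually by fastforce
qed

text \<open>The time derivative of \<open>Q\<close> in the shape that the derivative rules produce;
  its two \<open>hh'\<close> terms cancel.\<close>

definition Qt :: "real => real^'n => real" where
 "Qt t y = - (lapV (%y. ft (y, t)) y + 2 * dd S (gradient S G (%y. f (y, t)) y) (%y. ft (y, t)) y + hh' (f (y, t)) * ft (y, t))
   + (1 - be) * (2 * dd S (gradient S G (%y. f (y, t)) y) (%y. ft (y, t)) y) + hh' (f (y, t)) * ft (y, t)"

lemma time_Q:
 assumes "y : S" "0 < t" shows "((%s. Q s y) has_real_derivative Qt t y) (at t)" unfolding Q_def Qt_def
 by (intro DERIV_add DERIV_minus DERIV_cmult time_ft time_nsq time_hh assms)

lemma Q_eq: assumes "y : S" "0 < t"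
 shows "Q t y = - lapV (%y. f (y, t)) y - be * nsq (%y. f (y, t)) y" using pde[OF assms] by (simp add: Q_def ft_def hh_def algebra_simps)

text \<open>Here F stands for Delta_V f and w for |grad f|^2. Each summand carries the factor - (F +
  2 be w) + (1 - p i) w, and F < - be w leaves more than (1 - p i - be) w, which is nonnegative by
  the choice of \<open>be\<close>.\<close>

lemma hh_ineq: assumes "0 <= w" "F < - be * w"
 shows "0 <= hh' z * (F + 2 * be * w) + hh'' z * w"
proof -
 have "hh' z * (F + 2 * be * w) + hh'' z * w
  = (SUM i=1..N. a i * exp ((p i - 1) * z) * ((1 - p i) * (- (F + 2 * be * w) + (1 - p i) * w)))"
  unfolding hh'_def hh''_def sum_distrib_right sum.distrib[symmetric] by (intro sum.cong refl) (simp add: power2_eq_square algebra_simps)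
 moreover have "0 <= a i * exp ((p i - 1) * z) * ((1 - p i) * (- (F + 2 * be * w) + (1 - p i) * w))" if i: "i : {1..N}" for i
 proof (cases "p i = 1")
  case False
  hence b: "be <= 1 - p i" using p[OF i] by blast
  hence "be * w <= (1 - p i) * w" using assms(1) by (rule mult_right_mono)
  hence "0 <= - (F + 2 * be * w) + (1 - p i) * w" using assms(2) by linarith
  moreover have "0 <= 1 - p i" using b be by linarith
  ultimately show ?thesis using a[OF i] by (intro mult_nonneg_nonneg) auto
 qed simp
 ultimately show ?thesis using sum_nonneg[of "{1..N}"] by (metis (no_types, lifting))
qed

text \<open>The Bochner formula brings third derivatives of f in as X(Delta_V f). Once the equation
  is substituted there, all terms with the time derivative of f cancel; what remains is the
  trace-plus-Ricci term \<open>R\<close> and the reaction terms of \<open>hh_ineq\<close>.\<close>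

lemma Q_inequality:
 assumes y: "y : S" and t: "0 < t" and Qpos: "0 < Q t y"
 defines "X \<equiv> gradient S G (%y. f (y, t)) y" and "w \<equiv> nsq (%y. f (y, t)) y"
 shows "2 * (1 - be) / m * (Q t y + be * w)^2 <= lapV (Q t) y + 2 * dd S X (Q t) y - Qt t y"
proof -
 let ?f = "%y. f (y, t)" and ?ft = "%y. ft (y, t)"
 let ?F = "lapV ?f y" and ?z = "f (y, t)"
 have c2: "Ck_on 2 S (%y. (-1) * ft (y, t))" "Ck_on 2 S (%y. (1 - be) * nsq ?f y)" "Ck_on 2 S (%y. hh (f (y, t)))"
  by (intro Ck_on_mult[OF thick] Ck_on_const[OF thick] ft_Ck Ck_nsq[OF f_Ck] hh_Ck t)+
 have n2: "Ck_on 2 S (nsq ?f)" by (intro Ck_nsq[OF f_Ck] t)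
 have c2': "Ck_on (Suc (Suc 0)) S (%y. (-1) * ft (y, t))" "Ck_on (Suc (Suc 0)) S (%y. (1 - be) * nsq ?f y)"
  "Ck_on (Suc (Suc 0)) S (%y. hh (f (y, t)))" "Ck_on (Suc (Suc 0)) S (nsq ?f)" using c2 n2 by (simp_all add: numeral_2_eq_2)
 note hc = laplacian_V_chain[OF f_Ck[OF t] y hh_deriv c2(3)]
 have Qe: "Q t = (%y. (-1) * ft (y, t) + ((1 - be) * nsq ?f y + hh (f (y, t))))" by (simp add: Q_def fun_eq_iff)
 have lapQ: "lapV (Q t) y = - lapV ?ft y + (1 - be) * lapV (nsq ?f) y + hh' ?z * ?F + hh'' ?z * w"
  unfolding Qe laplacian_V_add[OF c2(1) Ck_on_add[OF thick c2(2,3)] y] laplacian_V_add[OF c2(2,3) y]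
   laplacian_V_cmult[OF ft_Ck[OF t] y] laplacian_V_cmult[OF n2 y] hc(1) by (simp add: w_def)
 have Xf: "dd S X ?f y = w" unfolding X_def w_def nsq_def using ip_gradient(1)[OF f_Ck[OF t] y] by simp
 have dQ: "dd S X (Q t) y = - dd S X ?ft y + (1 - be) * dd S X (nsq ?f) y + hh' ?z * w"
  unfolding Qe dd_add[OF c2'(1) Ck_on_add[OF thick c2'(2,3)] y] dd_add[OF c2'(2,3) y]
   dd_cmult[OF ft_Ck[OF t] y] dd_cmult[OF c2'(4) y] hc(2) Xf by simp
 have F1: "dd S X (lapV ?f) y = dd S X ?ft y - dd S X (nsq ?f) y - hh' ?z * w"
 proof -
  have "dd S X (lapV ?f) y = dd S X (%y. ?ft y + ((-1) * nsq ?f y + (-1) * hh (f (y, t)))) y"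
   by (rule dd_cong[OF _ y]) (simp add: pde t ft_def hh_def)
  also have "... = dd S X ?ft y + ((-1) * dd S X (nsq ?f) y + (-1) * dd S X (%y. hh (f (y, t))) y)"
   by (rule dd_eq[OF thick y]) (intro has_derivative_add has_derivative_mult_right Ck_on_deriv[OF _ y, of 0] ft_Ck t
     Ck_nsq[OF f_Ck] hh_Ck)
  finally show ?thesis by (simp add: hc(2) Xf)
 qed
 define R where "R = trc (%u. nab (gradient S G ?f) y (nab (gradient S G ?f) y u)) + X \<bullet> (ricci_V S G W y *v X)"
 have lapn: "lapV (nsq ?f) y = 2 * R + 2 * dd S X (lapV ?f) y" unfolding bochner_V[OF f_Ck[OF t] W y] R_def X_def by (simp add: algebra_simps)
 have R: "?F\<^sup>2 / m <= R" unfolding R_def X_def by (rule bochner_lower_bound[OF f_Ck[OF t] W y m ric[OF y]])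
 have LQ: "lapV (Q t) y + 2 * dd S X (Q t) y - Qt t y = 2 * (1 - be) * R + (hh' ?z * (?F + 2 * be * w) + hh'' ?z * w)"
  unfolding lapQ dQ lapn F1 Qt_def X_def[symmetric] by (simp add: algebra_simps)
 have w0: "0 <= w" unfolding w_def nsq_def by (rule ip_nonneg[OF y])
 have QF: "Q t y = - ?F - be * w" using Q_eq[OF y t] by (simp add: w_def)
 hence "?F < - be * w" using Qpos by simp
 from hh_ineq[OF w0 this, of ?z]
 have "2 * (1 - be) * R <= lapV (Q t) y + 2 * dd S X (Q t) y - Qt t y" unfolding LQ by linarith
 \<comment> \<open>\<open>Q t y + be * w\<close> is - Delta_V f, so the square in the claim is the
   one in the curvature-dimension bound for \<open>R\<close>.\<close>
 moreover have "2 * (1 - be) / m * (Q t y + be * w)^2 = 2 * (1 - be) * (?F\<^sup>2 / m)" unfolding QF by (simp add: power2_eq_square)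
 moreover have "2 * (1 - be) * (?F\<^sup>2 / m) <= 2 * (1 - be) * R" using R be by (intro mult_left_mono) auto
 ultimately show ?thesis by linarith
qed

text \<open>The barrier is \<open>1 / (c (t - \<epsilon>)) + b(\<rho>)\<close> at time distance \<open>t - \<epsilon>\<close> from its pole; \<open>b\<close>, \<open>b1\<close>, \<open>b2\<close> are the values of
  the function \<open>b\<close> and of its first two derivatives, and \<open>(q, H)\<close> bounds \<open>\<rho>\<close> from above to second order.\<close>

lemma barrier_contradiction:
 assumes y: "y : S" and t: "0 < t" and ta: "0 < ta" and b: "0 < b" "0 <= b1" "0 <= b2"
  and lin: "linear q" "!!v. linear (%u. H u v)" "!!u. linear (H u)" and first: "!!v. dd S v (Q t) y = b1 * q v"
  and second: "!!v. dd S v (dd S v (Q t)) y <= b1 * H v v + b2 * (q v)^2" and lam: "gtr y (%u v. H u v - q (Gam y u v)) + q (W y) <= 2 * m"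
  and grad: "gtr y (%u v. q u * q v) <= 4 * r" and c: "c = 2 * (1 - be) / m" and time: "- (1 / (c * ta\<^sup>2)) <= Qt t y"
  and above: "1 / (c * ta) + b <= Q t y" and ineq: "b1 * (2 * m) + b2 * (4 * r) + b1\<^sup>2 * (4 * r) / (2 * c * be * b) < c * b\<^sup>2"
 shows False
proof -
 let ?X = "gradient S G (%y. f (y, t)) y"
 define w where "w = nsq (%y. f (y, t)) y"
 have m0: "m > 0" using m by (meson of_nat_0_le_iff order_le_less_trans)
 have c0: "c > 0" using c be m0 by simp
 have w0: "0 <= w" unfolding w_def nsq_def by (rule ip_nonneg[OF y])
 obtain e where e: "onb y e" using onb_exists[OF y] by blast
 have Q2: "Ck_on (Suc (Suc 0)) S (Q t)" by (rule Q_Ck[OF t])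
 have linQ: "linear (%u. dd S u (dd S v (Q t)) y)" "linear (%v. dd S u (dd S v (Q t)) y)" for u v
 proof -
  show l: "linear (%u. dd S u (dd S v (Q t)) y)" for v by (rule dd_linear[OF Ck_on_dd[OF thick Q2] y])
  have "(%v. dd S u (dd S v (Q t)) y) = (%v. dd S v (dd S u (Q t)) y)" using dd_commute[OF thick fat _ y, of "Q t"] Q2 by (simp add: numeral_2_eq_2)
  thus "linear (%v. dd S u (dd S v (Q t)) y)" using l by simp
 qed
 have "lapV (Q t) y = gtr y (%u v. dd S u (dd S v (Q t)) y) - b1 * gtr y (%u v. q (Gam y u v)) + b1 * q (W y)"
  by (simp add: laplacian_V_gtr[OF Q2 y] first gtr_lin)
 also have "gtr y (%u v. dd S u (dd S v (Q t)) y) = (SUM i:UNIV. dd S (e i) (dd S (e i) (Q t)) y)" by (rule gtr_onb[OF y e linQ])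
 also have "... <= (SUM i:UNIV. b1 * H (e i) (e i) + b2 * (q (e i) * q (e i)))" using second by (intro sum_mono) (simp add: power2_eq_square)
 also have "... = b1 * gtr y H + b2 * gtr y (%u v. q u * q v)"
 proof -
  have "linear (%u. q u * q v)" "linear (%v. q u * q v)" for u v using lin(1) by (auto simp: linear_iff algebra_simps)
  from gtr_onb[OF y e this] show ?thesis by (simp add: gtr_onb[OF y e lin(2,3)] sum.distrib sum_distrib_left)
 qed
 finally have lap: "lapV (Q t) y <= b1 * (gtr y (%u v. H u v - q (Gam y u v)) + q (W y)) + b2 * gtr y (%u v. q u * q v)"
  by (simp add: gtr_lin algebra_simps)
 define g where "g = gtr y (%u v. q u * q v)"
 \<comment> \<open>g is the squared dual norm of q: \<open>A\<close> is the vector dual to q, g = q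
   A = |A|^2, and Cauchy-Schwarz applies.\<close>
 have qg: "(q v)^2 <= g * ip y v v" for v
 proof -
  define A where "A = (SUM i:UNIV. q (e i) *\<^sub>R e i)"
  have qA: "q v = ip y A v" for v
   by (subst onb_expand[OF y e, of v]) (simp add: A_def linear_sum[OF lin(1)] linear_cmul[OF lin(1)] linear_sum[OF linear_ip1] ip_simps ip_sym[OF y, of v] mult.commute)
  have "linear (%u. q u * q v)" "linear (%v. q u * q v)" for u v using lin(1) by (auto simp: linear_iff algebra_simps)
  from gtr_onb[OF y e this] have "g = (SUM i:UNIV. q (e i) * q (e i))" by (simp add: g_def)
  also have "... = q A" by (simp add: A_def linear_sum[OF lin(1)] linear_cmul[OF lin(1)])
  finally have "g = ip y A A" using qA by simp
  thus ?thesis using ip_CS[OF y, of A v] qA by simp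
 qed
 have g0: "0 <= g"
 proof -
  have "linear (%u. q u * q v)" "linear (%v. q u * q v)" for u v using lin(1) by (auto simp: linear_iff algebra_simps)
  from gtr_onb[OF y e this] show ?thesis unfolding g_def by (simp add: sum_nonneg)
 qed
 have r: "g <= 4 * r" using grad by (simp add: g_def)
 have Qpos: "0 < Q t y" using above b c0 ta by (smt (verit) divide_pos_pos mult_pos_pos)
 have main: "c * (Q t y + be * w)^2 <= lapV (Q t) y + 2 * dd S ?X (Q t) y - Qt t y" using Q_inequality[OF y t Qpos] unfolding w_def c .
 \<comment> \<open>Young's inequality, weighted so that the term in w equals the cross term kept in
   \<open>lower\<close> and drops out of the final comparison.\<close>
 have gradterm: "2 * b1 * q ?X <= 2 * c * be * b * w + b1\<^sup>2 * g / (2 * c * be * b)"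
 proof -
  define k where "k = 2 * c * be * b"
  have k: "k > 0" using c0 be b by (simp add: k_def)
  have amgm: "4 * x * z <= (x + z)^2" for x z :: real using zero_le_power2[of "x - z"] by (simp add: power2_eq_square algebra_simps)
  have "(q ?X)^2 <= g * w" using qg[of ?X] by (simp add: w_def nsq_def)
  hence "(b1 * q ?X)^2 <= b1\<^sup>2 * (g * w)" by (simp add: power_mult_distrib mult_left_mono)
  moreover have "4 * (k * w) * (b1\<^sup>2 * g / k) = 4 * (b1\<^sup>2 * (g * w))" using k by simp
  moreover have "4 * (k * w) * (b1\<^sup>2 * g / k) <= (k * w + b1\<^sup>2 * g / k)^2" by (rule amgm)
  ultimately have "(2 * (b1 * q ?X))^2 <= (k * w + b1\<^sup>2 * g / k)^2" by (simp add: power_mult_distrib)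
  moreover have "0 <= k * w + b1\<^sup>2 * g / k" using k w0 g0 by simp
  ultimately show ?thesis unfolding k_def[symmetric] using abs_le_square_iff[of "2 * (b1 * q ?X)" "k * w + b1\<^sup>2 * g / k"] by simp
 qed
 \<comment> \<open>Three terms of the expanded square are kept: the first balances the time
   derivative of the barrier, the second must beat its second order terms, the third absorbs the
   gradient term.\<close>
 have lower: "1 / (c * ta\<^sup>2) + c * b\<^sup>2 + 2 * c * be * b * w <= c * (Q t y + be * w)^2"
 proof -
  let ?s = "1 / (c * ta)"
  have s: "0 <= ?s" using c0 ta by simp
  have "?s\<^sup>2 + b\<^sup>2 + 2 * b * (be * w) <= (?s + b + be * w)^2"
  proof -
   have "(?s + b + be * w)^2 = ?s\<^sup>2 + b\<^sup>2 + 2 * b * (be * w) + ((be * w)^2 + 2 * ?s * b + 2 * ?s * (be * w))"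
    by (simp add: power2_eq_square algebra_simps)
   moreover have "0 <= (be * w)^2 + 2 * ?s * b + 2 * ?s * (be * w)" using s b be w0 by (intro add_nonneg_nonneg mult_nonneg_nonneg) auto
   ultimately show ?thesis by linarith
  qed
  also have "... <= (Q t y + be * w)^2" using above s b be w0 by (intro power_mono add_mono) auto
  finally have "c * (?s\<^sup>2 + b\<^sup>2 + 2 * b * (be * w)) <= c * (Q t y + be * w)^2" using c0 by simp
  moreover have "c * ?s\<^sup>2 = 1 / (c * ta\<^sup>2)" using c0 by (simp add: power2_eq_square)
  ultimately show ?thesis by (simp add: algebra_simps)
 qed
 have "b1\<^sup>2 * g / (2 * c * be * b) <= b1\<^sup>2 * (4 * r) / (2 * c * be * b)" using r c0 be b by (intro divide_right_mono mult_left_mono) auto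
 moreover have "b2 * g <= b2 * (4 * r)" using r b by (intro mult_left_mono)
 moreover have "b1 * (gtr y (%u v. H u v - q (Gam y u v)) + q (W y)) <= b1 * (2 * m)" using lam b by (intro mult_left_mono)
 moreover have "2 * dd S ?X (Q t) y = 2 * b1 * q ?X" using first by simp
 ultimately show False using main lower gradterm lap time ineq unfolding g_def[symmetric] by linarith
qed

end

section \<open>Second variation of energy\<close>

text \<open>Banach's theorem, used as the existence theorem for parallel fields and for geodesics.
  Stating the contraction with a pointwise bound \<open>b\<close> spares its users the supremum
  norm.\<close>

lemma interval_fixpoint:
 fixes Ph :: "(real => 'v::euclidean_space) => real => 'v"
 assumes M: "0 <= M" and c: "0 <= c" "c < 1" and self: "!!u. continuous_on {0..1} u ==> (!!s. s : {0..1} ==> norm (u s) <= M) ==>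
   continuous_on {0..1} (Ph u) & (ALL s:{0..1}. norm (Ph u s) <= M)"
  and contr: "!!u v b s. continuous_on {0..1} u ==> (!!s. s : {0..1} ==> norm (u s) <= M) ==>
   continuous_on {0..1} v ==> (!!s. s : {0..1} ==> norm (v s) <= M) ==>
   (!!s. s : {0..1} ==> norm (u s - v s) <= b) ==> s : {0..1} ==> norm (Ph u s - Ph v s) <= c * b"
 obtains u where "continuous_on {0..1} u" "!!s. s : {0..1} ==> norm (u s) <= M" "!!s. s : {0..1} ==> u s = Ph u s"
proof -
 define S where "S = (PiC UNIV (%_. cball 0 M) :: (real \<Rightarrow>\<^sub>C 'v) set)"
 have S: "f : S \<longleftrightarrow> (ALL x. norm (apply_bcontfun f x) <= M)" for f by (auto simp: S_def mem_PiC_iff)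
 have "complete S" unfolding S_def by (intro complete_eq_closed[THEN iffD2] closed_PiC) auto
 moreover have "0 : S" using M by (simp add: S)
 \<comment> \<open>Bounded continuous functions live on the whole line here; clamping the argument
   freezes the values outside the unit interval.\<close>
 define cl where "cl = (%s::real. max 0 (min 1 s))"
 have cl: "cl s : {0..1}" "s : {0..1} ==> cl s = s" for s by (auto simp: cl_def)
 have contcl: "continuous_on UNIV cl" unfolding cl_def by (intro continuous_intros)
 define F where "F = (%f. Bcontfun (%s. Ph (apply_bcontfun f) (cl s)))"
 have inb: "(%s. Ph (apply_bcontfun f) (cl s)) : bcontfun" if "f : S" for f
 proof (rule bcontfun_normI[where b=M])
  have "continuous_on {0..1} (Ph (apply_bcontfun f))" using self[of "apply_bcontfun f"] that by (auto simp: S)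
  thus "continuous_on UNIV (%s. Ph (apply_bcontfun f) (cl s))" by (rule continuous_on_compose2[OF _ contcl]) (use cl in auto)
  show "norm (Ph (apply_bcontfun f) (cl s)) <= M" for s using self[of "apply_bcontfun f"] that cl by (auto simp: S)
 qed
 have Fapp: "apply_bcontfun (F f) = (%s. Ph (apply_bcontfun f) (cl s))" if "f : S" for f unfolding F_def by (rule Bcontfun_inverse[OF inb[OF that]])
 have FS: "F ` S \<subseteq> S"
 proof
  fix g assume "g : F ` S"
  then obtain f where f: "f : S" "g = F f" by auto
  thus "g : S" using self[of "apply_bcontfun f"] cl by (auto simp: S Fapp)
 qed
 have lip: "dist (F f) (F g) <= c * dist f g" if "f : S" "g : S" for f g
 proof (rule dist_bound)
  fix s
  have "norm (Ph (apply_bcontfun f) (cl s) - Ph (apply_bcontfun g) (cl s)) <= c * dist f g"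
   by (rule contr) (use that cl dist_bounded[of f _ g] in \<open>auto simp: S dist_norm\<close>)
  thus "dist (apply_bcontfun (F f) s) (apply_bcontfun (F g) s) <= c * dist f g" using that by (simp add: Fapp dist_norm)
 qed
 obtain f where f: "f : S" "F f = f" using Banach_fix[OF \<open>complete S\<close> _ c FS lip] \<open>0 : S\<close> by blast
 show ?thesis
 proof (rule that[of "apply_bcontfun f"])
  show "apply_bcontfun f s = Ph (apply_bcontfun f) s" if "s : {0..1}" for s using Fapp[OF f(1)] f(2) cl(2)[OF that] by (metis (no_types, lifting))
 qed (use f S in auto)
qed

text \<open>An upper second order Taylor bound with error o(|v|^2): what remains of differential and
  Hessian for a function controlled only from above. \<open>H\<close> need not be symmetric, since
  only \<open>H v v\<close> enters the bound.\<close>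

definition superjet :: "(real^'n => real) => real^'n => (real^'n => real) => (real^'n => real^'n => real) => bool" where
 "superjet rh y q H \<longleftrightarrow> linear q & (ALL v. linear (%u. H u v)) & (ALL u. linear (H u)) &
   (ALL ka>0. EX dl>0. ALL v. norm v < dl --> rh (y + v) <= rh y + q v + H v v / 2 + ka * (norm v)^2)"

locale coord_metric_open = coord_metric S G for S :: "(real^'n::finite) set" and G +
 assumes open_S: "open S"
begin

lemma at_S: "y : S ==> at y within S = at y" using open_S at_within_open by blast

lemma smooth_curve:
 assumes F: "Ck_on (Suc k) S F" and g: "(ga has_vector_derivative u) (at s within T)" "ga s : S"
 shows "((%s. F (ga s)) has_vector_derivative dd S u F (ga s)) (at s within T)"
proof -
 have "(F has_derivative (%e. dd S e F (ga s))) (at (ga s) within ga ` T)"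
  using Ck_on_deriv[OF F g(2)] at_S[OF g(2)] has_derivative_at_withinI by metis
 from vector_derivative_diff_chain_within[OF g(1) this] show ?thesis by (simp add: o_def)
qed

lemma ip_curve:
 assumes g: "(ga has_vector_derivative u) (at s within T)" "ga s : S"
  and P: "(P has_vector_derivative P') (at s within T)" and Q: "(Q has_vector_derivative Q') (at s within T)"
 shows "((%s. ip (ga s) (P s) (Q s)) has_vector_derivative
   (ip (ga s) (P' + Gam (ga s) u (P s)) (Q s) + ip (ga s) (P s) (Q' + Gam (ga s) u (Q s)))) (at s within T)"
proof -
 have "((%s. G (ga s) *v Q s) has_vector_derivative (G (ga s) *v Q' + dd S u G (ga s) *v Q s)) (at s within T)"
  by (rule bounded_bilinear.has_vector_derivative[OF bounded_bilinear_matrix_vector smooth_curve[OF smooth_onD[OF smooth] g] Q])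
 from bounded_bilinear.has_vector_derivative[OF bounded_bilinear_inner P this]
 have "((%s. ip (ga s) (P s) (Q s)) has_vector_derivative
   (P s \<bullet> (G (ga s) *v Q' + dd S u G (ga s) *v Q s) + P' \<bullet> (G (ga s) *v Q s))) (at s within T)" by (simp add: ip_def)
 moreover have "P s \<bullet> (G (ga s) *v Q' + dd S u G (ga s) *v Q s) + P' \<bullet> (G (ga s) *v Q s)
  = ip (ga s) (P s) Q' + dG (ga s) u (P s) (Q s) + ip (ga s) P' (Q s)" by (simp add: ip_def dG_def inner_add_right)
 ultimately show ?thesis by (simp add: metric_compat[OF g(2)] ip_simps algebra_simps)
qed

lemma Gam_curve:
 assumes g: "(ga has_vector_derivative u) (at s within T)" "ga s : S"
  and P: "(P has_vector_derivative P') (at s within T)" and Q: "(Q has_vector_derivative Q') (at s within T)"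
 shows "((%s. Gam (ga s) (P s) (Q s)) has_vector_derivative
   (DGam (ga s) u (P s) (Q s) + Gam (ga s) P' (Q s) + Gam (ga s) (P s) Q')) (at s within T)"
proof -
 have nth: "((%s. P s $ i) has_vector_derivative P' $ i) (at s within T)"
  if "(P has_vector_derivative P') (at s within T)" for P :: "real => real^'n" and P' i
  by (rule bounded_linear.has_vector_derivative[OF bounded_linear_vec_nth that])
 have "((%s. SUM i:UNIV. SUM j:UNIV. (P s $ i * Q s $ j) *\<^sub>R Gam (ga s) (axis i 1) (axis j 1)) has_vector_derivative
   (SUM i:UNIV. SUM j:UNIV. (P s $ i * Q s $ j) *\<^sub>R DGam (ga s) u (axis i 1) (axis j 1)
    + (P s $ i * Q' $ j + P' $ i * Q s $ j) *\<^sub>R Gam (ga s) (axis i 1) (axis j 1))) (at s within T)" unfolding DGam_def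
  by (intro has_vector_derivative_sum bounded_bilinear.has_vector_derivative[OF bounded_bilinear_scaleR]
    bounded_bilinear.has_vector_derivative[OF bounded_bilinear_mult] nth P Q smooth_curve[OF smooth_onD[OF smooth_Gam] g])
 also have "(%s. SUM i:UNIV. SUM j:UNIV. (P s $ i * Q s $ j) *\<^sub>R Gam (ga s) (axis i 1) (axis j 1)) = (%s. Gam (ga s) (P s) (Q s))"
  by (rule ext, subst (2) Gam_expand) simp
 also have "(SUM i:UNIV. SUM j:UNIV. (P s $ i * Q s $ j) *\<^sub>R DGam (ga s) u (axis i 1) (axis j 1)
    + (P s $ i * Q' $ j + P' $ i * Q s $ j) *\<^sub>R Gam (ga s) (axis i 1) (axis j 1))
   = DGam (ga s) u (P s) (Q s) + Gam (ga s) P' (Q s) + Gam (ga s) (P s) Q'"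
  by (simp add: DGam_expand[OF g(2), of _ "P s"] Gam_expand[of "ga s" P'] Gam_expand[of "ga s" "P s"]
    sum.distrib algebra_simps)
 finally show ?thesis .
qed

text \<open>Metric compatibility differentiated once more, with the vectors c and d held
  constant.\<close>

lemma ddG:
 assumes y: "y : S" shows "c \<bullet> (dd S a (dd S b G) y *v d) =
  ip y (Gam y a (Gam y b c)) d + ip y (Gam y b c) (Gam y a d) + ip y (DGam y a b c) d
  + ip y (Gam y a c) (Gam y b d) + ip y c (Gam y a (Gam y b d)) + ip y c (DGam y a b d)"
proof -
 have "dd S a (%z. dG z b c d) y = c \<bullet> (dd S a (dd S b G) y *v d)" unfolding dG_def by (rule dd_eq[OF thick y])
   (intro has_derivative_inner_right bounded_linear.has_derivative[OF linear_conv_bounded_linear[THEN iffD1, OF linear_matrix_vector_left]]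
    smooth_on_deriv[OF smooth_on_dd[OF thick smooth] y])
 moreover have "dd S a (%z. dG z b c d) y = dd S a (%z. ip z (Gam z b c) d + ip z c (Gam z b d)) y" by (rule dd_cong[OF _ y]) (rule metric_compat)
 moreover have "dd S a (%z. ip z (Gam z b c) d + ip z c (Gam z b d)) y =
   (dG y a (Gam y b c) d + ip y (DGam y a b c) d + ip y (Gam y b c) 0) + (dG y a c (Gam y b d) + ip y 0 (Gam y b d) + ip y c (DGam y a b d))"
  unfolding DGam_def
  by (rule dd_eq[OF thick y]) (intro has_derivative_add ip_derivative[OF y] has_derivative_const smooth_on_deriv[OF smooth_Gam y])
 ultimately show ?thesis by (simp add: metric_compat[OF y] ip_simps)
qed

text \<open>Second derivatives of the metric commute. Antisymmetrising \<open>ddG\<close> in a and b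
  cancels the products of two \<open>Gam\<close> terms taken across c and d and leaves the curvature
  acting on each slot.\<close>

lemma Rm_skew:
 assumes y: "y : S" shows "ip y (Rm y a b c) d = - ip y c (Rm y a b d)"
proof -
 have "dd S a (dd S b G) y = dd S b (dd S a G) y" by (rule dd_commute[OF thick fat smooth_onD[OF smooth] y])
 thus ?thesis using ddG[OF y, of c a b d] ddG[OF y, of c b a d] by (simp add: Rm_def ip_simps)
qed

text \<open>The part of \<open>ip (y + x) (T + x') (T + x')\<close> quadratic in (x, x'), polarised
  by a second pair (z, z'). The variation is linear in the coordinates, so the expression is not
  covariant by itself.\<close>

definition qb :: "real^'n => real^'n => real^'n => real^'n => real^'n => real^'n => real" where
 "qb y T x x' z z' = (1/2) * (T \<bullet> (dd S x (dd S z G) y *v T)) + 2 * dG y x T z' + ip y x' z'"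

text \<open>Variations linear in the coordinates have covariant acceleration \<open>Gam\<close> of
  (X, X). Its pairing with the velocity is the total derivative that separates \<open>qb\<close>
  from the covariant index form |nabla_T X|^2 + <T, R(X,T)X>.\<close>

lemma second_variation_identity:
 assumes g: "(ga has_vector_derivative u s) (at s within T)" "ga s : S" and geo: "(u has_vector_derivative - Gam (ga s) (u s) (u s)) (at s within T)"
  and X: "(X has_vector_derivative X') (at s within T)"
 defines "y \<equiv> ga s" and "t \<equiv> u s" and "x \<equiv> X s"
 shows "((%s. ip (ga s) (u s) (Gam (ga s) (X s) (X s))) has_vector_derivative
  (qb y t x X' x X' - ip y (X' + Gam y t x) (X' + Gam y t x) - ip y t (Rm y x t x))) (at s within T)"
proof -
 have y: "y : S" using g by (simp add: y_def)
 have 1: "((%s. ip (ga s) (u s) (Gam (ga s) (X s) (X s))) has_vector_derivative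
  (ip y (- Gam y t t + Gam y t t) (Gam y x x) + ip y t ((DGam y t x x + Gam y X' x + Gam y x X') + Gam y t (Gam y x x)))) (at s within T)"
  unfolding y_def t_def x_def by (rule ip_curve[OF g geo Gam_curve[OF g X X]])
 have 2: "qb y t x X' x X' = ip y t (Gam y x (Gam y x t)) + ip y (Gam y x t) (Gam y x t) + ip y t (DGam y x x t)
   + 2 * (ip y (Gam y x t) X' + ip y t (Gam y x X')) + ip y X' X'" unfolding qb_def ddG[OF y] metric_compat[OF y]
  using ip_sym[OF y, of "Gam y x (Gam y x t)" t] ip_sym[OF y, of "DGam y x x t" t] by (simp add: algebra_simps)
 have DGs: "DGam y x t x = DGam y x x t" unfolding DGam_def by (rule dd_cong[OF Gam_sym y])
 have "ip y (- Gam y t t + Gam y t t) (Gam y x x) + ip y t ((DGam y t x x + Gam y X' x + Gam y x X') + Gam y t (Gam y x x))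
  = qb y t x X' x X' - ip y (X' + Gam y t x) (X' + Gam y t x) - ip y t (Rm y x t x)"
  unfolding 2 Rm_def DGs Gam_sym[OF y, of t x] Gam_sym[OF y, of X' x] ip_simps ip_sym[OF y, of X' "Gam y x t"] by simp
 thus ?thesis using 1 by (simp only:)
qed

text \<open>The velocity of a geodesic is parallel, so only W is differentiated, and <T, nabla_T W>
  is half the Lie derivative. Through this identity the drift enters the second variation.\<close>

lemma lie_curve:
 assumes W: "Ck_on (Suc 0) S W" and g: "(ga has_vector_derivative u s) (at s within T)" "ga s : S"
  and geo: "(u has_vector_derivative - Gam (ga s) (u s) (u s)) (at s within T)" shows "((%s. ip (ga s) (u s) (W (ga s))) has_vector_derivative
  ((1/2) * (u s \<bullet> (lie_metric S G W (ga s) *v u s)))) (at s within T)"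
proof -
 let ?y = "ga s" and ?t = "u s"
 have 1: "((%s. ip (ga s) (u s) (W (ga s))) has_vector_derivative
  (ip ?y (- Gam ?y ?t ?t + Gam ?y ?t ?t) (W ?y) + ip ?y ?t (dd S ?t W ?y + Gam ?y ?t (W ?y)))) (at s within T)"
  by (rule ip_curve[OF g geo smooth_curve[OF W g]])
 have 2: "(1/2) * (?t \<bullet> (lie_metric S G W ?y *v ?t)) = ip ?y ?t (dd S ?t W ?y + Gam ?y ?t (W ?y))"
  unfolding lie_quadratic[OF W g(2)] metric_compat[OF g(2)] using ip_sym[OF g(2)] Gam_sym[OF g(2), of "W ?y" ?t] by (simp add: ip_simps)
 show ?thesis using 1 unfolding 2 by (simp add: ip_simps)
qed

subsection \<open>Parallel frames\<close>

lemma continuous_curve_Gam: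
 assumes "continuous_on T ga" "ga ` T \<subseteq> S" "continuous_on T P" "continuous_on T Q" shows "continuous_on T (%s. Gam (ga s) (P s) (Q s))"
 by (subst Gam_expand)
  (intro continuous_intros assms continuous_on_compose2[OF Ck_on_continuous[OF smooth_onD[OF smooth_Gam, of 0]] assms(1,2)])

lemma integral_tail_has_vector_derivative:
 fixes h :: "real => 'v::euclidean_space"
 assumes "continuous_on {0..1} h" "s : {0..1}" shows "((%s. integral {s..1} h) has_vector_derivative - h s) (at s within {0..1})"
proof -
 have 1: "((%s. integral {0..1} h - integral {0..s} h) has_vector_derivative 0 - h s) (at s within {0..1})"
  by (intro has_vector_derivative_diff has_vector_derivative_const integral_has_vector_derivative assms)
 have 2: "integral {s..1} h = integral {0..1} h - integral {0..s} h" if "s : {0..1}" for s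
  using Henstock_Kurzweil_Integration.integral_combine[of 0 s 1 h] integrable_continuous_real[OF assms(1)] that by (simp add: algebra_simps)
 show ?thesis by (rule has_vector_derivative_transform[OF assms(2) 2]) (use 1 in auto)
qed

text \<open>The integral runs backwards from 1, where the value is prescribed. The bound
  \<open>small\<close> makes the Picard map a contraction with factor 1/2 on the whole interval at
  once.\<close>

lemma parallel_field_exists:
 assumes g: "continuous_on {0..1} ga" "ga ` {0..1} \<subseteq> S" and u: "continuous_on {0..1} u"
  and small: "!!s v. s : {0..1} ==> norm (Gam (ga s) (u s) v) <= norm v / 2"
 shows "EX E. E 1 = v & (ALL s:{0..1}. (E has_vector_derivative - Gam (ga s) (u s) (E s)) (at s within {0..1}))"
proof -
 define Ph :: "(real => real^'n) => real => real^'n" where "Ph = (%E s. v + integral {s..1} (%ta. Gam (ga ta) (u ta) (E ta)))"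
 have cG: "continuous_on {0..1} (%ta. Gam (ga ta) (u ta) (E ta))" if "continuous_on {0..1} E" for E :: "real => real^'n"
  by (rule continuous_curve_Gam[OF g u that])
 have der: "(Ph E has_vector_derivative - Gam (ga s) (u s) (E s)) (at s within {0..1})" if "continuous_on {0..1} E" "s : {0..1}" for E s
  using has_vector_derivative_add[OF has_vector_derivative_const[of v] integral_tail_has_vector_derivative[OF cG[OF that(1)] that(2)]]
  by (simp add: Ph_def)
 have int_bound: "norm (integral {s..1} h) <= B" if "continuous_on {0..1} h" "s : {0..1}" "!!ta. ta : {0..1} ==> norm (h ta) <= B" "0 <= B" for h :: "real => real^'n" and s B
 proof -
  have "norm (integral {s..1} h) <= B * (1 - s)" by (rule integral_bound) (use that in \<open>auto intro: continuous_on_subset\<close>)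
  also have "... <= B * 1" using that by (intro mult_left_mono) auto
  finally show ?thesis by simp
 qed
 obtain E where E: "continuous_on {0..1} E" "!!s. s : {0..1} ==> E s = Ph E s"
 proof (rule interval_fixpoint[where M="2 * norm v" and c="1/2" and Ph=Ph])
  fix E :: "real => real^'n" assume E: "continuous_on {0..1} E" "!!s. s : {0..1} ==> norm (E s) <= 2 * norm v"
  have "continuous_on {0..1} (Ph E)" using has_vector_derivative_continuous der[OF E(1)] by (fastforce simp: continuous_on_eq_continuous_within)
  moreover have "norm (Ph E s) <= 2 * norm v" if s: "s : {0..1}" for s
  proof -
   have "norm (integral {s..1} (%ta. Gam (ga ta) (u ta) (E ta))) <= norm v"
   proof (rule int_bound[OF cG[OF E(1)] s])
    fix ta :: real assume t: "ta : {0..1}"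
    show "norm (Gam (ga ta) (u ta) (E ta)) <= norm v" using small[OF t, of "E ta"] E(2)[OF t] by linarith
   qed simp
   thus ?thesis unfolding Ph_def using norm_triangle_ineq[of v "integral {s..1} (%ta. Gam (ga ta) (u ta) (E ta))"] by linarith
  qed
  ultimately show "continuous_on {0..1} (Ph E) & (ALL s:{0..1}. norm (Ph E s) <= 2 * norm v)" by blast
 next
  fix E F :: "real => real^'n" and b s :: real
  assume EF: "continuous_on {0..1} E" "continuous_on {0..1} F" "!!s. s : {0..1} ==> norm (E s - F s) <= b" and s: "s : {0..1}"
  have b: "0 <= b" using EF(3)[OF s] norm_ge_zero order_trans by blast
  have "Ph E s - Ph F s = integral {s..1} (%ta. Gam (ga ta) (u ta) (E ta - F ta))"
  proof -
   have i: "(%ta. Gam (ga ta) (u ta) (E ta)) integrable_on {s..1}" if "continuous_on {0..1} E" for E :: "real => real^'n"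
    using s by (intro integrable_continuous_real continuous_on_subset[OF cG[OF that]]) auto
   show ?thesis by (simp add: Ph_def Gam_simps integral_diff[OF i[OF EF(1)] i[OF EF(2)]])
  qed
  also have "norm ... <= b / 2"
  proof (rule int_bound[OF cG s])
   show "continuous_on {0..1} (%ta. E ta - F ta)" by (intro continuous_intros EF)
   fix ta :: real assume t: "ta : {0..1}"
   show "norm (Gam (ga ta) (u ta) (E ta - F ta)) <= b / 2" using small[OF t, of "E ta - F ta"] EF(3)[OF t] by linarith
  qed (use b in simp)
  finally show "norm (Ph E s - Ph F s) <= 1/2 * b" by simp
 qed auto
 have "(E has_vector_derivative - Gam (ga s) (u s) (E s)) (at s within {0..1})" if "s : {0..1}" for s
  by (rule has_vector_derivative_transform[OF that E(2) der[OF E(1) that]])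
 moreover have "E 1 = v" using E(2)[of 1] by (simp add: Ph_def)
 ultimately show ?thesis by blast
qed

lemma parallel_ip_constant:
 assumes g: "!!s. s : {0..1} ==> (ga has_vector_derivative u s) (at s within {0..1})" "!!s. s : {0..1} ==> ga s : S"
  and E: "!!s. s : {0..1} ==> (E has_vector_derivative - Gam (ga s) (u s) (E s)) (at s within {0..1})"
  and F: "!!s. s : {0..1} ==> (F has_vector_derivative - Gam (ga s) (u s) (F s)) (at s within {0..1})" and s: "s : {0..1::real}"
 shows "ip (ga s) (E s) (F s) = ip (ga 1) (E 1) (F 1)"
proof -
 have "((%s. ip (ga s) (E s) (F s)) has_vector_derivative 0) (at s within {0..1})" if "s : {0..1}" for s
  using ip_curve[OF g(1)[OF that] g(2)[OF that] E[OF that] F[OF that]] by (simp add: ip_simps)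
 then obtain c where "!!s. s : {0..1} ==> ip (ga s) (E s) (F s) = c"
  using has_vector_derivative_zero_constant[of "{0..1::real}" "%s. ip (ga s) (E s) (F s)"] by auto
 thus ?thesis using s by simp
qed

text \<open>The variation fields are mu / s' times parallel fields, with the linear weight mu = s +
  h ta. Summed over the frame, the derivative of mu yields h^2 n and the curvature yields - mu^2
  Ric(T,T). The total derivative of mu^2 <T, W> supplies the Lie derivative; its leftover 2 h mu <T,
  W> is absorbed by a square completed against the last term of Ric_V^m, which adds h^2 (m -
  n).\<close>

lemma index_form_bound:
 assumes g: "!!ta. ta : {0..1} ==> (ga has_vector_derivative u ta) (at ta within {0..1})" "!!ta. ta : {0..1} ==> ga ta : S"
  and geo: "!!ta. ta : {0..1} ==> (u has_vector_derivative - Gam (ga ta) (u ta) (u ta)) (at ta within {0..1})"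
  and W: "Ck_on (Suc 0) S W" and m: "m > real CARD('n)" and ric: "!!y \<xi>. y : S ==> 0 <= \<xi> \<bullet> (ricci_V_m m S G W y *v \<xi>)"
  and E: "!!i ta. ta : {0..1} ==> (E i has_vector_derivative - Gam (ga ta) (u ta) (E i ta)) (at ta within {0..1})"
  and onbE: "onb (ga 1) (%i. E i 1)" and s: "0 <= s" "0 < h" "s' = s + h"
 defines "X \<equiv> %i ta. ((s + h * ta) / s') *\<^sub>R E i ta"
  and "X' \<equiv> %i ta. (h / s') *\<^sub>R E i ta - ((s + h * ta) / s') *\<^sub>R Gam (ga ta) (u ta) (E i ta)"
 assumes K: "!!i. ((%ta. qb (ga ta) (u ta) (X i ta) (X' i ta) (X i ta) (X' i ta)) has_integral K i) {0..1}"
 shows "s'\<^sup>2 * (SUM i:UNIV. K i) + (s'\<^sup>2 * ip (ga 1) (u 1) (W (ga 1)) - s\<^sup>2 * ip (ga 0) (u 0) (W (ga 0)))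
  <= h\<^sup>2 * m + s'\<^sup>2 * (SUM i:UNIV. ip (ga 1) (u 1) (Gam (ga 1) (X i 1) (X i 1)) - ip (ga 0) (u 0) (Gam (ga 0) (X i 0) (X i 0)))"
proof -
 have s': "s' > 0" using s by simp
 have Xd: "(X i has_vector_derivative X' i ta) (at ta within {0..1})" if "ta : {0..1}" for i ta
 proof -
  have "((%ta. (s + h * ta) / s') has_vector_derivative h / s') (at ta within {0..1})"
   using s' by (auto intro!: derivative_eq_intros simp: has_real_derivative_iff_has_vector_derivative[symmetric])
  from bounded_bilinear.has_vector_derivative[OF bounded_bilinear_scaleR this E[OF that]] show ?thesis by (simp add: X_def X'_def)
 qed
 define Ps where "Ps = (%i ta. qb (ga ta) (u ta) (X i ta) (X' i ta) (X i ta) (X' i ta)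
   - ip (ga ta) (X' i ta + Gam (ga ta) (u ta) (X i ta)) (X' i ta + Gam (ga ta) (u ta) (X i ta)) - ip (ga ta) (u ta) (Rm (ga ta) (X i ta) (u ta) (X i ta)))"
 have I1: "(Ps i has_integral (ip (ga 1) (u 1) (Gam (ga 1) (X i 1) (X i 1)) - ip (ga 0) (u 0) (Gam (ga 0) (X i 0) (X i 0)))) {0..1}" for i
  unfolding Ps_def by (rule fundamental_theorem_of_calculus) (use second_variation_identity[OF g geo Xd] in auto)
 define L where "L = (%ta. 2 * h * (s + h * ta) * ip (ga ta) (u ta) (W (ga ta))
   + (s + h * ta)^2 * ((1/2) * (u ta \<bullet> (lie_metric S G W (ga ta) *v u ta))))"
 have I2: "(L has_integral (s'\<^sup>2 * ip (ga 1) (u 1) (W (ga 1)) - s\<^sup>2 * ip (ga 0) (u 0) (W (ga 0)))) {0..1}"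
 proof -
  have "((%ta. (s + h * ta)^2 * ip (ga ta) (u ta) (W (ga ta))) has_vector_derivative L ta) (at ta within {0..1})" if "ta : {0..1}" for ta
  proof -
   have "((%ta. (s + h * ta)^2) has_vector_derivative 2 * h * (s + h * ta)) (at ta within {0..1})"
    by (auto intro!: derivative_eq_intros simp: has_real_derivative_iff_has_vector_derivative[symmetric])
   from bounded_bilinear.has_vector_derivative[OF bounded_bilinear_mult this lie_curve[OF W g[OF that] geo[OF that]]]
   show ?thesis by (simp add: L_def add.commute)
  qed
  from fundamental_theorem_of_calculus[OF zero_le_one this] show ?thesis using s(3) by simp
 qed
 have bound: "s'\<^sup>2 * (SUM i:UNIV. qb (ga ta) (u ta) (X i ta) (X' i ta) (X i ta) (X' i ta)) + L ta <= h\<^sup>2 * m + s'\<^sup>2 * (SUM i:UNIV. Ps i ta)"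
  if t: "ta : {0..1}" for ta
 proof -
  let ?y = "ga ta" and ?t = "u ta"
  define \<mu> where "\<mu> = s + h * ta"
  have y: "?y : S" using g(2)[OF t] .
  have onb: "onb ?y (%i. E i ta)" using onbE parallel_ip_constant[OF g E E t] by (simp add: onb_def)
  have "X' i ta + Gam ?y ?t (X i ta) = (h / s') *\<^sub>R E i ta" for i by (simp add: X_def X'_def Gam_simps)
  hence 1: "ip ?y (X' i ta + Gam ?y ?t (X i ta)) (X' i ta + Gam ?y ?t (X i ta)) = (h / s')^2" for i
   using onb by (simp add: ip_simps onb_def power2_eq_square)
  have "ip ?y ?t (Rm ?y (X i ta) ?t (X i ta)) = - (\<mu> / s')\<^sup>2 * ip ?y (Rm ?y (E i ta) ?t ?t) (E i ta)" for i
  proof -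
   have "Rm ?y (c *\<^sub>R x) ?t z = c *\<^sub>R Rm ?y x ?t z" for c x z
    by (simp add: Rm_def linear_cmul[OF DGam_linear(1)[OF y]] linear_cmul[OF DGam_linear(2)[OF y]] Gam_simps algebra_simps)
   hence "ip ?y (Rm ?y (X i ta) ?t ?t) (X i ta) = (\<mu> / s')^2 * ip ?y (Rm ?y (E i ta) ?t ?t) (E i ta)"
    by (simp add: X_def ip_simps \<mu>_def power2_eq_square)
   thus ?thesis using Rm_skew[OF y, of "X i ta" ?t ?t "X i ta"] by simp
  qed
  hence "(SUM i:UNIV. ip ?y ?t (Rm ?y (X i ta) ?t (X i ta))) = - (\<mu> / s')\<^sup>2 * (SUM i:UNIV. ip ?y (Rm ?y (E i ta) ?t ?t) (E i ta))"
   by (simp add: sum_distrib_left)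
  also have "(SUM i:UNIV. ip ?y (Rm ?y (E i ta) ?t ?t) (E i ta)) = ?t \<bullet> (ricci S G ?y *v ?t)"
  proof -
   have "linear (%v. Rm ?y v ?t ?t)"
    by (rule linearI) (simp_all add: Rm_def linear_add[OF DGam_linear(1)[OF y]] linear_add[OF DGam_linear(2)[OF y]]
      linear_cmul[OF DGam_linear(1)[OF y]] linear_cmul[OF DGam_linear(2)[OF y]] Gam_simps algebra_simps)
   from trc_onb[OF y onb this] show ?thesis by (simp add: Rm_ricci[OF y])
  qed
  finally have 2: "(SUM i:UNIV. ip ?y ?t (Rm ?y (X i ta) ?t (X i ta))) = - (\<mu> / s')\<^sup>2 * (?t \<bullet> (ricci S G ?y *v ?t))" .
  have sumq: "s'\<^sup>2 * (SUM i:UNIV. qb ?y ?t (X i ta) (X' i ta) (X i ta) (X' i ta)) = s'\<^sup>2 * (SUM i:UNIV. Ps i ta) + h\<^sup>2 * real CARD('n) - \<mu>\<^sup>2 * (?t \<bullet> (ricci S G ?y *v ?t))"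
  proof -
   have "(SUM i:UNIV. qb ?y ?t (X i ta) (X' i ta) (X i ta) (X' i ta)) = (SUM i:UNIV. Ps i ta) + (SUM i:(UNIV::'n set). (h / s')^2) + (SUM i:UNIV. ip ?y ?t (Rm ?y (X i ta) ?t (X i ta)))"
    unfolding sum.distrib[symmetric] by (rule sum.cong) (simp_all add: Ps_def 1)
   hence "s'\<^sup>2 * (SUM i:UNIV. qb ?y ?t (X i ta) (X' i ta) (X i ta) (X' i ta)) = s'\<^sup>2 * (SUM i:UNIV. Ps i ta)
     + (s'\<^sup>2 * (h / s')^2) * real CARD('n) - (s'\<^sup>2 * (\<mu> / s')^2) * (?t \<bullet> (ricci S G ?y *v ?t))"
    unfolding 2 by (simp only: sum_constant ring_distribs) (simp add: algebra_simps)
   moreover have "s'\<^sup>2 * (h / s')^2 = h\<^sup>2" "s'\<^sup>2 * (\<mu> / s')^2 = \<mu>\<^sup>2" using s' by (simp_all add: power_divide)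
   ultimately show ?thesis by simp
  qed
  define aa where "aa = ip ?y ?t (W ?y)"
  have "?t \<bullet> (ricci_V_m m S G W ?y *v ?t) = ?t \<bullet> (ricci S G ?y *v ?t) - (1/2) * (?t \<bullet> (lie_metric S G W ?y *v ?t)) - aa\<^sup>2 / (m - real CARD('n))"
  proof -
   have "?t \<bullet> ((\<chi> i j. flat G W ?y $ i * flat G W ?y $ j) *v ?t) = (?t \<bullet> flat G W ?y)^2"
    by (simp add: inner_vec_def matrix_vector_mult_def power2_eq_square sum_product sum_distrib_left mult_ac)
   also have "?t \<bullet> flat G W ?y = aa" by (simp add: flat_def ip_def aa_def)
   finally show ?thesis
    by (simp add: ricci_V_m_def ricci_V_def matrix_vector_mult_diff_rdistrib inner_diff_right scaleR_matrix_vector_assoc[symmetric])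
  qed
  hence "0 <= \<mu>\<^sup>2 * (?t \<bullet> (ricci S G ?y *v ?t) - (1/2) * (?t \<bullet> (lie_metric S G W ?y *v ?t)) - aa\<^sup>2 / (m - real CARD('n)))"
   using ric[OF y, of ?t] by simp
  moreover have "2 * h * \<mu> * aa <= h\<^sup>2 * (m - real CARD('n)) + \<mu>\<^sup>2 * (aa\<^sup>2 / (m - real CARD('n)))"
  proof -
   have k: "m - real CARD('n) > 0" using m by simp
   have "h\<^sup>2 * (m - real CARD('n)) + \<mu>\<^sup>2 * (aa\<^sup>2 / (m - real CARD('n))) - 2 * h * \<mu> * aa = (h * (m - real CARD('n)) - \<mu> * aa)^2 / (m - real CARD('n))"
    using k by (simp add: field_simps power2_eq_square)
   moreover have "... >= 0" using k by (intro divide_nonneg_pos) auto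
   ultimately show ?thesis by linarith
  qed
  moreover have "L ta = 2 * h * \<mu> * aa + \<mu>\<^sup>2 * ((1/2) * (?t \<bullet> (lie_metric S G W ?y *v ?t)))" by (simp add: L_def \<mu>_def aa_def)
  ultimately show ?thesis unfolding sumq by (simp add: algebra_simps)
 qed
 have "((%ta. s'\<^sup>2 * (SUM i:UNIV. qb (ga ta) (u ta) (X i ta) (X' i ta) (X i ta) (X' i ta)) + L ta) has_integral
  (s'\<^sup>2 * (SUM i:UNIV. K i) + (s'\<^sup>2 * ip (ga 1) (u 1) (W (ga 1)) - s\<^sup>2 * ip (ga 0) (u 0) (W (ga 0))))) {0..1}"
  by (intro has_integral_add I2 has_integral_mult_right has_integral_sum K finite)
 moreover have "((%ta. h\<^sup>2 * m + s'\<^sup>2 * (SUM i:UNIV. Ps i ta)) has_integral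
  (h\<^sup>2 * m + s'\<^sup>2 * (SUM i:UNIV. ip (ga 1) (u 1) (Gam (ga 1) (X i 1) (X i 1)) - ip (ga 0) (u 0) (Gam (ga 0) (X i 0) (X i 0))))) {0..1}"
 proof -
  have "((%ta. h\<^sup>2 * m) has_integral h\<^sup>2 * m) {0..1::real}"
   using has_integral_const_real[of "h\<^sup>2 * m" 0 1] by (simp del: has_integral_mult_right has_integral_mult_left)
  thus ?thesis by (intro has_integral_add has_integral_mult_right[of "%ta. SUM i:UNIV. Ps i ta"] has_integral_sum I1 finite)
 qed
 ultimately show ?thesis by (rule has_integral_le) (use bound in auto)
qed

end

context coord_metric_open begin

subsection \<open>Second order expansion of energy\<close>

lemma dd_bilinear_expand:
 fixes F :: "real^'n => 'z::real_normed_vector"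
 assumes "smooth_on S F" "y : S"
 shows "dd S u (dd S v F) y = (SUM i:UNIV. SUM j:UNIV. (u $ i * v $ j) *\<^sub>R dd S (axis i 1) (dd S (axis j 1) F) y)"
proof -
 have s2: "smooth_on S (dd S v F)" for v by (rule smooth_on_dd[OF thick assms(1)])
 have "dd S u (dd S v F) y = dd S u (%z. SUM j:UNIV. v $ j *\<^sub>R dd S (axis j 1) F z) y"
  by (rule dd_cong[OF _ assms(2)]) (rule dd_expand[OF smooth_onD[OF assms(1)]])
 also have "... = (SUM j:UNIV. v $ j *\<^sub>R dd S u (dd S (axis j 1) F) y)"
  by (rule dd_eq[OF thick assms(2)]) (intro has_derivative_sum has_derivative_scaleR_right smooth_on_deriv[OF s2 assms(2)])
 also have "... = (SUM j:UNIV. SUM i:UNIV. (u $ i * v $ j) *\<^sub>R dd S (axis i 1) (dd S (axis j 1) F) y)"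
  by (subst dd_expand[OF smooth_onD[OF s2] assms(2), of u]) (simp add: scaleR_sum_right mult.commute)
 also have "... = (SUM i:UNIV. SUM j:UNIV. (u $ i * v $ j) *\<^sub>R dd S (axis i 1) (dd S (axis j 1) F) y)" by (rule sum.swap)
 finally show ?thesis .
qed

lemma dd_dd_scale:
 fixes F :: "real^'n => 'z::real_normed_vector"
 assumes "smooth_on S F" "y : S" shows "dd S (c *\<^sub>R x) (dd S (c *\<^sub>R x) F) y = c\<^sup>2 *\<^sub>R dd S x (dd S x F) y"
 unfolding dd_bilinear_expand[OF assms, of "c *\<^sub>R x"] dd_bilinear_expand[OF assms, of x]
 by (simp add: scaleR_sum_right power2_eq_square mult_ac)

lemma continuous_dd_dd:
 fixes F :: "real^'n => 'z::real_normed_vector"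
 assumes "smooth_on S F" shows "continuous_on (S \<times> UNIV) (%(y, x). dd S x (dd S x F) y)"
proof -
 have "continuous_on (S \<times> UNIV) (%p. SUM i:UNIV. SUM j:UNIV. (snd p $ i * snd p $ j) *\<^sub>R dd S (axis i 1) (dd S (axis j 1) F) (fst p))"
  by (intro continuous_intros continuous_on_compose2[OF Ck_on_continuous[OF smooth_onD[OF smooth_on_dd[OF thick smooth_on_dd[OF thick assms]], of 0]]]) auto
 thus ?thesis by (rule continuous_on_eq) (auto simp: dd_bilinear_expand[OF assms])
qed

lemma continuous_dd:
 fixes F :: "real^'n => 'z::real_normed_vector"
 assumes "smooth_on S F" shows "continuous_on (S \<times> UNIV) (%(y, x). dd S x F y)"
proof -
 have "continuous_on (S \<times> UNIV) (%p. SUM i:UNIV. snd p $ i *\<^sub>R dd S (axis i 1) F (fst p))"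
  by (intro continuous_intros continuous_on_compose2[OF Ck_on_continuous[OF smooth_onD[OF smooth_on_dd[OF thick assms], of 0]]]) auto
 thus ?thesis by (rule continuous_on_eq) (auto simp: dd_expand[OF smooth_onD[OF assms]])
qed

lemma dd_bound_compact:
 fixes F :: "real^'n => 'z::real_normed_vector"
 assumes F: "smooth_on S F" and K: "compact K" "K \<subseteq> S"
 obtains M where "M > 0" "!!y x. y : K ==> norm (dd S x F y) <= M * norm x"
  "!!y x. y : K ==> norm (dd S x (dd S x F) y) <= M * (norm x)^2"
proof -
 have cK: "compact (K \<times> cball (0::real^'n) 1)" by (intro compact_Times K compact_cball)
 have sub: "K \<times> cball (0::real^'n) 1 \<subseteq> S \<times> UNIV" using K by auto
 obtain M1 where M1: "!!p. p : K \<times> cball 0 1 ==> norm ((%(y, x). dd S x F y) p) <= M1"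
  using compact_imp_bounded[OF compact_continuous_image[OF continuous_on_subset[OF continuous_dd[OF F] sub] cK]] unfolding bounded_iff by blast
 obtain M2 where M2: "!!p. p : K \<times> cball 0 1 ==> norm ((%(y, x). dd S x (dd S x F) y) p) <= M2"
  using compact_imp_bounded[OF compact_continuous_image[OF continuous_on_subset[OF continuous_dd_dd[OF F] sub] cK]] unfolding bounded_iff by blast
 define M where "M = max 1 (max M1 M2)"
 show ?thesis
 proof (rule that[of M])
  show "M > 0" by (simp add: M_def)
  fix y x :: "real^'n" assume y: "y : K"
  have lin: "linear (%x. dd S x F y)" using dd_linear[OF smooth_onD[OF F]] y K by blast
  let ?e = "(1 / norm x) *\<^sub>R x"
  have x: "x = norm x *\<^sub>R ?e" by simp
  have e: "?e : cball 0 1" by (simp add: divide_simps)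
  have "dd S x F y = norm x *\<^sub>R dd S ?e F y" using linear_cmul[OF lin, of "norm x" ?e] by (cases "x = 0") auto
  moreover have "norm (dd S ?e F y) <= M" using M1[of "(y, ?e)"] y e by (auto simp: M_def)
  ultimately show "norm (dd S x F y) <= M * norm x" by (simp add: mult.commute[of M] mult_left_mono)
  have "dd S x (dd S x F) y = (norm x)^2 *\<^sub>R dd S ?e (dd S ?e F) y" using dd_dd_scale[OF F, of y "norm x" ?e] y K by (cases "x = 0") auto
  moreover have "norm (dd S ?e (dd S ?e F) y) <= M" using M2[of "(y, ?e)"] y e by (auto simp: M_def)
  ultimately show "norm (dd S x (dd S x F) y) <= M * (norm x)^2" by (simp add: mult.commute[of M] mult_left_mono)
 qed
qed

text \<open>Uniformity in y is the point, since y will run along a whole curve. Second derivatives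
  are uniformly continuous on a compact neighbourhood times the unit ball, and homogeneity of degree
  two reduces general x to unit vectors.\<close>

lemma taylor2_uniform:
 fixes F :: "real^'n => 'z::real_normed_vector"
 assumes F: "smooth_on S F" and K: "compact K" "K \<subseteq> S" and ka: "ka > 0"
 obtains dl where "dl > 0" "!!y x. y : K ==> norm x < dl ==> y + x : S &
  norm (F (y + x) - F y - dd S x F y - (1/2) *\<^sub>R dd S x (dd S x F) y) <= ka * (norm x)^2"
proof -
 obtain eps where eps: "eps > 0" "(\<Union>y\<in>K. cball y eps) \<subseteq> S"
  using compact_subset_open_imp_cball_epsilon_subset[OF K(1) open_S K(2)] by blast
 \<comment> \<open>The closed \<open>eps\<close>-neighbourhood of \<open>K\<close>, which contains
   the segments from y to y + x and is still a compact subset of \<open>S\<close>.\<close>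
 define K' where "K' = {a + b |a b. a : K & b : cball 0 eps}"
 have K': "compact K'" "K' \<subseteq> S"
 proof -
  show "compact K'" unfolding K'_def by (rule compact_sums[OF K(1) compact_cball])
  show "K' \<subseteq> S"
  proof
   fix z assume "z : K'"
   then obtain a b where "a : K" "norm b <= eps" "z = a + b" by (auto simp: K'_def)
   hence "z : (\<Union>y\<in>K. cball y eps)" by (auto simp: dist_norm intro!: bexI[of _ a])
   thus "z : S" using eps(2) by blast
  qed
 qed
 let ?B = "%(y, x). dd S x (dd S x F) y"
 have cB: "continuous_on (K' \<times> cball 0 1) ?B" by (rule continuous_on_subset[OF continuous_dd_dd[OF F]]) (use K' in auto)
 have "uniformly_continuous_on (K' \<times> cball 0 1) ?B" by (rule compact_uniformly_continuous[OF cB compact_Times[OF K'(1) compact_cball]])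
 then obtain d where d: "d > 0" "ALL p:K' \<times> cball 0 1. ALL p':K' \<times> cball 0 1. dist p' p < d --> dist (?B p') (?B p) < ka"
  unfolding uniformly_continuous_on_def using ka by blast
 show ?thesis
 proof (rule that[of "min eps d"])
  show "0 < min eps d" using eps d by simp
  fix y x :: "real^'n" assume y: "y : K" and x: "norm x < min eps d"
  have inK': "y + sg *\<^sub>R x : K'" if "sg : {0..1}" for sg
  proof -
   have "norm (sg *\<^sub>R x) <= 1 * norm x" unfolding norm_scaleR using that by (intro mult_right_mono) auto
   hence "sg *\<^sub>R x : cball 0 eps" using x by simp
   thus ?thesis unfolding K'_def using y by blast
  qed
  hence inS: "y + sg *\<^sub>R x : S" if "sg : {0..1}" for sg using that K' by blast
  have line: "((%sg. y + sg *\<^sub>R x) has_vector_derivative x) (at sg within {0..1})" for sg by (auto intro!: derivative_eq_intros)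
  let ?H = "%sg. dd S x (dd S x F) (y + sg *\<^sub>R x)"
  have Hb: "norm (?H sg - ?H 0) <= ka * (norm x)^2" if "sg : {0..1}" for sg
  proof (cases "x = 0")
   case False
   let ?e = "(1 / norm x) *\<^sub>R x"
   have e: "norm x *\<^sub>R ?e = x" "?e : cball 0 1" using False by auto
   have "?H sg = (norm x)^2 *\<^sub>R dd S ?e (dd S ?e F) (y + sg *\<^sub>R x)" if "sg : {0..1}" for sg
    using dd_dd_scale[OF F inS[OF that], of "norm x" ?e] e by simp
   from this[OF that] this[of 0]
   have "norm (?H sg - ?H 0) = (norm x)^2 * norm (dd S ?e (dd S ?e F) (y + sg *\<^sub>R x) - dd S ?e (dd S ?e F) (y + 0 *\<^sub>R x))"
    by (simp flip: scaleR_diff_right)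
   also have "norm (dd S ?e (dd S ?e F) (y + sg *\<^sub>R x) - dd S ?e (dd S ?e F) (y + 0 *\<^sub>R x)) < ka"
   proof -
    have "norm (sg *\<^sub>R x) <= 1 * norm x" unfolding norm_scaleR using that by (intro mult_right_mono) auto
    hence "dist (y + sg *\<^sub>R x, ?e) (y + 0 *\<^sub>R x, ?e) < d" using x by (simp add: dist_Pair_Pair dist_norm)
    thus ?thesis using d(2)[rule_format, of "(y + 0 *\<^sub>R x, ?e)" "(y + sg *\<^sub>R x, ?e)"] inK'[OF that] inK'[of 0] e by (simp add: dist_norm)
   qed
   finally show ?thesis using False by (simp add: mult.commute)
  next
   case True
   have "?H sg = 0" if "sg : {0..1}" for sg using dd_dd_scale[OF F inS[OF that], of 0 0] True by simp
   from this[OF that] this[of 0] show ?thesis by (simp add: True)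
  qed
  have d1: "norm (dd S x F (y + sg *\<^sub>R x) - dd S x F y - sg *\<^sub>R ?H 0) <= ka * (norm x)^2" if s: "sg : {0..1}" for sg
  proof -
   have "norm ((%sg. dd S x F (y + sg *\<^sub>R x)) sg - (%sg. dd S x F (y + sg *\<^sub>R x)) 0 - (sg - 0) *\<^sub>R ?H 0) <= norm (sg - 0) * (ka * (norm x)^2)"
    by (rule vector_differentiable_bound_linearization[where S="{0..1}"])
     (use s Hb inS in \<open>auto intro!: smooth_curve[OF smooth_onD[OF smooth_on_dd[OF thick F]] line] simp: closed_segment_eq_real_ivl\<close>)
   also have "... <= 1 * (ka * (norm x)^2)" using s ka by (intro mult_right_mono) auto
   finally show ?thesis by simp
  qed
  have "norm ((%sg. F (y + sg *\<^sub>R x) - (sg\<^sup>2 / 2) *\<^sub>R ?H 0) 1 - (%sg. F (y + sg *\<^sub>R x) - (sg\<^sup>2 / 2) *\<^sub>R ?H 0) 0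
    - (1 - 0) *\<^sub>R (dd S x F (y + 0 *\<^sub>R x) - 0 *\<^sub>R ?H 0)) <= norm (1 - 0 :: real) * (ka * (norm x)^2)"
  proof (rule vector_differentiable_bound_linearization[where S="{0..1}" and f'="%sg. dd S x F (y + sg *\<^sub>R x) - sg *\<^sub>R ?H 0"])
   fix sg :: real assume s: "sg : {0..1}"
   have "((%sg. sg\<^sup>2 / 2) has_vector_derivative sg) (at sg within {0..1})"
    by (auto intro!: derivative_eq_intros simp: has_real_derivative_iff_has_vector_derivative[symmetric])
   from has_vector_derivative_diff[OF smooth_curve[OF smooth_onD[OF F] line inS[OF s]]
     bounded_linear.has_vector_derivative[OF bounded_linear_scaleR_left this]]
   show "((%sg. F (y + sg *\<^sub>R x) - (sg\<^sup>2 / 2) *\<^sub>R ?H 0) has_vector_derivative dd S x F (y + sg *\<^sub>R x) - sg *\<^sub>R ?H 0) (at sg within {0..1})" .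
   show "norm (dd S x F (y + sg *\<^sub>R x) - sg *\<^sub>R ?H 0 - (dd S x F (y + 0 *\<^sub>R x) - 0 *\<^sub>R ?H 0)) <= ka * (norm x)^2"
    using d1[OF s] by (simp add: algebra_simps)
  qed (auto simp: closed_segment_eq_real_ivl)
  thus "y + x : S & norm (F (y + x) - F y - dd S x F y - (1/2) *\<^sub>R dd S x (dd S x F) y) <= ka * (norm x)^2"
   using inS[of 1] by (simp add: algebra_simps)
 qed
qed

text \<open>With the second order Taylor expansion of the metric inserted, what is left over is of
  order at least three in (x, x') or comes from the Taylor remainder. Each of the three error groups
  is given half of \<open>ka\<close>.\<close>

lemma energy_density_expansion:
 assumes K: "compact K" "K \<subseteq> S" and R: "0 <= R" and ka: "ka > 0"
 obtains dl where "dl > 0" "!!y T x x'. y : K ==> norm T <= R ==> norm x < dl ==> norm x' < dl ==> y + x : S &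
  \<bar>ip (y + x) (T + x') (T + x') - ip y T T - (dG y x T T + 2 * ip y T x') - qb y T x x' x x'\<bar> <= ka * ((norm x)^2 + (norm x')^2)"
proof -
 obtain B where B: "B > 0" "!!(A::real^'n^'n) v. norm (A *v v) <= norm A * norm v * B"
  using bounded_bilinear.pos_bounded[OF bounded_bilinear_matrix_vector] by blast
 have Bi: "\<bar>a \<bullet> (A *v b)\<bar> <= B * norm A * norm a * norm b" for a b :: "real^'n" and A :: "real^'n^'n"
 proof -
  have "\<bar>a \<bullet> (A *v b)\<bar> <= norm a * norm (A *v b)" by (rule Cauchy_Schwarz_ineq2)
  also have "... <= norm a * (norm A * norm b * B)" by (intro mult_left_mono B) auto
  finally show ?thesis by (simp add: mult_ac)
 qed
 obtain M where M: "M > 0" "!!y x. y : K ==> norm (dd S x G y) <= M * norm x"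
  "!!y x. y : K ==> norm (dd S x (dd S x G) y) <= M * (norm x)^2" using dd_bound_compact[OF smooth K] by blast
 \<comment> \<open>Tuned so that the Taylor remainder, applied to two vectors of norm at most R + 1
   with the bilinear bound B, costs exactly ka / 2 times |x|^2.\<close>
 define ka' where "ka' = ka / (2 * B * (R + 1)^2)"
 have R1: "R + 1 > 0" using R by simp
 have ka': "ka' > 0" using ka B R1 by (simp add: ka'_def)
 obtain dl0 where dl0: "dl0 > 0" "!!y x. y : K ==> norm x < dl0 ==> y + x : S &
  norm (G (y + x) - G y - dd S x G y - (1/2) *\<^sub>R dd S x (dd S x G) y) <= ka' * (norm x)^2" using taylor2_uniform[OF smooth K ka'] by blast
 define C where "C = B * M * (R + 1)"
 have C: "C > 0" using B M R1 by (simp add: C_def)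
 define dl where "dl = min dl0 (min 1 (ka / (2 * C)))"
 show ?thesis
 proof (rule that[of dl])
  show dl: "dl > 0" using dl0 ka C by (simp add: dl_def)
  fix y T x x' :: "real^'n" assume y: "y : K" and T: "norm T <= R" and x: "norm x < dl" and x': "norm x' < dl"
  have yS: "y : S" using y K by blast
  have tay: "y + x : S & norm (G (y + x) - G y - dd S x G y - (1/2) *\<^sub>R dd S x (dd S x G) y) <= ka' * (norm x)^2"
   using dl0(2)[OF y] x by (auto simp: dl_def)
  define A1 where "A1 = dd S x G y"
  define A2 where "A2 = dd S x (dd S x G) y"
  define r where "r = G (y + x) - G y - A1 - (1/2) *\<^sub>R A2"
  have Gx: "G (y + x) = G y + A1 + (1/2) *\<^sub>R A2 + r" by (simp add: r_def)
  have r: "norm r <= ka' * (norm x)^2" using tay by (simp add: r_def A1_def A2_def)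
  have A1s: "T \<bullet> (A1 *v x') = x' \<bullet> (A1 *v T)" using dG_sym[OF yS, of x T x'] by (simp add: dG_def A1_def)
  have Gs: "T \<bullet> (G y *v x') = x' \<bullet> (G y *v T)" using ip_sym[OF yS, of T x'] by (simp add: ip_def)
  have "ip (y + x) (T + x') (T + x') - ip y T T - (dG y x T T + 2 * ip y T x') - qb y T x x' x x'
   = x' \<bullet> (A1 *v x') + (1/2) * (T \<bullet> (A2 *v x') + x' \<bullet> (A2 *v T) + x' \<bullet> (A2 *v x')) + (T + x') \<bullet> (r *v (T + x'))"
   unfolding ip_def dG_def qb_def Gx A1_def[symmetric] A2_def[symmetric] using A1s Gs
   by (simp add: matrix_vector_mult_add_rdistrib matrix_vector_right_distrib inner_add_left inner_add_right
     scaleR_matrix_vector_assoc[symmetric] field_simps)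
  also have "\<bar>...\<bar> <= ka * ((norm x)^2 + (norm x')^2)"
  proof -
   let ?a = "norm x" and ?b = "norm x'"
   have b1: "?b <= 1" using x' by (simp add: dl_def)
   have a1: "?a <= ka / (2 * C)" and b2: "?b <= ka / (2 * C)" using x x' by (simp_all add: dl_def)
   have half: "C * (ka / (2 * C)) = ka / 2" using C by simp
   have n1: "norm A1 <= M * ?a" "norm A2 <= M * ?a\<^sup>2" using M(2,3)[OF y] by (simp_all add: A1_def A2_def)
   have BM: "B * M <= C" using B M R by (simp add: C_def)
   have t1: "\<bar>x' \<bullet> (A1 *v x')\<bar> <= ka / 2 * ?b\<^sup>2"
   proof -
    have "\<bar>x' \<bullet> (A1 *v x')\<bar> <= B * norm A1 * ?b * ?b" by (rule Bi)
    also have "... <= B * (M * ?a) * ?b * ?b" using B n1 by (intro mult_right_mono mult_left_mono) auto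
    also have "... = (B * M) * ?a * ?b\<^sup>2" by (simp add: power2_eq_square mult_ac)
    also have "... <= C * (ka / (2 * C)) * ?b\<^sup>2" using a1 BM C by (intro mult_right_mono mult_mono) auto
    finally show ?thesis unfolding half .
   qed
   have t2: "\<bar>(1/2) * (T \<bullet> (A2 *v x') + x' \<bullet> (A2 *v T) + x' \<bullet> (A2 *v x'))\<bar> <= ka / 2 * ?a\<^sup>2"
   proof -
    have e1: "\<bar>T \<bullet> (A2 *v x')\<bar> <= B * (M * ?a\<^sup>2) * R * ?b"
    proof -
     have "\<bar>T \<bullet> (A2 *v x')\<bar> <= B * norm A2 * norm T * ?b" by (rule Bi)
     also have "... <= B * (M * ?a\<^sup>2) * R * ?b" using B n1 T M by (intro mult_right_mono mult_mono mult_left_mono) auto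
     finally show ?thesis .
    qed
    have e2: "\<bar>x' \<bullet> (A2 *v T)\<bar> <= B * (M * ?a\<^sup>2) * R * ?b"
    proof -
     have "\<bar>x' \<bullet> (A2 *v T)\<bar> <= B * norm A2 * ?b * norm T" by (rule Bi)
     also have "... <= B * (M * ?a\<^sup>2) * ?b * R" using B n1 T M by (intro mult_right_mono mult_mono mult_left_mono) auto
     finally show ?thesis by (simp add: mult_ac)
    qed
    have e3: "\<bar>x' \<bullet> (A2 *v x')\<bar> <= B * (M * ?a\<^sup>2) * 1 * ?b"
    proof -
     have "\<bar>x' \<bullet> (A2 *v x')\<bar> <= B * norm A2 * ?b * ?b" by (rule Bi)
     also have "... <= B * (M * ?a\<^sup>2) * 1 * ?b" using B n1 b1 M by (intro mult_right_mono mult_mono mult_left_mono) auto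
     finally show ?thesis .
    qed
    have "\<bar>(1/2) * (T \<bullet> (A2 *v x') + x' \<bullet> (A2 *v T) + x' \<bullet> (A2 *v x'))\<bar>
     <= (1/2) * (\<bar>T \<bullet> (A2 *v x')\<bar> + \<bar>x' \<bullet> (A2 *v T)\<bar> + \<bar>x' \<bullet> (A2 *v x')\<bar>)" by simp
    also have "... <= (1/2) * (B * (M * ?a\<^sup>2) * R * ?b + B * (M * ?a\<^sup>2) * R * ?b + B * (M * ?a\<^sup>2) * 1 * ?b)"
     using e1 e2 e3 by (intro mult_left_mono add_mono) auto
    also have "... <= C * ?b * ?a\<^sup>2"
    proof -
     have "C * ?b * ?a\<^sup>2 - (1/2) * (B * (M * ?a\<^sup>2) * R * ?b + B * (M * ?a\<^sup>2) * R * ?b + B * (M * ?a\<^sup>2) * 1 * ?b) = B * M * ?a\<^sup>2 * ?b / 2"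
      by (simp add: C_def field_simps)
     moreover have "0 <= B * M * ?a\<^sup>2 * ?b / 2" using B M by simp
     ultimately show ?thesis by linarith
    qed
    also have "... <= C * (ka / (2 * C)) * ?a\<^sup>2" using b2 C by (intro mult_right_mono mult_left_mono) auto
    finally show ?thesis unfolding half .
   qed
   have t3: "\<bar>(T + x') \<bullet> (r *v (T + x'))\<bar> <= ka / 2 * ?a\<^sup>2"
   proof -
    have nT: "norm (T + x') <= R + 1" using norm_triangle_ineq[of T x'] T b1 by linarith
    have "\<bar>(T + x') \<bullet> (r *v (T + x'))\<bar> <= B * norm r * norm (T + x') * norm (T + x')" by (rule Bi)
    also have "... <= B * (ka' * ?a\<^sup>2) * (R + 1) * (R + 1)" using B r nT R1 ka' by (intro mult_mono mult_left_mono) auto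
    also have "... = (2 * B * (R + 1)^2 * ka') / 2 * ?a\<^sup>2" by (simp add: power2_eq_square)
    also have "2 * B * (R + 1)^2 * ka' = ka" using B R1 by (simp add: ka'_def)
    finally show ?thesis .
   qed
   have "ka * (?a\<^sup>2 + ?b\<^sup>2) = (ka / 2 * ?a\<^sup>2 + ka / 2 * ?a\<^sup>2) + (ka / 2 * ?b\<^sup>2 + ka / 2 * ?b\<^sup>2)" by (simp add: field_simps)
   moreover have "0 <= ka / 2 * ?b\<^sup>2" using ka by simp
   ultimately show ?thesis using t1 t2 t3 by linarith
  qed
  finally show "y + x : S & \<bar>ip (y + x) (T + x') (T + x') - ip y T T - (dG y x T T + 2 * ip y T x') - qb y T x x' x x'\<bar> <= ka * ((norm x)^2 + (norm x')^2)"
   using tay by blast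
 qed
qed

lemma qb_bound:
 assumes K: "compact K" "K \<subseteq> S" and R: "0 <= R"
 obtains C where "C > 0" "!!y T x x'. y : K ==> norm T <= R ==> \<bar>qb y T x x' x x'\<bar> <= C * ((norm x)^2 + (norm x')^2)"
proof -
 obtain B where B: "B > 0" "!!(A::real^'n^'n) v. norm (A *v v) <= norm A * norm v * B"
  using bounded_bilinear.pos_bounded[OF bounded_bilinear_matrix_vector] by blast
 have Bi: "\<bar>a \<bullet> (A *v b)\<bar> <= B * norm A * norm a * norm b" for a b :: "real^'n" and A :: "real^'n^'n"
 proof -
  have "\<bar>a \<bullet> (A *v b)\<bar> <= norm a * norm (A *v b)" by (rule Cauchy_Schwarz_ineq2)
  also have "... <= norm a * (norm A * norm b * B)" by (intro mult_left_mono B) auto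
  finally show ?thesis by (simp add: mult_ac)
 qed
 obtain M where M: "M > 0" "!!y x. y : K ==> norm (dd S x G y) <= M * norm x"
  "!!y x. y : K ==> norm (dd S x (dd S x G) y) <= M * (norm x)^2" using dd_bound_compact[OF smooth K] by blast
 have "continuous_on K G" using Ck_on_continuous[OF smooth_onD[OF smooth]] K continuous_on_subset by blast
 then obtain M0 where M0: "!!y. y : K ==> norm (G y) <= M0" "M0 > 0"
  using compact_imp_bounded[OF compact_continuous_image[OF _ K(1)]] bounded_pos by (metis imageI)
 define C where "C = B * M * R\<^sup>2 + B * M * R + B * M0"
 have C: "C > 0" using B M M0 R by (simp add: C_def add_nonneg_pos)
 show ?thesis
 proof (rule that[OF C])
  fix y T x x' :: "real^'n" assume y: "y : K" and T: "norm T <= R"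
  let ?a = "norm x" and ?b = "norm x'"
  have e1: "\<bar>T \<bullet> (dd S x (dd S x G) y *v T)\<bar> <= B * (M * ?a\<^sup>2) * R * R"
   using B M T R M(3)[OF y] by (intro order_trans[OF Bi] mult_mono mult_left_mono) auto
  have e2: "\<bar>T \<bullet> (dd S x G y *v x')\<bar> <= B * (M * ?a) * R * ?b"
   using B M T R M(2)[OF y] by (intro order_trans[OF Bi] mult_mono mult_left_mono) auto
  have e3: "\<bar>x' \<bullet> (G y *v x')\<bar> <= B * M0 * ?b * ?b"
   using B M0(2) M0(1)[OF y] by (intro order_trans[OF Bi] mult_mono mult_left_mono) auto
  have "2 * (?a * ?b) <= ?a\<^sup>2 + ?b\<^sup>2" using zero_le_power2[of "?a - ?b"] by (simp add: power2_diff)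
  hence "B * M * R * (2 * (?a * ?b)) <= B * M * R * (?a\<^sup>2 + ?b\<^sup>2)" using B M R by (intro mult_left_mono) auto
  moreover have "0 <= B * M * R\<^sup>2 * ?b\<^sup>2" "0 <= B * M * R\<^sup>2 * ?a\<^sup>2" "0 <= B * M0 * ?a\<^sup>2" using B M M0 by auto
  moreover have "C * (?a\<^sup>2 + ?b\<^sup>2) = B * M * R\<^sup>2 * ?a\<^sup>2 + B * M * R\<^sup>2 * ?b\<^sup>2 + B * M * R * (?a\<^sup>2 + ?b\<^sup>2) + B * M0 * ?a\<^sup>2 + B * M0 * ?b\<^sup>2"
   by (simp add: C_def algebra_simps)
  moreover have "\<bar>qb y T x x' x x'\<bar> <= (1/2) * (B * (M * ?a\<^sup>2) * R * R) + 2 * (B * (M * ?a) * R * ?b) + B * M0 * ?b * ?b"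
   unfolding qb_def dG_def ip_def using e1 e2 e3 by linarith
  moreover have "(1/2) * (B * (M * ?a\<^sup>2) * R * R) + 2 * (B * (M * ?a) * R * ?b) + B * M0 * ?b * ?b
   = (1/2) * (B * M * R\<^sup>2 * ?a\<^sup>2) + B * M * R * (2 * (?a * ?b)) + B * M0 * ?b\<^sup>2" by (simp add: power2_eq_square)
  ultimately show "\<bar>qb y T x x' x x'\<bar> <= C * (?a\<^sup>2 + ?b\<^sup>2)" by linarith
 qed
qed

lemma first_variation:
 assumes g: "!!ta. ta : {0..1} ==> (ga has_vector_derivative u ta) (at ta within {0..1})" "!!ta. ta : {0..1} ==> ga ta : S"
  and geo: "!!ta. ta : {0..1} ==> (u has_vector_derivative - Gam (ga ta) (u ta) (u ta)) (at ta within {0..1})"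
  and X: "!!ta. ta : {0..1} ==> (X has_vector_derivative X' ta) (at ta within {0..1})"
 shows "((%ta. dG (ga ta) (X ta) (u ta) (u ta) + 2 * ip (ga ta) (u ta) (X' ta)) has_integral
  2 * (ip (ga 1) (u 1) (X 1) - ip (ga 0) (u 0) (X 0))) {0..1}"
proof -
 have "((%ta. 2 * ip (ga ta) (u ta) (X ta)) has_vector_derivative dG (ga ta) (X ta) (u ta) (u ta) + 2 * ip (ga ta) (u ta) (X' ta)) (at ta within {0..1})"
  if t: "ta : {0..1}" for ta
 proof -
  have e: "2 * (ip (ga ta) (- Gam (ga ta) (u ta) (u ta) + Gam (ga ta) (u ta) (u ta)) (X ta) + ip (ga ta) (u ta) (X' ta + Gam (ga ta) (u ta) (X ta)))
   = dG (ga ta) (X ta) (u ta) (u ta) + 2 * ip (ga ta) (u ta) (X' ta)" unfolding metric_compat[OF g(2)[OF t]]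
   using Gam_sym[OF g(2)[OF t], of "X ta" "u ta"] ip_sym[OF g(2)[OF t], of "Gam (ga ta) (u ta) (X ta)"] by (simp add: ip_simps)
  have "((%ta. 2 * ip (ga ta) (u ta) (X ta)) has_vector_derivative
   2 * (ip (ga ta) (- Gam (ga ta) (u ta) (u ta) + Gam (ga ta) (u ta) (u ta)) (X ta) + ip (ga ta) (u ta) (X' ta + Gam (ga ta) (u ta) (X ta)))) (at ta within {0..1})"
   by (intro bounded_linear.has_vector_derivative[OF bounded_linear_mult_right] ip_curve g t geo X)
  thus ?thesis unfolding e .
 qed
 from fundamental_theorem_of_calculus[OF zero_le_one this] show ?thesis by (simp add: algebra_simps)
qed

end

lemma bilinear_sum_expand:
 fixes B :: "'a::real_vector => 'b::real_vector => real"
 assumes "!!v. linear (%u. B u v)" "!!u. linear (B u)"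
 shows "B (SUM i:I. c i *\<^sub>R x i) (SUM j:J. d j *\<^sub>R z j) = (SUM i:I. SUM j:J. c i * d j * B (x i) (z j))"
proof -
 have 1: "B (SUM i:I. c i *\<^sub>R x i) w = (SUM i:I. c i * B (x i) w)" for w by (simp add: linear_sum[OF assms(1)] linear_cmul[OF assms(1)])
 have 2: "B u (SUM j:J. d j *\<^sub>R z j) = (SUM j:J. d j * B u (z j))" for u by (simp add: linear_sum[OF assms(2)] linear_cmul[OF assms(2)])
 have "B (SUM i:I. c i *\<^sub>R x i) (SUM j:J. d j *\<^sub>R z j) = (SUM i:I. c i * B (x i) (SUM j:J. d j *\<^sub>R z j))" by (rule 1)
 thus ?thesis by (simp add: 2 sum_distrib_left mult.assoc)
qed

context coord_metric_open begin

lemma continuous_ip: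
 assumes "continuous_on T sg" "sg ` T \<subseteq> S" "continuous_on T P" "continuous_on T Q" shows "continuous_on T (%s. ip (sg s) (P s) (Q s))"
proof -
 have "continuous_on T (%s. G (sg s))" by (rule continuous_on_compose2[OF Ck_on_continuous[OF smooth_onD[OF smooth, of 0]] assms(1,2)])
 thus ?thesis unfolding ip_def by (intro continuous_on_inner bounded_bilinear.continuous_on[OF bounded_bilinear_matrix_vector] assms)
qed

lemma continuous_qb:
 assumes "continuous_on T sg" "sg ` T \<subseteq> S" "continuous_on T u"
  and "continuous_on T x" "continuous_on T x'" "continuous_on T z" "continuous_on T z'"
 shows "continuous_on T (%s. qb (sg s) (u s) (x s) (x' s) (z s) (z' s))"
proof -
 have 1: "continuous_on T (%s. dd S (x s) (dd S (z s) G) (sg s))"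
 proof -
  have "continuous_on T (%s. SUM i:UNIV. SUM j:UNIV. (x s $ i * z s $ j) *\<^sub>R dd S (axis i 1) (dd S (axis j 1) G) (sg s))"
   by (intro continuous_intros assms
     continuous_on_compose2[OF Ck_on_continuous[OF smooth_onD[OF smooth_on_dd[OF thick smooth_on_dd[OF thick smooth]], of 0]] assms(1,2)])
  thus ?thesis by (rule continuous_on_eq) (use assms(2) in \<open>auto intro!: dd_bilinear_expand[OF smooth, symmetric]\<close>)
 qed
 have 2: "continuous_on T (%s. dd S (x s) G (sg s))"
 proof -
  have "continuous_on T (%s. SUM i:UNIV. x s $ i *\<^sub>R dd S (axis i 1) G (sg s))" by (intro continuous_intros assms
     continuous_on_compose2[OF Ck_on_continuous[OF smooth_onD[OF smooth_on_dd[OF thick smooth], of 0]] assms(1,2)])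
  thus ?thesis by (rule continuous_on_eq) (use assms(2) in \<open>auto intro!: dd_expand[OF smooth_onD[OF smooth], symmetric]\<close>)
 qed
 show ?thesis unfolding qb_def dG_def
  by (intro continuous_intros continuous_on_inner bounded_bilinear.continuous_on[OF bounded_bilinear_matrix_vector] 1 2 continuous_ip assms)
qed

lemma qb_sum:
 fixes c :: "real^'n"
 assumes y: "y : S"
 shows "qb y T (SUM i:UNIV. c $ i *\<^sub>R x i) (SUM i:UNIV. c $ i *\<^sub>R x' i) (SUM i:UNIV. c $ i *\<^sub>R x i) (SUM i:UNIV. c $ i *\<^sub>R x' i)
  = (SUM i:UNIV. SUM j:UNIV. c $ i * c $ j * qb y T (x i) (x' i) (x j) (x' j))"
proof -
 define B where "B = (%u v. T \<bullet> (dd S u (dd S v G) y *v T))"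
 have lin1: "linear (%u. B u v)" for v
 proof -
  have l: "linear (%u. dd S u (dd S v G) y)" by (rule dd_linear[OF smooth_onD[OF smooth_on_dd[OF thick smooth]] y])
  show ?thesis unfolding B_def
   by (rule linearI) (simp_all add: linear_add[OF l] linear_cmul[OF l] matrix_vector_mult_add_rdistrib inner_add_right scaleR_matrix_vector_assoc[symmetric])
 qed
 have comm: "B u v = B v u" for u v unfolding B_def using dd_commute[OF thick fat smooth_onD[OF smooth] y, of u v] by simp
 have lin2: "linear (B u)" for u
 proof -
  have "B u = (%v. B v u)" using comm by auto
  thus ?thesis using lin1[of u] by simp
 qed
 have e1: "B (SUM i:UNIV. c $ i *\<^sub>R x i) (SUM j:UNIV. c $ j *\<^sub>R x j) = (SUM i:UNIV. SUM j:UNIV. c $ i * c $ j * B (x i) (x j))"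
  by (rule bilinear_sum_expand[where B=B, OF lin1 lin2])
 have l1: "linear (%u. dG y u T v)" for v by (rule linearI) (simp_all add: dG_linear1[OF y])
 have l2: "linear (%v. dG y u T v)" for u by (rule linearI) (simp_all add: dG_simps)
 have e2: "dG y (SUM i:UNIV. c $ i *\<^sub>R x i) T (SUM j:UNIV. c $ j *\<^sub>R x' j) = (SUM i:UNIV. SUM j:UNIV. c $ i * c $ j * dG y (x i) T (x' j))"
  by (rule bilinear_sum_expand[where B="%u v. dG y u T v", OF l1 l2])
 have e3: "ip y (SUM i:UNIV. c $ i *\<^sub>R x' i) (SUM j:UNIV. c $ j *\<^sub>R x' j) = (SUM i:UNIV. SUM j:UNIV. c $ i * c $ j * ip y (x' i) (x' j))"
  by (rule bilinear_sum_expand[where B="ip y", OF linear_ip1 linear_ip2])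
 show ?thesis unfolding qb_def e1[unfolded B_def] e2 e3 by (simp add: sum_distrib_left sum.distrib[symmetric] algebra_simps)
qed

text \<open>All n-parameter variations are treated at once, with an error uniform in the direction
  of c. The linear part is an endpoint term because \<open>ga\<close> is a geodesic.\<close>

lemma energy_expansion:
 assumes g: "!!ta. ta : {0..1} ==> (ga has_vector_derivative u ta) (at ta within {0..1})" "!!ta. ta : {0..1} ==> ga ta : S"
  and geo: "!!ta. ta : {0..1} ==> (u has_vector_derivative - Gam (ga ta) (u ta) (u ta)) (at ta within {0..1})"
  and X: "!!i ta. ta : {0..1} ==> (X i has_vector_derivative X' i ta) (at ta within {0..1})" and cX': "!!i. continuous_on {0..1} (X' i)"
  and K: "!!i j. ((%ta. qb (ga ta) (u ta) (X i ta) (X' i ta) (X j ta) (X' j ta)) has_integral K i j) {0..1}" and ka: "ka > 0"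
 shows "EX dl>0. ALL c::real^'n. norm c < dl --> (ALL ta:{0..1}. ga ta + (SUM i:UNIV. c $ i *\<^sub>R X i ta) : S) &
  integral {0..1} (%ta. ip (ga ta + (SUM i:UNIV. c $ i *\<^sub>R X i ta)) (u ta + (SUM i:UNIV. c $ i *\<^sub>R X' i ta)) (u ta + (SUM i:UNIV. c $ i *\<^sub>R X' i ta)))
  <= integral {0..1} (%ta. ip (ga ta) (u ta) (u ta))
   + 2 * (ip (ga 1) (u 1) (SUM i:UNIV. c $ i *\<^sub>R X i 1) - ip (ga 0) (u 0) (SUM i:UNIV. c $ i *\<^sub>R X i 0))
   + (SUM i:UNIV. SUM j:UNIV. c $ i * c $ j * K i j) + ka * (norm c)^2"
proof -
 have cvd: "continuous_on {0..1::real} h" if "!!ta. ta : {0..1} ==> (h has_vector_derivative h' ta) (at ta within {0..1})" for h h' :: "real => real^'n"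
  unfolding continuous_on_eq_continuous_within using has_vector_derivative_continuous[OF that] by blast
 have cga: "continuous_on {0..1} ga" by (rule cvd[OF g(1)])
 have cu: "continuous_on {0..1} u" by (rule cvd[OF geo])
 have cX: "continuous_on {0..1} (X i)" for i by (rule cvd[OF X])
 have bnd: "EX C>0. ALL ta:{0..1}. ALL c::real^'n. norm (SUM i:UNIV. c $ i *\<^sub>R Y i ta) <= C * norm c"
  if cY: "!!i. continuous_on {0..1} (Y i)" for Y :: "'n => real => real^'n"
 proof -
  have "EX b>0. ALL ta:{0..1}. norm (Y i ta) <= b" for i
   using compact_imp_bounded[OF compact_continuous_image[OF cY compact_Icc]] unfolding bounded_pos by blast
  then obtain b where b: "!!i. b i > 0" "!!i ta. ta : {0..1} ==> norm (Y i ta) <= b i" by metis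
  have "norm (SUM i:UNIV. c $ i *\<^sub>R Y i ta) <= (SUM i:UNIV. b i) * norm c" if "ta : {0..1}" for ta and c :: "real^'n"
  proof -
   have "norm (SUM i:UNIV. c $ i *\<^sub>R Y i ta) <= (SUM i:UNIV. norm c * b i)"
    by (rule sum_norm_le) (use b that component_le_norm_cart[of c] in \<open>auto intro!: mult_mono\<close>)
   thus ?thesis by (simp add: sum_distrib_left mult.commute)
  qed
  moreover have "(SUM i:UNIV. b i) > 0" using b by (intro sum_pos) auto
  ultimately show ?thesis by blast
 qed
 obtain C1 where C1: "C1 > 0" "!!ta c. ta : {0..1} ==> norm (SUM i:UNIV. c $ i *\<^sub>R X i ta) <= C1 * norm (c::real^'n)"
  using bnd[of X, OF cX] by blast
 obtain C2 where C2: "C2 > 0" "!!ta c. ta : {0..1} ==> norm (SUM i:UNIV. c $ i *\<^sub>R X' i ta) <= C2 * norm (c::real^'n)"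
  using bnd[of X', OF cX'] by blast
 define C where "C = max C1 C2"
 have C: "C > 0" "C1 <= C" "C2 <= C" using C1 C2 by (auto simp: C_def)
 obtain R where R: "R > 0" "!!ta. ta : {0..1} ==> norm (u ta) <= R"
  using compact_imp_bounded[OF compact_continuous_image[OF cu compact_Icc]] unfolding bounded_pos by blast
 have cK: "compact (ga ` {0..1})" "ga ` {0..1} \<subseteq> S" using compact_continuous_image[OF cga compact_Icc] g(2) by auto
 have ka': "ka / (2 * C\<^sup>2) > 0" using ka C by simp
 obtain dl0 where dl0: "dl0 > 0" "!!y T x x'. y : ga ` {0..1} ==> norm T <= R ==> norm x < dl0 ==> norm x' < dl0 ==> y + x : S &
  \<bar>ip (y + x) (T + x') (T + x') - ip y T T - (dG y x T T + 2 * ip y T x') - qb y T x x' x x'\<bar> <= ka / (2 * C\<^sup>2) * ((norm x)^2 + (norm x')^2)"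
  using energy_density_expansion[OF cK less_imp_le[OF R(1)] ka'] by blast
 show ?thesis
 proof (rule exI[of _ "dl0 / C"], rule conjI, goal_cases)
  case 1 show ?case using dl0 C by simp
 next
  case 2 show ?case
  proof (rule allI, rule impI)
  fix c :: "real^'n" assume c: "norm c < dl0 / C"
  let ?x = "%ta. SUM i:UNIV. c $ i *\<^sub>R X i ta" and ?x' = "%ta. SUM i:UNIV. c $ i *\<^sub>R X' i ta"
  have nx: "norm (?x ta) <= C * norm c" "norm (?x' ta) <= C * norm c" if "ta : {0..1}" for ta
   using C1(2)[OF that, of c] C2(2)[OF that, of c] mult_right_mono[OF C(2) norm_ge_zero[of c]] mult_right_mono[OF C(3) norm_ge_zero[of c]]
   by linarith+
  have Cc: "C * norm c < dl0" using c C by (simp add: field_simps)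
  have pt: "ga ta + ?x ta : S &
   \<bar>ip (ga ta + ?x ta) (u ta + ?x' ta) (u ta + ?x' ta) - ip (ga ta) (u ta) (u ta) - (dG (ga ta) (?x ta) (u ta) (u ta) + 2 * ip (ga ta) (u ta) (?x' ta)) - qb (ga ta) (u ta) (?x ta) (?x' ta) (?x ta) (?x' ta)\<bar>
    <= ka * (norm c)^2" if t: "ta : {0..1}" for ta
  proof -
   have n1: "norm (?x ta) < dl0" "norm (?x' ta) < dl0" using nx[OF t] Cc by linarith+
   have "(norm (?x ta))^2 <= (C * norm c)^2" "(norm (?x' ta))^2 <= (C * norm c)^2" using nx[OF t] by (simp_all add: power_mono)
   hence "ka / (2 * C\<^sup>2) * ((norm (?x ta))^2 + (norm (?x' ta))^2) <= ka / (2 * C\<^sup>2) * ((C * norm c)^2 + (C * norm c)^2)"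
    using ka' by (intro mult_left_mono add_mono) auto
   also have "... = ka * (norm c)^2" using C by (simp add: power_mult_distrib field_simps)
   finally show ?thesis using dl0(2)[OF imageI[OF t] R(2)[OF t] n1] by linarith
  qed
  have Xc: "(?x has_vector_derivative ?x' ta) (at ta within {0..1})" if "ta : {0..1}" for ta
   by (intro has_vector_derivative_sum bounded_linear.has_vector_derivative[OF bounded_linear_scaleR_right] X that)
  have i1: "((%ta. ip (ga ta) (u ta) (u ta)) has_integral integral {0..1} (%ta. ip (ga ta) (u ta) (u ta))) {0..1}"
   by (intro integrable_integral integrable_continuous_real continuous_ip cga cu cK)
  have i2: "((%ta. qb (ga ta) (u ta) (?x ta) (?x' ta) (?x ta) (?x' ta)) has_integral (SUM i:UNIV. SUM j:UNIV. c $ i * c $ j * K i j)) {0..1}"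
  proof (rule has_integral_eq)
   show "((%ta. SUM i:UNIV. SUM j:UNIV. c $ i * c $ j * qb (ga ta) (u ta) (X i ta) (X' i ta) (X j ta) (X' j ta)) has_integral (SUM i:UNIV. SUM j:UNIV. c $ i * c $ j * K i j)) {0..1}"
    by (intro has_integral_sum has_integral_mult_right K finite)
  qed (rule qb_sum[OF g(2), symmetric])
  have i3: "((%ta::real. ka * (norm c)^2) has_integral ka * (norm c)^2) {0..1}"
   using has_integral_const_real[of "ka * (norm c)^2" 0 1] by (simp del: has_integral_mult_right has_integral_mult_left)
  have i4: "((%ta. ip (ga ta + ?x ta) (u ta + ?x' ta) (u ta + ?x' ta)) has_integral integral {0..1} (%ta. ip (ga ta + ?x ta) (u ta + ?x' ta) (u ta + ?x' ta))) {0..1}"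
   by (intro integrable_integral integrable_continuous_real continuous_ip continuous_intros cga cu cX cX') (use pt in auto)
  have "integral {0..1} (%ta. ip (ga ta + ?x ta) (u ta + ?x' ta) (u ta + ?x' ta))
   <= ((integral {0..1} (%ta. ip (ga ta) (u ta) (u ta)) + 2 * (ip (ga 1) (u 1) (?x 1) - ip (ga 0) (u 0) (?x 0))) + (SUM i:UNIV. SUM j:UNIV. c $ i * c $ j * K i j)) + ka * (norm c)^2"
   by (rule has_integral_le[OF i4 has_integral_add[OF has_integral_add[OF has_integral_add[OF i1 first_variation[OF g geo Xc]] i2] i3]])
    (use pt in \<open>force simp: abs_le_iff\<close>)+
  thus "(ALL ta:{0..1}. ga ta + ?x ta : S) & integral {0..1} (%ta. ip (ga ta + ?x ta) (u ta + ?x' ta) (u ta + ?x' ta))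
   <= integral {0..1} (%ta. ip (ga ta) (u ta) (u ta)) + 2 * (ip (ga 1) (u 1) (?x 1) - ip (ga 0) (u 0) (?x 0))
   + (SUM i:UNIV. SUM j:UNIV. c $ i * c $ j * K i j) + ka * (norm c)^2" using pt by auto
  qed
 qed
qed

text \<open>The value of Delta_V at y on a function with differential q and coordinate Hessian H
  there; \<open>Gam\<close> corrects the coordinate Hessian to the covariant one.\<close>

definition Lam :: "real^'n => (real^'n => real) => (real^'n => real^'n => real) => (real^'n => real^'n) => real" where
 "Lam y q H W = gtr y (%u v. H u v - q (Gam y u v)) + q (W y)"

lemma Lam_onb:
 assumes y: "y : S" and e: "onb y e" and q: "linear q" and H: "!!v. linear (%u. H u v)" "!!u. linear (H u)"
 shows "Lam y q H W = (SUM i:UNIV. H (e i) (e i) - q (Gam y (e i) (e i))) + q (W y)"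
proof -
 have "linear (%u. H u v - q (Gam y u v))" "linear (%u. H v u - q (Gam y v u))" for v
  by (rule linearI; simp add: linear_add[OF H(1)] linear_cmul[OF H(1)] linear_add[OF H(2)] linear_cmul[OF H(2)] Gam_simps linear_add[OF q] linear_cmul[OF q] algebra_simps)+
 from gtr_onb[OF y e this] show ?thesis by (simp add: Lam_def)
qed

text \<open>One step of the induction along a minimizing broken geodesic. At \<open>s = 0\<close> the term with \<open>rh0\<close>
  disappears because \<open>s' / s = 0\<close>.\<close>

lemma superjet_step:
 assumes g: "!!ta. ta : {0..1} ==> (ga has_vector_derivative u ta) (at ta within {0..1})" "!!ta. ta : {0..1} ==> ga ta : S"
  and geo: "!!ta. ta : {0..1} ==> (u has_vector_derivative - Gam (ga ta) (u ta) (u ta)) (at ta within {0..1})"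
  and small: "!!s v. s : {0..1} ==> norm (Gam (ga s) (u s) v) <= norm v / 2" and W: "Ck_on (Suc 0) S W" and m: "m > real CARD('n)"
  and ric: "!!y \<xi>. y : S ==> 0 <= \<xi> \<bullet> (ricci_V_m m S G W y *v \<xi>)" and s: "0 <= s" "0 < h" "s' = s + h"
  and jet0: "0 < s ==> superjet rh0 (ga 0) q0 H0 & (ALL v. q0 v = 2 * s / h * ip (ga 0) (u 0) v) & Lam (ga 0) q0 H0 W <= 2 * m"
  and comp: "!!sg sg'. (!!ta. ta : {0..1} ==> (sg has_vector_derivative sg' ta) (at ta within {0..1}) & sg ta : S) ==>
    continuous_on {0..1} sg' ==> (s = 0 ==> sg 0 = ga 0) ==>
    rh1 (sg 1) <= s' / s * rh0 (sg 0) + s' / h * integral {0..1} (%ta. ip (sg ta) (sg' ta) (sg' ta))"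
  and eq: "rh1 (ga 1) = s' / s * rh0 (ga 0) + s' / h * integral {0..1} (%ta. ip (ga ta) (u ta) (u ta))"
 shows "EX q1 H1. superjet rh1 (ga 1) q1 H1 & (ALL v. q1 v = 2 * s' / h * ip (ga 1) (u 1) v) & Lam (ga 1) q1 H1 W <= 2 * m"
proof -
 have s': "s' > 0" using s by simp
 have cvd: "continuous_on {0..1::real} h" if "!!ta. ta : {0..1} ==> (h has_vector_derivative h' ta) (at ta within {0..1})" for h h' :: "real => real^'n"
  unfolding continuous_on_eq_continuous_within using has_vector_derivative_continuous[OF that] by blast
 have cga: "continuous_on {0..1} ga" by (rule cvd[OF g(1)])
 have cu: "continuous_on {0..1} u" by (rule cvd[OF geo])
 have im: "ga ` {0..1} \<subseteq> S" using g(2) by auto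
 have y1: "ga 1 : S" and y0: "ga 0 : S" using g(2) by auto
 obtain e where e: "onb (ga 1) e" using onb_exists[OF y1] by blast
 have "ALL i. EX E. E 1 = e i & (ALL ta:{0..1}. (E has_vector_derivative - Gam (ga ta) (u ta) (E ta)) (at ta within {0..1}))"
  using parallel_field_exists[OF cga im cu small] by blast
 then obtain E where E1: "!!i. E i 1 = e i"
  and E: "!!i ta. ta : {0..1} ==> (E i has_vector_derivative - Gam (ga ta) (u ta) (E i ta)) (at ta within {0..1})" by metis
 have onbE: "onb (ga 1) (%i. E i 1)" using e by (simp add: E1)
 have onbE0: "onb (ga 0) (%i. E i 0)" using onbE parallel_ip_constant[OF g E E, of 0] by (simp add: onb_def)
 have cE: "continuous_on {0..1} (E i)" for i by (rule cvd[OF E])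
 \<comment> \<open>When the end point moves by v, the starting point moves by s / s' times the
   parallel translate of v, in proportion to the distances from the centre; it stays fixed when s =
   0.\<close>
 define X where "X = (%i ta. ((s + h * ta) / s') *\<^sub>R E i ta)"
 define X' where "X' = (%i ta. (h / s') *\<^sub>R E i ta - ((s + h * ta) / s') *\<^sub>R Gam (ga ta) (u ta) (E i ta))"
 have Xd: "(X i has_vector_derivative X' i ta) (at ta within {0..1})" if "ta : {0..1}" for i ta
 proof -
  have "((%ta. (s + h * ta) / s') has_vector_derivative h / s') (at ta within {0..1})"
   using s' by (auto intro!: derivative_eq_intros simp: has_real_derivative_iff_has_vector_derivative[symmetric])
  from bounded_bilinear.has_vector_derivative[OF bounded_bilinear_scaleR this E[OF that]] show ?thesis by (simp add: X_def X'_def)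
 qed
 have cX: "continuous_on {0..1} (X i)" for i by (rule cvd[OF Xd])
 have cX': "continuous_on {0..1} (X' i)" for i unfolding X'_def by (intro continuous_intros cE continuous_curve_Gam cga im cu) (use s' in auto)
 define K where "K = (%i j. integral {0..1} (%ta. qb (ga ta) (u ta) (X i ta) (X' i ta) (X j ta) (X' j ta)))"
 have K: "((%ta. qb (ga ta) (u ta) (X i ta) (X' i ta) (X j ta) (X' j ta)) has_integral K i j) {0..1}" for i j
  unfolding K_def by (intro integrable_integral integrable_continuous_real continuous_qb cga im cu cX cX')
 have X1: "X i 1 = E i 1" for i using s s' by (simp add: X_def)
 have X0: "X i 0 = (s / s') *\<^sub>R E i 0" for i by (simp add: X_def)
 define A where "A = s' / s"
 define B where "B = s' / h"
 have B: "B > 0" using s s' by (simp add: B_def)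
 have A: "A >= 0" using s s' by (simp add: A_def)
 \<comment> \<open>The components of v in the frame at \<open>ga 1\<close>; the curve varied with
   these coefficients ends at \<open>ga 1 + v\<close>.\<close>
 define cc where "cc = (%v. (\<chi> i. ip (ga 1) v (e i)) :: real^'n)"
 have linc: "linear cc" by (rule linearI) (simp_all add: cc_def vec_eq_iff ip_simps)
 have cc_e: "cc (e j) $ i = (if i = j then 1 else 0)" for i j using e by (auto simp: cc_def onb_def)
 have cc_rec: "(SUM i:UNIV. cc v $ i *\<^sub>R X i 1) = v" for v using onb_expand[OF y1 e, of v] by (simp add: cc_def X1 E1)
 obtain C where C: "C > 0" "!!v. norm (cc v) <= C * norm v" using linear_bounded_pos[OF linc] by blast
 define x0 where "x0 = (%v. SUM i:UNIV. cc v $ i *\<^sub>R X i 0)"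
 have linx0: "linear x0" unfolding x0_def
  by (rule linearI) (simp_all add: linear_add[OF linc] linear_cmul[OF linc] algebra_simps sum.distrib scaleR_sum_right)
 obtain C0 where C0: "C0 > 0" "!!v. norm (x0 v) <= C0 * norm v" using linear_bounded_pos[OF linx0] by blast
 define HA where "HA = (%i j. if s = 0 then 0 else A * H0 (X i 0) (X j 0))"
 define H1 where "H1 = (%v w. SUM i:UNIV. SUM j:UNIV. cc v $ i * cc w $ j * (HA i j + 2 * B * K i j))"
 define q1 where "q1 = (%v. 2 * s' / h * ip (ga 1) (u 1) v)"
 have linq1: "linear q1" unfolding q1_def by (rule linearI) (simp_all add: ip_simps algebra_simps)
 have linH1: "linear (%v. H1 v w)" "linear (H1 v)" for v w
  unfolding H1_def by (rule linearI; simp add: linear_add[OF linc] linear_cmul[OF linc] algebra_simps sum.distrib sum_distrib_left)+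
 have HA_eval: "(SUM i:UNIV. SUM j:UNIV. cc v $ i * cc v $ j * HA i j) = A * H0 (x0 v) (x0 v)" if "0 < s" for v
 proof -
  have l: "linear (%u. H0 u v)" "linear (H0 u)" for u v using jet0[OF that] by (auto simp: superjet_def)
  show ?thesis using that
   by (subst sum.swap) (simp add: x0_def HA_def linear_sum[OF l(1)] linear_cmul[OF l(1)] linear_sum[OF l(2)] linear_cmul[OF l(2)] sum_distrib_left mult_ac)
 qed
 have jet: "superjet rh1 (ga 1) q1 H1" unfolding superjet_def
 proof (intro conjI allI impI linq1 linH1)
  fix ka :: real assume ka: "ka > 0"
  define ka1 where "ka1 = ka / (2 * B * C\<^sup>2)"
  have ka1: "ka1 > 0" using ka B C by (simp add: ka1_def)
  define P where "P = (%c::real^'n. (ALL ta:{0..1}. ga ta + (SUM i:UNIV. c $ i *\<^sub>R X i ta) : S) &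
   integral {0..1} (%ta. ip (ga ta + (SUM i:UNIV. c $ i *\<^sub>R X i ta)) (u ta + (SUM i:UNIV. c $ i *\<^sub>R X' i ta)) (u ta + (SUM i:UNIV. c $ i *\<^sub>R X' i ta)))
   <= integral {0..1} (%ta. ip (ga ta) (u ta) (u ta))
   + 2 * (ip (ga 1) (u 1) (SUM i:UNIV. c $ i *\<^sub>R X i 1) - ip (ga 0) (u 0) (SUM i:UNIV. c $ i *\<^sub>R X i 0))
   + (SUM i:UNIV. SUM j:UNIV. c $ i * c $ j * K i j) + ka1 * (norm c)^2)"
  have "EX dl>0. ALL c. norm c < dl --> P c" unfolding P_def by (rule energy_expansion[where X=X and X'=X' and K=K, OF g geo Xd cX' K ka1])
  then obtain dl1 where dl1: "dl1 > 0" "!!c. norm c < dl1 ==> P c" by blast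
  \<comment> \<open>A + 1 rather than A, because A is 0 when s = 0.\<close>
  define ka0 where "ka0 = ka / (2 * (A + 1) * C0\<^sup>2)"
  have ka0: "ka0 > 0" using ka A C0 by (simp add: ka0_def)
  have "EX dl>0. 0 < s --> (ALL v. norm v < dl --> rh0 (ga 0 + v) <= rh0 (ga 0) + q0 v + H0 v v / 2 + ka0 * (norm v)^2)"
  proof (cases "0 < s")
   case True
   thus ?thesis using jet0 ka0 unfolding superjet_def by blast
  qed (auto intro: exI[of _ 1])
  then obtain dl0 where dl0: "dl0 > 0" "!!v. 0 < s ==> norm v < dl0 ==> rh0 (ga 0 + v) <= rh0 (ga 0) + q0 v + H0 v v / 2 + ka0 * (norm v)^2"
   by blast
  show "EX dl>0. ALL v. norm v < dl --> rh1 (ga 1 + v) <= rh1 (ga 1) + q1 v + H1 v v / 2 + ka * (norm v)^2"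
  proof (intro exI[of _ "min (dl1 / C) (dl0 / C0)"] conjI allI impI)
   show "0 < min (dl1 / C) (dl0 / C0)" using dl1 dl0 C C0 by simp
   fix v :: "real^'n" assume v: "norm v < min (dl1 / C) (dl0 / C0)"
   let ?c = "cc v"
   have "C * norm v < dl1" "C0 * norm v < dl0" using v C C0 by (auto simp: field_simps)
   hence nc: "norm ?c < dl1" and nx0: "norm (x0 v) < dl0" using C(2)[of v] C0(2)[of v] by linarith+
   define sg where "sg = (%ta. ga ta + (SUM i:UNIV. ?c $ i *\<^sub>R X i ta))"
   define sg' where "sg' = (%ta. u ta + (SUM i:UNIV. ?c $ i *\<^sub>R X' i ta))"
   note ex = dl1(2)[OF nc, unfolded P_def]
   have "rh1 (sg 1) <= s' / s * rh0 (sg 0) + s' / h * integral {0..1} (%ta. ip (sg ta) (sg' ta) (sg' ta))"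
   proof (rule comp)
    fix ta :: real assume t: "ta : {0..1}"
    show "(sg has_vector_derivative sg' ta) (at ta within {0..1}) & sg ta : S" using ex t unfolding sg_def sg'_def
     by (intro conjI has_vector_derivative_add has_vector_derivative_sum bounded_linear.has_vector_derivative[OF bounded_linear_scaleR_right] Xd g) auto
   next
    show "continuous_on {0..1} sg'" unfolding sg'_def by (intro continuous_intros cu cX')
    show "sg 0 = ga 0" if "s = 0" using that by (simp add: sg_def X0)
   qed
   moreover have "sg 1 = ga 1 + v" by (simp add: sg_def cc_rec)
   moreover have "sg 0 = ga 0 + x0 v" by (simp add: sg_def x0_def)
   ultimately have r1: "rh1 (ga 1 + v) <= A * rh0 (ga 0 + x0 v) + B * integral {0..1} (%ta. ip (sg ta) (sg' ta) (sg' ta))"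
    by (simp add: A_def B_def)
   let ?E = "integral {0..1} (%ta. ip (ga ta) (u ta) (u ta))" and ?K = "SUM i:UNIV. SUM j:UNIV. ?c $ i * ?c $ j * K i j"
   have r2: "B * integral {0..1} (%ta. ip (sg ta) (sg' ta) (sg' ta)) <= B * ?E + (q1 v - 2 * B * ip (ga 0) (u 0) (x0 v)) + B * ?K + ka / 2 * (norm v)^2"
   proof -
    have "integral {0..1} (%ta. ip (sg ta) (sg' ta) (sg' ta)) <= ?E + 2 * (ip (ga 1) (u 1) v - ip (ga 0) (u 0) (x0 v)) + ?K + ka1 * (norm ?c)^2"
     using ex by (simp add: sg_def sg'_def cc_rec x0_def)
    also have "ka1 * (norm ?c)^2 <= ka1 * (C * norm v)^2" using C(2)[of v] ka1 by (intro mult_left_mono power_mono) auto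
    finally have "B * integral {0..1} (%ta. ip (sg ta) (sg' ta) (sg' ta)) <= B * (?E + 2 * (ip (ga 1) (u 1) v - ip (ga 0) (u 0) (x0 v)) + ?K + ka1 * (C * norm v)^2)"
     using B by simp
    moreover have "B * (ka1 * (C * norm v)^2) = ka / 2 * (norm v)^2" using B C by (simp add: ka1_def power_mult_distrib field_simps)
    moreover have "q1 v = 2 * B * ip (ga 1) (u 1) v" by (simp add: q1_def B_def)
    moreover have "B * (x1 + 2 * (x2 - x3) + x4 + x5) = B * x1 + 2 * B * x2 - 2 * B * x3 + B * x4 + B * x5" for x1 x2 x3 x4 x5
     by (simp add: algebra_simps)
    ultimately show ?thesis by simp
   qed
   \<comment> \<open>By the prescribed q0, the linear term of the jet at \<open>ga 0\<close> is 2 B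
     <u 0, x0 v>; it cancels the endpoint term at the start of the curve in
     \<open>r2\<close>.\<close>
   have r3: "A * rh0 (ga 0 + x0 v) <= A * rh0 (ga 0) + 2 * B * ip (ga 0) (u 0) (x0 v) + (SUM i:UNIV. SUM j:UNIV. ?c $ i * ?c $ j * HA i j) / 2 + ka / 2 * (norm v)^2"
   proof (cases "0 < s")
    case True
    have "A * rh0 (ga 0 + x0 v) <= A * (rh0 (ga 0) + q0 (x0 v) + H0 (x0 v) (x0 v) / 2 + ka0 * (norm (x0 v))^2)"
     by (intro mult_left_mono A dl0(2)[OF True nx0])
    moreover have "A * (ka0 * (norm (x0 v))^2) <= ka / 2 * (norm v)^2"
    proof -
     have "A * (ka0 * (norm (x0 v))^2) <= (A + 1) * (ka0 * (C0 * norm v)^2)" using A ka0 C0(2)[of v] by (intro mult_mono power_mono) auto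
     also have "... = ((A + 1) * (2 * C0\<^sup>2) * ka0) / 2 * (norm v)^2" by (simp add: power_mult_distrib)
     also have "(A + 1) * (2 * C0\<^sup>2) * ka0 = ka"
     proof -
      have "D * (2 * C0\<^sup>2) * (ka / (2 * D * C0\<^sup>2)) = ka" if "D ~= 0" for D using that C0 by simp
      from this[of "A + 1"] show ?thesis unfolding ka0_def using A by argo
     qed
     finally show ?thesis .
    qed
    moreover have "A * q0 (x0 v) = 2 * B * ip (ga 0) (u 0) (x0 v)" using jet0[OF True] True by (simp add: A_def B_def)
    moreover have "A * (x1 + x2 + x3 / 2 + x4) = A * x1 + A * x2 + A * x3 / 2 + A * x4" for x1 x2 x3 x4 by (simp add: algebra_simps)
    ultimately show ?thesis unfolding HA_eval[OF True] by simp
   next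
    case False
    hence s0: "s = 0" using s by simp
    hence "x0 v = 0" by (simp add: x0_def X0)
    thus ?thesis using s0 ka by (simp add: A_def HA_def ip_simps)
   qed
   have H1v: "H1 v v = (SUM i:UNIV. SUM j:UNIV. ?c $ i * ?c $ j * HA i j) + 2 * B * ?K"
    unfolding H1_def by (simp add: distrib_left sum.distrib sum_distrib_left mult_ac)
   show "rh1 (ga 1 + v) <= rh1 (ga 1) + q1 v + H1 v v / 2 + ka * (norm v)^2"
   proof -
    have "ka / 2 * (norm v)^2 + ka / 2 * (norm v)^2 = ka * (norm v)^2" by simp
    moreover have "H1 v v / 2 = (SUM i:UNIV. SUM j:UNIV. ?c $ i * ?c $ j * HA i j) / 2 + B * ?K" unfolding H1v by (simp add: add_divide_distrib)
    ultimately show ?thesis using r1 r2 r3 eq[folded A_def B_def] by linarith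
   qed
  qed
 qed
 \<comment> \<open>The old bound enters with weight s / s' and the index form with weight h / s'.
   The weights add up to 1, so 2 m does not grow along the chain. The endpoint terms of the index
   form cancel against the Christoffel and drift parts of \<open>Lam\<close> at both ends.\<close>
 have Lam1: "Lam (ga 1) q1 H1 W <= 2 * m"
 proof -
  have H1e: "H1 (e k) (e k) = HA k k + 2 * B * K k k" for k
  proof -
   have "H1 (e k) (e k) = (SUM i:UNIV. SUM j:UNIV. if i = k then (if j = k then HA i j + 2 * B * K i j else 0) else 0)"
    unfolding H1_def by (intro sum.cong refl) (simp add: cc_e)
   also have "... = (SUM i:UNIV. if i = k then (SUM j:UNIV. if j = k then HA i j + 2 * B * K i j else 0) else 0)" by (intro sum.cong refl) auto
   finally show ?thesis by simp
  qed
  define P1 where "P1 = (SUM i:UNIV. ip (ga 1) (u 1) (Gam (ga 1) (e i) (e i)))"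
  define P0 where "P0 = (SUM i:UNIV. ip (ga 0) (u 0) (Gam (ga 0) (E i 0) (E i 0)))"
  define V1 where "V1 = ip (ga 1) (u 1) (W (ga 1))"
  define V0 where "V0 = ip (ga 0) (u 0) (W (ga 0))"
  have q1B: "q1 v = 2 * B * ip (ga 1) (u 1) v" for v by (simp add: q1_def B_def)
  define SK where "SK = (SUM i:UNIV. K i i)"
  have main: "s'\<^sup>2 * SK + (s'\<^sup>2 * V1 - s\<^sup>2 * V0) <= h\<^sup>2 * m + s'\<^sup>2 * (P1 - (s / s')\<^sup>2 * P0)"
  proof -
   have "(SUM i:UNIV. ip (ga 1) (u 1) (Gam (ga 1) (X i 1) (X i 1)) - ip (ga 0) (u 0) (Gam (ga 0) (X i 0) (X i 0))) = P1 - (s / s')\<^sup>2 * P0"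
    by (simp add: P1_def P0_def X1 X0 E1 Gam_simps ip_simps sum_subtractf sum_distrib_left power2_eq_square mult_ac)
   thus ?thesis using index_form_bound[OF g geo W m ric E onbE s K[unfolded X_def X'_def], folded X_def X'_def]
    by (simp add: SK_def V1_def V0_def X_def)
  qed
  have L1: "Lam (ga 1) q1 H1 W = (SUM i:UNIV. HA i i) + 2 * B * SK - 2 * B * P1 + 2 * B * V1" unfolding Lam_onb[OF y1 e linq1 linH1]
   by (simp add: H1e q1B SK_def P1_def V1_def sum.distrib sum_subtractf sum_distrib_left algebra_simps)
  have HA0: "(SUM i:UNIV. HA i i) <= (s / s') * (2 * m) + 2 * B * (s / s')^2 * P0 - 2 * B * (s / s')^2 * V0"
  proof (cases "0 < s")
   case True
   have l: "linear (%u. H0 u v)" "linear (H0 u)" "linear q0" for u v using jet0[OF True] by (auto simp: superjet_def)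
   have q0: "q0 v = 2 * s / h * ip (ga 0) (u 0) v" for v using jet0[OF True] by blast
   have k: "A * (s / s')^2 = s / s'" "(s / s') * (2 * s / h) = 2 * B * (s / s')^2"
    using True s' s(2) by (simp_all add: A_def B_def power2_eq_square mult_ac)
   have "(SUM i:UNIV. HA i i) = A * (s / s')^2 * (SUM i:UNIV. H0 (E i 0) (E i 0))"
    using True by (simp add: HA_def X0 linear_cmul[OF l(1)] linear_cmul[OF l(2)] sum_distrib_left power2_eq_square mult_ac)
   also have "(SUM i:UNIV. H0 (E i 0) (E i 0)) = Lam (ga 0) q0 H0 W + 2 * s / h * P0 - 2 * s / h * V0"
    unfolding Lam_onb[OF y0 onbE0 l(3) l(1,2)] by (simp add: q0 P0_def V0_def sum_subtractf sum_distrib_left)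
   also have "A * (s / s')^2 * ... = (s / s') * Lam (ga 0) q0 H0 W + 2 * B * (s / s')^2 * P0 - 2 * B * (s / s')^2 * V0"
    unfolding k(1) k(2)[symmetric] by (simp add: algebra_simps)
   also have "(s / s') * Lam (ga 0) q0 H0 W <= (s / s') * (2 * m)" using jet0[OF True] s s' by (intro mult_left_mono) auto
   finally show ?thesis by simp
  next
   case False
   hence "s = 0" using s by simp
   thus ?thesis by (simp add: HA_def)
  qed
  have k: "2 * B / s'\<^sup>2 * (s'\<^sup>2 * SK + (s'\<^sup>2 * V1 - s\<^sup>2 * V0)) = 2 * B * SK + 2 * B * V1 - 2 * B * (s / s')^2 * V0"
   "2 * B / s'\<^sup>2 * (h\<^sup>2 * m + s'\<^sup>2 * (P1 - (s / s')\<^sup>2 * P0)) = (h / s') * (2 * m) + 2 * B * P1 - 2 * B * (s / s')^2 * P0"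
  proof -
   have b1: "2 * B / s'\<^sup>2 * (h\<^sup>2 * m) = (h / s') * (2 * m)" using s' s(2) by (simp add: B_def power2_eq_square)
   have b2: "2 * B / s'\<^sup>2 * (s'\<^sup>2 * z) = 2 * B * z" for z using s' by simp
   have b3: "2 * B / s'\<^sup>2 * (s\<^sup>2 * z) = 2 * B * (s / s')^2 * z" for z by (simp add: power_divide)
   show "2 * B / s'\<^sup>2 * (s'\<^sup>2 * SK + (s'\<^sup>2 * V1 - s\<^sup>2 * V0)) = 2 * B * SK + 2 * B * V1 - 2 * B * (s / s')^2 * V0"
    unfolding distrib_left right_diff_distrib b2 b3 by simp
   show "2 * B / s'\<^sup>2 * (h\<^sup>2 * m + s'\<^sup>2 * (P1 - (s / s')\<^sup>2 * P0)) = (h / s') * (2 * m) + 2 * B * P1 - 2 * B * (s / s')^2 * P0"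
    unfolding distrib_left b1 b2 by (simp add: algebra_simps)
  qed
  have "2 * B * SK + 2 * B * V1 - 2 * B * (s / s')^2 * V0 <= (h / s') * (2 * m) + 2 * B * P1 - 2 * B * (s / s')^2 * P0"
   unfolding k[symmetric] using main B by (intro mult_left_mono) auto
  hence "Lam (ga 1) q1 H1 W <= (s / s') * (2 * m) + (h / s') * (2 * m)" using L1 HA0 by linarith
  also have "... = ((s + h) / s') * (2 * m)" by (simp only: distrib_right add_divide_distrib)
  also have "... = 2 * m" using s' s(3) by simp
  finally show ?thesis .
 qed
 show ?thesis using jet Lam1 q1_def by blast
qed

end

section \<open>Short geodesics\<close>

lemma vector_derivative_continuous_on:
 assumes "!!ta. ta : T ==> (h has_vector_derivative h' ta) (at ta within T)" shows "continuous_on T h"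
 unfolding continuous_on_eq_continuous_within using has_vector_derivative_continuous[OF assms] by blast

lemma norm_integral_unit_le:
 fixes h :: "real => 'v::euclidean_space"
 assumes "continuous_on {0..1} h" "s : {0..1}" "!!ta. ta : {0..1} ==> norm (h ta) <= B" shows "norm (integral {0..s} h) <= B"
proof -
 have B: "0 <= B" using order_trans[OF norm_ge_zero assms(3)[of 0]] by simp
 have "norm (integral {0..s} h) <= B * (s - 0)" by (rule integral_bound) (use assms in \<open>auto intro: continuous_on_subset\<close>)
 also have "... <= B * 1" using assms(2) B by (intro mult_left_mono) auto
 finally show ?thesis by simp
qed

lemma mult_mono2:
 fixes C :: real assumes "0 <= C" "0 <= x" "x <= x'" "0 <= y" "y <= y'"
 shows "C * x * y <= C * x' * y'" using assms by (intro mult_mono[OF mult_left_mono]) auto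

lemma mult_mono3:
 fixes C :: real assumes "0 <= C" "0 <= x" "x <= x'" "0 <= y" "y <= y'" "0 <= z" "z <= z'"
 shows "C * x * y * z <= C * x' * y' * z'" using assms by (intro mult_mono[OF mult_mono2]) auto

context coord_metric_open begin

lemma lipschitz_compact_convex:
 fixes F :: "real^'n => 'z::real_normed_vector"
 assumes F: "smooth_on S F" and K: "compact K" "convex K" "K \<subseteq> S"
 obtains M where "M > 0" "!!y. y : K ==> norm (F y) <= M" "!!y y'. y : K ==> y' : K ==> norm (F y - F y') <= M * norm (y - y')"
proof -
 obtain M1 where M1: "M1 > 0" "!!y x. y : K ==> norm (dd S x F y) <= M1 * norm x"
   "!!y x. y : K ==> norm (dd S x (dd S x F) y) <= M1 * (norm x)^2" using dd_bound_compact[OF F K(1,3)] by blast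
 have "continuous_on K F" using Ck_on_continuous[OF smooth_onD[OF F, of 0]] K continuous_on_subset by blast
 hence "bounded (F ` K)" by (intro compact_imp_bounded compact_continuous_image K(1))
 then obtain M0 where M0: "M0 > 0" "!!y. y : K ==> norm (F y) <= M0" by (auto simp: bounded_pos)
 have lip: "norm (F y - F y') <= M1 * norm (y - y')" if "y : K" "y' : K" for y y'
 proof (rule differentiable_bound[OF K(2) _ _ that])
  fix x assume x: "x : K"
  thus "(F has_derivative (%e. dd S e F x)) (at x within K)" using smooth_on_deriv[OF F, of x] K(3) has_derivative_subset by blast
  show "onorm (%e. dd S e F x) <= M1" by (rule onorm_bound) (use M1 x in auto)
 qed
 show ?thesis
 proof (rule that[of "max M0 M1"])
  show "max M0 M1 > 0" using M0 by simp
  show "norm (F y) <= max M0 M1" if "y : K" for y using M0(2)[OF that] by simp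
  show "norm (F y - F y') <= max M0 M1 * norm (y - y')" if "y : K" "y' : K" for y y'
   using lip[OF that] mult_right_mono[of M1 "max M0 M1" "norm (y - y')"] by simp
 qed
qed

lemma Gam_bounds:
 assumes K: "compact K" "convex K" "K \<subseteq> S"
 obtains C where "C > 0" "!!y a b. y : K ==> norm (Gam y a b) <= C * norm a * norm b"
  "!!y y' a b. y : K ==> y' : K ==> norm (Gam y a b - Gam y' a b) <= C * norm (y - y') * norm a * norm b"
proof -
 have "EX M>0. (ALL y:K. norm (Gam y (axis i 1) (axis j 1)) <= M) & (ALL y:K. ALL y':K. norm (Gam y (axis i 1) (axis j 1) - Gam y' (axis i 1) (axis j 1)) <= M * norm (y - y'))" for i j
  using lipschitz_compact_convex[OF smooth_Gam K, of "axis i 1" "axis j 1"] by metis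
 then obtain M where M: "!!i j. M i j > 0" "!!i j y. y : K ==> norm (Gam y (axis i 1) (axis j 1)) <= M i j"
  "!!i j y y'. y : K ==> y' : K ==> norm (Gam y (axis i 1) (axis j 1) - Gam y' (axis i 1) (axis j 1)) <= M i j * norm (y - y')" by metis
 define C where "C = (SUM i:UNIV. SUM j:UNIV. M i j)"
 have C: "C > 0" unfolding C_def using M by (intro sum_pos) auto
 have ab: "\<bar>a $ i * b $ j\<bar> <= norm a * norm b" for a b :: "real^'n" and i j
  unfolding abs_mult using component_le_norm_cart[of a i] component_le_norm_cart[of b j] by (intro mult_mono) auto
 have bd: "norm (SUM i:UNIV. SUM j:UNIV. (a $ i * b $ j) *\<^sub>R V i j) <= C * t * norm a * norm b"
  if "!!i j. norm (V i j) <= M i j * t" "0 <= t" for a b :: "real^'n" and V :: "'n => 'n => real^'n" and t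
 proof -
  have "norm (SUM i:UNIV. SUM j:UNIV. (a $ i * b $ j) *\<^sub>R V i j) <= (SUM i:UNIV. SUM j:UNIV. (norm a * norm b) * (M i j * t))"
  proof (rule sum_norm_le, rule sum_norm_le)
   fix i j
   show "norm ((a $ i * b $ j) *\<^sub>R V i j) <= (norm a * norm b) * (M i j * t)"
    unfolding norm_scaleR using ab[of a i b j] that(1)[of i j] by (intro mult_mono) auto
  qed
  thus ?thesis by (simp add: C_def sum_distrib_left sum_distrib_right mult_ac)
 qed
 show ?thesis
 proof (rule that[OF C])
  show "norm (Gam y a b) <= C * norm a * norm b" if "y : K" for y a b
   using bd[of "%i j. Gam y (axis i 1) (axis j 1)" 1 a b] M(2)[OF that] by (simp flip: Gam_expand)
  show "norm (Gam y a b - Gam y' a b) <= C * norm (y - y') * norm a * norm b" if "y : K" "y' : K" for y y' a b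
  proof -
   have "Gam y a b - Gam y' a b = (SUM i:UNIV. SUM j:UNIV. (a $ i * b $ j) *\<^sub>R (Gam y (axis i 1) (axis j 1) - Gam y' (axis i 1) (axis j 1)))"
    by (subst (1 2) Gam_expand) (simp add: sum_subtractf scaleR_diff_right)
   thus ?thesis using bd[of "%i j. Gam y (axis i 1) (axis j 1) - Gam y' (axis i 1) (axis j 1)" "norm (y - y')" a b] M(3)[OF that] by simp
  qed
 qed
qed

lemma metric_bounds:
 assumes K: "compact K" "K \<subseteq> S" "K ~= {}"
 obtains l L where "l > 0" "L > 0" "!!y v. y : K ==> l * (norm v)^2 <= ip y v v" "!!y v. y : K ==> ip y v v <= L * (norm v)^2"
proof -
 let ?T = "K \<times> sphere (0::real^'n) 1"
 have cT: "compact ?T" by (intro compact_Times K compact_sphere)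
 have neT: "?T ~= {}" using K(3) by (auto intro!: exI[of _ "axis undefined 1"])
 have cf: "continuous_on ?T (%p. ip (fst p) (snd p) (snd p))" by (rule continuous_ip) (use K in \<open>auto intro!: continuous_intros\<close>)
 obtain p0 where p0: "p0 : ?T" "!!p. p : ?T ==> ip (fst p0) (snd p0) (snd p0) <= ip (fst p) (snd p) (snd p)"
  using continuous_attains_inf[OF cT neT cf] by blast
 obtain p1 where p1: "p1 : ?T" "!!p. p : ?T ==> ip (fst p) (snd p) (snd p) <= ip (fst p1) (snd p1) (snd p1)"
  using continuous_attains_sup[OF cT neT cf] by blast
 define l where "l = ip (fst p0) (snd p0) (snd p0)"
 define L where "L = ip (fst p1) (snd p1) (snd p1)"
 have l: "l > 0" unfolding l_def using p0(1) K(2) by (intro ip_pos) auto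
 have "l <= L" using p0(2)[OF p1(1)] by (simp add: l_def L_def)
 have sc: "ip y v v = (norm v)^2 * ip y ((1 / norm v) *\<^sub>R v) ((1 / norm v) *\<^sub>R v)" if "v ~= 0" for y v
  using that by (simp add: ip_simps power2_eq_square)
 show ?thesis
 proof (rule that[of l L])
  show "l > 0" "L > 0" using l \<open>l <= L\<close> by auto
  fix y v assume y: "y : K"
  show "l * (norm v)^2 <= ip y v v"
  proof (cases "v = 0")
   case False
   have "l <= ip y ((1 / norm v) *\<^sub>R v) ((1 / norm v) *\<^sub>R v)"
    using p0(2)[of "(y, (1 / norm v) *\<^sub>R v)"] y False by (simp add: l_def)
   from mult_right_mono[OF this zero_le_power2[of "norm v"]]
   show ?thesis unfolding sc[OF False, of y] by (simp only: mult.commute[of "(norm v)^2"])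
  qed (simp add: ip_simps)
  show "ip y v v <= L * (norm v)^2"
  proof (cases "v = 0")
   case False
   have "ip y ((1 / norm v) *\<^sub>R v) ((1 / norm v) *\<^sub>R v) <= L"
    using p1(2)[of "(y, (1 / norm v) *\<^sub>R v)"] y False by (simp add: L_def)
   from mult_right_mono[OF this zero_le_power2[of "norm v"]]
   show ?thesis unfolding sc[OF False, of y] by (simp only: mult.commute[of "(norm v)^2"])
  qed (simp add: ip_simps)
 qed
qed

text \<open>The last clause is the smallness that \<open>parallel_field_exists\<close> asks for;
  with it every such geodesic carries parallel frames.\<close>

definition geo :: "real^'n => (real => real^'n) => (real => real^'n) => real^'n => bool" where
 "geo z ga u w \<longleftrightarrow> ga 0 = z & ga 1 = z + w &
  (ALL ta:{0..1}. ga ta : S & (ga has_vector_derivative u ta) (at ta within {0..1}) &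
    (u has_vector_derivative - Gam (ga ta) (u ta) (u ta)) (at ta within {0..1}) &
    (ALL v. norm (Gam (ga ta) (u ta) v) <= norm v / 2))"

text \<open>The two-point problem becomes a fixed point equation for the velocity: u = w - A +
  mean(A), where A integrates \<open>Gam\<close> of (u, u) along the path. Adding the mean forces
  the total displacement to be w. Of the dependence on w only a Lipschitz bound is
  extracted.\<close>

lemma geodesic_bvp:
 assumes K: "cball p R \<subseteq> S" and R: "R > 0"
 obtains om where "om > 0" "4 * om <= R" "!!z. z : cball p om ==> EX ga u.
   (ALL w. norm w <= om --> geo z (ga w) (u w) w & (ALL ta:{0..1}. ga w ta : cball p R & norm (u w ta) <= 2 * norm w)) &
   (ALL w w'. norm w <= om --> norm w' <= om --> (ALL ta:{0..1}. norm (u w ta - u w' ta) <= 2 * norm (w - w') &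
    norm (ga w ta - ga w' ta) <= 2 * norm (w - w')))"
proof -
 obtain C where C: "C > 0" "!!y a b. y : cball p R ==> norm (Gam y a b) <= C * norm a * norm b"
  "!!y y' a b. y : cball p R ==> y' : cball p R ==> norm (Gam y a b - Gam y' a b) <= C * norm (y - y') * norm a * norm b"
  using Gam_bounds[OF compact_cball convex_cball K] by blast
 \<comment> \<open>32 C om <= 1 gives contraction factor 1/2 on velocities of norm at most 2 om, and
   4 om <= R keeps the paths, which stay within 3 om of p, in the ball.\<close>
 define om where "om = min (R / 4) (min 1 (1 / (32 * C)))"
 have om: "om > 0" "4 * om <= R" "om <= 1" using R C by (auto simp: om_def)
 have Com: "32 * C * om <= 1"
 proof -
  have "om <= 1 / (32 * C)" by (simp add: om_def)
  hence "32 * C * om <= 32 * C * (1 / (32 * C))" using C by (intro mult_left_mono) auto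
  thus ?thesis using C by simp
 qed
 show ?thesis
 proof (rule that[OF om(1,2)])
  fix z assume z: "z : cball p om"
  define path where "path = (%(u::real => real^'n) ta. z + integral {0..ta} u)"
  define acc where "acc = (%u ta. Gam (path u ta) (u ta) (u ta))"
  define AA where "AA = (%u s. integral {0..s} (acc u))"
  define Ph where "Ph = (%w u s. w - AA u s + integral {0..1} (AA u))"
  define adm where "adm = (%u::real => real^'n. continuous_on {0..1} u & (ALL s:{0..1}. norm (u s) <= 2 * om))"
  have pathd: "(path u has_vector_derivative u ta) (at ta within {0..1})" if "adm u" "ta : {0..1}" for u ta
   using has_vector_derivative_add[OF has_vector_derivative_const integral_has_vector_derivative[of 0 1 u ta]] that by (simp add: path_def adm_def)
  have pathK: "path u ta : cball p R" if "adm u" "ta : {0..1}" for u ta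
  proof -
   have "norm (integral {0..ta} u) <= 2 * om" using norm_integral_unit_le[of u ta "2 * om"] that by (auto simp: adm_def)
   hence "dist p (path u ta) <= om + 2 * om"
    using z norm_triangle_ineq4[of "p - z" "integral {0..ta} u"] by (simp add: path_def dist_norm diff_diff_eq)
   thus ?thesis using om by simp
  qed
  have cpath: "continuous_on {0..1} (path u)" if "adm u" for u by (rule vector_derivative_continuous_on) (rule pathd[OF that])
  have cacc: "continuous_on {0..1} (acc u)" if "adm u" for u unfolding acc_def using pathK[OF that] K that
   by (intro continuous_curve_Gam cpath[OF that]) (auto simp: adm_def)
  have AAd: "(AA u has_vector_derivative acc u s) (at s within {0..1})" if "adm u" "s : {0..1}" for u s
   unfolding AA_def by (rule integral_has_vector_derivative[OF cacc[OF that(1)] that(2)])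
  have cAA: "continuous_on {0..1} (AA u)" if "adm u" for u by (rule vector_derivative_continuous_on) (rule AAd[OF that])
  have acc_b: "norm (acc u ta) <= 4 * C * om\<^sup>2" if "adm u" "ta : {0..1}" for u ta
  proof -
   have "norm (acc u ta) <= C * norm (u ta) * norm (u ta)" unfolding acc_def by (rule C(2)[OF pathK[OF that]])
   also have "... <= C * (2 * om) * (2 * om)" using that C om by (intro mult_mono) (auto simp: adm_def)
   finally show ?thesis by (simp add: power2_eq_square)
  qed
  have small: "8 * C * om\<^sup>2 <= om / 4" using mult_right_mono[OF Com, of "om / 4"] om by (simp add: power2_eq_square)
  have pd: "norm (path u ta - path v ta) <= b" if "adm u" "adm v" "!!s. s : {0..1} ==> norm (u s - v s) <= b" "ta : {0..1}" for u v b ta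
  proof -
   have i: "f integrable_on {0..ta}" if "adm f" for f
    using that \<open>ta : {0..1}\<close> by (intro integrable_continuous_real) (auto simp: adm_def intro: continuous_on_subset)
   have "path u ta - path v ta = integral {0..ta} (%s. u s - v s)" by (simp add: path_def integral_diff[OF i[OF that(1)] i[OF that(2)]])
   also have "norm ... <= b" by (rule norm_integral_unit_le) (use that in \<open>auto simp: adm_def intro: continuous_on_diff\<close>)
   finally show ?thesis .
  qed
  have accd: "norm (acc u ta - acc v ta) <= b / 4" if "adm u" "adm v" "!!s. s : {0..1} ==> norm (u s - v s) <= b" "ta : {0..1}" for u v b ta
  proof -
   have b: "0 <= b" using that(3)[OF that(4)] norm_ge_zero order_trans by blast
   have nu: "norm (u ta) <= 2 * om" "norm (v ta) <= 2 * om" using that by (auto simp: adm_def)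
   have C0: "0 <= C" and w0: "0 <= 2 * om" using C om by auto
   have eq: "acc u ta - acc v ta = (Gam (path u ta) (u ta) (u ta) - Gam (path v ta) (u ta) (u ta)) + Gam (path v ta) (u ta - v ta) (u ta) + Gam (path v ta) (v ta) (u ta - v ta)"
    by (simp add: acc_def Gam_simps)
   have "norm (acc u ta - acc v ta) <= norm (Gam (path u ta) (u ta) (u ta) - Gam (path v ta) (u ta) (u ta)) + norm (Gam (path v ta) (u ta - v ta) (u ta)) + norm (Gam (path v ta) (v ta) (u ta - v ta))"
    unfolding eq by (rule order_trans[OF norm_triangle_ineq add_right_mono[OF norm_triangle_ineq]])
   also have "... <= C * b * (2 * om) * (2 * om) + C * b * (2 * om) + C * (2 * om) * b"
   proof (intro add_mono)
    show "norm (Gam (path u ta) (u ta) (u ta) - Gam (path v ta) (u ta) (u ta)) <= C * b * (2 * om) * (2 * om)"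
     by (rule order_trans[OF C(3)[OF pathK[OF that(1,4)] pathK[OF that(2,4)]] mult_mono3[OF C0 norm_ge_zero pd[OF that] norm_ge_zero nu(1) norm_ge_zero nu(1)]])
    show "norm (Gam (path v ta) (u ta - v ta) (u ta)) <= C * b * (2 * om)"
     by (rule order_trans[OF C(2)[OF pathK[OF that(2,4)]] mult_mono2[OF C0 norm_ge_zero that(3)[OF that(4)] norm_ge_zero nu(1)]])
    show "norm (Gam (path v ta) (v ta) (u ta - v ta)) <= C * (2 * om) * b"
     by (rule order_trans[OF C(2)[OF pathK[OF that(2,4)]] mult_mono2[OF C0 norm_ge_zero nu(2) norm_ge_zero that(3)[OF that(4)]]])
   qed
   also have "... = (4 * C * om * om + 4 * C * om) * b" by (simp add: algebra_simps)
   also have "... <= (4 * C * om * 1 + 4 * C * om) * b" using C om b by (intro mult_right_mono add_mono mult_left_mono) auto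
   also have "... <= (1 / 4) * b" using Com b by (intro mult_right_mono) auto
   finally show ?thesis by simp
  qed
  have AAdiff: "norm (AA u s - AA v s) <= b / 4" if "adm u" "adm v" "!!s. s : {0..1} ==> norm (u s - v s) <= b" "s : {0..1}" for u v b s
  proof -
   have i: "acc f integrable_on {0..s}" if "adm f" for f
    using cacc[OF that] \<open>s : {0..1}\<close> by (intro integrable_continuous_real) (auto intro: continuous_on_subset)
   have "AA u s - AA v s = integral {0..s} (%ta. acc u ta - acc v ta)" by (simp add: AA_def integral_diff[OF i[OF that(1)] i[OF that(2)]])
   also have "norm ... <= b / 4"
    by (rule norm_integral_unit_le[OF continuous_on_diff[OF cacc[OF that(1)] cacc[OF that(2)]] that(4)]) (rule accd[OF that(1-3)])
   finally show ?thesis .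
  qed
  have intAAdiff: "norm (integral {0..1} (AA u) - integral {0..1} (AA v)) <= b / 4" if "adm u" "adm v" "!!s. s : {0..1} ==> norm (u s - v s) <= b" for u v b
  proof -
   have "integral {0..1} (AA u) - integral {0..1} (AA v) = integral {0..1} (%ta. AA u ta - AA v ta)"
    by (intro integral_diff[symmetric] integrable_continuous_real cAA that)
   also have "norm ... <= b / 4"
    by (rule norm_integral_unit_le[OF continuous_on_diff[OF cAA[OF that(1)] cAA[OF that(2)]]]) (use AAdiff[OF that(1-3)] in auto)
   finally show ?thesis .
  qed
  have Phdiff: "norm (Ph w u s - Ph w' v s) <= norm (w - w') + b / 2" if "adm u" "adm v" "!!s. s : {0..1} ==> norm (u s - v s) <= b" "s : {0..1}" for w w' u v b s
  proof -
   have "Ph w u s - Ph w' v s = (w - w') - (AA u s - AA v s) + (integral {0..1} (AA u) - integral {0..1} (AA v))" by (simp add: Ph_def)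
   also have "norm ... <= norm (w - w') + norm (AA u s - AA v s) + norm (integral {0..1} (AA u) - integral {0..1} (AA v))"
    by (rule order_trans[OF norm_triangle_ineq add_right_mono[OF norm_triangle_ineq4]])
   also have "... <= norm (w - w') + b / 4 + b / 4" using AAdiff[OF that] intAAdiff[OF that(1-3)] by (intro add_mono) auto
   finally show ?thesis by simp
  qed
  have sol: "EX u. adm u & (ALL s:{0..1}. u s = Ph w u s)" if w: "norm w <= om" for w
  proof -
   obtain u where "continuous_on {0..1} u" "!!s. s : {0..1} ==> norm (u s) <= 2 * om" "!!s. s : {0..1} ==> u s = Ph w u s"
   proof (rule interval_fixpoint[where M="2 * om" and c="1/2" and Ph="Ph w"])
    fix u :: "real => real^'n" assume "continuous_on {0..1} u" "!!s. s : {0..1} ==> norm (u s) <= 2 * om"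
    hence u: "adm u" by (simp add: adm_def)
    have "norm (Ph w u s) <= 2 * om" if s: "s : {0..1}" for s
    proof -
     have a: "norm (AA u s) <= 4 * C * om\<^sup>2" if "s : {0..1}" for s
      unfolding AA_def by (rule norm_integral_unit_le[OF cacc[OF u] that]) (rule acc_b[OF u])
     have "norm (integral {0..1} (AA u)) <= 4 * C * om\<^sup>2" by (rule norm_integral_unit_le[OF cAA[OF u]]) (use a in auto)
     moreover have "norm (Ph w u s) <= norm w + norm (AA u s) + norm (integral {0..1} (AA u))"
      unfolding Ph_def by (rule order_trans[OF norm_triangle_ineq add_right_mono[OF norm_triangle_ineq4]])
     ultimately show ?thesis using a[OF s] w small om by linarith
    qed
    moreover have "continuous_on {0..1} (Ph w u)" unfolding Ph_def by (intro continuous_intros cAA[OF u])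
    ultimately show "continuous_on {0..1} (Ph w u) & (ALL s:{0..1}. norm (Ph w u s) <= 2 * om)" by blast
   next
    fix u v :: "real => real^'n" and b s :: real
    assume uv: "continuous_on {0..1} u" "!!s. s : {0..1} ==> norm (u s) <= 2 * om" "continuous_on {0..1} v"
     "!!s. s : {0..1} ==> norm (v s) <= 2 * om" "!!s. s : {0..1} ==> norm (u s - v s) <= b" "s : {0..1}"
    hence "adm u" "adm v" by (auto simp: adm_def)
    from Phdiff[OF this uv(5,6), of w w] show "norm (Ph w u s - Ph w v s) <= 1 / 2 * b" by simp
   qed (use om in auto)
   thus ?thesis unfolding adm_def by blast
  qed
  have "ALL w. EX u. norm w <= om --> adm u & (ALL s:{0..1}. u s = Ph w u s)" using sol by blast
  then obtain u where "ALL w. norm w <= om --> adm (u w) & (ALL s:{0..1}. u w s = Ph w (u w) s)"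
   using choice[of "%w u. norm w <= om --> adm u & (ALL s:{0..1}. u s = Ph w u s)"] by blast
  hence u: "adm (u w)" "!!s. s : {0..1} ==> u w s = Ph w (u w) s" if "norm w <= om" for w using that by blast+
  have ulip: "norm (u w s - u w' s) <= 2 * norm (w - w')" if w: "norm w <= om" "norm w' <= om" and s: "s : {0..1}" for w w' s
  proof -
   have c: "continuous_on {0..1} (%s. norm (u w s - u w' s))" using u(1)[OF w(1)] u(1)[OF w(2)] by (auto simp: adm_def intro!: continuous_intros)
   obtain s0 where s0: "s0 : {0..1}" "!!s. s : {0..1} ==> norm (u w s - u w' s) <= norm (u w s0 - u w' s0)"
    using continuous_attains_sup[OF compact_Icc _ c] by auto
   have "norm (u w s0 - u w' s0) <= norm (w - w') + norm (u w s0 - u w' s0) / 2"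
    using Phdiff[OF u(1)[OF w(1)] u(1)[OF w(2)] s0(2) s0(1), of w w'] u(2)[OF w(1) s0(1)] u(2)[OF w(2) s0(1)] by simp
   thus ?thesis using s0(2)[OF s] by linarith
  qed
  \<comment> \<open>For w = 0 the solution is at rest; comparing with it through the Lipschitz bound
    yields |u| <= 2 |w|.\<close>
  have u0: "u 0 s = 0" if "s : {0..1}" for s
  proof -
   have a0: "adm (%s. 0)" using om by (simp add: adm_def)
   have "acc (%s. 0) = (%s. 0)" by (simp add: acc_def Gam_simps)
   hence "Ph 0 (%s. 0) = (%s. 0)" by (simp add: Ph_def AA_def)
   moreover have n0: "norm (0::real^'n) <= om" using om by simp
   have c: "continuous_on {0..1} (%s. norm (u 0 s - 0))" using u(1)[OF n0] by (auto simp: adm_def intro!: continuous_intros)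
   obtain s0 where s0: "s0 : {0..1}" "!!s. s : {0..1} ==> norm (u 0 s - 0) <= norm (u 0 s0 - 0)"
    using continuous_attains_sup[OF compact_Icc _ c] by auto
   have "norm (Ph 0 (u 0) s0 - Ph 0 (%s. 0) s0) <= norm (0 - 0 :: real^'n) + norm (u 0 s0 - 0) / 2" using s0 by (intro Phdiff u(1)[OF n0] a0) auto
   ultimately have "norm (u 0 s0) <= 0" using u(2)[OF n0 s0(1)] by simp
   thus ?thesis using s0(2)[OF that] by simp
  qed
  have unorm: "norm (u w s) <= 2 * norm w" if "norm w <= om" "s : {0..1}" for w s using ulip[OF that(1) _ that(2), of 0] u0[OF that(2)] om by simp
  have "geo z (path (u w)) (u w) w" if w: "norm w <= om" for w unfolding geo_def
  proof (intro conjI ballI allI)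
   show "path (u w) 0 = z" by (simp add: path_def)
   have i: "AA (u w) integrable_on {0..1}" by (intro integrable_continuous_real cAA u w)
   have "integral {0..1} (u w) = integral {0..1} (Ph w (u w))" by (rule integral_cong) (use u(2)[OF w] in auto)
   also have "... = w"
    using has_integral_add[OF has_integral_diff[OF has_integral_const_real[of w 0 1] integrable_integral[OF i]] has_integral_const_real[of "integral {0..1} (AA (u w))" 0 1]]
    by (intro integral_unique) (simp add: Ph_def)
   finally show "path (u w) 1 = z + w" by (simp add: path_def)
   fix ta :: real assume t: "ta : {0..1}"
   show "path (u w) ta : S" using pathK[OF u(1)[OF w] t] K by blast
   show "(path (u w) has_vector_derivative u w ta) (at ta within {0..1})" by (rule pathd[OF u(1)[OF w] t])
   have "(Ph w (u w) has_vector_derivative (0 - acc (u w) ta) + 0) (at ta within {0..1})"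
    unfolding Ph_def by (intro has_vector_derivative_add has_vector_derivative_diff has_vector_derivative_const AAd u w t)
   thus "(u w has_vector_derivative - Gam (path (u w) ta) (u w ta) (u w ta)) (at ta within {0..1})"
    using has_vector_derivative_transform[OF t u(2)[OF w]] by (simp add: acc_def)
   fix v :: "real^'n"
   have "norm (Gam (path (u w) ta) (u w ta) v) <= C * norm (u w ta) * norm v" by (rule C(2)[OF pathK[OF u(1)[OF w] t]])
   also have "... <= C * (2 * om) * norm v" using C u(1)[OF w] t by (intro mult_right_mono mult_left_mono) (auto simp: adm_def)
   also have "... <= (1 / 2) * norm v" using Com by (intro mult_right_mono) auto
   finally show "norm (Gam (path (u w) ta) (u w ta) v) <= norm v / 2" by simp
  qed
  moreover have "norm (path (u w) ta - path (u w') ta) <= 2 * norm (w - w')" if "norm w <= om" "norm w' <= om" "ta : {0..1}" for w w' ta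
   by (rule pd[OF u(1)[OF that(1)] u(1)[OF that(2)] ulip[OF that(1,2)] that(3)])
  ultimately show "EX ga u. (ALL w. norm w <= om --> geo z (ga w) (u w) w & (ALL ta:{0..1}. ga w ta : cball p R & norm (u w ta) <= 2 * norm w)) &
   (ALL w w'. norm w <= om --> norm w' <= om --> (ALL ta:{0..1}. norm (u w ta - u w' ta) <= 2 * norm (w - w') &
    norm (ga w ta - ga w' ta) <= 2 * norm (w - w')))" using ulip unorm pathK u(1) by (intro exI[of _ "%w. path (u w)"] exI[of _ u]) blast
 qed
qed

lemma geo_constant_speed:
 assumes "geo z ga u w" "ta : {0..1}" shows "ip (ga ta) (u ta) (u ta) = ip (ga 1) (u 1) (u 1)"
 by (rule parallel_ip_constant[where u=u]) (use assms in \<open>auto simp: geo_def\<close>)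

lemma geo_energy:
 assumes "geo z ga u w" shows "integral {0..1} (%ta. ip (ga ta) (u ta) (u ta)) = ip (ga 1) (u 1) (u 1)"
proof -
 have "integral {0..1} (%ta. ip (ga ta) (u ta) (u ta)) = integral {0..1} (%ta::real. ip (ga 1) (u 1) (u 1))"
  by (rule integral_cong) (rule geo_constant_speed[OF assms])
 thus ?thesis by simp
qed

text \<open>Two geodesics from z with nearby ends are variations of one another of size at most 2
  |v|. The first variation gives the linear term and the rest is quadratic in |v|, so the energy is
  differentiable although the geodesic is only known to depend on its end in a Lipschitz
  way.\<close>

lemma energy_has_derivative:
 assumes G: "!!w. norm w <= om ==> geo z (ga w) (u w) w"
  and lip: "!!w w' ta. norm w <= om ==> norm w' <= om ==> ta : {0..1} ==> norm (u w ta - u w' ta) <= 2 * norm (w - w') &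
    norm (ga w ta - ga w' ta) <= 2 * norm (w - w')"
  and w: "norm w < om"
 defines "e \<equiv> %w. ip (ga w 1) (u w 1) (u w 1)"
 shows "(e has_derivative (%v. 2 * ip (z + w) (u w 1) v)) (at w)"
proof -
 have g: "geo z (ga w) (u w) w" using G w by simp
 have gd: "ga w ta : S" "(ga w has_vector_derivative u w ta) (at ta within {0..1})"
  "(u w has_vector_derivative - Gam (ga w ta) (u w ta) (u w ta)) (at ta within {0..1})" if "ta : {0..1}" "norm w <= om" for ta w
  using G[OF that(2)] that by (auto simp: geo_def)
 have cg: "continuous_on {0..1} (ga w)" if "norm w <= om" for w by (rule vector_derivative_continuous_on) (rule gd(2)[OF _ that])
 have cu: "continuous_on {0..1} (u w)" if "norm w <= om" for w by (rule vector_derivative_continuous_on) (rule gd(3)[OF _ that])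
 have wl: "norm w <= om" using w by simp
 obtain R where R: "R > 0" "!!ta. ta : {0..1} ==> norm (u w ta) <= R"
  using compact_imp_bounded[OF compact_continuous_image[OF cu[OF wl] compact_Icc]] by (auto simp: bounded_pos)
 have cK: "compact (ga w ` {0..1})" "ga w ` {0..1} \<subseteq> S" using compact_continuous_image[OF cg[OF wl] compact_Icc] gd(1)[OF _ wl] by auto
 obtain dl where dl: "dl > 0" "!!y T x x'. y : ga w ` {0..1} ==> norm T <= R ==> norm x < dl ==> norm x' < dl ==> y + x : S &
  \<bar>ip (y + x) (T + x') (T + x') - ip y T T - (dG y x T T + 2 * ip y T x') - qb y T x x' x x'\<bar> <= 1 * ((norm x)^2 + (norm x')^2)"
  using energy_density_expansion[OF cK less_imp_le[OF R(1)] zero_less_one] by blast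
 obtain C where C: "C > 0" "!!y T x x'. y : ga w ` {0..1} ==> norm T <= R ==> \<bar>qb y T x x' x x'\<bar> <= C * ((norm x)^2 + (norm x')^2)"
  using qb_bound[OF cK less_imp_le[OF R(1)]] by blast
 have z1: "ga w 1 = z + w" using g by (simp add: geo_def)
 \<comment> \<open>The factor 8 is 2^2 + 2^2 from the Lipschitz bounds on path and velocity; 1 and C
   bound the remainder and the quadratic part of the energy density.\<close>
 have main: "\<bar>e (w + v) - e w - 2 * ip (z + w) (u w 1) v\<bar> <= 8 * (1 + C) * (norm v)^2" if v: "norm (w + v) <= om" "2 * norm v < dl" for v
 proof -
  let ?x = "%ta. ga (w + v) ta - ga w ta" and ?x' = "%ta. u (w + v) ta - u w ta"
  have nx: "norm (?x ta) <= 2 * norm v" "norm (?x' ta) <= 2 * norm v" if "ta : {0..1}" for ta using lip[OF v(1) wl that] by simp_all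
  have pt: "\<bar>ip (ga (w + v) ta) (u (w + v) ta) (u (w + v) ta) - ip (ga w ta) (u w ta) (u w ta) - (dG (ga w ta) (?x ta) (u w ta) (u w ta) + 2 * ip (ga w ta) (u w ta) (?x' ta))\<bar>
   <= 8 * (1 + C) * (norm v)^2" if t: "ta : {0..1}" for ta
  proof -
   have "(norm (?x ta))^2 + (norm (?x' ta))^2 <= (2 * norm v)^2 + (2 * norm v)^2" using nx[OF t] by (intro add_mono power_mono) auto
   hence b: "(norm (?x ta))^2 + (norm (?x' ta))^2 <= 8 * (norm v)^2" by (simp add: power_mult_distrib)
   have "C * ((norm (?x ta))^2 + (norm (?x' ta))^2) <= C * (8 * (norm v)^2)" using b C by (intro mult_left_mono) auto
   moreover have "8 * (1 + C) * (norm v)^2 = 8 * (norm v)^2 + C * (8 * (norm v)^2)" by (simp add: algebra_simps)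
   ultimately show ?thesis
    using dl(2)[OF imageI[OF t] R(2)[OF t], of "?x ta" "?x' ta"] C(2)[OF imageI[OF t] R(2)[OF t], of "?x ta" "?x' ta"] nx[OF t] v(2) b
    by (simp add: abs_le_iff)
  qed
  have xd: "(?x has_vector_derivative ?x' ta) (at ta within {0..1})" if "ta : {0..1}" for ta by (intro has_vector_derivative_diff gd that v wl)
  have i: "((%ta. ip (ga w ta) (u w ta) (u w ta)) has_integral e w) {0..1}" if "norm w <= om" for w
  proof -
   have "ga w ` {0..1} \<subseteq> S" using gd(1)[OF _ that] by auto
   hence "((%ta. ip (ga w ta) (u w ta) (u w ta)) has_integral integral {0..1} (%ta. ip (ga w ta) (u w ta) (u w ta))) {0..1}"
    by (intro integrable_integral integrable_continuous_real continuous_ip cg cu that)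
   thus ?thesis unfolding geo_energy[OF G[OF that]] e_def .
  qed
  have "((%ta. ip (ga (w + v) ta) (u (w + v) ta) (u (w + v) ta) - ip (ga w ta) (u w ta) (u w ta) - (dG (ga w ta) (?x ta) (u w ta) (u w ta) + 2 * ip (ga w ta) (u w ta) (?x' ta)))
   has_integral (e (w + v) - e w - 2 * (ip (ga w 1) (u w 1) (?x 1) - ip (ga w 0) (u w 0) (?x 0)))) {0..1}"
   by (intro has_integral_diff i v wl first_variation[OF gd(2,1,3) xd])
  from has_integral_bound[OF _ this[unfolded cbox_interval[symmetric]], of "8 * (1 + C) * (norm v)^2"]
  have "\<bar>e (w + v) - e w - 2 * (ip (ga w 1) (u w 1) (?x 1) - ip (ga w 0) (u w 0) (?x 0))\<bar> <= 8 * (1 + C) * (norm v)^2" using pt C by simp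
  moreover have x01: "?x 0 = 0" "?x 1 = v" using G[OF v(1)] g by (auto simp: geo_def)
  ultimately show ?thesis unfolding x01 by (simp add: ip_simps z1)
 qed
 show ?thesis unfolding has_derivative_at_alt
 proof (intro conjI allI impI)
  show "bounded_linear (%v. 2 * ip (z + w) (u w 1) v)"
   unfolding linear_conv_bounded_linear[symmetric] by (rule linearI) (simp_all add: ip_simps algebra_simps)
  fix eps :: real assume eps: "0 < eps"
  define d where "d = min (om - norm w) (min (dl / 2) (eps / (8 * (1 + C))))"
  have d: "d > 0" using w dl eps C by (simp add: d_def)
  show "EX d>0. ALL y. norm (y - w) < d --> norm (e y - e w - 2 * ip (z + w) (u w 1) (y - w)) <= eps * norm (y - w)"
  proof (intro exI[of _ d] conjI allI impI d)
   fix y assume y: "norm (y - w) < d"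
   have "norm y <= om" using y norm_triangle_ineq2[of y w] by (simp add: d_def)
   hence "\<bar>e (w + (y - w)) - e w - 2 * ip (z + w) (u w 1) (y - w)\<bar> <= 8 * (1 + C) * (norm (y - w))^2"
    using y by (intro main) (auto simp: d_def)
   also have "... = (8 * (1 + C) * norm (y - w)) * norm (y - w)" by (simp add: power2_eq_square)
   also have "... <= eps * norm (y - w)" using y C by (intro mult_right_mono) (auto simp: d_def field_simps)
   finally show "norm (e y - e w - 2 * ip (z + w) (u w 1) (y - w)) <= eps * norm (y - w)" by simp
  qed
 qed
qed

end

section \<open>Charts and lengths of curves\<close>

locale riem =
 fixes b :: "'n::finite" and A :: "('a::{t2_space,second_countable_topology}, 'n) chart set" and g :: "('a, 'n) tensor2"
 assumes mfd: "riemannian_manifold b A g"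
begin

lemma chart: assumes "c : A"
 shows "open (cdom c)" "homeomorphism (cdom c) (cimg c) (cmap c) (cinv c)"
  "open (cimg c) \<or> openin (top_of_set (half_space b)) (cimg c)"
 using mfd assms by (auto simp: riemannian_manifold_def smooth_atlas_def is_chart_def)

lemma chart_cover: "EX c:A. x : cdom c" using mfd unfolding riemannian_manifold_def smooth_atlas_def by blast

lemma cinv_cmap: "c : A ==> x : cdom c ==> cinv c (cmap c x) = x" using chart(2) by (auto simp: homeomorphism_def)

lemma cmap_cinv: "c : A ==> y : cimg c ==> cmap c (cinv c y) = y" using chart(2) by (auto simp: homeomorphism_def)

lemma cmap_in: "x : cdom c ==> cmap c x : cimg c" by (simp add: cimg_def)

lemma cinv_in: "c : A ==> y : cimg c ==> cinv c y : cdom c" using chart(2) by (auto simp: homeomorphism_def)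

lemma continuous_cmap: "c : A ==> continuous_on (cdom c) (cmap c)" using chart(2) by (auto simp: homeomorphism_def)

lemma continuous_cinv: "c : A ==> continuous_on (cimg c) (cinv c)" using chart(2) by (auto simp: homeomorphism_def)

lemma coord: assumes "c : A" shows "coord_metric (cimg c) (g c)"
proof
 show "thick (cimg c)" using chart(3)[OF assms] thick_open thick_openin_half_space by blast
 show "cimg c \<subseteq> closure (interior (cimg c))" using chart(3)[OF assms]
 proof
  assume "open (cimg c)" thus ?thesis using closure_subset by (metis interior_open)
 next
  assume "openin (top_of_set (half_space b)) (cimg c)"
  from closure_interior_openin[OF closure_interior_half_space this] show ?thesis .
 qed
 have rm: "riemannian_metric A g" using mfd by (simp add: riemannian_manifold_def)
 thus "smooth_on (cimg c) (g c)" using assms by (simp add: riemannian_metric_def)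
 show "transpose (g c y) = g c y" if "y : cimg c" for y using rm assms that by (simp add: riemannian_metric_def)
 show "0 < v \<bullet> (g c y *v v)" if "y : cimg c" "v ~= 0" for y v using rm assms that by (simp add: riemannian_metric_def)
qed

lemma overlap_eq: assumes "c : A" shows "overlap c d = {y : cimg c. cinv c y : cdom d}"
 using cinv_cmap[OF assms] cmap_cinv[OF assms] cinv_in[OF assms] cmap_in by (force simp: overlap_def)

lemma overlap_openin: assumes "c : A" "d : A" shows "openin (top_of_set (cimg c)) (overlap c d)"
proof -
 have "overlap c d = cimg c \<inter> cinv c -` cdom d" using overlap_eq[OF assms(1)] by auto
 thus ?thesis using continuous_openin_preimage_gen[OF continuous_cinv[OF assms(1)] chart(1)[OF assms(2)]] by simp
qed

lemma transition_derivative: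
 assumes "c : A" "d : A" "y : overlap c d" shows "(transition c d has_derivative (%v. jacobian_cd c d y *v v)) (at y within cimg c)"
  "smooth_on (overlap c d) (transition c d)"
proof -
 show sm: "smooth_on (overlap c d) (transition c d)" using mfd assms by (simp add: riemannian_manifold_def smooth_atlas_def)
 let ?D = "frechet_derivative (transition c d) (at y within overlap c d)"
 have D: "(transition c d has_derivative ?D) (at y within overlap c d)" using smooth_on_deriv[OF sm assms(3)] by (simp add: dd_def)
 have "(%v. jacobian_cd c d y *v v) = ?D" using matrix_works[of ?D] has_derivative_linear[OF D] by (auto simp: jacobian_cd_def)
 thus "(transition c d has_derivative (%v. jacobian_cd c d y *v v)) (at y within cimg c)"
  using D unfolding dd_openin(2)[OF overlap_openin[OF assms(1,2)] assms(3)] by (simp only:)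
qed

lemma metric_transform:
 assumes "c : A" "d : A" "y : overlap c d"
 shows "u \<bullet> (g c y *v v) = (jacobian_cd c d y *v u) \<bullet> (g d (transition c d y) *v (jacobian_cd c d y *v v))"
proof -
 have "g c y = transpose (jacobian_cd c d y) ** g d (transition c d y) ** jacobian_cd c d y"
  using mfd assms by (simp add: riemannian_manifold_def riemannian_metric_def)
 hence "u \<bullet> (g c y *v v) = u \<bullet> (transpose (jacobian_cd c d y) *v (g d (transition c d y) *v (jacobian_cd c d y *v v)))"
  by (simp add: matrix_vector_mul_assoc matrix_mul_assoc)
 also have "... = (jacobian_cd c d y *v u) \<bullet> (g d (transition c d y) *v (jacobian_cd c d y *v v))"
  by (metis dot_lmul_matrix vector_transpose_matrix)
 finally show ?thesis .
qed

lemma transition_cmap: "c : A ==> x : cdom c ==> transition c d (cmap c x) = cmap d x" by (simp add: transition_def cinv_cmap)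

lemma cmap_overlap: "x : cdom c ==> x : cdom d ==> cmap c x : overlap c d" by (auto simp: overlap_def)

end

locale riem_open = riem b A g for b :: "'n::finite" and A :: "('a::{t2_space,second_countable_topology}, 'n) chart set" and g +
 assumes no_boundary: "mfd_boundary A = {}"
begin

lemma open_cimg: assumes "c : A" shows "open (cimg c)"
proof -
 have "y : interior (cimg c)" if "y : cimg c" for y
 proof -
  have "cinv c y ~: mfd_boundary A" using no_boundary by simp
  thus ?thesis using assms cinv_in[OF assms that] cmap_cinv[OF assms that] by (auto simp: mfd_boundary_def charts_at_def)
 qed
 thus ?thesis by (metis interior_subset open_interior subsetI subset_antisym)
qed

lemma coord_open: "c : A ==> coord_metric_open (cimg c) (g c)" using coord open_cimg by (simp add: coord_metric_open_def coord_metric_open_axioms_def)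

lemma transition_derivative_at:
 assumes "c : A" "d : A" "y : overlap c d" shows "(transition c d has_derivative (%v. jacobian_cd c d y *v v)) (at y)"
 using transition_derivative(1)[OF assms] at_within_open[OF _ open_cimg[OF assms(1)]] overlap_eq[OF assms(1)] assms(3) by auto

text \<open>Local version of the regularity required in \<open>piecewise_C1_curve\<close>.\<close>

definition reg :: "(real => 'a) => real => bool" where
 "reg ga s \<longleftrightarrow> (ALL c:A. ga s : cdom c --> (EX N. open N & s : N & (cmap c \<circ> ga) C1_differentiable_on N))"

lemma open_preimage:
 fixes ga :: "real => 'a"
 assumes "continuous_on {0..1} ga" "open U" shows "open {s : {0<..<1}. ga s : U}"
proof -
 have "continuous_on {0<..<1} ga" by (rule continuous_on_subset[OF assms(1)]) auto
 from continuous_open_preimage[OF this open_greaterThanLessThan assms(2)]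
 show ?thesis by (simp add: vimage_def Int_def)
qed

lemma C1_local:
 assumes "!!s. s : T ==> EX N. open N & s : N & f C1_differentiable_on N" shows "f C1_differentiable_on T" unfolding C1_differentiable_on_eq
proof
 show "ALL x:T. f differentiable at x" using assms unfolding C1_differentiable_on_eq by blast
 show "continuous_on T (%x. vector_derivative f (at x))" unfolding continuous_on_eq_continuous_within
 proof
  fix s assume "s : T"
  then obtain N where N: "open N" "s : N" "continuous_on N (%x. vector_derivative f (at x))" using assms unfolding C1_differentiable_on_eq by blast
  hence "continuous (at s) (%x. vector_derivative f (at x))" using continuous_on_eq_continuous_at by blast
  thus "continuous (at s within T) (%x. vector_derivative f (at x))" using continuous_at_imp_continuous_at_within by blast
 qed
qed

text \<open>The parameters outside \<open>F\<close> whose image lies in a given chart domain form an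
  open set, so regularity on that set is regularity near each of its points. The pointwise form is
  stable under reparametrisation and concatenation.\<close>

lemma piecewise_iff:
 "piecewise_C1_curve A ga \<longleftrightarrow> continuous_on {0..1} ga & (EX F. finite F & (ALL s:{0<..<1} - F. reg ga s))"
proof
 assume p: "piecewise_C1_curve A ga"
 then obtain F where F: "finite F" "continuous_on {0..1} ga"
  "ALL c:A. (cmap c \<circ> ga) C1_differentiable_on {s. s : {0<..<1} - F & ga s : cdom c}" by (auto simp: piecewise_C1_curve_def)
 have "reg ga s" if s: "s : {0<..<1} - F" for s unfolding reg_def
 proof (intro ballI impI)
  fix c assume c: "c : A" "ga s : cdom c"
  have "open ({s : {0<..<1}. ga s : cdom c} - F)" by (intro open_Diff open_preimage F chart(1) c finite_imp_closed)
  moreover have "{s : {0<..<1}. ga s : cdom c} - F = {s. s : {0<..<1} - F & ga s : cdom c}" by auto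
  ultimately show "EX N. open N & s : N & (cmap c \<circ> ga) C1_differentiable_on N"
   using F(3) c s by (intro exI[of _ "{s. s : {0<..<1} - F & ga s : cdom c}"]) auto
 qed
 thus "continuous_on {0..1} ga & (EX F. finite F & (ALL s:{0<..<1} - F. reg ga s))" using F by blast
next
 assume "continuous_on {0..1} ga & (EX F. finite F & (ALL s:{0<..<1} - F. reg ga s))"
 then obtain F where F: "finite F" "continuous_on {0..1} ga" "!!s. s : {0<..<1} - F ==> reg ga s" by blast
 have "ALL c:A. (cmap c \<circ> ga) C1_differentiable_on {s. s : {0<..<1} - F & ga s : cdom c}" using F(3) by (auto intro!: C1_local simp: reg_def)
 thus "piecewise_C1_curve A ga" unfolding piecewise_C1_curve_def using F by blast
qed

lemma reg_cong:
 assumes "reg ga s" "open N" "s : N" "!!t. t : N ==> ga t = ga' t" shows "reg ga' s" unfolding reg_def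
proof (intro ballI impI)
 fix c assume c: "c : A" "ga' s : cdom c"
 then obtain M where M: "open M" "s : M" "(cmap c \<circ> ga) C1_differentiable_on M" using assms unfolding reg_def by metis
 then obtain D where D: "!!x. x : M ==> ((cmap c \<circ> ga) has_vector_derivative D x) (at x)" "continuous_on M D"
  unfolding C1_differentiable_on_def by blast
 have "((cmap c \<circ> ga') has_vector_derivative D x) (at x)" if "x : M \<inter> N" for x
  by (rule has_vector_derivative_transform_within_open[OF D(1) assms(2)]) (use that assms(4) in auto)
 hence "(cmap c \<circ> ga') C1_differentiable_on (M \<inter> N)"
  unfolding C1_differentiable_on_def by (intro exI[of _ D] conjI ballI) (auto intro: continuous_on_subset[OF D(2)])
 thus "EX N. open N & s : N & (cmap c \<circ> ga') C1_differentiable_on N" using M assms by (intro exI[of _ "M \<inter> N"]) auto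
qed

lemma reg_affine:
 assumes "reg ga (aa + be * s)" shows "reg (%s. ga (aa + be * s)) s" unfolding reg_def
proof (intro ballI impI)
 fix c assume "c : A" "ga (aa + be * s) : cdom c"
 then obtain M where M: "open M" "aa + be * s : M" "(cmap c \<circ> ga) C1_differentiable_on M" using assms unfolding reg_def by metis
 then obtain D where D: "!!x. x : M ==> ((cmap c \<circ> ga) has_vector_derivative D x) (at x)" "continuous_on M D"
  unfolding C1_differentiable_on_def by blast
 define N where "N = (%s. aa + be * s) -` M"
 have oN: "open N" unfolding N_def by (intro open_vimage M continuous_intros)
 have "((cmap c \<circ> (%s. ga (aa + be * s))) has_vector_derivative be *\<^sub>R D (aa + be * x)) (at x)" if "x : N" for x
 proof -
  have "((%s. aa + be * s) has_vector_derivative be) (at x)"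
   by (auto intro!: derivative_eq_intros simp: has_real_derivative_iff_has_vector_derivative[symmetric])
  from vector_diff_chain_at[OF this D(1)] that show ?thesis by (simp add: N_def o_def)
 qed
 moreover have "continuous_on N (%x. be *\<^sub>R D (aa + be * x))" by (intro continuous_intros continuous_on_compose2[OF D(2)]) (auto simp: N_def)
 ultimately have "(cmap c \<circ> (%s. ga (aa + be * s))) C1_differentiable_on N"
  unfolding C1_differentiable_on_def by (intro exI[of _ "%x. be *\<^sub>R D (aa + be * x)"] conjI ballI)
 thus "EX N. open N & s : N & (cmap c \<circ> (%s. ga (aa + be * s))) C1_differentiable_on N" using oN M by (intro exI[of _ N]) (auto simp: N_def)
qed

text \<open>The Jacobian maps the velocity in one chart to that in another and the metric transforms
  accordingly, so the chart picked by \<open>SOME\<close> may be replaced by any convenient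
  one.\<close>

lemma speed_eq:
 assumes c: "c : A" "ga s : cdom c" and v: "((cmap c \<circ> ga) has_vector_derivative v) (at s)" and cont: "continuous_on {0..1} ga" "s : {0<..<1}"
 shows "speed A g ga s = sqrt (v \<bullet> (g c (cmap c (ga s)) *v v))"
proof -
 define d where "d = (SOME c. c : charts_at A (ga s))"
 have "c : charts_at A (ga s)" using c by (simp add: charts_at_def)
 hence "d : charts_at A (ga s)" unfolding d_def by (rule someI)
 hence d: "d : A" "ga s : cdom d" by (auto simp: charts_at_def)
 let ?y = "cmap c (ga s)" and ?N = "{s : {0<..<1}. ga s : cdom c}"
 have y: "?y : overlap c d" by (rule cmap_overlap[OF c(2) d(2)])
 have "((%t. transition c d ((cmap c \<circ> ga) t)) has_derivative (%h. jacobian_cd c d ?y *v (h *\<^sub>R v))) (at s)"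
  by (rule has_derivative_compose[OF v[unfolded has_vector_derivative_def]]) (use transition_derivative_at[OF c(1) d(1) y] in simp)
 hence "((%t. transition c d ((cmap c \<circ> ga) t)) has_vector_derivative (jacobian_cd c d ?y *v v)) (at s)"
  by (simp add: has_vector_derivative_def matrix_vector_mult_scaleR)
 hence "((cmap d \<circ> ga) has_vector_derivative (jacobian_cd c d ?y *v v)) (at s)"
  by (rule has_vector_derivative_transform_within_open[OF _ open_preimage[OF cont(1) chart(1)[OF c(1)]]]) (use c cont transition_cmap in auto)
 hence "vector_derivative (cmap d \<circ> ga) (at s) = jacobian_cd c d ?y *v v" by (rule vector_derivative_at)
 thus ?thesis unfolding speed_def d_def[symmetric] Let_def metric_transform[OF c(1) d(1) y] by (simp add: transition_cmap[OF c])
qed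

lemma continuous_metric:
 assumes "c : A" "continuous_on T sg" "sg ` T \<subseteq> cimg c" "continuous_on T P" "continuous_on T Q"
 shows "continuous_on T (%s. P s \<bullet> (g c (sg s) *v Q s))" using coord_metric_open.continuous_ip[OF coord_open[OF assms(1)] assms(2-5)]
 by (simp add: coord_metric.ip_def[OF coord[OF assms(1)]])

lemma speed_continuous:
 assumes r: "reg ga s" and cont: "continuous_on {0..1} ga" "s : {0<..<1}" shows "isCont (speed A g ga) s"
proof -
 obtain c where c: "c : A" "ga s : cdom c" using chart_cover by blast
 obtain N where N: "open N" "s : N" "(cmap c \<circ> ga) C1_differentiable_on N" using r c by (auto simp: reg_def)
 then obtain D where D: "!!x. x : N ==> ((cmap c \<circ> ga) has_vector_derivative D x) (at x)" "continuous_on N D"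
  unfolding C1_differentiable_on_def by blast
 define M where "M = N \<inter> {s : {0<..<1}. ga s : cdom c}"
 have M: "open M" "s : M" unfolding M_def using open_Int[OF N(1) open_preimage[OF cont(1) chart(1)[OF c(1)]]] N c cont by auto
 have "continuous_on M (%s. D s \<bullet> (g c ((cmap c \<circ> ga) s) *v D s))"
 proof (rule continuous_metric[OF c(1)])
  show cD: "continuous_on M D" by (rule continuous_on_subset[OF D(2)]) (simp add: M_def)
  show "continuous_on M D" by (rule cD)
  show "continuous_on M (cmap c \<circ> ga)"
   by (intro continuous_at_imp_continuous_on ballI has_vector_derivative_continuous[OF D(1)]) (simp add: M_def)
  show "(cmap c \<circ> ga) ` M \<subseteq> cimg c" using cmap_in by (auto simp: M_def)
 qed
 hence "continuous_on M (%s. sqrt (D s \<bullet> (g c ((cmap c \<circ> ga) s) *v D s)))" by (rule continuous_on_real_sqrt)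
 hence "continuous_on M (speed A g ga)"
 proof (rule continuous_on_eq)
  show "sqrt (D x \<bullet> (g c ((cmap c \<circ> ga) x) *v D x)) = speed A g ga x" if "x : M" for x
   using that speed_eq[OF c(1) _ D(1) cont(1), of x] by (simp add: M_def)
 qed
 thus ?thesis using M continuous_on_eq_continuous_at by blast
qed

text \<open>The speed is continuous off the finite exceptional set, while its values on that set are
  arbitrary. Restricting to the complement gives measurability, and the removed points form a null
  set.\<close>

lemma length_on:
 assumes cont: "continuous_on {0..1} ga" and F: "finite F" "!!s. s : {0<..<1} - F ==> reg ga s"
 shows "(%s. ennreal (speed A g ga s) * indicator ({0<..<1} - F) s) : borel_measurable borel"
  "curve_length A g ga = (\<integral>\<^sup>+ s. ennreal (speed A g ga s) * indicator ({0<..<1} - F) s \<partial>lborel)"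
proof -
 have op: "open ({0<..<1} - F)" by (intro open_Diff open_greaterThanLessThan finite_imp_closed F)
 have "continuous_on ({0<..<1} - F) (%s. speed A g ga s)" using speed_continuous[OF F(2) cont] by (intro continuous_at_imp_continuous_on) auto
 hence "(%s. indicator ({0<..<1} - F) s *\<^sub>R speed A g ga s) : borel_measurable borel"
  by (intro borel_measurable_continuous_on_indicator) (use op in auto)
 hence "(%s. ennreal (indicator ({0<..<1} - F) s *\<^sub>R speed A g ga s)) : borel_measurable borel" by simp
 moreover have "(%s. ennreal (indicator ({0<..<1} - F) s *\<^sub>R speed A g ga s)) = (%s. ennreal (speed A g ga s) * indicator ({0<..<1} - F) s)"
  by (auto simp: indicator_def)
 ultimately show "(%s. ennreal (speed A g ga s) * indicator ({0<..<1} - F) s) : borel_measurable borel" by simp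
 have null: "insert 0 (insert 1 F) : null_sets lborel" using F(1) by (intro finite_imp_null_set_lborel) simp
 show "curve_length A g ga = (\<integral>\<^sup>+ s. ennreal (speed A g ga s) * indicator ({0<..<1} - F) s \<partial>lborel)"
  unfolding curve_length_def by (rule nn_integral_cong_AE) (use AE_not_in[OF null] in \<open>eventually_elim, auto simp: indicator_def\<close>)
qed

text \<open>Substitution in the length integral. Allowing negative \<open>be\<close> treats subarcs
  and reversal together, with \<open>min\<close> and \<open>max\<close> ordering the end
  points.\<close>

lemma affine_curve:
 assumes cont: "continuous_on {0..1} ga" and F: "finite F" "!!s. s : {0<..<1} - F ==> reg ga s"
  and ab: "be ~= 0" "0 <= aa" "aa <= 1" "0 <= aa + be" "aa + be <= 1" shows "piecewise_C1_curve A (%s. ga (aa + be * s))"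
  "curve_length A g (%s. ga (aa + be * s)) = (\<integral>\<^sup>+ s. ennreal (speed A g ga s) * indicator ({0<..<1} - F) s * indicator {min aa (aa+be)<..<max aa (aa+be)} s \<partial>lborel)"
proof -
 let ?h = "%s. aa + be * s" and ?sg = "%s. ga (aa + be * s)"
 have closed: "?h s : {0..1}" if "s : {0..1}" for s
 proof -
  have "?h s = (1 - s) * aa + s * (aa + be)" by (simp add: algebra_simps)
  moreover have "0 <= (1 - s) * aa" "(1 - s) * aa <= (1 - s) * 1" by (intro mult_nonneg_nonneg mult_left_mono; use that ab in simp)+
  moreover have "0 <= s * (aa + be)" "s * (aa + be) <= s * 1" by (intro mult_nonneg_nonneg mult_left_mono; use that ab in simp)+
  ultimately show ?thesis unfolding atLeastAtMost_iff mult_1_right by (intro conjI; linarith)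
 qed
 have between: "?h s : {min aa (aa+be)<..<max aa (aa+be)} \<longleftrightarrow> s : {0<..<1}" for s
 proof (cases "be > 0")
  case True
  hence "0 < be * s \<longleftrightarrow> 0 < s" "be * s < be \<longleftrightarrow> s < 1"
   using mult_less_cancel_left_pos[OF True, of s 1] by (simp_all add: zero_less_mult_iff)
  thus ?thesis using True by (simp add: min_def max_def)
 next
  case False
  hence b: "be < 0" using ab by simp
  hence "be * s < 0 \<longleftrightarrow> 0 < s" "be < be * s \<longleftrightarrow> s < 1" using mult_less_cancel_left_neg[OF b, of 1 s] by (auto simp: mult_less_0_iff)
  thus ?thesis using b by (simp add: min_def max_def) blast
 qed
 have sub: "{min aa (aa+be)<..<max aa (aa+be)} \<subseteq> {0<..<1}" using ab by auto
 define F' where "F' = ?h -` F"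
 have F': "finite F'" unfolding F'_def using F(1) ab(1) by (intro finite_vimageI) (auto simp: inj_on_def)
 have cont': "continuous_on {0..1} ?sg" by (rule continuous_on_compose2[OF cont]) (use closed in \<open>auto intro!: continuous_intros\<close>)
 have op: "?h s : {0<..<1} - F" if "s : {0<..<1} - F'" for s using between[of s] sub that by (auto simp: F'_def)
 have reg': "reg ?sg s" if "s : {0<..<1} - F'" for s by (rule reg_affine[OF F(2)[OF op[OF that]]])
 show "piecewise_C1_curve A ?sg" unfolding piecewise_iff using cont' F' reg' by blast
 have sp: "speed A g ?sg s = \<bar>be\<bar> * speed A g ga (?h s)" if s: "s : {0<..<1} - F'" for s
 proof -
  obtain c where c: "c : A" "ga (?h s) : cdom c" using chart_cover by blast
  obtain N where N: "open N" "?h s : N" "(cmap c \<circ> ga) C1_differentiable_on N" using F(2)[OF op[OF s]] c by (auto simp: reg_def)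
  then obtain D where D: "((cmap c \<circ> ga) has_vector_derivative D) (at (?h s))" unfolding C1_differentiable_on_def by blast
  have "(?h has_vector_derivative be) (at s)" by (auto intro!: derivative_eq_intros simp: has_real_derivative_iff_has_vector_derivative[symmetric])
  from vector_diff_chain_at[OF this D]
  have D': "((cmap c \<circ> ?sg) has_vector_derivative be *\<^sub>R D) (at s)" by (simp add: o_def)
  have s1: "s : {0<..<1}" "?h s : {0<..<1}" using s op[OF s] by auto
  have "speed A g ?sg s = sqrt (be\<^sup>2 * (D \<bullet> (g c (cmap c (ga (?h s))) *v D)))" unfolding speed_eq[where ga="?sg", OF c D' cont' s1(1)]
   by (simp add: matrix_vector_mult_scaleR power2_eq_square mult.assoc)
  thus ?thesis unfolding speed_eq[OF c D cont s1(2)] by (simp add: real_sqrt_mult)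
 qed
 let ?f = "%s. ennreal (speed A g ga s) * indicator ({0<..<1} - F) s * indicator {min aa (aa+be)<..<max aa (aa+be)} s"
 have meas: "?f : borel_measurable borel" using length_on(1)[OF cont F] by measurable
 have "curve_length A g ?sg = (\<integral>\<^sup>+ s. ennreal (speed A g ?sg s) * indicator ({0<..<1} - F') s \<partial>lborel)"
  by (rule length_on(2)[OF cont' F' reg'])
 also have "... = (\<integral>\<^sup>+ s. ennreal \<bar>be\<bar> * ?f (?h s) \<partial>lborel)"
 proof (rule nn_integral_cong)
  fix s :: real
  show "ennreal (speed A g ?sg s) * indicator ({0<..<1} - F') s = ennreal \<bar>be\<bar> * ?f (?h s)"
  proof (cases "s : {0<..<1} - F'")
   case True
   thus ?thesis using op[OF True] between[of s] by (simp add: sp[OF True] ennreal_mult')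
  next
   case False
   hence "?f (?h s) = 0" using between[of s] by (auto simp: F'_def indicator_def)
   thus ?thesis using False by simp
  qed
 qed
 also have "... = ennreal \<bar>be\<bar> * (\<integral>\<^sup>+ s. ?f (?h s) \<partial>lborel)" by (intro nn_integral_cmult) (use meas in measurable)
 also have "... = (\<integral>\<^sup>+ s. ?f s \<partial>lborel)" using nn_integral_real_affine[OF meas ab(1), of aa] by simp
 finally show "curve_length A g ?sg = (\<integral>\<^sup>+ s. ?f s \<partial>lborel)" .
qed

lemma split_curve:
 assumes p: "piecewise_C1_curve A ga" and s: "s : {0<..<1}"
 shows "piecewise_C1_curve A (%t. ga (s * t))" "piecewise_C1_curve A (%t. ga (s + (1 - s) * t))"
  "curve_length A g ga = curve_length A g (%t. ga (s * t)) + curve_length A g (%t. ga (s + (1 - s) * t))"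
proof -
 obtain F0 where F0: "finite F0" "continuous_on {0..1} ga" "!!t. t : {0<..<1} - F0 ==> reg ga t" using p unfolding piecewise_iff by blast
 define F where "F = insert s F0"
 have F: "finite F" "!!t. t : {0<..<1} - F ==> reg ga t" using F0 by (auto simp: F_def)
 note a1 = affine_curve[OF F0(2) F, of s 0] and a2 = affine_curve[OF F0(2) F, of "1 - s" s]
 show "piecewise_C1_curve A (%t. ga (s * t))" using a1(1) s by simp
 show "piecewise_C1_curve A (%t. ga (s + (1 - s) * t))" using a2(1) s by simp
 let ?f = "%s. ennreal (speed A g ga s) * indicator ({0<..<1} - F) s"
 have meas: "?f : borel_measurable borel" by (rule length_on(1)[OF F0(2) F])
 have m1: "(%t. ?f t * indicator {0<..<s} t) : borel_measurable borel" using meas by measurable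
 have m2: "(%t. ?f t * indicator {s<..<1} t) : borel_measurable borel" using meas by measurable
 have "curve_length A g ga = (\<integral>\<^sup>+ t. ?f t \<partial>lborel)" by (rule length_on(2)[OF F0(2) F])
 also have "... = (\<integral>\<^sup>+ t. ?f t * indicator {0<..<s} t + ?f t * indicator {s<..<1} t \<partial>lborel)"
  by (rule nn_integral_cong) (use s in \<open>auto simp: indicator_def F_def\<close>)
 also have "... = (\<integral>\<^sup>+ t. ?f t * indicator {0<..<s} t \<partial>lborel) + (\<integral>\<^sup>+ t. ?f t * indicator {s<..<1} t \<partial>lborel)"
  using m1 m2 by (intro nn_integral_add) auto
 finally show "curve_length A g ga = curve_length A g (%t. ga (s * t)) + curve_length A g (%t. ga (s + (1 - s) * t))"
  using a1(2) a2(2) s by (simp add: min_def max_def)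
qed

lemma reverse_curve:
 assumes p: "piecewise_C1_curve A ga" shows "piecewise_C1_curve A (%t. ga (1 - t))" "curve_length A g (%t. ga (1 - t)) = curve_length A g ga"
proof -
 obtain F where F: "finite F" "continuous_on {0..1} ga" "!!t. t : {0<..<1} - F ==> reg ga t" using p unfolding piecewise_iff by blast
 note a = affine_curve[OF F(2,1,3), of "-1" 1]
 show "piecewise_C1_curve A (%t. ga (1 - t))" using a(1) by simp
 have "curve_length A g (%t. ga (1 - t)) = (\<integral>\<^sup>+ s. ennreal (speed A g ga s) * indicator ({0<..<1} - F) s * indicator {0<..<1} s \<partial>lborel)"
  using a(2) by (simp add: min_def max_def)
 also have "... = (\<integral>\<^sup>+ s. ennreal (speed A g ga s) * indicator ({0<..<1} - F) s \<partial>lborel)"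
  by (rule nn_integral_cong) (auto simp: indicator_def)
 finally show "curve_length A g (%t. ga (1 - t)) = curve_length A g ga" using length_on(2)[OF F(2,1,3)] by simp
qed

text \<open>The length is found by splitting the concatenation again at 1/2 and recognising the two
  halves.\<close>

lemma join_curve:
 assumes p: "piecewise_C1_curve A ga1" "piecewise_C1_curve A ga2" and e: "ga1 1 = ga2 0"
 shows "piecewise_C1_curve A (ga1 +++ ga2)" "curve_length A g (ga1 +++ ga2) = curve_length A g ga1 + curve_length A g ga2"
proof -
 let ?ga = "ga1 +++ ga2"
 obtain F1 where F1: "finite F1" "continuous_on {0..1} ga1" "!!t. t : {0<..<1} - F1 ==> reg ga1 t" using p(1) unfolding piecewise_iff by blast
 obtain F2 where F2: "finite F2" "continuous_on {0..1} ga2" "!!t. t : {0<..<1} - F2 ==> reg ga2 t" using p(2) unfolding piecewise_iff by blast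
 have cont: "continuous_on {0..1} ?ga" using path_join_imp[of ga1 ga2] F1(2) F2(2) e by (simp add: path_def pathfinish_def pathstart_def)
 define F where "F = insert (1/2) ((%s. 0 + 2 * s) -` F1 \<union> (%s. -1 + 2 * s) -` F2)"
 have finF: "finite F" unfolding F_def using F1(1) F2(1) by (intro finite.insertI finite_UnI finite_vimageI) (auto simp: inj_on_def)
 have "reg ?ga s" if s: "s : {0<..<1} - F" for s
 proof (cases "s < 1/2")
  case True
  have "reg ga1 (0 + 2 * s)" using s True by (intro F1(3)) (auto simp: F_def)
  from reg_affine[OF this] show ?thesis by (rule reg_cong[where N="{..<1/2}"]) (use True in \<open>auto simp: joinpaths_def\<close>)
 next
  case False
  hence h: "s > 1/2" using s by (auto simp: F_def)
  have "reg ga2 (-1 + 2 * s)" using s h by (intro F2(3)) (auto simp: F_def)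
  from reg_affine[OF this] show ?thesis by (rule reg_cong[where N="{1/2<..}"]) (use h in \<open>auto simp: joinpaths_def algebra_simps\<close>)
 qed
 thus pw: "piecewise_C1_curve A ?ga" unfolding piecewise_iff using cont finF by blast
 have s: "(1/2::real) : {0<..<1}" by simp
 \<comment> \<open>The reparametrised halves agree with the given curves only on the closed unit
   interval; that is enough, because the speeds then agree at the regular parameters of its
   interior.\<close>
 have cong: "curve_length A g sg = curve_length A g ta" if pc: "piecewise_C1_curve A sg" "piecewise_C1_curve A ta" and st: "!!t. t : {0..1} ==> sg t = ta t" for sg ta
 proof -
  obtain H where H: "finite H" "continuous_on {0..1} sg" "!!t. t : {0<..<1} - H ==> reg sg t" using pc(1) unfolding piecewise_iff by blast
  have ct: "continuous_on {0..1} ta" using pc(2) by (simp add: piecewise_C1_curve_def)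
  have rt: "reg ta t" if t: "t : {0<..<1} - H" for t by (rule reg_cong[OF H(3)[OF t], of "{0<..<1}"]) (use t st in auto)
  have "speed A g sg t = speed A g ta t" if t: "t : {0<..<1} - H" for t
  proof -
   obtain c where c: "c : A" "sg t : cdom c" using chart_cover by blast
   obtain N D where N: "open N" "t : N" "((cmap c \<circ> sg) has_vector_derivative D) (at t)"
    using H(3)[OF t] c unfolding reg_def C1_differentiable_on_def by blast
   have "((cmap c \<circ> ta) has_vector_derivative D) (at t)"
    by (rule has_vector_derivative_transform_within_open[OF N(3) open_greaterThanLessThan[of 0 1]]) (use t st in auto)
   moreover have "ta t = sg t" using t st[of t] by auto
   ultimately show ?thesis using speed_eq[OF c N(3) H(2)] speed_eq[of c ta t D] c ct t by simp
  qed
  hence "(\<integral>\<^sup>+ s. ennreal (speed A g sg s) * indicator ({0<..<1} - H) s \<partial>lborel)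
   = (\<integral>\<^sup>+ s. ennreal (speed A g ta s) * indicator ({0<..<1} - H) s \<partial>lborel)"
   by (intro nn_integral_cong) (simp add: indicator_def)
  thus ?thesis by (simp only: length_on(2)[OF H(2,1,3)] length_on(2)[OF ct H(1) rt])
 qed
 have "curve_length A g (%t. ?ga (1/2 * t)) = curve_length A g ga1" by (rule cong[OF split_curve(1)[OF pw s] p(1)]) (auto simp: joinpaths_def)
 moreover have "curve_length A g (%t. ?ga (1/2 + (1 - 1/2) * t)) = curve_length A g ga2"
  by (rule cong[OF split_curve(2)[OF pw s] p(2)]) (use e in \<open>auto simp: joinpaths_def\<close>)
 ultimately show "curve_length A g ?ga = curve_length A g ga1 + curve_length A g ga2" using split_curve(3)[OF pw s] by simp
qed

end

context riem
begin

lemma thick_overlap: "c : A ==> d : A ==> thick (overlap c d)" using thick_openin[OF _ overlap_openin] coord by (simp add: coord_metric_def)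

lemma jacobian_dd:
 assumes "c : A" "d : A" "y : overlap c d" shows "jacobian_cd c d y *v v = dd (overlap c d) v (transition c d) y"
 by (rule dd_eq[OF thick_overlap[OF assms(1,2)] assms(3), symmetric])
  (rule transition_derivative(1)[OF assms, folded dd_openin(2)[OF overlap_openin[OF assms(1,2)] assms(3)]])

lemma continuous_jacobian:
 assumes c: "c : A" "d : A" and sg: "continuous_on T sg" "sg ` T \<subseteq> overlap c d" and v: "continuous_on T v"
 shows "continuous_on T (%s. jacobian_cd c d (sg s) *v v s)"
proof -
 have ci: "continuous_on T (%s. jacobian_cd c d (sg s) *v axis i 1)" for i
 proof (cases "T = {}")
  case False
  hence sm: "smooth_on (overlap c d) (transition c d)" using transition_derivative(2)[OF c] sg(2) by blast
  have "continuous_on T (%s. dd (overlap c d) (axis i 1) (transition c d) (sg s))"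
   by (rule continuous_on_compose2[OF Ck_on_continuous[OF smooth_onD[OF smooth_on_dd[OF thick_overlap[OF c] sm], of 0]] sg])
  thus ?thesis by (rule continuous_on_eq) (use jacobian_dd[OF c] sg(2) in auto)
 qed simp
 have "continuous_on T (%s. SUM i:UNIV. v s $ i *\<^sub>R (jacobian_cd c d (sg s) *v axis i 1))" by (intro continuous_intros v ci)
 moreover have "jacobian_cd c d (sg s) *v v s = (SUM i:UNIV. v s $ i *\<^sub>R (jacobian_cd c d (sg s) *v axis i 1))" for s
  by (rule linear_basis_expansion) (rule matrix_vector_mul_linear)
 ultimately show ?thesis by simp
qed

end

context riem_open
begin

section \<open>Upper bounds by energy and lower bounds by calibration\<close>

lemma dist_le:
 assumes "piecewise_C1_curve A ga" "ga 0 = x" "ga 1 = y" shows "riem_dist A g x y <= curve_length A g ga"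
 unfolding riem_dist_def by (rule Inf_lower) (use assms in auto)

lemma dist_less:
 assumes "riem_dist A g x y < e"
 obtains ga where "piecewise_C1_curve A ga" "ga 0 = x" "ga 1 = y" "curve_length A g ga < e" using assms unfolding riem_dist_def Inf_less_iff by auto

text \<open>Instead of Cauchy-Schwarz for integrals: speed <= (speed^2 / l + l) / 2 with l = sqrt E
  + eps, integrated. The \<open>eps\<close> keeps l positive when the energy vanishes and is removed
  at the end.\<close>

lemma chart_curve:
 assumes c: "c : A" and sg: "!!ta. ta : {0..1} ==> (sg has_vector_derivative v ta) (at ta within {0..1})"
  "!!ta. ta : {0..1} ==> sg ta : cimg c" and v: "continuous_on {0..1} v"
 shows "riem_dist A g (cinv c (sg 0)) (cinv c (sg 1)) <= ennreal (sqrt (integral {0..1} (%ta. v ta \<bullet> (g c (sg ta) *v v ta))))"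
proof -
 let ?ga = "%t. cinv c (sg t)"
 have csg: "continuous_on {0..1} sg" unfolding continuous_on_eq_continuous_within using has_vector_derivative_continuous[OF sg(1)] by blast
 have cont: "continuous_on {0..1} ?ga" by (rule continuous_on_compose2[OF continuous_cinv[OF c] csg]) (use sg(2) in auto)
 have at: "(sg has_vector_derivative v t) (at t)" if "t : {0<..<1}" for t using sg(1)[of t] that at_within_Icc_at[of 0 t 1] by simp
 have reg: "reg ?ga s" if s: "s : {0<..<1} - {}" for s unfolding reg_def
 proof (intro ballI impI)
  fix d assume d: "d : A" "?ga s : cdom d"
  let ?N = "{t : {0<..<1}. ?ga t : cdom d}"
  have N: "open ?N" by (rule open_preimage[OF cont chart(1)[OF d(1)]])
  have ov: "sg t : overlap c d" if "t : ?N" for t using that sg(2) overlap_eq[OF c] by auto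
  have D: "((cmap d \<circ> ?ga) has_vector_derivative (jacobian_cd c d (sg t) *v v t)) (at t)" if t: "t : ?N" for t
  proof -
   have "((%t. transition c d (sg t)) has_derivative (%h. jacobian_cd c d (sg t) *v (h *\<^sub>R v t))) (at t)"
    by (rule has_derivative_compose[OF at[unfolded has_vector_derivative_def] transition_derivative_at[OF c d(1) ov[OF t]]]) (use t in auto)
   thus ?thesis by (simp add: has_vector_derivative_def matrix_vector_mult_scaleR transition_def o_def)
  qed
  have "continuous_on ?N (%t. jacobian_cd c d (sg t) *v v t)"
   by (rule continuous_jacobian[OF c d(1)]) (use ov in \<open>auto intro!: continuous_on_subset[OF csg] continuous_on_subset[OF v]\<close>)
  hence "(cmap d \<circ> ?ga) C1_differentiable_on ?N" unfolding C1_differentiable_on_def using D by (intro exI conjI ballI)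
  thus "EX N. open N & s : N & (cmap d \<circ> ?ga) C1_differentiable_on N" using N s d by blast
 qed
 have pw: "piecewise_C1_curve A ?ga" unfolding piecewise_iff using cont reg by blast
 define D where "D = (%ta. v ta \<bullet> (g c (sg ta) *v v ta))"
 have cD: "continuous_on {0..1} D" unfolding D_def by (rule continuous_metric[OF c csg _ v v]) (use sg(2) in auto)
 have D0: "D t >= 0" if "t : {0..1}" for t
  using coord_metric.ip_nonneg[OF coord[OF c] sg(2)[OF that]] by (simp add: D_def coord_metric.ip_def[OF coord[OF c]])
 have sp: "speed A g ?ga t = sqrt (D t)" if t: "t : {0<..<1}" for t
 proof -
  have "sg t : cimg c" using sg(2) t by auto
  have "((cmap c \<circ> ?ga) has_vector_derivative v t) (at t)"
   by (rule has_vector_derivative_transform_within_open[OF at[OF t] open_greaterThanLessThan t]) (use sg(2) cmap_cinv[OF c] in auto)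
  from speed_eq[OF c cinv_in[OF c \<open>sg t : cimg c\<close>] this cont t] show ?thesis
   using cmap_cinv[OF c \<open>sg t : cimg c\<close>] by (simp add: D_def)
 qed
 define E where "E = integral {0..1} D"
 have E0: "E >= 0" unfolding E_def by (rule integral_nonneg[OF integrable_continuous_real[OF cD]]) (use D0 in auto)
 have "curve_length A g ?ga <= ennreal (sqrt E) + ennreal eps" if eps: "eps > 0" for eps
 proof -
  define l where "l = sqrt E + eps"
  have l: "l > 0" "E <= l * l" using eps E0 mult_mono[of "sqrt E" l "sqrt E" l] by (auto simp: l_def add_nonneg_pos)
  let ?f = "%t. (D t / l + l) / 2"
  have cf: "continuous_on {0..1} ?f" using l by (intro continuous_intros cD) auto
  have f0: "?f t >= 0" if "t : {0..1}" for t using D0[OF that] l by simp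
  have am: "sqrt (D t) <= ?f t" if "t : {0..1}" for t
  proof -
   have "0 <= (sqrt (D t))^2 + l\<^sup>2 - 2 * sqrt (D t) * l" using zero_le_power2[of "sqrt (D t) - l"] unfolding power2_diff .
   hence "sqrt (D t) * (l * 2) <= D t + l * l" using D0[OF that] by (simp add: power2_eq_square[of l] mult.commute mult.left_commute)
   thus ?thesis using l(1) by (simp add: field_simps)
  qed
  have si: "set_integrable lborel {0..1} ?f" by (rule borel_integrable_atLeastAtMost'[OF cf])
  have "curve_length A g ?ga = (\<integral>\<^sup>+ s. ennreal (speed A g ?ga s) * indicator ({0<..<1} - {}) s \<partial>lborel)"
   by (rule length_on(2)[OF cont _ reg]) auto
  also have "... <= (\<integral>\<^sup>+ s. ennreal (indicator {0..1} s *\<^sub>R ?f s) \<partial>lborel)"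
   by (rule nn_integral_mono) (use am sp in \<open>auto simp: indicator_def intro!: ennreal_leI\<close>)
  also have "... = ennreal (LINT s:{0..1}|lborel. ?f s)" unfolding set_lebesgue_integral_def using si f0 unfolding set_integrable_def
   by (intro nn_integral_eq_integral AE_I2) (auto simp: indicator_def)
  also have "(LINT s:{0..1}|lborel. ?f s) = integral {0..1} ?f" using set_borel_integral_eq_integral(2)[OF si] .
  also have "integral {0..1} ?f = (E / l + l) / 2"
  proof -
   have "(D has_integral E) {0..1}" unfolding E_def using integrable_continuous_real[OF cD] by (simp add: has_integral_integral)
   from has_integral_mult_left[OF has_integral_add[OF has_integral_mult_left[OF this, of "1/l"] has_integral_const_real[of l 0 1]], of "1/2"]
   show ?thesis by (intro integral_unique) (simp add: field_simps)
  qed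
  also have "... <= l" using l by (simp add: field_simps)
  finally show ?thesis using eps E0 by (simp add: l_def ennreal_plus ennreal_leI)
 qed
 hence "curve_length A g ?ga <= ennreal (sqrt E)" by (rule ennreal_le_epsilon)
 thus ?thesis using dist_le[OF pw refl refl] by (simp add: E_def D_def)
qed

text \<open>Calibration: a function whose differential is bounded by the metric norm grows by at
  most the length. Only the initial arc up to s has to stay in the chart, which allows curves that
  leave it later.\<close>

lemma length_ge:
 assumes p: "piecewise_C1_curve A ga" and c: "c : A" and s: "0 <= s" "s <= 1" and U: "!!t. t : {0..s} ==> ga t : cdom c & cmap c (ga t) : U"
  and ph: "!!y. y : U ==> (ph has_derivative ph' y) (at y)" "!!y v. y : U ==> ph' y v <= sqrt (v \<bullet> (g c y *v v))"
 shows "ennreal (ph (cmap c (ga s)) - ph (cmap c (ga 0))) <= curve_length A g ga"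
proof -
 obtain F where F: "finite F" "continuous_on {0..1} ga" "!!t. t : {0<..<1} - F ==> reg ga t" using p unfolding piecewise_iff by blast
 let ?g = "%t. speed A g ga t * indicator ({0<..<1} - F) t"
 have eq: "ennreal (?g t) = ennreal (speed A g ga t) * indicator ({0<..<1} - F) t" for t by (simp add: indicator_def)
 have meas: "(%t. ennreal (?g t)) : borel_measurable borel" unfolding eq by (rule length_on(1)[OF F(2,1,3)])
 have len: "curve_length A g ga = (\<integral>\<^sup>+ t. ennreal (?g t) \<partial>lborel)" unfolding eq by (rule length_on(2)[OF F(2,1,3)])
 have D: "EX D. ((cmap c \<circ> ga) has_vector_derivative D) (at t) & speed A g ga t = sqrt (D \<bullet> (g c (cmap c (ga t)) *v D))"
  if t: "t : {0<..<s} - F" for t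
 proof -
  have t1: "t : {0<..<1} - F" "ga t : cdom c" using t s U by auto
  hence "EX D. ((cmap c \<circ> ga) has_vector_derivative D) (at t)" using F(3)[OF t1(1)] c unfolding reg_def C1_differentiable_on_def by blast
  then obtain D where D: "((cmap c \<circ> ga) has_vector_derivative D) (at t)" by blast
  from speed_eq[OF c t1(2) D F(2)] t1 D show ?thesis by blast
 qed
 then obtain D where D: "!!t. t : {0<..<s} - F ==> ((cmap c \<circ> ga) has_vector_derivative D t) (at t)"
  "!!t. t : {0<..<s} - F ==> speed A g ga t = sqrt (D t \<bullet> (g c (cmap c (ga t)) *v D t))" by metis
 have sp0: "0 <= speed A g ga t" if t: "t : {0<..<1} - F" for t
 proof -
  obtain d where d: "d : A" "ga t : cdom d" using chart_cover by blast
  have "EX D. ((cmap d \<circ> ga) has_vector_derivative D) (at t)" using F(3)[OF t] d unfolding reg_def C1_differentiable_on_def by blast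
  then obtain D where "((cmap d \<circ> ga) has_vector_derivative D) (at t)" by blast
  from speed_eq[OF d this F(2)] t show ?thesis
   using coord_metric.ip_nonneg[OF coord[OF d(1)] cmap_in[OF d(2)]] by (simp add: coord_metric.ip_def[OF coord[OF d(1)]])
 qed
 have g0: "?g t >= 0" for t using sp0 by (auto simp: indicator_def)
 define f' where "f' = (%t. if t : {0<..<s} - F then ph' (cmap c (ga t)) (D t) else 0)"
 have "(f' has_integral (ph (cmap c (ga s)) - ph (cmap c (ga 0)))) {0..s}"
 proof (rule fundamental_theorem_of_calculus_interior_strong[OF F(1) s(1)])
  fix t assume t: "t : {0<..<s} - F"
  have "((%t. ph ((cmap c \<circ> ga) t)) has_derivative (%h. ph' (cmap c (ga t)) (h *\<^sub>R D t))) (at t)"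
   by (rule has_derivative_compose[OF D(1)[OF t, unfolded has_vector_derivative_def]]) (use U[of t] ph(1) t in auto)
  moreover have "linear (ph' (cmap c (ga t)))" using has_derivative_linear[OF ph(1)] U[of t] t by auto
  ultimately show "((%t. ph (cmap c (ga t))) has_vector_derivative f' t) (at t)" using t by (simp add: has_vector_derivative_def f'_def linear_cmul)
 next
  have "continuous_on U ph" using ph(1) has_derivative_continuous continuous_at_imp_continuous_on by blast
  moreover have "continuous_on {0..s} (%t. cmap c (ga t))"
   by (rule continuous_on_compose2[OF continuous_cmap[OF c]]) (use U s in \<open>auto intro!: continuous_on_subset[OF F(2)]\<close>)
  ultimately show "continuous_on {0..s} (%t. ph (cmap c (ga t)))" by (rule continuous_on_compose2) (use U in auto)
 qed
 hence I: "((%t. if t : {0..s} then f' t else 0) has_integral (ph (cmap c (ga s)) - ph (cmap c (ga 0)))) UNIV" unfolding has_integral_restrict_UNIV .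
 have le: "(if t : {0..s} then f' t else 0) <= ?g t" for t
 proof (cases "t : {0<..<s} - F")
  case True
  hence "f' t <= speed A g ga t" unfolding D(2)[OF True] f'_def using ph(2) U[of t] by simp
  thus ?thesis using True s by (simp add: indicator_def)
 next
  case False hence "f' t = 0" unfolding f'_def by (rule if_not_P)
  thus ?thesis using g0[of t] by simp
 qed
 show ?thesis
 proof (cases "curve_length A g ga < \<infinity>")
  case True
  have "(%t. enn2real (ennreal (?g t))) : borel_measurable lborel" using meas by measurable
  hence "?g : borel_measurable lborel" using g0 by simp
  hence "integrable lborel ?g" by (rule integrableI_nonneg) (use g0 True len in auto)
  note i = this
  have "ph (cmap c (ga s)) - ph (cmap c (ga 0)) <= integral\<^sup>L lborel ?g"
   by (rule has_integral_le[OF I has_integral_integral_lborel[OF i]]) (use le in auto)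
  thus ?thesis unfolding len using nn_integral_eq_integral[OF i] g0 by (simp add: ennreal_leI)
 next
  case False thus ?thesis by (simp add: less_top[symmetric])
 qed
qed

section \<open>The distance as an extended pseudometric\<close>

lemma dist_self: "riem_dist A g x x = 0"
proof -
 obtain c where c: "c : A" "x : cdom c" using chart_cover by blast
 from chart_curve[OF c(1), of "%_. cmap c x" "%_. 0"] show ?thesis using cmap_in[OF c(2)] cinv_cmap[OF c] by simp
qed

lemma dist_sym: "riem_dist A g x y = riem_dist A g y x"
proof -
 have *: "riem_dist A g x y <= riem_dist A g y x" for x y
 proof (rule ccontr)
  assume "\<not> riem_dist A g x y <= riem_dist A g y x"
  then obtain ga where ga: "piecewise_C1_curve A ga" "ga 0 = y" "ga 1 = x" "curve_length A g ga < riem_dist A g x y" by (meson dist_less not_le)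
  from dist_le[OF reverse_curve(1)[OF ga(1)], of x y] have "riem_dist A g x y <= curve_length A g (%t. ga (1 - t))" using ga by simp
  thus False using reverse_curve(2)[OF ga(1)] ga(4) by simp
 qed
 show ?thesis by (intro antisym *)
qed

lemma dist_triangle: "riem_dist A g x z <= riem_dist A g x y + riem_dist A g y z"
proof (rule ennreal_le_epsilon)
 let ?a = "riem_dist A g x y" and ?b = "riem_dist A g y z"
 fix e :: real assume e: "0 < e" and "?a + ?b < top"
 hence fin: "?a < \<infinity>" "?b < \<infinity>" by (auto simp: less_top[symmetric])
 have "?a < ?a + ennreal (e/2)" "?b < ?b + ennreal (e/2)" using fin e by (auto simp: ennreal_add_left_cancel_less[of _ 0, simplified])
 then obtain ga1 ga2 where ga: "piecewise_C1_curve A ga1" "ga1 0 = x" "ga1 1 = y" "curve_length A g ga1 < ?a + ennreal (e/2)"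
  "piecewise_C1_curve A ga2" "ga2 0 = y" "ga2 1 = z" "curve_length A g ga2 < ?b + ennreal (e/2)" by (metis dist_less)
 have j: "ga1 1 = ga2 0" using ga by simp
 have "riem_dist A g x z <= curve_length A g ga1 + curve_length A g ga2"
  using dist_le[OF join_curve(1)[OF ga(1,5) j]] join_curve(2)[OF ga(1,5) j] ga by (simp add: joinpaths_def)
 also have "... <= (?a + ennreal (e/2)) + (?b + ennreal (e/2))" using ga by (intro add_mono) auto
 also have "... = ?a + ?b + ennreal (e/2 + e/2)" using e by (simp only: ennreal_plus) (simp add: ac_simps)
 finally show "riem_dist A g x z <= ?a + ?b + ennreal e" by simp
qed

end

section \<open>The Riemannian distance near a point\<close>

context riem_open
begin

abbreviation "cip c y u v \<equiv> coord_metric.ip (g c) y u v"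
abbreviation "dist_g \<equiv> riem_dist A g"

lemma cip: "c : A ==> cip c y u v = u \<bullet> (g c y *v v)" using coord_metric.ip_def[OF coord] by simp

text \<open>The calibrating function sqrt e fails to be differentiable where e vanishes; sqrt (e +
  eps^2) is used in its place, at a cost of at most eps.\<close>

lemma length_ge_sqrt:
 assumes p: "piecewise_C1_curve A ga" and c: "c : A" and s: "0 <= s" "s <= 1"
  and U: "!!t. t : {0..s} ==> ga t : cdom c & cmap c (ga t) : U" "U \<subseteq> cimg c"
  and e: "!!y. y : U ==> 0 <= e y" "!!y. y : U ==> (e has_derivative e' y) (at y)" "!!y v. y : U ==> (e' y v)\<^sup>2 <= 4 * e y * cip c y v v"
 shows "ennreal (sqrt (e (cmap c (ga s))) - sqrt (e (cmap c (ga 0)))) <= curve_length A g ga"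
proof (rule ennreal_le_epsilon)
 fix eps :: real assume eps: "0 < eps"
 define ph where "ph = (%y. sqrt (e y + eps\<^sup>2))"
 have pos: "0 < e y + eps\<^sup>2" if "y : U" for y using e(1)[OF that] eps by (simp add: add_nonneg_pos)
 have in_U: "cmap c (ga t) : U" if "t : {0..s}" for t using U(1)[OF that] by blast
 have "ennreal (ph (cmap c (ga s)) - ph (cmap c (ga 0))) <= curve_length A g ga"
 proof (rule length_ge[OF p c s U(1)])
  fix y assume y: "y : U"
  show "(ph has_derivative (%v. e' y v * inverse (sqrt (e y + eps\<^sup>2)) / 2)) (at y)"
   unfolding ph_def using pos[OF y] by (auto intro!: derivative_eq_intros e(2)[OF y])
  fix v
  have n: "0 <= cip c y v v" using coord_metric.ip_nonneg[OF coord[OF c]] U(2) y by blast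
  have "(e' y v)^2 <= 4 * (e y + eps\<^sup>2) * cip c y v v" by (rule order_trans[OF e(3)[OF y]]) (intro mult_right_mono n, simp)
  hence "\<bar>e' y v\<bar> <= sqrt (4 * (e y + eps\<^sup>2) * cip c y v v)" by (simp only: real_le_rsqrt power2_abs)
  also have "... = 2 * sqrt (e y + eps\<^sup>2) * sqrt (cip c y v v)" using real_sqrt_mult[of 4] by (simp add: real_sqrt_mult del: distrib_left_numeral)
  finally have "e' y v <= 2 * sqrt (e y + eps\<^sup>2) * sqrt (cip c y v v)" by simp
  moreover have "0 < sqrt (e y + eps\<^sup>2)" using pos[OF y] by simp
  ultimately have "e' y v * inverse (sqrt (e y + eps\<^sup>2)) / 2 <= sqrt (cip c y v v)" by (simp add: field_simps)
  thus "e' y v * inverse (sqrt (e y + eps\<^sup>2)) / 2 <= sqrt (v \<bullet> (g c y *v v))" by (simp add: cip[OF c])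
 qed auto
 moreover have "sqrt (e (cmap c (ga s))) <= ph (cmap c (ga s))" unfolding ph_def by simp
 moreover have "ph (cmap c (ga 0)) <= sqrt (e (cmap c (ga 0))) + eps"
  using sqrt_add_le_add_sqrt[of "e (cmap c (ga 0))" "eps\<^sup>2"] e(1) in_U[of 0] s eps by (simp add: ph_def)
 ultimately have "ennreal (sqrt (e (cmap c (ga s))) - sqrt (e (cmap c (ga 0)))) <= ennreal (ph (cmap c (ga s)) - ph (cmap c (ga 0)) + eps)"
  by (intro ennreal_leI) linarith
 also have "... <= ennreal (ph (cmap c (ga s)) - ph (cmap c (ga 0))) + ennreal eps"
  using eps by (cases "0 <= ph (cmap c (ga s)) - ph (cmap c (ga 0))") (auto simp: ennreal_neg ennreal_plus[symmetric] simp del: ennreal_plus intro!: ennreal_leI)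
 finally show "ennreal (sqrt (e (cmap c (ga s))) - sqrt (e (cmap c (ga 0)))) <= curve_length A g ga + ennreal eps"
  using \<open>ennreal (ph (cmap c (ga s)) - ph (cmap c (ga 0))) <= curve_length A g ga\<close> by (meson add_right_mono order_trans)
qed

lemma open_chart_set: "c : A ==> open U ==> open {x : cdom c. cmap c x : U}"
 using continuous_open_preimage[OF continuous_cmap chart(1)] by (simp add: vimage_def Int_def)

lemma compact_chart_set:
 assumes "c : A" "compact K" "K \<subseteq> cimg c" shows "compact {x : cdom c. cmap c x : K}"
proof -
 have "{x : cdom c. cmap c x : K} = cinv c ` K" using assms(3) cinv_cmap[OF assms(1)] cmap_cinv[OF assms(1)] cinv_in[OF assms(1)] by force
 thus ?thesis using compact_continuous_image[OF continuous_on_subset[OF continuous_cinv[OF assms(1)] assms(3)] assms(2)] by simp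
qed

lemma chart_exit:
 fixes ga :: "real => 'a"
 assumes c: "c : A" "cball y0 R \<subseteq> cimg c" and ga: "continuous_on {0..1} ga" "ga 0 : cdom c" "cmap c (ga 0) : ball y0 R"
  and ex: "t0 : {0..1}" "\<not> (ga t0 : cdom c & cmap c (ga t0) : ball y0 R)"
 shows "EX s:{0..1}. (ALL t:{0..s}. ga t : cdom c & cmap c (ga t) : cball y0 R) & dist y0 (cmap c (ga s)) = R"
proof -
 let ?B = "{x : cdom c. cmap c x : ball y0 R}" and ?K = "{x : cdom c. cmap c x : cball y0 R}"
 define T where "T = {0..1} \<inter> ga -` (- ?B)"
 have clT: "closed T" unfolding T_def
  by (intro continuous_closed_preimage[OF ga(1)] closed_atLeastAtMost closed_Compl open_chart_set[OF c(1) open_ball])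
 have neT: "T ~= {}" "bdd_below T" using ex by (auto simp: T_def)
 define s where "s = Inf T"
 have sT: "s : T" unfolding s_def by (rule closed_contains_Inf[OF neT clT])
 hence s: "s : {0..1}" "ga s ~: ?B" by (auto simp: T_def)
 have before: "ga t : ?B" if "t : {0..<s}" for t using that s(1) cInf_lower[OF _ neT(2), of t] by (auto simp: T_def s_def)
 have "s ~= 0" using s(2) ga by auto
 hence s0: "0 < s" using s by auto
 have "closed ({0..1} \<inter> ga -` ?K)"
  by (intro continuous_closed_preimage[OF ga(1)] closed_atLeastAtMost compact_imp_closed compact_chart_set[OF c(1) compact_cball c(2)])
 moreover have "{0..<s} \<subseteq> {0..1} \<inter> ga -` ?K" using before s(1) by fastforce
 ultimately have "closure {0..<s} \<subseteq> {0..1} \<inter> ga -` ?K" by (rule closure_minimal[rotated])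
 hence K: "ga t : ?K" if "t : {0..s}" for t using that s0 by auto
 have "cmap c (ga s) ~: ball y0 R" "cmap c (ga s) : cball y0 R" using K[of s] s s0 by auto
 hence "dist y0 (cmap c (ga s)) = R" by auto
 thus ?thesis using s(1) K by blast
qed

text \<open>Up to its first exit from the chart ball the curve is calibrated by sqrt l times the
  Euclidean distance to y0.\<close>

lemma exit_length:
 assumes c: "c : A" "cball y0 R \<subseteq> cimg c" and l: "l > 0" "!!y v. y : cball y0 R ==> l * (norm v)^2 <= cip c y v v"
  and p: "piecewise_C1_curve A ga" "ga 0 : cdom c" "cmap c (ga 0) : ball y0 R"
  and ex: "t0 : {0..1}" "\<not> (ga t0 : cdom c & cmap c (ga t0) : ball y0 R)"
 shows "ennreal (sqrt l * (R - dist y0 (cmap c (ga 0)))) <= curve_length A g ga"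
proof -
 have cont: "continuous_on {0..1} ga" using p(1) by (simp add: piecewise_C1_curve_def)
 obtain s where s: "s : {0..1}" "ALL t:{0..s}. ga t : cdom c & cmap c (ga t) : cball y0 R" "dist y0 (cmap c (ga s)) = R"
  using chart_exit[OF c cont p(2,3) ex] by blast
 define e where "e = (%y. l * ((y - y0) \<bullet> (y - y0)))"
 have en: "sqrt (e y) = sqrt l * dist y0 y" for y by (simp add: e_def real_sqrt_mult dist_norm norm_eq_sqrt_inner[symmetric] norm_minus_commute)
 have "ennreal (sqrt (e (cmap c (ga s))) - sqrt (e (cmap c (ga 0)))) <= curve_length A g ga"
 proof (rule length_ge_sqrt[OF p(1) c(1) _ _ _ c(2)])
  fix y assume y: "y : cball y0 R"
  show "0 <= e y" using l by (simp add: e_def)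
  show "(e has_derivative (%v. 2 * l * ((y - y0) \<bullet> v))) (at y)"
   unfolding e_def by (auto intro!: derivative_eq_intros simp: inner_commute algebra_simps)
  fix v
  have "((y - y0) \<bullet> v)^2 <= ((y - y0) \<bullet> (y - y0)) * (norm v)^2"
   using Cauchy_Schwarz_ineq[of "y - y0" v] by (simp add: power2_norm_eq_inner)
  hence "(2 * l * ((y - y0) \<bullet> v))^2 <= 4 * l\<^sup>2 * (((y - y0) \<bullet> (y - y0)) * (norm v)^2)"
   by (simp add: power_mult_distrib mult_left_mono)
  also have "... = 4 * e y * (l * (norm v)^2)" by (simp add: e_def power2_eq_square)
  also have "... <= 4 * e y * cip c y v v" using l by (intro mult_left_mono l(2)[OF y]) (auto simp: e_def)
  finally show "(2 * l * ((y - y0) \<bullet> v))^2 <= 4 * e y * cip c y v v" .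
 qed (use s in auto)
 thus ?thesis unfolding en s(3) by (simp add: algebra_simps)
qed

lemma chart_radius:
 assumes c: "c : A" "x : cdom c" and B: "open B" "x : B"
 obtains R l L where "R > 0" "cball (cmap c x) R \<subseteq> cimg c" "!!y. y : cdom c ==> cmap c y : cball (cmap c x) R ==> y : B"
  "l > 0" "L > 0" "!!y v. y : cball (cmap c x) R ==> l * (norm v)^2 <= cip c y v v"
  "!!y v. y : cball (cmap c x) R ==> cip c y v v <= L * (norm v)^2"
proof -
 interpret C: coord_metric_open "cimg c" "g c" by (rule coord_open[OF c(1)])
 have "open (cimg c \<inter> cinv c -` B)" by (rule continuous_open_preimage[OF continuous_cinv[OF c(1)] open_cimg[OF c(1)] B(1)])
 moreover have "cmap c x : cimg c \<inter> cinv c -` B" using cmap_in[OF c(2)] cinv_cmap[OF c] B(2) by simp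
 ultimately obtain R where R: "R > 0" "cball (cmap c x) R \<subseteq> cimg c \<inter> cinv c -` B" by (meson open_contains_cball)
 hence sub: "cball (cmap c x) R \<subseteq> cimg c" by blast
 moreover have "y : B" if "y : cdom c" "cmap c y : cball (cmap c x) R" for y using R(2) that cinv_cmap[OF c(1) that(1)] by auto
 moreover have "cball (cmap c x) R ~= {}" using R(1) by simp
 from C.metric_bounds[OF compact_cball sub this] obtain l L where "l > 0" "L > 0"
  "!!y v. y : cball (cmap c x) R ==> l * (norm v)^2 <= cip c y v v" "!!y v. y : cball (cmap c x) R ==> cip c y v v <= L * (norm v)^2" by blast
 ultimately show ?thesis using that[OF R(1)] by blast
qed

text \<open>A curve that ends outside \<open>B\<close> must leave a chart ball contained in
  \<open>B\<close>, and that takes a definite length.\<close>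

lemma dist_small:
 assumes "open B" "x : B" shows "EX eps>0. ALL y. dist_g x y < ennreal eps --> y : B"
proof -
 obtain c where c: "c : A" "x : cdom c" using chart_cover by blast
 obtain R l L where R: "R > 0" "cball (cmap c x) R \<subseteq> cimg c" "!!y. y : cdom c ==> cmap c y : cball (cmap c x) R ==> y : B"
  and l0: "l > 0" and "L > 0" and l1: "!!y v. y : cball (cmap c x) R ==> l * (norm v)^2 <= cip c y v v"
  and "!!y v. y : cball (cmap c x) R ==> cip c y v v <= L * (norm v)^2" by (rule chart_radius[OF c assms]) blast
 note l = l0 l1
 have "y : B" if d: "dist_g x y < ennreal (sqrt l * R)" for y
 proof (rule ccontr)
  assume y: "y ~: B"
  obtain ga where ga: "piecewise_C1_curve A ga" "ga 0 = x" "ga 1 = y" "curve_length A g ga < ennreal (sqrt l * R)" using dist_less[OF d] by blast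
  have "ennreal (sqrt l * (R - dist (cmap c x) (cmap c (ga 0)))) <= curve_length A g ga"
   by (rule exit_length[OF c(1) R(2) l ga(1), of 1]) (use ga c R y in \<open>auto simp: less_imp_le\<close>)
  thus False using ga by simp
 qed
 thus ?thesis using R(1) l(1) by (intro exI[of _ "sqrt l * R"]) simp
qed

abbreviation "normal_at c x e y \<equiv> 0 <= e (cmap c y) & dist_g x y = ennreal (sqrt (e (cmap c y))) &
 (EX ga u. coord_metric_open.geo (cimg c) (g c) (cmap c x) ga u (cmap c y - cmap c x) & e (cmap c y) = cip c (cmap c y) (u 1) (u 1) & (e has_derivative (%v. 2 * cip c (cmap c y) (u 1) v)) (at (cmap c y)))"

text \<open>\<open>normal_set c B\<close>: any two points of \<open>B\<close> are joined by a minimizing geodesic in the chart \<open>c\<close>, and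
  half the gradient of the squared distance is its final velocity.\<close>

definition normal_set :: "('a, 'n) chart => 'a set => bool" where
 "normal_set c B \<longleftrightarrow> c : A & open B & B \<subseteq> cdom c & (ALL x:B. EX e. ALL y:B. normal_at c x e y)"

text \<open>The Gauss lemma in calibrated form: e = |u 1|^2 has differential 2 <u 1, .>, so
  Cauchy-Schwarz gives the hypothesis of \<open>length_ge_sqrt\<close>, and no curve inside the
  larger ball is shorter than the geodesic. Curves that leave this ball are excluded by
  \<open>exit_length\<close>.\<close>

lemma normal_set_exists: "EX c B. normal_set c B & p : B"
proof -
 obtain c where c: "c : A" "p : cdom c" using chart_cover by blast
 interpret C: coord_metric_open "cimg c" "g c" by (rule coord_open[OF c(1)])
 let ?y0 = "cmap c p"
 obtain R l L where R: "R > 0" "cball ?y0 R \<subseteq> cimg c" "!!y. y : cdom c ==> cmap c y : cball ?y0 R ==> y : UNIV"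
  and l: "l > 0" "L > 0" "!!y v. y : cball ?y0 R ==> l * (norm v)^2 <= C.ip y v v" "!!y v. y : cball ?y0 R ==> C.ip y v v <= L * (norm v)^2"
  by (rule chart_radius[OF c open_UNIV UNIV_I]) blast
 obtain om where om: "om > 0" "4 * om <= R" and fam: "!!z. z : cball ?y0 om ==> EX ga u.
   (ALL w. norm w <= om --> C.geo z (ga w) (u w) w & (ALL ta:{0..1}. ga w ta : cball ?y0 R & norm (u w ta) <= 2 * norm w)) &
   (ALL w w'. norm w <= om --> norm w' <= om --> (ALL ta:{0..1}. norm (u w ta - u w' ta) <= 2 * norm (w - w') &
    norm (ga w ta - ga w' ta) <= 2 * norm (w - w')))" by (rule C.geodesic_bvp[OF R(2,1)]) blast
 define R1 where "R1 = om / 2"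
 \<comment> \<open>Two points of the r-ball are joined by a geodesic of length at most 4 sqrt L r,
   whereas leaving the R1-ball costs at least sqrt l (R1 - r). This r makes the former the smaller
   one.\<close>
 define r where "r = min (om / 4) (sqrt l * om / (16 * sqrt L))"
 have r: "r > 0" "r <= om / 4" using om l by (auto simp: r_def)
 have rL: "4 * sqrt L * r <= sqrt l * (R1 - r)"
 proof -
  have "sqrt L * r <= sqrt L * (sqrt l * om / (16 * sqrt L))" using l by (intro mult_left_mono) (auto simp: r_def)
  also have "... = sqrt l * om / 16" using l by simp
  finally have "4 * sqrt L * r <= sqrt l * (om / 4)" by simp
  also have "... <= sqrt l * (R1 - r)" using r l by (intro mult_left_mono) (auto simp: R1_def)
  finally show ?thesis .
 qed
 have R1: "cball ?y0 R1 \<subseteq> cball ?y0 R" "cball ?y0 R1 \<subseteq> cimg c" "r < R1" using om R(2) r by (auto simp: R1_def subset_eq)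
 define B where "B = {x : cdom c. cmap c x : ball ?y0 r}"
 have "EX e. ALL y:B. normal_at c x e y" if x: "x : B" for x
 proof -
  define z where "z = cmap c x"
  have z: "dist ?y0 z < r" "z : cball ?y0 om" and xc: "x : cdom c" using x r om by (auto simp: B_def z_def)
  from fam[OF z(2)] obtain ga u where
   f1: "ALL w. norm w <= om --> C.geo z (ga w) (u w) w & (ALL ta:{0..1}. ga w ta : cball ?y0 R & norm (u w ta) <= 2 * norm w)"
   and f2: "ALL w w'. norm w <= om --> norm w' <= om --> (ALL ta:{0..1}. norm (u w ta - u w' ta) <= 2 * norm (w - w') &
    norm (ga w ta - ga w' ta) <= 2 * norm (w - w'))" by (elim exE conjE) (rule that)
  have G: "C.geo z (ga w) (u w) w" if "norm w <= om" for w using f1 that by blast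
  have b: "norm (u w ta) <= 2 * norm w" if "norm w <= om" "ta : {0..1}" for w ta using f1 that by blast
  have lip: "norm (u w ta - u w' ta) <= 2 * norm (w - w') & norm (ga w ta - ga w' ta) <= 2 * norm (w - w')"
   if "norm w <= om" "norm w' <= om" "ta : {0..1}" for w w' ta using f2 that by blast
  have end1: "ga w 1 = z + w" if "norm w <= om" for w using G[OF that] by (simp add: C.geo_def)
  define e where "e = (%y. C.ip (ga (y - z) 1) (u (y - z) 1) (u (y - z) 1))"
  have near: "norm (y - z) < om" if "y : cball ?y0 R1" for y
   using dist_triangle2[of y z ?y0] that z r om by (auto simp: R1_def dist_norm norm_minus_commute)
  have e_eq: "e y = C.ip y (u (y - z) 1) (u (y - z) 1)" if "y : cball ?y0 R1" for y using end1[of "y - z"] near[OF that] by (simp add: e_def)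
  have e0: "0 <= e y" if "y : cball ?y0 R1" for y unfolding e_eq[OF that] using C.ip_nonneg R1 that by blast
  have de: "(e has_derivative (%v. 2 * C.ip y (u (y - z) 1) v)) (at y)" if y: "y : cball ?y0 R1" for y
  proof -
   have "((%y. y - z) has_derivative (%v. v)) (at y)" by (auto intro!: derivative_eq_intros)
   from has_derivative_compose[OF this C.energy_has_derivative[OF G lip near[OF y]]] show ?thesis by (simp add: e_def)
  qed
  have ez: "e z = 0" using b[of 0 1] om C.ip_simps by (simp add: e_def C.ip_def)
  have zR: "z : ball ?y0 R1" using z(1) R1(3) by simp
  have D: "dist_g x y = ennreal (sqrt (e (cmap c y)))" if y: "y : B" for y
  proof (rule antisym)
   have yc: "y : cdom c" and yr: "cmap c y : cball ?y0 R1" "dist ?y0 (cmap c y) < r" using y R1(3) by (auto simp: B_def)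
   let ?w = "cmap c y - z"
   have w: "norm ?w <= om" using near[OF yr(1)] by simp
   have geo: "C.geo z (ga ?w) (u ?w) ?w" by (rule G[OF w])
   have gd: "ga ?w ta : cimg c" "(ga ?w has_vector_derivative u ?w ta) (at ta within {0..1})"
    "(u ?w has_vector_derivative - C.Gam (ga ?w ta) (u ?w ta) (u ?w ta)) (at ta within {0..1})" if "ta : {0..1}" for ta
    using geo that unfolding C.geo_def by blast+
   have g01: "ga ?w 0 = cmap c x" "ga ?w 1 = cmap c y" using geo unfolding C.geo_def by (simp_all add: z_def)
   have cu: "continuous_on {0..1} (u ?w)" unfolding continuous_on_eq_continuous_within using has_vector_derivative_continuous[OF gd(3)] by blast
   have "dist_g (cinv c (ga ?w 0)) (cinv c (ga ?w 1)) <= ennreal (sqrt (integral {0..1} (%ta. u ?w ta \<bullet> (g c (ga ?w ta) *v u ?w ta))))"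
    by (rule chart_curve[OF c(1) gd(2,1) cu])
   thus "dist_g x y <= ennreal (sqrt (e (cmap c y)))" using C.geo_energy[OF geo] unfolding g01 cinv_cmap[OF c(1) xc] cinv_cmap[OF c(1) yc]
    by (simp only: e_def C.ip_def g01)
   show "ennreal (sqrt (e (cmap c y))) <= dist_g x y" unfolding riem_dist_def
   proof (rule Inf_greatest, clarify)
    fix ka assume ka: "piecewise_C1_curve A ka" "x = ka 0" "y = ka 1"
    show "ennreal (sqrt (e (cmap c (ka 1)))) <= curve_length A g ka"
    proof (cases "ALL t:{0..1}. ka t : cdom c & cmap c (ka t) : ball ?y0 R1")
     case True
     have "ennreal (sqrt (e (cmap c (ka 1))) - sqrt (e (cmap c (ka 0)))) <= curve_length A g ka"
     proof (rule length_ge_sqrt[OF ka(1) c(1) _ _ _ R1(2) e0 de])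
      fix y v assume y: "y : cball ?y0 R1"
      have "(C.ip y (u (y - z) 1) v)^2 <= C.ip y (u (y - z) 1) (u (y - z) 1) * C.ip y v v" using C.ip_CS R1(2) y by blast
      thus "(2 * C.ip y (u (y - z) 1) v)^2 <= 4 * e y * C.ip y v v" unfolding e_eq[OF y] by (simp add: power_mult_distrib)
     qed (use True in \<open>auto simp: less_imp_le\<close>)
     thus ?thesis using ez ka(2) by (simp add: z_def)
    next
     case False
     then obtain t0 where t0: "t0 : {0..1}" "\<not> (ka t0 : cdom c & cmap c (ka t0) : ball ?y0 R1)" by blast
     have len: "ennreal (sqrt l * (R1 - dist ?y0 (cmap c (ka 0)))) <= curve_length A g ka"
      by (rule exit_length[OF c(1) R1(2) l(1) _ ka(1) _ _ t0]) (use l(3) R1(1) xc zR ka(2) in \<open>auto simp: z_def\<close>)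
     have "e (cmap c y) <= L * (norm (u ?w 1))^2" unfolding e_eq[OF yr(1)] using l(4) R1(1) yr(1) by blast
     also have "... <= L * (2 * (2 * r))^2"
     proof (intro mult_left_mono power_mono)
      have "norm ?w <= 2 * r" using dist_triangle2[of "cmap c y" z ?y0] yr z by (simp add: dist_norm norm_minus_commute)
      thus "norm (u ?w 1) <= 2 * (2 * r)" using b[OF w, of 1] by simp
     qed (use l in auto)
     finally have "sqrt (e (cmap c y)) <= sqrt (L * (2 * (2 * r))^2)" by simp
     also have "... = 4 * sqrt L * r" using r by (simp add: real_sqrt_mult)
     also have "... <= sqrt l * (R1 - dist ?y0 (cmap c (ka 0)))"
      by (rule order_trans[OF rL]) (use z(1) l ka(2) in \<open>auto simp: z_def intro!: mult_left_mono\<close>)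
     finally show ?thesis using len ka(3) by (meson ennreal_leI order_trans)
    qed
   qed
  qed
  show ?thesis
  proof (intro exI[of _ e] ballI)
   fix y assume y: "y : B"
   hence yr: "cmap c y : cball ?y0 R1" using R1(3) by (auto simp: B_def)
   have geo: "C.geo (cmap c x) (ga (cmap c y - z)) (u (cmap c y - z)) (cmap c y - cmap c x)"
    using G[of "cmap c y - z"] near[OF yr] by (simp add: z_def)
   show "normal_at c x e y" using e0[OF yr] D[OF y] geo e_eq[OF yr] de[OF yr] by blast
  qed
 qed
 moreover have "open B" unfolding B_def by (rule open_chart_set[OF c(1) open_ball])
 moreover have "p : B" using c r by (simp add: B_def)
 ultimately show ?thesis unfolding normal_set_def using c(1) by (intro exI[of _ c] exI[of _ B]) (auto simp: B_def)
qed

lemma nbhd_dist: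
 assumes "eps > 0" shows "EX B. open B & x : B & (ALL y:B. dist_g x y < ennreal eps)"
proof -
 obtain c B where B: "normal_set c B" "x : B" using normal_set_exists by blast
 hence "EX e. ALL y:B. normal_at c x e y" by (simp only: normal_set_def)
 then obtain e where E: "ALL y:B. normal_at c x e y" ..
 have e: "0 <= e (cmap c y)" "dist_g x y = ennreal (sqrt (e (cmap c y)))" "isCont e (cmap c y)" if "y : B" for y
  using E that has_derivative_continuous by blast+
 have c: "c : A" "open B" "B \<subseteq> cdom c" using B(1) by (auto simp: normal_set_def)
 have "continuous_on (cmap c ` B) e" using e(3) by (intro continuous_at_imp_continuous_on) auto
 hence "continuous_on B (%y. e (cmap c y))" by (rule continuous_on_compose2[OF _ continuous_on_subset[OF continuous_cmap[OF c(1)] c(3)]]) auto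
 from continuous_open_preimage[OF this c(2), of "{..<eps\<^sup>2}"] have "open (B \<inter> (%y. e (cmap c y)) -` {..<eps\<^sup>2})" by simp
 moreover have "e (cmap c x) = 0" using e(1,2)[OF B(2)] dist_self[of x] by simp
 moreover have "dist_g x y < ennreal eps" if "y : B" "e (cmap c y) < eps\<^sup>2" for y
  using e(1,2)[OF that(1)] that(2) assms by (simp add: ennreal_less_iff real_less_lsqrt)
 ultimately show ?thesis using B(2) assms by (intro exI[of _ "B \<inter> (%y. e (cmap c y)) -` {..<eps\<^sup>2}"]) auto
qed

end

section \<open>The Hopf-Rinow theorem\<close>

locale riem_pointed = riem_open b A g for b :: "'n::finite" and A :: "('a::{t2_space,second_countable_topology}, 'n) chart set" and g +
 fixes x0 :: 'a
 assumes complete: "riem_complete A g"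
begin

definition comp0 :: "'a set" where "comp0 = {x. dist_g x0 x < top}"
text \<open>A genuine distance only on \<open>comp0\<close>; where the distance is infinite,
  \<open>enn2real\<close> returns 0.\<close>

definition rd :: "'a => 'a => real" where "rd x y = enn2real (dist_g x y)"
definition cb0 :: "real => 'a set" where "cb0 r = {x. dist_g x0 x <= ennreal r}"

lemma x0_comp0: "x0 : comp0" by (simp add: comp0_def dist_self)

lemma dist_finite: assumes "x : comp0" "dist_g x y < top" shows "y : comp0"
 using dist_triangle[of x0 y x] assms by (auto simp: comp0_def less_top[symmetric] top_unique)

lemma dist_comp0: assumes "x : comp0" "y : comp0" shows "dist_g x y = ennreal (rd x y)"
proof -
 have "dist_g x y <= dist_g x0 x + dist_g x0 y" using dist_triangle[of x y x0] dist_sym[of x x0] by simp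
 hence "dist_g x y ~= top" using assms by (auto simp: comp0_def top_unique)
 thus ?thesis by (simp add: rd_def less_top)
qed

lemma rd_nonneg: "0 <= rd x y" by (simp add: rd_def)
lemma rd_sym: "rd x y = rd y x" by (simp add: rd_def dist_sym[of x y])
lemma rd_self: "rd x x = 0" by (simp add: rd_def dist_self)

lemma rd_triangle: assumes "x : comp0" "y : comp0" "z : comp0" shows "rd x z <= rd x y + rd y z"
 using dist_triangle[of x z y] assms by (simp add: dist_comp0 rd_nonneg flip: ennreal_plus)

lemma cb0_iff: "0 <= r ==> x : cb0 r \<longleftrightarrow> x : comp0 & rd x0 x <= r"
 using dist_comp0[OF x0_comp0, of x] by (auto simp: cb0_def comp0_def rd_nonneg le_less_trans[OF _ ennreal_less_top])

lemma dist_small0: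
 assumes "open B" "x : B" "x : comp0" shows "EX eps>0. ALL y:comp0. rd x y < eps --> y : B"
proof -
 obtain eps where eps: "eps > 0" "!!y. dist_g x y < ennreal eps ==> y : B" using dist_small[OF assms(1,2)] by blast
 thus ?thesis using dist_comp0[OF assms(3)] rd_nonneg by (intro exI[of _ eps]) (simp add: ennreal_less_iff)
qed

lemma nbhd_dist0:
 assumes "x : comp0" "eps > 0" shows "EX B. open B & x : B & (ALL y:B. y : comp0 & rd x y < eps)"
proof -
 obtain B where B: "open B" "x : B" "!!y. y : B ==> dist_g x y < ennreal eps" using nbhd_dist[OF assms(2), of x] by blast
 have "y : comp0 & rd x y < eps" if "y : B" for y
 proof -
  have "dist_g x y < top" using B(3)[OF that] by (meson ennreal_less_top less_trans)
  from dist_finite[OF assms(1) this] show ?thesis using B(3)[OF that] dist_comp0[OF assms(1)] by (simp add: ennreal_less_iff rd_nonneg)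
 qed
 thus ?thesis using B by blast
qed

lemma rd_eq_0: assumes "x : comp0" "y : comp0" "rd x y = 0" shows "x = y"
proof (rule ccontr)
 assume "x ~= y"
 then obtain B where B: "open B" "x : B" "y ~: B" using t1_space by blast
 show False using dist_small0[OF B(1,2) assms(1)] assms B by auto
qed

lemma open_comp0: "open comp0"
proof (rule open_subopen[THEN iffD2], rule ballI)
 fix x assume "x : comp0"
 from nbhd_dist0[OF this zero_less_one] show "EX T. open T & x : T & T \<subseteq> comp0" by (meson subsetI)
qed

lemma continuous_rd: assumes "x : comp0" shows "continuous_on comp0 (rd x)" unfolding continuous_on_def tendsto_iff
proof (intro ballI allI impI)
 fix y and eps :: real assume y: "y : comp0" and e: "0 < eps"
 obtain B where B: "open B" "y : B" "!!z. z : B ==> z : comp0 & rd y z < eps" using nbhd_dist0[OF y e] by blast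
 have "dist (rd x z) (rd x y) < eps" if "z : B" for z
  using B(3)[OF that] rd_triangle[OF assms y, of z] rd_triangle[OF assms _ y, of z] rd_sym[of y z] by (auto simp: dist_real_def)
 thus "\<forall>\<^sub>F z in at y within comp0. dist (rd x z) (rd x y) < eps" using B by (auto simp: eventually_at_topological)
qed

lemma closed_cb0: assumes "0 <= r" shows "closed (cb0 r)" unfolding closed_def
proof (rule open_subopen[THEN iffD2], rule ballI)
 fix x assume x: "x : - cb0 r"
 show "EX T. open T & x : T & T \<subseteq> - cb0 r"
 proof (cases "x : comp0")
  case True
  have "open (comp0 \<inter> rd x0 -` {r<..})" by (rule continuous_open_preimage[OF continuous_rd[OF x0_comp0] open_comp0 open_greaterThan])
  thus ?thesis using x True unfolding Compl_iff cb0_iff[OF assms] subset_iff by (intro exI[of _ "comp0 \<inter> rd x0 -` {r<..}"]) simp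
 next
  case False
  obtain B where B: "open B" "x : B" "!!y. y : B ==> dist_g x y < ennreal 1" using nbhd_dist[OF zero_less_one, of x] by blast
  have "y ~: comp0" if "y : B" for y
  proof
   assume "y : comp0"
   hence "x : comp0" using dist_finite[of y x] B(3)[OF that] dist_sym[of x y] by (metis ennreal_less_top less_trans)
   thus False using False by simp
  qed
  thus ?thesis using B cb0_iff[OF assms] by blast
 qed
qed

lemma lebesgue_number:
 assumes S: "compact S" "S \<subseteq> comp0" and U: "!!p. p : S ==> open (U p) & p : U p"
 shows "EX F dl. finite F & F \<subseteq> S & dl > 0 & (ALL z:S. EX p:F. ALL x:comp0. rd z x < dl --> x : U p)"
proof -
 have "ALL p:S. EX eps>0. ALL y:comp0. rd p y < eps --> y : U p" using dist_small0 U S(2) by blast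
 then obtain eps where eps: "!!p. p : S ==> eps p > 0" "!!p y. p : S ==> y : comp0 ==> rd p y < eps p ==> y : U p" by metis
 have "ALL p:S. EX B. open B & p : B & (ALL y:B. y : comp0 & rd p y < eps p / 2)" using nbhd_dist0 eps(1) S(2) by (meson half_gt_zero subsetD)
 then obtain B where B: "!!p. p : S ==> open (B p)" "!!p. p : S ==> p : B p" "!!p y. p : S ==> y : B p ==> y : comp0 & rd p y < eps p / 2" by metis
 obtain F where F: "F \<subseteq> S" "finite F" "S \<subseteq> (\<Union>p\<in>F. B p)" by (rule compactE_image[OF S(1), of S B]) (use B in auto)
 define dl where "dl = Min (insert 1 ((%p. eps p / 2) ` F))"
 have d: "dl > 0" using F(1,2) eps(1) by (auto simp: dl_def subset_eq)
 have d2: "dl <= eps p / 2" if "p : F" for p unfolding dl_def by (rule Min_le) (use F(2) that in auto)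
 have "EX p:F. ALL x:comp0. rd z x < dl --> x : U p" if z: "z : S" for z
 proof -
  obtain p where p: "p : F" "z : B p" using F(3) z by blast
  hence pS: "p : S" "p : comp0" "z : comp0" using F(1) z S(2) by blast+
  have "x : U p" if "x : comp0" "rd z x < dl" for x
  proof (rule eps(2)[OF pS(1) that(1)])
   show "rd p x < eps p" using rd_triangle[OF pS(2,3) that(1)] B(3)[OF pS(1) p(2)] d2[OF p(1)] that(2) by linarith
  qed
  thus ?thesis using p(1) by blast
 qed
 thus ?thesis using F(1,2) d by blast
qed

text \<open>The finite-distance component as a metric space, which makes total boundedness
  available. Compactness remains that of the manifold topology, and the next two lemmas connect the
  two.\<close>

sublocale M: Metric_space comp0 rd
proof (rule Metric_space.intro[OF rd_nonneg rd_sym _ rd_triangle])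
 fix x y assume "x : comp0" "y : comp0"
 thus "(rd x y = 0) = (x = y)" using rd_eq_0[of x y] rd_self[of y] by blast
qed

lemma compact_imp_mtotally_bounded:
 assumes "compact S" "S \<subseteq> comp0" shows "M.mtotally_bounded S" unfolding M.mtotally_bounded_def
proof (intro allI impI)
 fix eps :: real assume "eps > 0"
 hence "ALL p:S. EX B. open B & p : B & (ALL y:B. y : comp0 & rd p y < eps)" using nbhd_dist0 assms(2) by blast
 then obtain B where B: "!!p. p : S ==> open (B p)" "!!p. p : S ==> p : B p" "!!p y. p : S ==> y : B p ==> y : comp0 & rd p y < eps" by metis
 obtain F where F: "F \<subseteq> S" "finite F" "S \<subseteq> (\<Union>p\<in>F. B p)" by (rule compactE_image[OF assms(1), of S B]) (use B in auto)
 have "S \<subseteq> (\<Union>x\<in>F. M.mball x eps)"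
 proof
  fix z assume "z : S"
  then obtain p where p: "p : F" "z : B p" using F by blast
  hence "z : M.mball p eps" using B(3)[of p z] F(1) assms(2) by (auto simp: M.mball_def)
  thus "z : (\<Union>x\<in>F. M.mball x eps)" using p by blast
 qed
 thus "EX K. finite K & K \<subseteq> S & S \<subseteq> (\<Union>x\<in>K. M.mball x eps)" using F by blast
qed

text \<open>This is where metric completeness enters: total boundedness yields a Cauchy subsequence,
  and its limit in distance is a topological limit. Second countability turns sequential compactness
  into compactness.\<close>

lemma mtotally_bounded_imp_compact:
 assumes "closed S" "M.mtotally_bounded S" shows "compact S"
proof -
 have "seq_compact S" unfolding seq_compact_def
 proof (intro allI impI)
  fix f :: "nat => 'a" assume f: "ALL n. f n : S"
  then obtain r where r: "strict_mono r" "M.MCauchy (f \<circ> r)"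
   using assms(2) unfolding M.mtotally_bounded_sequentially by (metis image_subset_iff)
  hence in0: "f (r i) : comp0" for i by (auto simp: M.MCauchy_def)
  have "EX K. ALL i>=K. ALL j>=K. dist_g ((f \<circ> r) i) ((f \<circ> r) j) < ennreal e" if "e > 0" for e :: real
   using r(2) that in0 unfolding M.MCauchy_def by (simp add: dist_comp0 ennreal_less_iff rd_nonneg)
  then obtain x where x: "(%i. dist_g ((f \<circ> r) i) x) \<longlonglongrightarrow> 0" using complete unfolding riem_complete_def by meson
  have "(f \<circ> r) \<longlonglongrightarrow> x"
  proof (rule topological_tendstoI)
   fix B assume "open B" "x : B"
   then obtain eps where eps: "eps > 0" "!!y. dist_g x y < ennreal eps ==> y : B" using dist_small by blast
   have "\<forall>\<^sub>F i in sequentially. dist_g ((f \<circ> r) i) x < ennreal eps" by (rule order_tendstoD(2)[OF x]) (use eps in simp)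
   thus "\<forall>\<^sub>F i in sequentially. (f \<circ> r) i : B" by eventually_elim (use eps(2) dist_sym in auto)
  qed
  moreover from this have "x : S" using f closed_sequentially[OF assms(1)] by (metis comp_apply)
  ultimately show "EX l:S. EX r. strict_mono r & (f \<circ> r) \<longlonglongrightarrow> l" using r(1) by blast
 qed
 thus ?thesis using seq_compact_eq_countably_compact countably_compact_eq_compact by metis
qed

text \<open>The intermediate value theorem for the distance from x along a curve from x to y of
  length less than a + be; the rest of that curve bounds the distance to y.\<close>

lemma mid_approx:
 assumes xy: "x : comp0" "y : comp0" and a: "0 <= a" "0 < be" "a <= rd x y" "rd x y < a + be" shows "EX z:comp0. rd x z = a & rd z y <= be"
proof -
 have "dist_g x y < ennreal (a + be)" using a by (simp add: dist_comp0[OF xy] ennreal_less_iff rd_nonneg del: ennreal_plus)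
 then obtain ga where ga: "piecewise_C1_curve A ga" "ga 0 = x" "ga 1 = y" "curve_length A g ga < ennreal (a + be)" using dist_less by blast
 have cont: "continuous_on {0..1} ga" using ga(1) by (simp add: piecewise_C1_curve_def)
 have pre: "ga t : comp0" "dist_g x (ga t) + dist_g (ga t) y < ennreal (a + be)" if t: "t : {0..1}" for t
 proof -
  have le: "dist_g x (ga t) + dist_g (ga t) y <= curve_length A g ga"
  proof (cases "t : {0<..<1}")
   case True
   note s = split_curve[OF ga(1) True]
   have "dist_g x (ga t) <= curve_length A g (%s. ga (t * s))" by (rule dist_le[OF s(1)]) (use ga in auto)
   moreover have "dist_g (ga t) y <= curve_length A g (%s. ga (t + (1 - t) * s))" by (rule dist_le[OF s(2)]) (use ga in auto)
   ultimately show ?thesis unfolding s(3) by (rule add_mono)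
  next
   case False
   hence "t = 0 \<or> t = 1" using t by auto
   thus ?thesis using dist_le[OF ga(1-3)] ga(2,3) dist_self by auto
  qed
  thus l: "dist_g x (ga t) + dist_g (ga t) y < ennreal (a + be)" using ga(4) by simp
  hence "dist_g x (ga t) < top" by (metis add_increasing2 ennreal_less_top le_less_trans less_trans order_refl zero_le)
  thus "ga t : comp0" by (rule dist_finite[OF xy(1)])
 qed
 have "continuous_on {0..1} (%t. rd x (ga t))" by (rule continuous_on_compose2[OF continuous_rd[OF xy(1)] cont]) (use pre in auto)
 then obtain t where t: "t : {0..1}" "rd x (ga t) = a" using IVT'[of "%t. rd x (ga t)" 0 a 1] a ga(2,3) rd_self by auto
 have "rd x (ga t) + rd (ga t) y < a + be" using pre[OF t(1)] xy a by (simp add: dist_comp0 rd_nonneg ennreal_less_iff flip: ennreal_plus)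
 thus ?thesis using t pre(1)[OF t(1)] by (intro bexI[of _ "ga t"]) auto
qed

lemma compact_nbhd: fixes p :: 'a shows "EX B K. open B & p : B & B \<subseteq> K & compact K"
proof -
 obtain c where c: "c : A" "p : cdom c" using chart_cover by blast
 obtain R where R: "R > 0" "cball (cmap c p) R \<subseteq> cimg c" using open_contains_cball[of "cimg c"] open_cimg[OF c(1)] cmap_in[OF c(2)] by blast
 show ?thesis using open_chart_set[OF c(1) open_ball, of "cmap c p" R] compact_chart_set[OF c(1) compact_cball R(2)] c R
  by (intro exI[of _ "{x : cdom c. cmap c x : ball (cmap c p) R}"] exI[of _ "{x : cdom c. cmap c x : cball (cmap c p) R}"]) auto
qed

text \<open>The radii with compact balls form an interval from 0. Were it bounded, its supremum S
  would belong to it, by total boundedness, and then so would a larger radius, by local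
  compactness.\<close>

theorem compact_cb0: assumes "0 <= r" shows "compact (cb0 r)"
proof (rule ccontr)
 assume nc: "\<not> compact (cb0 r)"
 define J where "J = {r. 0 <= r & compact (cb0 r)}"
 have sub: "cb0 r \<subseteq> cb0 r'" if "0 <= r" "r <= r'" for r r' using that cb0_iff by auto
 have down: "r' : J" if "r'' : J" "0 <= r'" "r' <= r''" for r' r''
  using that sub[of r' r''] closed_cb0[of r'] compact_Int_closed[of "cb0 r''" "cb0 r'"] by (auto simp: J_def Int_absorb1)
 have "x = x0" if "x : cb0 0" for x using cb0_iff[of 0 x] that rd_nonneg[of x0 x] rd_eq_0[OF x0_comp0, of x] by simp
 moreover have "x0 : cb0 0" using cb0_iff[of 0] x0_comp0 rd_self by simp
 ultimately have "cb0 0 = {x0}" by blast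
 hence J0: "0 : J" by (simp add: J_def)
 have bd: "s < r" if "s : J" for s using down[OF that assms] nc by (cases "s < r") (auto simp: J_def)
 define S where "S = Sup J"
 have bdd: "bdd_above J" by (rule bdd_aboveI[of _ r]) (use bd in \<open>auto intro: less_imp_le\<close>)
 have S0: "0 <= S" unfolding S_def by (rule cSup_upper[OF J0 bdd])
 have below: "s : J" if "0 <= s" "s < S" for s
 proof -
  have "EX x:J. s < x" using that(2) less_cSup_iff[of J s] J0 bdd unfolding S_def by blast
  thus ?thesis using down that(1) by (meson less_imp_le)
 qed
 have "S : J"
 proof (cases "S = 0")
  case False
  \<comment> \<open>Every point of the S-ball lies within 2 dl of the compact ball of radius S - dl,
    so an eps/4-net of the latter is an eps-net of the former.\<close>
  have "M.mtotally_bounded (cb0 S)" unfolding M.mtotally_bounded_def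
  proof (intro allI impI)
   fix eps :: real assume eps: "eps > 0"
   define dl where "dl = min (eps / 4) (S / 2)"
   have Spos: "0 < S" using S0 False by linarith
   have dl: "dl > 0" "dl <= eps / 4" "dl <= S / 2" unfolding dl_def using eps Spos by (simp, linarith, linarith)
   have "S - dl : J" by (rule below) (use dl Spos in linarith)+
   hence cd: "compact (cb0 (S - dl))" and Sdl: "0 <= S - dl" by (auto simp: J_def)
   have tb: "M.mtotally_bounded (cb0 (S - dl))" by (rule compact_imp_mtotally_bounded[OF cd]) (use cb0_iff[OF Sdl] in auto)
   have "eps / 4 > 0" using eps by simp
   from tb[unfolded M.mtotally_bounded_def, rule_format, OF this] obtain K where K: "finite K" "K \<subseteq> cb0 (S - dl)" "cb0 (S - dl) \<subseteq> (\<Union>x\<in>K. M.mball x (eps / 4))"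
    by (elim exE conjE) (rule that)
   have "cb0 S \<subseteq> (\<Union>x\<in>K. M.mball x eps)"
   proof
    fix x assume "x : cb0 S"
    hence x: "x : comp0" "rd x0 x <= S" using cb0_iff[OF S0] by auto
    have "EX y:cb0 (S - dl). rd y x <= 2 * dl"
    proof (cases "rd x0 x <= S - dl")
     case True thus ?thesis using x cb0_iff[OF Sdl] dl rd_self[of x] by (intro bexI[of _ x]) auto
    next
     case f: False
     have "EX z:comp0. rd x0 z = S - dl & rd z x <= 2 * dl" by (rule mid_approx[OF x0_comp0 x(1)]) (use f x dl in auto)
     thus ?thesis using cb0_iff[OF Sdl] by auto
    qed
    then obtain y k where y: "y : cb0 (S - dl)" "rd y x <= 2 * dl" and k: "k : K" "y : M.mball k (eps / 4)" using K(3) by blast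
    hence "rd k x < eps" "k : comp0" using M.triangle[of k y x] x(1) dl by (auto simp: M.mball_def)
    thus "x : (\<Union>x\<in>K. M.mball x eps)" using k x(1) by (auto simp: M.mball_def)
   qed
   moreover have "K \<subseteq> cb0 S" using K(2) sub[of "S - dl" S] Sdl dl(1) by auto
   ultimately show "EX K. finite K & K \<subseteq> cb0 S & cb0 S \<subseteq> (\<Union>x\<in>K. M.mball x eps)" using K(1) by blast
  qed
  from mtotally_bounded_imp_compact[OF closed_cb0[OF S0] this] show ?thesis using S0 by (simp add: J_def)
 qed (use J0 in simp)
 hence cS: "compact (cb0 S)" by (simp add: J_def)
 \<comment> \<open>Finitely many compact neighbourhoods cover the S-ball together with a collar of
   width dl / 4, by a Lebesgue number.\<close>
 obtain B K :: "'a => 'a set" where BK: "!!p. open (B p)" "!!p. p : B p" "!!p. B p \<subseteq> K p" "!!p. compact (K p)" using compact_nbhd by metis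
 have "cb0 S \<subseteq> comp0" using cb0_iff[OF S0] by auto
 have "EX F dl. finite F & F \<subseteq> cb0 S & dl > 0 & (ALL z:cb0 S. EX p:F. ALL x:comp0. rd z x < dl --> x : B p)"
  by (rule lebesgue_number[OF cS \<open>cb0 S \<subseteq> comp0\<close>]) (use BK in blast)
 then obtain F dl where F: "finite F" "dl > 0"
  and F3: "ALL z:cb0 S. EX p:F. ALL x:comp0. rd z x < dl --> x : B p" by (elim exE conjE) (rule that)
 have "cb0 (S + dl/4) \<subseteq> (\<Union>p\<in>F. K p)"
 proof
  fix x assume "x : cb0 (S + dl/4)"
  hence x: "x : comp0" "rd x0 x <= S + dl/4" using cb0_iff[of "S + dl/4"] S0 F(2) by auto
  have "EX y:cb0 S. rd y x <= dl/2"
  proof (cases "rd x0 x <= S")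
   case True thus ?thesis using x cb0_iff[OF S0] rd_self[of x] F(2) by (intro bexI[of _ x]) auto
  next
   case f: False
   have "EX z:comp0. rd x0 z = S & rd z x <= dl/2" by (rule mid_approx[OF x0_comp0 x(1)]) (use f x F(2) S0 in auto)
   thus ?thesis using cb0_iff[OF S0] by auto
  qed
  then obtain y where y: "y : cb0 S" "rd y x <= dl/2" by blast
  then obtain p where p: "p : F" "ALL x:comp0. rd y x < dl --> x : B p" using F3 by blast
  have "rd y x < dl" using y(2) F(2) by simp
  thus "x : (\<Union>p\<in>F. K p)" using p x(1) BK(3) by blast
 qed
 moreover have "compact (\<Union>p\<in>F. K p)" using F(1) BK(4) by (intro compact_UN) auto
 ultimately have "compact (cb0 (S + dl/4))"
  using closed_cb0[of "S + dl/4"] compact_Int_closed[of "\<Union>p\<in>F. K p" "cb0 (S + dl/4)"] S0 F(2) by (simp add: Int_absorb1)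
 hence "S + dl/4 : J" using S0 F(2) by (simp add: J_def)
 hence "S + dl/4 <= S" unfolding S_def[symmetric] using cSup_upper[OF _ bdd] S_def by metis
 thus False using F(2) by simp
qed

text \<open>A limit of approximate intermediate points, found in the compact a-ball. It takes the
  place of a minimizing geodesic from x0 to x: only points at prescribed distances are ever
  needed.\<close>

lemma mid_exact:
 assumes x: "x : comp0" and a: "0 <= a" "0 <= be" "rd x0 x = a + be" shows "EX z:comp0. rd x0 z = a & rd z x = be"
proof -
 have "EX z:comp0. rd x0 z = a & rd z x <= be + inverse (real (Suc n))" for n
  by (rule mid_approx[OF x0_comp0 x]) (use a in \<open>auto intro: add_nonneg_pos\<close>)
 then obtain z where z: "!!n. z n : comp0" "!!n. rd x0 (z n) = a" "!!n. rd (z n) x <= be + inverse (real (Suc n))" by metis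
 hence "ALL n. z n : cb0 a" using cb0_iff[OF a(1)] by simp
 then obtain w r where w: "w : cb0 a" "strict_mono r" "(z \<circ> r) \<longlonglongrightarrow> w"
  using compact_imp_seq_compact[OF compact_cb0[OF a(1)]] unfolding seq_compact_def by meson
 have w0: "w : comp0" "rd x0 w <= a" using w(1) cb0_iff[OF a(1)] by auto
 have "isCont (rd x) w" using continuous_rd[OF x] open_comp0 w0(1) continuous_on_eq_continuous_at by blast
 hence "(%n. rd x ((z \<circ> r) n)) \<longlonglongrightarrow> rd x w" by (rule isCont_tendsto_compose[OF _ w(3)])
 moreover have "((%n. be + inverse (real (Suc n))) \<circ> r) \<longlonglongrightarrow> be + 0"
  by (intro LIMSEQ_subseq_LIMSEQ[OF _ w(2)] tendsto_intros LIMSEQ_inverse_real_of_nat)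
 ultimately have "rd x w <= be + 0" by (rule LIMSEQ_le) (use z(3) rd_sym in auto)
 moreover have "rd x0 x <= rd x0 w + rd w x" by (rule rd_triangle[OF x0_comp0 w0(1) x])
 ultimately show ?thesis using w0 a rd_sym[of x w] by (intro bexI[of _ w]) auto
qed

text \<open>A Lebesgue number for the cover by normal sets: one step length that works throughout
  the ball.\<close>

lemma uniform_normal:
 assumes "0 <= r" shows "EX dl>0. ALL z:cb0 r. ALL x:comp0. rd z x < dl --> (EX c B. normal_set c B & z : B & x : B)"
proof -
 obtain c B where B: "!!p. normal_set (c p) (B p)" "!!p. p : B p" using normal_set_exists by metis
 have "open (B p) & p : B p" for p using B by (simp add: normal_set_def)
 moreover have "cb0 r \<subseteq> comp0" using cb0_iff[OF assms] by auto
 ultimately have "EX F dl. finite F & F \<subseteq> cb0 r & dl > 0 & (ALL z:cb0 r. EX p:F. ALL x:comp0. rd z x < dl --> x : B p)"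
  by (intro lebesgue_number compact_cb0 assms)
 then obtain F dl where F: "dl > 0" "ALL z:cb0 r. EX p:F. ALL x:comp0. rd z x < dl --> x : B p" by (elim exE conjE) (rule that)
 have "EX c B. normal_set c B & z : B & x : B" if zx: "z : cb0 r" "x : comp0" "rd z x < dl" for z x
 proof -
  obtain p where p: "ALL x:comp0. rd z x < dl --> x : B p" using F(2) zx(1) by blast
  hence "z : B p" "x : B p" using zx cb0_iff[OF assms] rd_self[of z] F(1) by auto
  thus ?thesis using B(1) by blast
 qed
 thus ?thesis using F(1) by blast
qed

end

section \<open>Change of charts\<close>

context riem
begin

lemma transition_in:
 assumes "c : A" "d : A" "y : overlap c d" shows "transition c d y : overlap d c" "transition c d y : cimg d" "transition d c (transition c d y) = y"
 using assms by (auto simp: overlap_def transition_def cinv_cmap cimg_def)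

lemma jacobian_inverse:
 assumes c: "c : A" "d : A" and y: "y : overlap c d" shows "jacobian_cd d c (transition c d y) *v (jacobian_cd c d y *v v) = v"
proof -
 have D1: "(transition c d has_derivative (%v. jacobian_cd c d y *v v)) (at y within overlap c d)"
  using transition_derivative(1)[OF c y] dd_openin(2)[OF overlap_openin[OF c] y] by blast
 have sub: "transition c d ` overlap c d \<subseteq> cimg d" using transition_in(2)[OF c] by blast
 have D2: "(transition d c has_derivative (%v. jacobian_cd d c (transition c d y) *v v)) (at (transition c d y) within transition c d ` overlap c d)"
  by (rule has_derivative_subset[OF transition_derivative(1)[OF c(2,1) transition_in(1)[OF c y]] sub])
 have "(transition d c \<circ> transition c d has_derivative (%v. jacobian_cd d c (transition c d y) *v v) \<circ> (%v. jacobian_cd c d y *v v)) (at y within overlap c d)"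
  by (rule diff_chain_within[OF D1 D2])
 hence "((%w. w) has_derivative (%v. jacobian_cd d c (transition c d y) *v v) \<circ> (%v. jacobian_cd c d y *v v)) (at y within overlap c d)"
  by (rule has_derivative_transform[OF y, rotated]) (simp add: transition_in(3)[OF c])
 from dd_eq[OF thick_overlap[OF c] y this] dd_eq[OF thick_overlap[OF c] y has_derivative_ident]
 show ?thesis by (metis comp_apply)
qed

end

context riem_open
begin

lemma coord_overlap: assumes "c : A" "d : A" shows "coord_metric_open (overlap c d) (g c)"
proof -
 interpret C: coord_metric_open "cimg c" "g c" by (rule coord_open[OF assms(1)])
 note o = overlap_openin[OF assms]
 have "overlap c d \<subseteq> cimg c" using o openin_imp_subset by blast
 moreover have op: "open (overlap c d)" using o C.open_S openin_open_trans by blast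
 moreover have "overlap c d \<subseteq> closure (interior (overlap c d))" using op closure_subset by (simp add: interior_open)
 ultimately show ?thesis using thick_overlap[OF assms] smooth_on_openin[OF C.thick o C.smooth] C.sym C.pos by unfold_locales blast+
qed

abbreviation "hess_trans c d y u v \<equiv> dd (overlap c d) u (dd (overlap c d) v (transition c d)) y"

lemma hess_trans:
 assumes c: "c : A" "d : A" and y: "y : overlap c d"
 shows "hess_trans c d y u v = hess_trans c d y v u" "linear (%u. hess_trans c d y u v)" "linear (%v. hess_trans c d y u v)"
proof -
 interpret O: coord_metric_open "overlap c d" "g c" by (rule coord_overlap[OF c])
 have sm: "smooth_on (overlap c d) (transition c d)" by (rule transition_derivative(2)[OF c y])
 show s: "hess_trans c d y u v = hess_trans c d y v u" for u v by (rule dd_commute[OF O.thick O.fat smooth_onD[OF sm] y])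
 show l: "linear (%u. hess_trans c d y u v)" for v by (rule dd_linear[OF smooth_onD[OF smooth_on_dd[OF O.thick sm]] y])
 show "linear (%v. hess_trans c d y u v)" using l[of u] by (subst s)
qed

text \<open>Uniqueness of the Levi-Civita connection. The defect \<open>T\<close> of the law is
  symmetric in u and v; differentiating the transformation law of the metric along a line shows that
  its pairing with w is skew in v and w. Such a trilinear form vanishes.\<close>

lemma Gam_change:
 assumes c: "c : A" "d : A" and y: "y : overlap c d" shows "jacobian_cd c d y *v coord_metric.Gam (cimg c) (g c) y u v =
  coord_metric.Gam (cimg d) (g d) (transition c d y) (jacobian_cd c d y *v u) (jacobian_cd c d y *v v) + hess_trans c d y u v"
proof -
 interpret C: coord_metric_open "cimg c" "g c" by (rule coord_open[OF c(1)])
 interpret D: coord_metric_open "cimg d" "g d" by (rule coord_open[OF c(2)])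
 interpret O: coord_metric_open "overlap c d" "g c" by (rule coord_overlap[OF c])
 let ?ta = "transition c d" and ?J = "%v. jacobian_cd c d y *v v" and ?B = "hess_trans c d y"
 have sm: "smooth_on (overlap c d) ?ta" by (rule transition_derivative(2)[OF c y])
 have yC: "y : cimg c" using y overlap_eq[OF c(1)] by auto
 have yD: "?ta y : cimg d" by (rule transition_in(2)[OF c y])
 define T where "T = (%u v. ?B u v + D.Gam (?ta y) (?J u) (?J v) - ?J (C.Gam y u v))"
 have T_sym: "T u v = T v u" for u v
  unfolding T_def hess_trans(1)[OF c y, of u v] D.Gam_sym[OF yD, of "?J u" "?J v"] C.Gam_sym[OF yC, of u v] by (rule refl)
 have skew: "D.ip (?ta y) (T u v) (?J w) = - D.ip (?ta y) (?J v) (T u w)" for u v w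
 proof -
  have line: "((%s. y + s *\<^sub>R u) has_vector_derivative u) (at 0)" by (auto intro!: derivative_eq_intros simp: has_vector_derivative_def)
  have cst: "((%s::real. x) has_vector_derivative 0) (at 0)" for x :: "real^'n" by simp
  have tac: "((%s. ?ta (y + s *\<^sub>R u)) has_vector_derivative ?J u) (at 0)"
   using O.smooth_curve[OF smooth_onD[OF sm] line] y jacobian_dd[OF c y] by simp
  have Pc: "((%s. dd (overlap c d) x ?ta (y + s *\<^sub>R u)) has_vector_derivative ?B u x) (at 0)" for x
   using O.smooth_curve[OF smooth_onD[OF smooth_on_dd[OF O.thick sm]] line] y by simp
  have 1: "((%s. C.ip (y + s *\<^sub>R u) v w) has_vector_derivative (C.ip y (C.Gam y u v) w + C.ip y v (C.Gam y u w))) (at 0)"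
   using C.ip_curve[OF line _ cst cst, of v w] yC by simp
  have 2: "((%s. D.ip (?ta (y + s *\<^sub>R u)) (dd (overlap c d) v ?ta (y + s *\<^sub>R u)) (dd (overlap c d) w ?ta (y + s *\<^sub>R u))) has_vector_derivative
    (D.ip (?ta y) (?B u v + D.Gam (?ta y) (?J u) (?J v)) (?J w) + D.ip (?ta y) (?J v) (?B u w + D.Gam (?ta y) (?J u) (?J w)))) (at 0)"
   using D.ip_curve[OF tac _ Pc Pc, of v w] yD jacobian_dd[OF c y] by simp
  have "\<forall>\<^sub>F s in at 0. y + s *\<^sub>R u : overlap c d"
  proof -
   have "((%s. y + s *\<^sub>R u) \<longlongrightarrow> y + 0 *\<^sub>R u) (at 0)" by (intro tendsto_intros)
   thus ?thesis using topological_tendstoD[OF _ O.open_S] y by simp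
  qed
  hence ev: "\<forall>\<^sub>F s in at 0. D.ip (?ta (y + s *\<^sub>R u)) (dd (overlap c d) v ?ta (y + s *\<^sub>R u)) (dd (overlap c d) w ?ta (y + s *\<^sub>R u)) = C.ip (y + s *\<^sub>R u) v w"
   by eventually_elim (simp add: C.ip_def D.ip_def metric_transform[OF c] jacobian_dd[OF c])
  have at0: "D.ip (?ta (y + 0 *\<^sub>R u)) (dd (overlap c d) v ?ta (y + 0 *\<^sub>R u)) (dd (overlap c d) w ?ta (y + 0 *\<^sub>R u)) = C.ip (y + 0 *\<^sub>R u) v w"
   using y by (simp add: C.ip_def D.ip_def metric_transform[OF c] jacobian_dd[OF c])
  have "((%s. C.ip (y + s *\<^sub>R u) v w) has_vector_derivative
    (D.ip (?ta y) (?B u v + D.Gam (?ta y) (?J u) (?J v)) (?J w) + D.ip (?ta y) (?J v) (?B u w + D.Gam (?ta y) (?J u) (?J w)))) (at 0)"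
   unfolding has_vector_derivative_def by (rule has_derivative_transform_eventually[OF 2[unfolded has_vector_derivative_def] ev at0 UNIV_I])
  from vector_derivative_unique_at[OF 1 this]
  have "D.ip (?ta y) (?J (C.Gam y u v)) (?J w) + D.ip (?ta y) (?J v) (?J (C.Gam y u w)) =
   D.ip (?ta y) (?B u v + D.Gam (?ta y) (?J u) (?J v)) (?J w) + D.ip (?ta y) (?J v) (?B u w + D.Gam (?ta y) (?J u) (?J w))"
   using metric_transform[OF c y] by (simp add: C.ip_def D.ip_def)
  thus ?thesis by (simp add: T_def D.ip_simps)
 qed
 define t where "t = (%u v w. D.ip (?ta y) (T u v) (?J w))"
 have "t u v w = - t u w v" for u v w using skew[of u v w] D.ip_sym[OF yD] by (simp add: t_def)
 moreover have "t u v w = t v u w" for u v w by (simp add: t_def T_sym[of u v])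
 ultimately have t0: "t u v w = 0" for u v w by (smt (verit))
 have "D.ip (?ta y) (T u v) x = 0" for x using t0[of u v "jacobian_cd d c (?ta y) *v x"] jacobian_inverse[OF c(2,1) transition_in(1)[OF c y], of x]
  by (simp add: t_def transition_in(3)[OF c y])
 hence "T u v = 0" by (intro D.ip_eqI[OF yD]) (simp only: D.ip_simps)
 thus ?thesis by (simp add: T_def add.commute)
qed

text \<open>The second order chain rule for upper bounds; the extra term comes from the second
  derivative of the transition map. It is needed because consecutive links of the chain lie in
  normal sets of different charts.\<close>

lemma superjet_change:
 assumes c: "c : A" "d : A" and x: "x : cdom c" "x : cdom d" and jet: "superjet (%y. ph (cinv d y)) (cmap d x) q H"
 shows "superjet (%y. ph (cinv c y)) (cmap c x) (%v. q (jacobian_cd c d (cmap c x) *v v))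
  (%u v. H (jacobian_cd c d (cmap c x) *v u) (jacobian_cd c d (cmap c x) *v v) + q (hess_trans c d (cmap c x) u v))"
proof -
 interpret O: coord_metric_open "overlap c d" "g c" by (rule coord_overlap[OF c])
 let ?y = "cmap c x" and ?ta = "transition c d"
 let ?J = "%v. jacobian_cd c d ?y *v v" and ?B = "hess_trans c d ?y"
 have y: "?y : overlap c d" by (rule cmap_overlap[OF x])
 have sm: "smooth_on (overlap c d) ?ta" by (rule transition_derivative(2)[OF c y])
 have J: "?J v = dd (overlap c d) v ?ta ?y" for v by (rule jacobian_dd[OF c y])
 have q: "linear q" and H: "linear (%u. H u v)" "linear (H u)" for u v using jet by (auto simp: superjet_def)
 have lJ: "linear ?J" by (rule matrix_vector_mul_linear)
 have l1: "linear (%v. q (?J v))" using linear_compose[OF lJ q] by (simp add: o_def)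
 have "linear (%u. H (?J u) w)" for w using linear_compose[OF lJ H(1)] by (simp add: o_def)
 moreover have "linear (%u. q (?B u v))" for v using linear_compose[OF hess_trans(2)[OF c y] q] by (simp add: o_def)
 ultimately have l2: "linear (%u. H (?J u) (?J v) + q (?B u v))" for v by (intro linear_compose_add)
 have "linear (%v. H w (?J v))" for w using linear_compose[OF lJ H(2)] by (simp add: o_def)
 moreover have "linear (%v. q (?B u v))" for u using linear_compose[OF hess_trans(3)[OF c y] q] by (simp add: o_def)
 ultimately have l3: "linear (%v. H (?J u) (?J v) + q (?B u v))" for u by (intro linear_compose_add)
 obtain Cq where Cq: "Cq > 0" "!!v. \<bar>q v\<bar> <= Cq * norm v" using linear_bounded_pos[OF q] by auto
 have "bilinear H" using H by (simp add: bilinear_def)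
 then obtain Ch where Ch: "Ch > 0" "!!u v. \<bar>H u v\<bar> <= Ch * norm u * norm v" using bilinear_bounded_pos[of H] by auto
 have cy: "compact {?y}" "{?y} \<subseteq> overlap c d" using y by auto
 obtain M where M: "M > 0" "!!z v. z : {?y} ==> norm (dd (overlap c d) v ?ta z) <= M * norm v"
  "!!z v. z : {?y} ==> norm (dd (overlap c d) v (dd (overlap c d) v ?ta) z) <= M * (norm v)^2" by (rule O.dd_bound_compact[OF sm cy]) blast
 define K where "K = M + 1"
 have K: "K > 0" "M <= K" using M by (auto simp: K_def)
 have main: "EX dl>0. ALL v. norm v < dl --> ph (cinv c (?y + v)) <= ph (cinv c ?y) + q (?J v) + (H (?J v) (?J v) + q (?B v v)) / 2 + ka * (norm v)^2"
  if ka: "ka > 0" for ka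
 proof -
  \<comment> \<open>\<open>et\<close>, \<open>ka'\<close> and \<open>dl\<close> each allot a quarter
    of \<open>ka\<close> to one error: the Taylor remainder of the transition map under q, the error
    of the given jet, and half the difference of the quadratic terms.\<close>
  define et where "et = min 1 (ka / (4 * Cq))"
  have et: "et > 0" "et <= 1" "Cq * et <= ka / 4"
  proof -
   show "et > 0" "et <= 1" using ka Cq by (auto simp: et_def)
   have "et <= ka / (4 * Cq)" by (simp add: et_def)
   thus "Cq * et <= ka / 4" using Cq(1) by (simp add: field_simps)
  qed
  define ka' where "ka' = ka / (16 * K\<^sup>2)"
  have ka': "ka' > 0" "4 * ka' * K\<^sup>2 = ka / 4" using ka K by (auto simp: ka'_def)
  obtain dl1 where dl1: "dl1 > 0" "!!z v. z : {?y} ==> norm v < dl1 ==> z + v : overlap c d &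
   norm (?ta (z + v) - ?ta z - dd (overlap c d) v ?ta z - (1/2) *\<^sub>R dd (overlap c d) v (dd (overlap c d) v ?ta) z) <= et * (norm v)^2"
   by (rule O.taylor2_uniform[OF sm cy et(1)]) blast
  obtain dl2 where dl2: "dl2 > 0" "!!w. norm w < dl2 ==> ph (cinv d (cmap d x + w)) <= ph (cinv d (cmap d x)) + q w + H w w / 2 + ka' * (norm w)^2"
   using jet ka'(1) unfolding superjet_def by blast
  define dl where "dl = Min {1, dl1, dl2 / (2 * K), ka / (6 * Ch * K\<^sup>2)}"
  have dl: "dl > 0" "dl <= 1" "dl <= dl1" "dl <= dl2 / (2 * K)" "dl <= ka / (6 * Ch * K\<^sup>2)" using ka dl1 dl2 K Ch by (auto simp: dl_def)
  have "ph (cinv c (?y + v)) <= ph (cinv c ?y) + q (?J v) + (H (?J v) (?J v) + q (?B v v)) / 2 + ka * (norm v)^2" if v: "norm v < dl" for v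
  proof -
   define n where "n = norm v"
   define w where "w = ?ta (?y + v) - ?ta ?y"
   define E where "E = w - ?J v - (1/2) *\<^sub>R ?B v v"
   define R where "R = w - ?J v"
   have n: "0 <= n" "n < dl" "n <= 1" "n * n <= n" using v dl mult_left_le[of n n] by (auto simp: n_def)
   have yv: "?y + v : overlap c d" and E: "norm E <= et * n\<^sup>2" using dl1(2)[of ?y v] v dl by (auto simp: E_def w_def n_def J)
   have Jn: "norm (?J v) <= K * n" and Bn: "norm (?B v v) <= M * n\<^sup>2"
    using M(2)[of ?y v] M(3)[of ?y v] mult_right_mono[OF K(2) n(1)] by (auto simp: J n_def)
   have "R = (1/2) *\<^sub>R ?B v v + E" by (simp add: R_def E_def)
   hence "norm R <= M * n\<^sup>2 / 2 + et * n\<^sup>2" using E Bn norm_triangle_ineq[of "(1/2) *\<^sub>R ?B v v" E] by simp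
   also have "... = (M / 2 + et) * n\<^sup>2" by (simp add: algebra_simps)
   also have "... <= K * n\<^sup>2" using et(2) M(1) by (intro mult_right_mono) (auto simp: K_def)
   finally have Rn: "norm R <= K * n\<^sup>2" .
   have "K * n\<^sup>2 <= K * n" using n K by (intro mult_left_mono) (auto simp: power2_eq_square)
   hence wn: "norm w <= 2 * K * n" using norm_triangle_ineq[of "?J v" R] Jn Rn by (simp add: R_def)
   have "2 * K * n < dl2"
   proof -
    have "n < dl2 / (2 * K)" using n(2) dl(4) by simp
    thus ?thesis using K(1) by (simp add: field_simps)
   qed
   hence "ph (cinv d (cmap d x + w)) <= ph (cinv d (cmap d x)) + q w + H w w / 2 + ka' * (norm w)^2" using wn by (intro dl2(2)) simp
   moreover have "cmap d x + w = ?ta (?y + v)" by (simp add: w_def transition_cmap[OF c(1) x(1)])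
   moreover have "cinv d (?ta (?y + v)) = cinv c (?y + v)" using yv overlap_eq[OF c(1)] cinv_cmap[OF c(2)] by (simp add: transition_def)
   ultimately have up: "ph (cinv c (?y + v)) <= ph (cinv c ?y) + q w + H w w / 2 + ka' * (norm w)^2"
    by (simp add: cinv_cmap[OF c(1) x(1)] cinv_cmap[OF c(2) x(2)])
   have "q w = q (?J v) + q (?B v v) / 2 + q E"
   proof -
    have "w = ?J v + (1/2) *\<^sub>R ?B v v + E" by (simp add: E_def)
    hence "q w = q (?J v + (1/2) *\<^sub>R ?B v v + E)" by (rule arg_cong)
    thus ?thesis by (simp add: linear_add[OF q] linear_cmul[OF q])
   qed
   moreover have "q E <= ka / 4 * n\<^sup>2"
   proof -
    have "q E <= Cq * norm E" using Cq(2)[of E] by simp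
    also have "... <= Cq * (et * n\<^sup>2)" using E Cq(1) by (intro mult_left_mono) auto
    also have "... = (Cq * et) * n\<^sup>2" by simp
    also have "... <= ka / 4 * n\<^sup>2" using et(3) by (intro mult_right_mono) auto
    finally show ?thesis .
   qed
   moreover have "H w w = H (?J v) (?J v) + H (?J v) R + H R w"
   proof -
    have "H w w = H (?J v) w + H R w" using linear_add[OF H(1), of "?J v" R w] by (simp add: R_def)
    thus ?thesis using linear_add[OF H(2), of "?J v" "?J v" R] by (simp add: R_def)
   qed
   moreover have "H (?J v) R + H R w <= ka / 2 * n\<^sup>2"
   proof -
    have "H (?J v) R <= Ch * norm (?J v) * norm R" "H R w <= Ch * norm R * norm w" using Ch(2) abs_le_D1 by blast+
    moreover have "Ch * norm (?J v) * norm R <= Ch * (K * n) * (K * n\<^sup>2)" using Jn Rn Ch(1) K n by (intro mult_mono mult_left_mono) auto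
    moreover have "Ch * norm R * norm w <= Ch * (K * n\<^sup>2) * (2 * K * n)" using wn Rn Ch(1) K n by (intro mult_mono mult_left_mono) auto
    ultimately have "H (?J v) R + H R w <= (3 * Ch * K\<^sup>2 * n) * n\<^sup>2" by (simp add: power2_eq_square algebra_simps)
    also have "... <= ka / 2 * n\<^sup>2"
    proof (rule mult_right_mono)
     have "n <= ka / (6 * Ch * K\<^sup>2)" using n(2) dl(5) by simp
     thus "3 * Ch * K\<^sup>2 * n <= ka / 2" using Ch(1) K(1) by (simp add: field_simps)
    qed simp
    finally show ?thesis .
   qed
   moreover have "ka' * (norm w)^2 <= ka / 4 * n\<^sup>2"
   proof -
    have "(norm w)^2 <= (2 * K * n)^2" using wn by (rule power_mono) simp
    hence "ka' * (norm w)^2 <= ka' * (2 * K * n)^2" using ka'(1) by (simp add: mult_left_mono)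
    also have "... = (4 * ka' * K\<^sup>2) * n\<^sup>2" by (simp add: power2_eq_square)
    finally show ?thesis unfolding ka'(2) .
   qed
   moreover have "0 <= ka * n\<^sup>2" using ka by simp
   ultimately have "ph (cinv c (?y + v)) <= ph (cinv c ?y) + q (?J v) + (H (?J v) (?J v) + q (?B v v)) / 2 + ka * n\<^sup>2" using up by argo
   thus ?thesis by (simp add: n_def)
  qed
  thus ?thesis using dl(1) by blast
 qed
 show ?thesis unfolding superjet_def using l1 l2 l3 main by blast
qed

text \<open>The inhomogeneous term of \<open>Gam_change\<close> cancels the term with
  \<open>hess_trans\<close> in the transformed Hessian; the Jacobian carries orthonormal frames to
  orthonormal frames.\<close>

lemma Lam_change:
 assumes c: "c : A" "d : A" and x: "x : cdom c" "x : cdom d" and V: "C1_vector_field A V"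
  and q: "linear q" and H: "!!v. linear (%u. H u v)" "!!u. linear (H u)"
 shows "coord_metric_open.Lam (cimg c) (g c) (cmap c x) (%v. q (jacobian_cd c d (cmap c x) *v v))
  (%u v. H (jacobian_cd c d (cmap c x) *v u) (jacobian_cd c d (cmap c x) *v v) + q (hess_trans c d (cmap c x) u v)) (V c) =
  coord_metric_open.Lam (cimg d) (g d) (cmap d x) q H (V d)"
proof -
 interpret C: coord_metric_open "cimg c" "g c" by (rule coord_open[OF c(1)])
 interpret D: coord_metric_open "cimg d" "g d" by (rule coord_open[OF c(2)])
 let ?y = "cmap c x" and ?J = "%v. jacobian_cd c d (cmap c x) *v v" and ?B = "hess_trans c d (cmap c x)"
 have y: "?y : overlap c d" by (rule cmap_overlap[OF x])
 have ta: "transition c d ?y = cmap d x" by (rule transition_cmap[OF c(1) x(1)])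
 obtain e where e: "C.onb ?y e" using C.onb_exists[OF cmap_in[OF x(1)]] by blast
 have e': "D.onb (cmap d x) (%i. ?J (e i))" using e metric_transform[OF c y] unfolding C.onb_def D.onb_def C.ip_def D.ip_def ta by simp
 have lJ: "linear ?J" by (rule matrix_vector_mul_linear)
 have l1: "linear (%v. q (?J v))" using linear_compose[OF lJ q] by (simp add: o_def)
 have "linear (%u. H (?J u) w)" for w using linear_compose[OF lJ H(1)] by (simp add: o_def)
 moreover have "linear (%u. q (?B u v))" for v using linear_compose[OF hess_trans(2)[OF c y] q] by (simp add: o_def)
 ultimately have l2: "linear (%u. H (?J u) (?J v) + q (?B u v))" for v by (intro linear_compose_add)
 have "linear (%v. H w (?J v))" for w using linear_compose[OF lJ H(2)] by (simp add: o_def)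
 moreover have "linear (%v. q (?B u v))" for u using linear_compose[OF hess_trans(3)[OF c y] q] by (simp add: o_def)
 ultimately have l3: "linear (%v. H (?J u) (?J v) + q (?B u v))" for u by (intro linear_compose_add)
 have "?J (V c ?y) = V d (cmap d x)" using V c y ta by (metis C1_vector_field_def)
 thus ?thesis unfolding C.Lam_onb[OF cmap_in[OF x(1)] e l1 l2 l3] D.Lam_onb[OF cmap_in[OF x(2)] e' q H]
  by (simp add: Gam_change[OF c y] ta linear_add[OF q])
qed

end

section \<open>A superjet of the squared distance\<close>

text \<open>At a local minimum of rh / j + e the two differentials must balance, although rh itself
  may not be differentiable: the quadratic upper bound of rh, put in its place, has the same minimum
  along each line.\<close>

lemma superjet_touching:
 assumes jet: "superjet rh y q H" and e: "(e has_derivative e') (at y)" and j: "0 < j"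
  and touch: "\<forall>\<^sub>F x in nhds y. rh y / j + e y <= rh x / j + e x" shows "q v = - j * e' v"
proof -
 have q: "linear q" and H: "linear (H u)" "linear (%u. H u w)" for u w using jet by (auto simp: superjet_def)
 obtain dl where dl: "dl > 0" "!!v. norm v < dl ==> rh (y + v) <= rh y + q v + H v v / 2 + 1 * (norm v)^2"
  using jet unfolding superjet_def by (metis zero_less_one)
 define ps where "ps = (%s. (s * q v + s\<^sup>2 * (H v v / 2 + (norm v)^2)) / j + e (y + s *\<^sub>R v))"
 have "((%s. y + s *\<^sub>R v) has_derivative (%s. s *\<^sub>R v)) (at 0)" by (auto intro!: derivative_eq_intros)
 from has_derivative_compose[OF this, of e e'] e have "((%s. e (y + s *\<^sub>R v)) has_derivative (%s. e' (s *\<^sub>R v))) (at 0)" by simp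
 moreover have "(%s. e' (s *\<^sub>R v)) = (%s. e' v * s)" using linear_cmul[OF has_derivative_linear[OF e]] by auto
 ultimately have "((%s. e (y + s *\<^sub>R v)) has_real_derivative e' v) (at 0)" by (simp add: has_field_derivative_def)
 hence d: "(ps has_real_derivative q v / j + e' v) (at 0)" unfolding ps_def using j by (auto intro!: derivative_eq_intros)
 have "((%s. y + s *\<^sub>R v) \<longlongrightarrow> y + 0 *\<^sub>R v) (nhds 0)" by (intro tendsto_intros filterlim_ident)
 hence "\<forall>\<^sub>F s in nhds 0. rh y / j + e y <= rh (y + s *\<^sub>R v) / j + e (y + s *\<^sub>R v)"
  using filterlim_iff[THEN iffD1, rule_format, OF _ touch, of "%s. y + s *\<^sub>R v" "nhds 0"] by simp
 moreover have "((%s. norm (s *\<^sub>R v)) \<longlongrightarrow> norm (0 *\<^sub>R v)) (nhds (0::real))" by (intro tendsto_intros filterlim_ident)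
 from order_tendstoD(2)[OF this, of dl] dl(1) have "\<forall>\<^sub>F s in nhds 0. norm (s *\<^sub>R v) < dl" by simp
 ultimately have "\<forall>\<^sub>F s in nhds 0. ps 0 <= ps s"
 proof eventually_elim
  case (elim s)
  have "rh (y + s *\<^sub>R v) <= rh y + q (s *\<^sub>R v) + H (s *\<^sub>R v) (s *\<^sub>R v) / 2 + (norm (s *\<^sub>R v))^2" using dl(2)[OF elim(2)] by simp
  also have "... = rh y + (s * q v + s\<^sup>2 * (H v v / 2 + (norm v)^2))"
   by (simp add: linear_cmul[OF q] linear_cmul[OF H(1)] linear_cmul[OF H(2)] power_mult_distrib power2_eq_square algebra_simps)
  finally have "rh (y + s *\<^sub>R v) / j <= (rh y + (s * q v + s\<^sup>2 * (H v v / 2 + (norm v)^2))) / j" using j by (simp add: divide_right_mono)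
  thus ?case using elim(1) by (simp add: ps_def add_divide_distrib)
 qed
 then obtain eps where eps: "eps > 0" "!!s. \<bar>0 - s\<bar> < eps ==> ps 0 <= ps s" unfolding eventually_nhds_metric by (auto simp: dist_real_def)
 from DERIV_local_min[OF d eps(1)] eps(2) have "q v / j + e' v = 0" by blast
 thus ?thesis using j by (simp add: field_simps)
qed

text \<open>Equality holds for a = j b, so that the triangle inequality for squared distances loses
  nothing at the nodes of a minimizing chain with equal links.\<close>

lemma weighted_square: "0 < j ==> (a + b)\<^sup>2 <= (j + 1) * (a\<^sup>2 / j + b\<^sup>2)" for a b j :: real
proof -
 assume j: "0 < j"
 have "(j + 1) * (a\<^sup>2 / j + b\<^sup>2) - (a + b)\<^sup>2 = (a - j * b)^2 / j" using j by (simp add: field_simps power2_eq_square)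
 moreover have "0 <= (a - j * b)^2 / j" using j by simp
 ultimately show ?thesis by linarith
qed

text \<open>The normal set supplies a geodesic from the new point x to z, while the step of the
  induction runs from z to x.\<close>

lemma (in coord_metric_open) geo_reverse:
 assumes "geo z ga u w" shows "geo (z + w) (%ta. ga (1 - ta)) (%ta. - u (1 - ta)) (- w)"
proof -
 have fl: "((%s. f (1 - s)) has_vector_derivative - f') (at ta within {0..1})"
  if "(f has_vector_derivative f') (at (1 - ta) within {0..1})" for f :: "real => real^'n" and f' ta
 proof -
  have r: "((%s::real. 1 - s) has_derivative (%s. - s)) (at ta within {0..1})" by (auto intro!: derivative_eq_intros)
  have "(%s::real. 1 - s) ` {0..1} = {0..1}" by (auto simp: image_iff intro: exI[of _ "1 - _"])
  hence "(f has_derivative (%h. h *\<^sub>R f')) (at (1 - ta) within (%s. 1 - s) ` {0..1})" using that by (simp add: has_vector_derivative_def)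
  from diff_chain_within[OF r this] show ?thesis by (simp add: has_vector_derivative_def o_def)
 qed
 have in1: "1 - ta : {0..1}" if "ta : {0..1}" for ta :: real using that by auto
 have A: "ga ta : S" "(ga has_vector_derivative u ta) (at ta within {0..1})"
  "(u has_vector_derivative - Gam (ga ta) (u ta) (u ta)) (at ta within {0..1})" "norm (Gam (ga ta) (u ta) v) <= norm v / 2"
  if "ta : {0..1}" for ta v using assms that unfolding geo_def by blast+
 have G: "Gam y a (- a') = - Gam y a a'" "Gam y (- a) a' = - Gam y a a'" for y a a' using Gam_simps[of y] by (metis minus_minus scaleR_minus1_left)+
 have "((%ta. - u (1 - ta)) has_vector_derivative - Gam (ga (1 - ta)) (- u (1 - ta)) (- u (1 - ta))) (at ta within {0..1})" if "ta : {0..1}" for ta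
  using has_vector_derivative_minus[OF fl[OF A(3)[OF in1[OF that]]]] by (simp add: G)
 thus ?thesis using assms fl[OF A(2)[OF in1]] A(1,4)[OF in1] unfolding geo_def by (simp add: G)
qed

context riem_pointed
begin

abbreviation "has_jet V m c x \<equiv> EX q H. superjet (%y. (rd x0 (cinv c y))^2) (cmap c x) q H &
 coord_metric_open.Lam (cimg c) (g c) (cmap c x) q H (V c) <= 2 * m &
 coord_metric.gtr (g c) (cmap c x) (%u v. q u * q v) = 4 * (rd x0 x)^2"

text \<open>One link of the chain, with time parameters s = j and h = 1. The energy e is centred at
  the new point x and differentiated at z; as z minimizes the weighted sum of squared distances to
  x0 and x, \<open>superjet_touching\<close> forces q0 to be 2 j times the velocity at z, as
  \<open>superjet_step\<close> demands.\<close>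

lemma superjet_extend:
 assumes V: "C1_vector_field A V" and m: "m > real CARD('n)" and ric: "nonneg_ricci_V_m m A g V"
  and B: "normal_set c B" "z : B" "x : B" and zx: "z : comp0" "x : comp0" and et: "0 <= et" and j: "0 <= j"
  and r: "rd x0 z = j * et" "rd z x = et" "rd x0 x = (j + 1) * et" and jet: "0 < j ==> superjet (%y. (rd x0 (cinv c y))^2) (cmap c z) q0 H0 &
   coord_metric_open.Lam (cimg c) (g c) (cmap c z) q0 H0 (V c) <= 2 * m"
 shows "has_jet V m c x"
proof -
 have c: "c : A" "open B" "B \<subseteq> cdom c" using B(1) by (auto simp: normal_set_def)
 interpret C: coord_metric_open "cimg c" "g c" by (rule coord_open[OF c(1)])
 let ?rh = "%y. (rd x0 (cinv c y))^2"
 have xz: "x : cdom c" "z : cdom c" using B c by auto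
 have "ALL x:B. EX e. ALL y:B. normal_at c x e y" using B(1) unfolding normal_set_def by (elim conjE)
 then obtain e where E: "ALL y:B. normal_at c x e y" using B(3) by blast
 have e: "0 <= e (cmap c y)" "dist_g x y = ennreal (sqrt (e (cmap c y)))" if "y : B" for y using E that by blast+
 have e_rd: "e (cmap c y) = (rd x y)^2" "y : comp0" if "y : B" for y using e[OF that] dist_finite[OF zx(2), of y] by (auto simp: rd_def)
 obtain ga' u' where G': "C.geo (cmap c x) ga' u' (cmap c z - cmap c x)" "e (cmap c z) = C.ip (cmap c z) (u' 1) (u' 1)"
  "(e has_derivative (%v. 2 * C.ip (cmap c z) (u' 1) v)) (at (cmap c z))" using E B(2) by blast
 define ga u where "ga = (%ta. ga' (1 - ta))" and "u = (%ta. - u' (1 - ta))"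
 have G: "C.geo (cmap c z) ga u (cmap c x - cmap c z)" using C.geo_reverse[OF G'(1)] by (simp add: ga_def u_def)
 have ends: "ga 0 = cmap c z" "ga 1 = cmap c x" using G unfolding C.geo_def by simp_all
 have GD: "ga ta : cimg c" "(ga has_vector_derivative u ta) (at ta within {0..1})"
  "(u has_vector_derivative - C.Gam (ga ta) (u ta) (u ta)) (at ta within {0..1})" "norm (C.Gam (ga ta) (u ta) v) <= norm v / 2"
  if "ta : {0..1}" for ta v using G that unfolding C.geo_def by blast+
 have u0: "u 0 = - u' 1" by (simp add: u_def)
 have en: "C.ip (ga 1) (u 1) (u 1) = et\<^sup>2"
 proof -
  have "C.ip (ga 1) (u 1) (u 1) = C.ip (ga 0) (u 0) (u 0)" using C.geo_constant_speed[OF G, of 0] by simp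
  also have "... = C.ip (cmap c z) (u' 1) (u' 1)" unfolding u0 ends by (simp only: C.ip_simps minus_minus)
  also have "... = et\<^sup>2" using G'(2) e_rd(1)[OF B(2)] r(2) rd_sym[of x z] by simp
  finally show ?thesis .
 qed
 have q0: "q0 v = 2 * j / 1 * C.ip (ga 0) (u 0) v" if j0: "0 < j" for v
 proof -
  have touch: "\<forall>\<^sub>F y in nhds (cmap c z). ?rh (cmap c z) / j + e (cmap c z) <= ?rh y / j + e y"
  proof -
   have "open (cimg c \<inter> cinv c -` B)" by (rule continuous_open_preimage[OF continuous_cinv[OF c(1)] C.open_S c(2)])
   moreover have "cmap c z : cimg c \<inter> cinv c -` B" using cmap_in[OF xz(2)] cinv_cmap[OF c(1) xz(2)] B(2) by simp
   moreover have "?rh (cmap c z) / j + e (cmap c z) <= ?rh y / j + e y" if y: "y : cimg c \<inter> cinv c -` B" for y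
   proof -
    have yB: "cinv c y : B" "cmap c (cinv c y) = y" using y cmap_cinv[OF c(1)] by auto
    have "rd x0 x <= rd x0 (cinv c y) + rd x (cinv c y)" using rd_triangle[OF x0_comp0 e_rd(2)[OF yB(1)] zx(2)] rd_sym by simp
    hence "(rd x0 x)^2 <= (rd x0 (cinv c y) + rd x (cinv c y))^2" by (rule power_mono) (rule rd_nonneg)
    also have "... <= (j + 1) * ((rd x0 (cinv c y))^2 / j + (rd x (cinv c y))^2)" by (rule weighted_square[OF j0])
    also have "(rd x (cinv c y))^2 = e y" using e_rd(1)[OF yB(1)] yB(2) by simp
    finally have "((j + 1) * et)^2 <= (j + 1) * (?rh y / j + e y)" unfolding r(3) .
    moreover have "((j + 1) * et)^2 = (j + 1) * ((j * et)^2 / j + et\<^sup>2)" using j0 by (simp add: field_simps power2_eq_square)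
    ultimately have "(j * et)^2 / j + et\<^sup>2 <= ?rh y / j + e y" using j0 by (metis add_pos_pos mult_le_cancel_left_pos zero_less_one)
    thus ?thesis using e_rd(1)[OF B(2)] rd_sym[of x z] r cinv_cmap[OF c(1) xz(2)] by simp
   qed
   ultimately show ?thesis unfolding eventually_nhds by blast
  qed
  have "q0 v = - j * (2 * C.ip (cmap c z) (u' 1) v)" by (rule superjet_touching[OF _ G'(3) j0 touch]) (use jet[OF j0] in blast)
  thus ?thesis unfolding u0 ends C.ip_simps by simp
 qed
 have cu: "continuous_on {0..1} u" unfolding continuous_on_eq_continuous_within using has_vector_derivative_continuous[OF GD(3)] by blast
 have "EX q1 H1. superjet ?rh (ga 1) q1 H1 & (ALL v. q1 v = 2 * (j + 1) / 1 * C.ip (ga 1) (u 1) v) & C.Lam (ga 1) q1 H1 (V c) <= 2 * m"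
 proof (rule C.superjet_step[where s=j and h=1 and s'="j + 1" and ?rh0.0="?rh" and ?q0.0=q0 and ?H0.0=H0, OF GD(2,1,3,4) _ m _ j zero_less_one refl])
  show "Ck_on (Suc 0) (cimg c) (V c)" using V c(1) by (simp add: C1_vector_field_def)
  show "0 <= \<xi> \<bullet> (ricci_V_m m (cimg c) (g c) (V c) y *v \<xi>)" if "y : cimg c" for y \<xi> using ric c(1) that by (simp add: nonneg_ricci_V_m_def)
  show "superjet ?rh (ga 0) q0 H0 & (ALL v. q0 v = 2 * j / 1 * C.ip (ga 0) (u 0) v) & C.Lam (ga 0) q0 H0 (V c) <= 2 * m" if "0 < j"
   using jet[OF that] q0[OF that] by (simp add: ends)
  show "?rh (ga 1) = (j + 1) / j * ?rh (ga 0) + (j + 1) / 1 * integral {0..1} (%ta. C.ip (ga ta) (u ta) (u ta))"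
   unfolding C.geo_energy[OF G] ends en[unfolded ends] cinv_cmap[OF c(1) xz(1)] cinv_cmap[OF c(1) xz(2)] r
   using j by (cases "j = 0") (auto simp: field_simps power2_eq_square)
  fix sg sg' assume sg: "!!ta. ta : {0..1} ==> (sg has_vector_derivative sg' ta) (at ta within {0..1}) & sg ta : cimg c"
   and csg': "continuous_on {0..1} sg'" and sg0: "j = 0 ==> sg 0 = ga 0"
  define E where "E = integral {0..1} (%ta. C.ip (sg ta) (sg' ta) (sg' ta))"
  have d: "dist_g (cinv c (sg 0)) (cinv c (sg 1)) <= ennreal (sqrt E)"
   unfolding E_def C.ip_def by (rule chart_curve[OF c(1) _ _ csg']) (use sg in blast)+
  have csg: "continuous_on {0..1} sg" unfolding continuous_on_eq_continuous_within using has_vector_derivative_continuous sg by blast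
  have im: "sg ` {0..1} \<subseteq> cimg c" using sg by blast
  have E0: "0 <= E"
   unfolding E_def by (rule integral_nonneg[OF integrable_continuous_real[OF C.continuous_ip[OF csg im csg' csg']]]) (use im C.ip_nonneg in blast)
  have jE: "0 <= (j + 1) / j * ?rh (sg 0)" using j by simp
  show "?rh (sg 1) <= (j + 1) / j * ?rh (sg 0) + (j + 1) / 1 * integral {0..1} (%ta. C.ip (sg ta) (sg' ta) (sg' ta))" unfolding E_def[symmetric]
  proof (cases "cinv c (sg 0) : comp0")
   case True
   have one: "cinv c (sg 1) : comp0" using dist_finite[OF True] d by (meson ennreal_less_top le_less_trans)
   have dE: "rd (cinv c (sg 0)) (cinv c (sg 1)) <= sqrt E" using d E0 by (simp add: dist_comp0[OF True one])
   have "(rd x0 (cinv c (sg 1)))^2 <= (rd x0 (cinv c (sg 0)) + sqrt E)^2"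
    using rd_triangle[OF x0_comp0 True one] dE rd_nonneg by (intro power_mono) auto
   also have "... <= (j + 1) / j * ?rh (sg 0) + (j + 1) / 1 * E"
   proof (cases "j = 0")
    case True
    hence "rd x0 (cinv c (sg 0)) = 0" using r(1) sg0 ends cinv_cmap[OF c(1) xz(2)] by simp
    thus ?thesis using True E0 by simp
   next
    case False
    thus ?thesis using weighted_square[of j "rd x0 (cinv c (sg 0))" "sqrt E"] j E0 by (simp add: algebra_simps)
   qed
   finally show "?rh (sg 1) <= (j + 1) / j * ?rh (sg 0) + (j + 1) / 1 * E" .
  next
   case False
   \<comment> \<open>A varied curve may start outside the component of x0. Then it also ends
     outside, where \<open>rd\<close> is 0 by default and the inequality holds trivially.\<close>
   have "cinv c (sg 1) ~: comp0"
    using False dist_finite[of "cinv c (sg 1)" "cinv c (sg 0)"] d dist_sym[of "cinv c (sg 0)"] by (metis ennreal_less_top le_less_trans)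
   hence "rd x0 (cinv c (sg 1)) = 0" by (simp add: comp0_def rd_def less_top[symmetric])
   thus "?rh (sg 1) <= (j + 1) / j * ?rh (sg 0) + (j + 1) / 1 * E" using jE j E0 by (simp del: times_divide_eq_left)
  qed
 qed
 then obtain q1 H1 where q1: "superjet ?rh (cmap c x) q1 H1" "!!v. q1 v = 2 * (j + 1) * C.ip (cmap c x) (u 1) v" "C.Lam (cmap c x) q1 H1 (V c) <= 2 * m"
  unfolding ends by auto
 have xc: "cmap c x : cimg c" by (rule cmap_in[OF xz(1)])
 obtain b where b: "C.onb (cmap c x) b" using C.onb_exists[OF xc] by blast
 have lq: "linear (%u. q1 u * q1 v)" "linear (%u. q1 v * q1 u)" for v using q1(1) unfolding superjet_def by (auto simp: linear_iff algebra_simps)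
 have "C.gtr (cmap c x) (%u v. q1 u * q1 v) = (SUM i:UNIV. q1 (b i) * q1 (b i))" by (rule C.gtr_onb[OF xc b lq])
 also have "... = (2 * (j + 1))^2 * (SUM i:UNIV. C.ip (cmap c x) (u 1) (b i) * C.ip (cmap c x) (u 1) (b i))"
  by (simp add: q1(2) sum_distrib_left power2_eq_square algebra_simps)
 also have "(SUM i:UNIV. C.ip (cmap c x) (u 1) (b i) * C.ip (cmap c x) (u 1) (b i)) = C.ip (cmap c x) (u 1) (u 1)"
 proof -
  have "C.ip (cmap c x) (u 1) (u 1) = C.ip (cmap c x) (u 1) (SUM i:UNIV. C.ip (cmap c x) (u 1) (b i) *\<^sub>R b i)"
   using C.onb_expand[OF xc b, of "u 1"] by simp
  also have "... = (SUM i:UNIV. C.ip (cmap c x) (u 1) (C.ip (cmap c x) (u 1) (b i) *\<^sub>R b i))"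
   by (rule linear_sum) (rule linearI; simp only: C.ip_simps real_scaleR_def)
  finally show ?thesis by (simp only: C.ip_simps)
 qed
 also have "... = et\<^sup>2" using en ends by simp
 finally have "C.gtr (cmap c x) (%u v. q1 u * q1 v) = 4 * (rd x0 x)^2" unfolding r(3) by (simp add: power2_eq_square algebra_simps)
 thus ?thesis using q1 by blast
qed

text \<open>The distance is cut into k + 1 equal links shorter than the uniform normal radius. Each
  node is found from the next one by \<open>mid_exact\<close>, and the jet is carried into the chart
  of the next link before it is extended.\<close>

theorem superjet_exists:
 assumes V: "C1_vector_field A V" and m: "m > real CARD('n)" and ric: "nonneg_ricci_V_m m A g V" and x: "x : comp0"
 shows "EX c:A. x : cdom c & has_jet V m c x"
proof -
 let ?D = "rd x0 x"
 obtain dl where dl: "dl > 0" "!!z y. z : cb0 ?D ==> y : comp0 ==> rd z y < dl ==> EX c B. normal_set c B & z : B & y : B"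
  using uniform_normal[OF rd_nonneg[of x0 x]] by blast
 obtain k where k: "?D / dl < real (Suc k)" using reals_Archimedean2[of "?D / dl"] less_Suc_eq by (metis of_nat_Suc less_add_one less_trans add.commute)
 define et where "et = ?D / real (Suc k)"
 have et: "0 <= et" "et < dl" "real (Suc k) * et = ?D"
  using k dl(1) rd_nonneg[of x0 x] by (auto simp: et_def divide_less_eq mult.commute simp del: of_nat_Suc)
 have ind: "EX c:A. y : cdom c & has_jet V m c y" if "y : comp0" "rd x0 y = real (Suc j) * et" "j <= k" for y j using that
 proof (induction j arbitrary: y)
  case 0
  have D0: "x0 : cb0 ?D" using cb0_iff[OF rd_nonneg] x0_comp0 rd_self rd_nonneg by simp
  obtain c B where B: "normal_set c B" "x0 : B" "y : B" using dl(2)[OF D0 0(1)] 0(2) et(2) by auto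
  have "c : A" "y : cdom c" using B by (auto simp: normal_set_def)
  moreover have "has_jet V m c y" by (rule superjet_extend[OF V m ric B x0_comp0 0(1) et(1), of 0]) (use 0 rd_self in auto)
  ultimately show ?case by blast
 next
  case (Suc j)
  have "EX z:comp0. rd x0 z = real (Suc j) * et & rd z y = et"
   by (rule mid_exact[OF Suc.prems(1) _ et(1)]) (use Suc.prems(2) et(1) in \<open>auto simp: algebra_simps\<close>)
  then obtain z where z: "z : comp0" "rd x0 z = real (Suc j) * et" "rd z y = et" by blast
  have "real (Suc j) * et <= real (Suc k) * et" using Suc.prems(3) et(1) by (intro mult_right_mono) auto
  hence "z : cb0 ?D" using cb0_iff[OF rd_nonneg] z et(3) by simp
  then obtain c B where B: "normal_set c B" "z : B" "y : B" using dl(2)[OF _ Suc.prems(1), of z] z(3) et(2) by auto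
  have c: "c : A" "y : cdom c" "z : cdom c" using B by (auto simp: normal_set_def)
  obtain d q H where d: "d : A" "z : cdom d" and jet: "superjet (%y. (rd x0 (cinv d y))^2) (cmap d z) q H"
   "coord_metric_open.Lam (cimg d) (g d) (cmap d z) q H (V d) <= 2 * m" using Suc.IH[OF z(1,2)] Suc.prems(3) by auto
  have lin: "linear q" "!!v. linear (%u. H u v)" "!!u. linear (H u)" using jet(1) by (auto simp: superjet_def)
  have "has_jet V m c y"
  proof (rule superjet_extend[OF V m ric B z(1) Suc.prems(1) et(1), of "real (Suc j)"])
   show "rd x0 y = (real (Suc j) + 1) * et" using Suc.prems(2) by (simp add: algebra_simps)
  qed (use z superjet_change[OF c(1) d(1) c(3) d(2) jet(1)] Lam_change[OF c(1) d(1) c(3) d(2) V lin] jet(2) in auto)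
  thus ?case using c by blast
 qed
 show ?thesis by (rule ind[OF x, of k]) (use et(3) in auto)
qed

end

section \<open>The auxiliary function on the manifold\<close>

lemma derivative_right_max:
 fixes ph :: "real => real"
 assumes dl: "dl > 0" and d: "(ph has_real_derivative l) (at 0 within {0..dl})" and le: "!!s. s : {0..dl} ==> ph s <= ph 0" shows "l <= 0"
proof (rule ccontr)
 assume "\<not> l <= 0"
 then obtain d where d: "d > 0" "!!h. 0 < h ==> 0 + h : {0..dl} ==> h < d ==> ph 0 < ph (0 + h)"
  using has_real_derivative_pos_inc_right[OF d] by auto
 have "ph 0 < ph (0 + min dl (d / 2))" by (rule d(2)) (use dl d(1) in auto)
 moreover have "ph (0 + min dl (d / 2)) <= ph 0" using dl d(1) by (intro le) auto
 ultimately show False by simp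
qed

lemma second_derivative_right_max:
 fixes ph :: "real => real"
 assumes dl: "dl > 0" and d: "!!s. s : {0..dl} ==> (ph has_real_derivative ph' s) (at s within {0..dl})"
  and z: "ph' 0 = 0" and d2: "(ph' has_real_derivative l) (at 0 within {0..dl})" and le: "!!s. s : {0..dl} ==> ph s <= ph 0" shows "l <= 0"
proof (rule ccontr)
 assume "\<not> l <= 0"
 then obtain d' where d': "d' > 0" "!!h. 0 < h ==> 0 + h : {0..dl} ==> h < d' ==> ph' 0 < ph' (0 + h)"
  using has_real_derivative_pos_inc_right[OF d2] by auto
 define h where "h = min dl (d' / 2)"
 have h: "0 < h" "h <= dl" "h < d'" using dl d'(1) by (auto simp: h_def)
 have "EX x:{0<..<h}. ph h - ph 0 = (*) (ph' x) (h - 0)"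
 proof (rule mvt_simple[OF h(1)])
  fix x assume "0 <= x" "x <= h"
  thus "(ph has_derivative (*) (ph' x)) (at x within {0..h})" using has_derivative_subset[OF d[of x, unfolded has_field_derivative_def]] h by auto
 qed
 then obtain x where x: "x : {0<..<h}" "ph h - ph 0 = ph' x * h" by auto
 hence "0 < ph' x" using d'(2)[of x] h z by auto
 hence "ph 0 < ph h" using x h by (simp add: algebra_simps)
 thus False using le[of h] h by auto
qed

lemma segment_derivative:
 fixes F :: "'e::euclidean_space => real"
 assumes F: "Ck_on (Suc k) S F" and seg: "!!s. s : {0..dl} ==> y + s *\<^sub>R v : S" and s: "s : {0..dl}"
 shows "((%s. F (y + s *\<^sub>R v)) has_real_derivative dd S v F (y + s *\<^sub>R v)) (at s within {0..dl})"
proof -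
 have "((%s. y + s *\<^sub>R v) has_derivative (%s. s *\<^sub>R v)) (at s within {0..dl})" by (auto intro!: derivative_eq_intros)
 moreover have "(F has_derivative (%e. dd S e F (y + s *\<^sub>R v))) (at (y + s *\<^sub>R v) within (%s. y + s *\<^sub>R v) ` {0..dl})"
  by (rule has_derivative_subset[OF Ck_on_deriv[OF F seg[OF s]]]) (use seg in auto)
 ultimately have "(F \<circ> (%s. y + s *\<^sub>R v) has_derivative (%e. dd S e F (y + s *\<^sub>R v)) \<circ> (%s. s *\<^sub>R v)) (at s within {0..dl})"
  by (rule diff_chain_within)
 moreover have "(%e. dd S e F (y + s *\<^sub>R v)) \<circ> (%s. s *\<^sub>R v) = (*) (dd S v F (y + s *\<^sub>R v))"
  using linear_cmul[OF dd_linear[OF F seg[OF s]]] by (auto simp: mult.commute)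
 ultimately show ?thesis by (simp add: has_field_derivative_def o_def)
qed

text \<open>One-sided in s, so that it also applies at boundary points, where only segments into
  \<open>S\<close> are available.\<close>

lemma (in coord_metric) touching_above:
 assumes F: "Ck_on (Suc (Suc 0)) S F" and dl: "dl > 0" and seg: "!!s. s : {0..dl} ==> y + s *\<^sub>R v : S"
  and te: "!!s. s : {0..dl} ==> (te has_real_derivative te' s) (at s within {0..dl})" "(te' has_real_derivative te'') (at 0 within {0..dl})"
  and le: "!!s. s : {0..dl} ==> F (y + s *\<^sub>R v) - te s <= F y - te 0"
 shows "dd S v F y <= te' 0" "dd S v F y = te' 0 ==> dd S v (dd S v F) y <= te''"
proof -
 let ?ph = "%s. F (y + s *\<^sub>R v) - te s" and ?ph' = "%s. dd S v F (y + s *\<^sub>R v) - te' s"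
 have 0: "(0::real) : {0..dl}" using dl by simp
 have d: "(?ph has_real_derivative ?ph' s) (at s within {0..dl})" if "s : {0..dl}" for s
  by (intro DERIV_diff segment_derivative[OF F seg that] te(1) that)
 have le': "?ph s <= ?ph 0" if "s : {0..dl}" for s using le[OF that] by simp
 have "?ph' 0 <= 0" by (rule derivative_right_max[OF dl d[OF 0] le'])
 thus "dd S v F y <= te' 0" by simp
 have "(?ph' has_real_derivative dd S v (dd S v F) (y + 0 *\<^sub>R v) - te'') (at 0 within {0..dl})"
  by (intro DERIV_diff segment_derivative[OF Ck_on_dd[OF thick F] seg 0] te(2))
 from second_derivative_right_max[OF dl d _ this le']
 show "dd S v (dd S v F) y <= te''" if "dd S v F y = te' 0" using that by simp
qed

context heat_chart
begin

lemma continuous_Q: "continuous_on ST (%(y, t). Q t y)"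
proof -
 have dir: "continuous_on ST (%x. dd S e (%y. f (y, snd x)) (fst x))" for e
 proof (rule continuous_on_eq)
  show "continuous_on ST (dd ST (e, 0) f)" by (rule Ck_on_continuous[OF smooth_onD[OF smooth_on_dd[OF thick_ST f_smooth], of 0]])
  show "dd ST (e, 0) f x = dd S e (%y. f (y, snd x)) (fst x)" if "x : ST" for x
   using dd_slice[OF thick smooth_onD[OF f_smooth], of "fst x" "snd x"] that by (auto simp: mem_Times_iff)
 qed
 have inv: "invertible (G x)" if "x : S" for x
  unfolding invertible_left_inverse using G_inv(2)[OF that] by (metis matrix_vector_mul_assoc matrix_eq matrix_vector_mul_lid)
 have mi: "continuous_on ST (%x. matrix_inv (G (fst x)) $ i $ j)" for i j
  by (rule continuous_on_compose2[OF Ck_on_continuous[OF smooth_onD[OF smooth_on_vec_nth[OF thick smooth_on_vec_nth[OF thick smooth_on_matrix_inv[OF thick smooth inv]]], of 0]]])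
   (auto intro: continuous_intros)
 have fc: "continuous_on ST f" "continuous_on ST ft" using Ck_on_continuous[OF smooth_onD[of _ _ 0]] f_smooth smooth_ft by blast+
 have "continuous_on ST (%x. - ft x + (1 - be) * (SUM i:UNIV. SUM j:UNIV. matrix_inv (G (fst x)) $ i $ j *
   (dd S (axis i 1) (%y. f (y, snd x)) (fst x) * dd S (axis j 1) (%y. f (y, snd x)) (fst x))) + (SUM i=1..N. a i * exp ((p i - 1) * f x)))"
  by (intro continuous_intros fc dir mi)
 thus ?thesis by (rule continuous_on_eq) (auto simp: Q_def nsq_gtr gtr_def hh_def)
qed

end

lemma (in riem) nsq_change:
 fixes F :: "'a => real"
 assumes c: "c : A" "d : A" and x: "x : cdom c" "x : cdom d"
  and F: "Ck_on (Suc 0) (cimg c) (%y. F (cinv c y))" "Ck_on (Suc 0) (cimg d) (%y. F (cinv d y))"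
 shows "coord_metric.nsq (cimg c) (g c) (%y. F (cinv c y)) (cmap c x) = coord_metric.nsq (cimg d) (g d) (%y. F (cinv d y)) (cmap d x)"
proof -
 interpret C: coord_metric "cimg c" "g c" by (rule coord[OF c(1)])
 interpret D: coord_metric "cimg d" "g d" by (rule coord[OF c(2)])
 let ?y = "cmap c x" and ?z = "cmap d x" and ?J = "%v. jacobian_cd c d (cmap c x) *v v"
 let ?Fc = "%y. F (cinv c y)" and ?Fd = "%y. F (cinv d y)"
 have y: "?y : overlap c d" by (rule cmap_overlap[OF x])
 have yC: "?y : cimg c" and zD: "?z : cimg d" by (rule cmap_in[OF x(1)], rule cmap_in[OF x(2)])
 have ta: "transition c d ?y = ?z" by (rule transition_cmap[OF c(1) x(1)])
 have chain: "dd (cimg c) v ?Fc ?y = dd (cimg d) (?J v) ?Fd ?z" for v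
 proof -
  have D1: "(transition c d has_derivative ?J) (at ?y within overlap c d)"
   using transition_derivative(1)[OF c y] dd_openin(2)[OF overlap_openin[OF c] y] by blast
  have "(?Fd has_derivative (%e. dd (cimg d) e ?Fd ?z)) (at (transition c d ?y) within transition c d ` overlap c d)"
   unfolding ta by (rule has_derivative_subset[OF Ck_on_deriv[OF F(2) zD]]) (use transition_in(2)[OF c] in blast)
  from diff_chain_within[OF D1 this]
  have "(?Fc has_derivative (%e. dd (cimg d) e ?Fd ?z) \<circ> ?J) (at ?y within overlap c d)"
   by (rule has_derivative_transform[OF y, rotated]) (use overlap_eq[OF c(1)] cinv_cmap[OF c(2)] in \<open>auto simp: transition_def\<close>)
  hence "(?Fc has_derivative (%e. dd (cimg d) e ?Fd ?z) \<circ> ?J) (at ?y within cimg c)" using dd_openin(2)[OF overlap_openin[OF c] y] by blast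
  from dd_eq[OF C.thick yC this] show ?thesis by simp
 qed
 let ?X = "gradient (cimg c) (g c) ?Fc ?y" and ?Y = "gradient (cimg d) (g d) ?Fd ?z"
 have ipJ: "C.ip ?y v w = D.ip ?z (?J v) (?J w)" for v w using metric_transform[OF c y] by (simp add: C.ip_def D.ip_def ta)
 have "D.ip ?z (?J ?X) v = D.ip ?z ?Y v" for v
 proof -
  have "v = ?J (jacobian_cd d c ?z *v v)"
   using jacobian_inverse[OF c(2,1) cmap_overlap[OF x(2,1)], of v] by (simp add: transition_cmap[OF c(2) x(2)])
  moreover have "D.ip ?z (?J ?X) (?J w) = D.ip ?z ?Y (?J w)" for w
   by (simp only: ipJ[symmetric] C.ip_gradient(1)[OF F(1) yC] D.ip_gradient(1)[OF F(2) zD] chain)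
  ultimately show ?thesis by metis
 qed
 hence "?J ?X = ?Y" by (rule D.ip_eqI[OF zD])
 thus ?thesis unfolding C.nsq_def D.nsq_def ipJ by simp
qed

locale heat_mfd = riem b A g for b :: "'n::finite" and A :: "('a::{t2_space,second_countable_topology}, 'n) chart set" and g +
 fixes V :: "('a, 'n) vfield" and m be :: real and N :: nat and a p :: "nat => real" and u :: "'a => real => real"
 assumes V: "C1_vector_field A V" and m: "m > real CARD('n)" and ric: "nonneg_ricci_V_m m A g V"
  and a: "!!i. i : {1..N} ==> 0 <= a i" and p: "!!i. i : {1..N} ==> p i = 1 \<or> be <= 1 - p i" and be: "0 < be" "be < 1"
  and smooth: "smooth_in_space_time A u" and pos: "!!x t. t > 0 ==> u x t > 0" and pde: "!!x t c. t > 0 ==> c : charts_at A x ==>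
   ((%s. u x s) has_real_derivative Delta_V g V c (%z. u z t) x + (SUM i=1..N. a i * u x t powr p i)) (at t)"
begin

definition fc :: "('a, 'n) chart => (real^'n) \<times> real => real" where
 "fc c = (%(y, t). ln (u (cinv c y) t))"

lemma smooth_u: "c : A ==> smooth_on (cimg c \<times> {0<..}) (%(y, t). u (cinv c y) t)" using smooth by (simp add: smooth_in_space_time_def)

lemma heat: assumes c: "c : A" shows "heat_chart (cimg c) (g c) (V c) (fc c) m be N a p"
proof -
 interpret C: coord_metric "cimg c" "g c" by (rule coord[OF c])
 let ?U = "%(y, t). u (cinv c y) t" and ?ST = "cimg c \<times> {0::real<..}"
 have th: "thick ?ST" by (intro thick_Times C.thick thick_open open_greaterThan)
 have "smooth_on ?ST (%x. ln (?U x))" by (rule smooth_on_ln[OF th smooth_u[OF c]]) (use pos in auto)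
 moreover have "fc c = (%x. ln (?U x))" by (auto simp: fc_def fun_eq_iff)
 ultimately have sf: "smooth_on ?ST (fc c)" by simp
 have slice: "smooth_on (cimg c) (%y. F (y, t))" if "smooth_on ?ST F" "0 < t" for F :: "_ => real" and t
  using smooth_on_slice[OF C.thick open_greaterThan that(1)] that(2) by simp
 have eq: "dd ?ST (0, 1) (fc c) (y, t) = laplacian_V (cimg c) (g c) (V c) (%y. fc c (y, t)) y + C.nsq (%y. fc c (y, t)) y
   + (SUM i=1..N. a i * exp ((p i - 1) * fc c (y, t)))" if y: "y : cimg c" and t: "0 < t" for y t
 proof -
  let ?x = "cinv c y" and ?f = "%y. fc c (y, t)"
  have cx: "c : charts_at A ?x" using c cinv_in[OF c y] by (simp add: charts_at_def)
  define R where "R = Delta_V g V c (%z. u z t) ?x + (SUM i=1..N. a i * u ?x t powr p i)"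
  have up: "u ?x t > 0" by (rule pos[OF t])
  have "((%s. ln (u ?x s)) has_real_derivative R / u ?x t) (at t)"
   using DERIV_chain2[where f=ln, OF DERIV_ln_divide[OF up] pde[OF t cx]] by (simp add: R_def)
  moreover have "((%s. fc c (y, s)) has_real_derivative dd ?ST (0, 1) (fc c) (y, t)) (at t)"
   by (rule time_derivative[OF smooth_onD[OF sf] y]) (use t in auto)
  ultimately have e1: "dd ?ST (0, 1) (fc c) (y, t) = R / u ?x t" using DERIV_unique by (simp add: fc_def) blast
  have uexp: "(%z. u z t) \<circ> cinv c = (%y. exp (?f y))" using pos[OF t] by (auto simp: fc_def)
  have "Ck_on 2 (cimg c) (%y. exp (?f y))" using smooth_onD[OF slice[OF smooth_u[OF c] t]] uexp by (simp add: o_def)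
  from C.laplacian_V_chain(1)[OF smooth_onD[OF slice[OF sf t]] y DERIV_exp DERIV_exp this, of "V c"]
  have "Delta_V g V c (%z. u z t) ?x = u ?x t * (laplacian_V (cimg c) (g c) (V c) ?f y + C.nsq ?f y)"
   using uexp pos[OF t] by (simp add: Delta_V_def cmap_cinv[OF c y] fc_def algebra_simps)
  moreover have "u ?x t powr p i = u ?x t * exp ((p i - 1) * fc c (y, t))" for i using up by (simp add: fc_def powr_def algebra_simps exp_diff)
  ultimately have "R = u ?x t * (laplacian_V (cimg c) (g c) (V c) ?f y + C.nsq ?f y + (SUM i=1..N. a i * exp ((p i - 1) * fc c (y, t))))"
   by (simp add: R_def sum_distrib_left algebra_simps)
  thus ?thesis using e1 up by simp
 qed
 show ?thesis
 proof (unfold_locales)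
  show "Ck_on (Suc 0) (cimg c) (V c)" using V c by (simp add: C1_vector_field_def)
  show "0 <= \<xi> \<bullet> (ricci_V_m m (cimg c) (g c) (V c) y *v \<xi>)" if "y : cimg c" for y \<xi> using ric c that by (simp add: nonneg_ricci_V_m_def)
 qed (use sf m a p be eq in auto)
qed

definition Qc :: "('a, 'n) chart => real => real^'n => real" where
 "Qc c = heat_chart.Q (cimg c) (g c) (fc c) be N a p"

lemma Q_change:
 assumes c: "c : A" "d : A" and x: "x : cdom c" "x : cdom d" and t: "0 < t" shows "Qc c t (cmap c x) = Qc d t (cmap d x)"
proof -
 interpret C: heat_chart "cimg c" "g c" "V c" "fc c" m be N a p by (rule heat[OF c(1)])
 interpret D: heat_chart "cimg d" "g d" "V d" "fc d" m be N a p by (rule heat[OF c(2)])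
 have f: "fc c (cmap c x, s) = ln (u x s)" "fc d (cmap d x, s) = ln (u x s)" for s
  by (simp_all add: fc_def cinv_cmap[OF c(1) x(1)] cinv_cmap[OF c(2) x(2)])
 have "C.ft (cmap c x, t) = D.ft (cmap d x, t)"
  using DERIV_unique[OF C.time_f[OF cmap_in[OF x(1)] t]] D.time_f[OF cmap_in[OF x(2)] t] unfolding f by blast
 moreover have "C.nsq (%y. fc c (y, t)) (cmap c x) = D.nsq (%y. fc d (y, t)) (cmap d x)"
  using nsq_change[OF c x, of "%x. ln (u x t)"] C.f_Ck[OF t] D.f_Ck[OF t] by (simp add: fc_def)
 ultimately show ?thesis unfolding Qc_def C.Q_def D.Q_def f C.hh_def D.hh_def by simp
qed

definition Qm :: "real => 'a => real" where
 "Qm t x = (let c = SOME c. c : charts_at A x in Qc c t (cmap c x))"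

lemma Qm_eq: assumes "c : A" "x : cdom c" "0 < t" shows "Qm t x = Qc c t (cmap c x)"
proof -
 define d where "d = (SOME c. c : charts_at A x)"
 have "d : charts_at A x" unfolding d_def by (rule someI[of _ c]) (use assms in \<open>simp add: charts_at_def\<close>)
 hence "d : A" "x : cdom d" by (auto simp: charts_at_def)
 thus ?thesis unfolding Qm_def d_def[symmetric] Let_def using Q_change[of d c x t] assms by blast
qed

lemma continuous_Qm: "continuous_on (UNIV \<times> {0<..}) (%(x, t). Qm t x)"
proof -
 have "continuous_on (cdom c \<times> {0<..}) (%(x, t). Qm t x)" if c: "c : A" for c
 proof -
  interpret C: heat_chart "cimg c" "g c" "V c" "fc c" m be N a p by (rule heat[OF c])
  have "continuous_on (cdom c \<times> {0<..}) (%x. (case (cmap c (fst x), snd x :: real) of (y, t) => C.Q t y))"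
   by (rule continuous_on_compose2[OF C.continuous_Q]) (auto intro!: continuous_intros continuous_on_compose2[OF continuous_cmap[OF c]] cmap_in)
  thus ?thesis by (rule continuous_on_eq) (auto simp: Qm_eq[OF c] Qc_def)
 qed
 hence "continuous_on (\<Union>c\<in>A. cdom c \<times> {0<..}) (%(x, t). Qm t x)"
  by (intro continuous_on_open_UN open_Times chart(1) open_greaterThan)
 moreover have "(\<Union>c\<in>A. cdom c \<times> {0<..}) = UNIV \<times> {0::real<..}" using chart_cover by auto
 ultimately show ?thesis by simp
qed

end

section \<open>The Neumann boundary condition\<close>

lemma half_space_segment:
 assumes S: "openin (top_of_set (half_space b)) S" and y: "y : S" and v: "y $ b > 0 \<or> v $ b >= 0"
 obtains dl where "dl > 0" "!!s. s : {0..dl} ==> y + s *\<^sub>R v : S"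
proof -
 obtain U where U: "open U" "S = half_space b \<inter> U" using S by (auto simp: openin_open)
 have "((%s. y + s *\<^sub>R v) \<longlongrightarrow> y + 0 *\<^sub>R v) (at 0)" by (intro tendsto_intros)
 from topological_tendstoD[OF this U(1)] have e1: "\<forall>\<^sub>F s in at 0. y + s *\<^sub>R v : U" using y U(2) by simp
 have "((%s. y $ b + s * v $ b) \<longlongrightarrow> y $ b + 0 * v $ b) (at 0)" by (intro tendsto_intros)
 from order_tendstoD(1)[OF this, of 0] have e2: "y $ b > 0 ==> \<forall>\<^sub>F s in at 0. 0 < y $ b + s * v $ b" by simp
 have "\<forall>\<^sub>F s in at 0. y + s *\<^sub>R v : U & (y $ b > 0 --> 0 < y $ b + s * v $ b)"
  using e1 e2 by (cases "y $ b > 0") (auto simp: eventually_conj_iff)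
 then obtain d where d: "d > 0" "!!s. s ~= 0 ==> \<bar>s\<bar> < d ==> y + s *\<^sub>R v : U & (y $ b > 0 --> 0 < y $ b + s * v $ b)"
  unfolding eventually_at by (auto simp: dist_real_def)
 have y0: "0 <= y $ b" "y : U" using y U(2) by (auto simp: half_space_def)
 have "y + s *\<^sub>R v : S" if s: "s : {0..d/2}" for s
 proof (cases "s = 0")
  case False
  hence u: "y + s *\<^sub>R v : U" "y $ b > 0 --> 0 < y $ b + s * v $ b" using d s by auto
  have "0 <= y $ b + s * v $ b"
  proof (cases "y $ b > 0")
   case f: False
   hence "v $ b >= 0" using v by simp
   thus ?thesis using s y0(1) by auto
  qed (use u in simp)
  thus ?thesis using u U(2) by (simp add: half_space_def)
 qed (use y in simp)
 thus ?thesis using that[of "d/2"] d(1) by simp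
qed

lemma open_segment:
 fixes y :: "real^'n"
 assumes S: "open S" and y: "y : S"
 obtains dl where "dl > 0" "!!s. s : {0..dl} ==> y + s *\<^sub>R v : S"
proof -
 have "((%s. y + s *\<^sub>R v) \<longlongrightarrow> y + 0 *\<^sub>R v) (at 0)" by (intro tendsto_intros)
 from topological_tendstoD[OF this S] have "\<forall>\<^sub>F s in at 0. y + s *\<^sub>R v : S" using y by simp
 then obtain d where d: "d > 0" "!!s. s ~= 0 ==> \<bar>s\<bar> < d ==> y + s *\<^sub>R v : S" unfolding eventually_at by (auto simp: dist_real_def)
 have "y + s *\<^sub>R v : S" if "s : {0..d/2}" for s using that d y by (cases "s = 0") auto
 thus ?thesis using that[of "d/2"] d(1) by simp
qed

context coord_metric
begin

lemma cov_deriv_nab: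
 assumes W: "Ck_on (Suc 0) S W" and y: "y : S" shows "cov_deriv S G \<xi> W y = nab W y \<xi>"
proof -
 have "dd S \<xi> W y $ i = (SUM j:UNIV. \<xi> $ j * pd S j (%z. W z $ i) y)" for i
 proof -
  have "dd S e (%z. W z $ i) y = dd S e W y $ i" for e using dd_inner[OF thick W y, of e "axis i 1"] by (simp add: inner_axis)
  thus ?thesis unfolding dd_expand[OF W y, of \<xi>] pd_dd by simp
 qed
 moreover have "Gam y \<xi> (W y) $ i = (SUM j:UNIV. \<xi> $ j * (SUM l:UNIV. christoffel S G i j l y * W y $ l))" for i
  by (simp add: Gam_def sum_distrib_left algebra_simps)
 ultimately show ?thesis by (simp add: vec_eq_iff cov_deriv_def nab_def distrib_left sum.distrib)
qed

lemma inv_G_pos: assumes "y : S" shows "0 < matrix_inv (G y) $ b $ b"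
proof -
 let ?n = "matrix_inv (G y) *v axis b 1"
 have "?n ~= 0" using G_inv(1)[OF assms, of "axis b 1"] by (metis axis_eq_0_iff matrix_vector_mult_0_right zero_neq_one)
 from ip_pos[OF assms this] have "0 < axis b 1 \<bullet> ?n" by (simp add: ip_inv[OF assms])
 thus ?thesis by (simp add: inner_axis' matrix_vector_mul_component inner_axis)
qed

lemma outer_normal_eq:
 assumes "y : S" shows "outer_normal b G y = (- 1 / sqrt (matrix_inv (G y) $ b $ b)) *\<^sub>R (matrix_inv (G y) *v axis b 1)"
  "ip y (outer_normal b G y) v = - v $ b / sqrt (matrix_inv (G y) $ b $ b)" "outer_normal b G y $ b < 0"
proof -
 show 1: "outer_normal b G y = (- 1 / sqrt (matrix_inv (G y) $ b $ b)) *\<^sub>R (matrix_inv (G y) *v axis b 1)"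
  by (simp add: vec_eq_iff outer_normal_def matrix_vector_mul_component inner_axis)
 show "ip y (outer_normal b G y) v = - v $ b / sqrt (matrix_inv (G y) $ b $ b)"
  unfolding 1 by (simp only: ip_simps ip_inv[OF assms]) (simp add: inner_axis')
 show "outer_normal b G y $ b < 0" using inv_G_pos[OF assms, of b] by (simp add: outer_normal_def)
qed

lemma smooth_outer_normal: "smooth_on S (outer_normal b G)"
proof (rule smooth_on_vec[OF thick])
 fix i
 have mi: "smooth_on S (%z. matrix_inv (G z) $ i $ j)" for i j
  by (intro smooth_on_vec_nth[OF thick] smooth_on_matrix_inv[OF thick smooth invertible_G])
 have "smooth_on S (%z. (-1) * (matrix_inv (G z) $ i $ b * exp ((-1/2) * ln (matrix_inv (G z) $ b $ b))))"
  by (intro smooth_on_mult[OF thick] smooth_on_const[OF thick] mi smooth_on_exp[OF thick] smooth_on_ln[OF thick] inv_G_pos)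
 thus "smooth_on S (%z. outer_normal b G z $ i)"
 proof (rule smooth_on_cong[rotated])
  fix z assume "z : S"
  from inv_G_pos[OF this, of b] have "exp ((-1/2) * ln (matrix_inv (G z) $ b $ b)) = 1 / sqrt (matrix_inv (G z) $ b $ b)"
   by (simp add: exp_minus inverse_eq_divide ln_sqrt[symmetric])
  thus "(-1) * (matrix_inv (G z) $ i $ b * exp ((-1/2) * ln (matrix_inv (G z) $ b $ b))) = outer_normal b G z $ i" by (simp add: outer_normal_def)
 qed
qed

lemma hess_neg:
 fixes F :: "real^'n => real"
 assumes F: "Ck_on (Suc (Suc 0)) S F" and y: "y : S" shows "dd S (- v) (dd S (- v) F) y = dd S v (dd S v F) y"
proof -
 have n: "dd S (- v) F z = (-1) * dd S v F z" if "z : S" for z using linear_neg[OF dd_linear[OF F that]] by simp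
 have "dd S (- v) (dd S (- v) F) y = - dd S v (dd S (- v) F) y" using linear_neg[OF dd_linear[OF Ck_on_dd[OF thick F] y]] by simp
 also have "dd S v (dd S (- v) F) y = dd S v (%z. (-1) * dd S v F z) y" by (rule dd_cong[OF n y])
 also have "... = (-1) * dd S v (dd S v F) y" by (rule dd_eq[OF thick y]) (intro has_derivative_mult_right Ck_on_deriv[OF Ck_on_dd[OF thick F] y])
 finally show ?thesis by simp
qed

text \<open>Tangential directions can be followed both ways, so their derivatives vanish; maximality
  along the inward normal and \<open>nd\<close> settle the normal direction. With zero gradient, v
  or - v points into \<open>S\<close>, and the second derivative does not see the sign.\<close>

lemma boundary_max:
 fixes F :: "real^'n => real"
 assumes S: "openin (top_of_set (half_space b)) S" and F: "Ck_on (Suc (Suc 0)) S F" and y: "y : S"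
  and max: "!!z. z : S ==> F z <= F y" and nd: "y $ b = 0 ==> dd S (outer_normal b G y) F y <= 0" shows "dd S v F y = 0" "dd S v (dd S v F) y <= 0"
proof -
 have touch: "dd S v F y <= 0" "dd S v F y = 0 ==> dd S v (dd S v F) y <= 0" if v: "y $ b > 0 \<or> v $ b >= 0" for v
 proof -
  obtain dl where dl: "dl > 0" "!!s. s : {0..dl} ==> y + s *\<^sub>R v : S" by (rule half_space_segment[OF S y v]) blast
  from touching_above[OF F dl, of "%_. 0" "%_. 0" 0] max dl(2)
  show "dd S v F y <= 0" "dd S v F y = 0 ==> dd S v (dd S v F) y <= 0" by auto
 qed
 have lin: "linear (%v. dd S v F y)" by (rule dd_linear[OF F y])
 have neg: "dd S (- v) F y = - dd S v F y" for v by (rule linear_neg[OF lin])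
 show z: "dd S v F y = 0" for v
 proof (cases "y $ b > 0")
  case True
  thus ?thesis using touch(1)[of v] touch(1)[of "- v"] neg by auto
 next
  case False
  moreover have "0 <= y $ b" using y openin_imp_subset[OF S] by (auto simp: half_space_def)
  ultimately have y0: "y $ b = 0" by simp
  let ?\<nu> = "outer_normal b G y"
  note \<nu> = outer_normal_eq(3)[OF y, of b]
  have "dd S (- ?\<nu>) F y <= 0" using \<nu> by (intro touch(1)) simp
  hence n0: "dd S ?\<nu> F y = 0" using nd[OF y0] neg by auto
  define k where "k = v $ b / ?\<nu> $ b"
  have "(v - k *\<^sub>R ?\<nu>) $ b = 0" using \<nu> by (simp add: k_def)
  hence "dd S (v - k *\<^sub>R ?\<nu>) F y = 0" using touch(1)[of "v - k *\<^sub>R ?\<nu>"] touch(1)[of "- (v - k *\<^sub>R ?\<nu>)"] neg by (metis dual_order.eq_iff neg_le_0_iff_le neg_0_le_iff_le vector_uminus_component neg_equal_0_iff_equal)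
  thus ?thesis using n0 by (simp add: linear_diff[OF lin] linear_cmul[OF lin])
 qed
 show "dd S v (dd S v F) y <= 0"
 proof (cases "v $ b >= 0")
  case True thus ?thesis using touch(2)[of v] z by blast
 next
  case False
  hence "dd S (- v) (dd S (- v) F) y <= 0" using touch(2)[of "- v"] z by simp
  thus ?thesis by (simp add: hess_neg[OF F y])
 qed
qed

end

text \<open>By the Neumann condition xi = grad f is tangent to the boundary, and <grad f, nu> = 0
  can be differentiated along it, giving <nabla_xi grad f, nu> = - II(xi, xi). By symmetry of the
  Hessian this is half the normal derivative of |grad f|^2. The other two terms of \<open>Q\<close>
  have zero normal derivative.\<close>

lemma (in heat_chart) normal_derivative_Q:
 assumes S: "openin (top_of_set (half_space b)) S" and y: "y : S" "y $ b = 0" and t: "0 < t"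
  and neu: "!!z s. z : S ==> z $ b = 0 ==> 0 < s ==> dd S (outer_normal b G z) (%y. f (y, s)) z = 0"
  and conv: "!!\<xi>. \<xi> $ b = 0 ==> 0 <= second_ff b S G y \<xi> \<xi>" shows "dd S (outer_normal b G y) (Q t) y <= 0"
proof -
 let ?\<nu> = "outer_normal b G" and ?f = "%y. f (y, t)"
 let ?X = "gradient S G ?f"
 have C\<nu>: "Ck_on (Suc 0) S ?\<nu>" by (rule smooth_onD[OF smooth_outer_normal])
 have CX: "Ck_on (Suc 0) S ?X" by (rule Ck_gradient[OF f_Ck[OF t]])
 have "dd S (?\<nu> y) (%y. ft (y, t)) y = 0"
 proof -
  have "((%s. dd S (?\<nu> y) (%y. f (y, s)) y) has_real_derivative dd S (?\<nu> y) (%y. ft (y, t)) y) (at t)"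
   unfolding ft_def by (rule time_dd[OF f_smooth y(1) t])
  moreover have "((%s. dd S (?\<nu> y) (%y. f (y, s)) y) has_real_derivative 0) (at t)"
   by (rule has_field_derivative_transform_within_open[OF DERIV_const[of 0] open_greaterThan[of 0]]) (use t neu[OF y] in auto)
  ultimately show ?thesis by (rule DERIV_unique)
 qed
 moreover have "dd S (?\<nu> y) (%y. hh (f (y, t))) y = 0"
  using laplacian_V_chain(2)[OF f_Ck[OF t] y(1) hh_deriv hh_Ck[OF t], of "?\<nu> y"] neu[OF y t] by simp
 moreover have "dd S (?\<nu> y) (nsq ?f) y <= 0"
 proof -
  define \<xi> where "\<xi> = ?X y"
  have "ip y (?\<nu> y) \<xi> = 0" unfolding \<xi>_def using ip_gradient(2)[OF f_Ck[OF t, of "Suc 0"] y(1)] neu[OF y t] by simp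
  hence \<xi>b: "\<xi> $ b = 0" using outer_normal_eq(2)[OF y(1), of b \<xi>] inv_G_pos[OF y(1), of b] by simp
  let ?P = "%z. ip z (?X z) (?\<nu> z)"
  have CP: "Ck_on (Suc 0) S ?P" by (rule ip_smooth[OF CX C\<nu>])
  obtain dl where dl: "dl > 0" "!!s. s : {0..dl} ==> y + s *\<^sub>R \<xi> : S"
   by (rule half_space_segment[OF S y(1), of \<xi>]) (use \<xi>b in auto)
  have P0: "?P (y + s *\<^sub>R \<xi>) = 0" if "s : {0..dl}" for s
   using ip_gradient(1)[OF f_Ck[OF t, of "Suc 0"] dl(2)[OF that]] neu[OF dl(2)[OF that] _ t] \<xi>b y(2) by simp
  have d0: "((%s. ?P (y + s *\<^sub>R \<xi>)) has_real_derivative dd S \<xi> ?P y) (at 0 within {0..dl})"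
   using segment_derivative[where dl=dl and s=0, OF CP dl(2)] dl(1) by simp
  have "dd S \<xi> ?P y <= 0" by (rule derivative_right_max[OF dl(1) d0]) (use P0 P0[of 0] dl(1) in auto)
  moreover have "- dd S \<xi> ?P y <= 0" by (rule derivative_right_max[OF dl(1) DERIV_minus[OF d0]]) (use P0 P0[of 0] dl(1) in auto)
  ultimately have "dd S \<xi> ?P y = 0" by simp
  hence "ip y (nab ?X y \<xi>) (?\<nu> y) = - ip y \<xi> (nab ?\<nu> y \<xi>)" using ip_nab[OF CX C\<nu> y(1), of \<xi>] by (simp add: \<xi>_def)
  also have "ip y \<xi> (nab ?\<nu> y \<xi>) = second_ff b S G y \<xi> \<xi>"
   unfolding second_ff_def cov_deriv_nab[OF C\<nu> y(1)] using ip_sym[OF y(1), of \<xi>] by (simp add: ip_def)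
  finally have "ip y (nab ?X y \<xi>) (?\<nu> y) <= 0" using conv[OF \<xi>b] by simp
  moreover have "dd S (?\<nu> y) (nsq ?f) y = 2 * ip y (nab ?X y \<xi>) (?\<nu> y)" unfolding dd_nsq[OF f_Ck[OF t, of "Suc (Suc 0)"] y(1)]
   using nab_gradient_selfadjoint[OF f_Ck[OF t, of "Suc (Suc 0)"] y(1), of "?\<nu> y" \<xi>] ip_sym[OF y(1), of "?\<nu> y" "nab ?X y \<xi>"] by (simp add: \<xi>_def)
  ultimately show ?thesis by simp
 qed
 moreover have "dd S (?\<nu> y) (Q t) y = - dd S (?\<nu> y) (%y. ft (y, t)) y + (1 - be) * dd S (?\<nu> y) (nsq ?f) y + dd S (?\<nu> y) (%y. hh (f (y, t))) y"
 proof (rule dd_eq[OF thick y(1)])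
  have "((%y. - ft (y, t) + (1 - be) * nsq ?f y + hh (f (y, t))) has_derivative
   (%v. - dd S v (%y. ft (y, t)) y + (1 - be) * dd S v (nsq ?f) y + dd S v (%y. hh (f (y, t))) y)) (at y within S)"
   by (intro has_derivative_add has_derivative_minus has_derivative_mult_right Ck_on_deriv[OF ft_Ck[OF t, of "Suc 0"]]
     Ck_on_deriv[OF Ck_nsq[OF f_Ck[OF t, of "Suc (Suc 0)"]]] Ck_on_deriv[OF hh_Ck[OF t, of "Suc 0"]] y(1))
  thus "(Q t has_derivative
   (%v. - dd S v (%y. ft (y, t)) y + (1 - be) * dd S v (nsq ?f) y + dd S v (%y. hh (f (y, t))) y)) (at y within S)" by (simp add: Q_def[abs_def])
 qed
 ultimately show ?thesis using be by (simp add: mult_nonneg_nonpos)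
qed

section \<open>The maximum principle\<close>

text \<open>Only times up to t are compared, because the maximum may sit at the final time. Hence a
  one-sided derivative in reversed time, and an inequality.\<close>

lemma (in heat_chart) time_bound:
 assumes y: "y : S" and t: "eps < t0" "0 < t0" "t0 < t" and c: "c > 0"
  and max: "!!s. s : {t0..t} ==> Q s y - 1 / (c * (s - eps)) <= Q t y - 1 / (c * (t - eps))" shows "- (1 / (c * (t - eps)^2)) <= Qt t y"
proof -
 let ?ph = "%s. Q s y - 1 / (c * (s - eps))"
 have "((%s. 1 / (c * (s - eps))) has_real_derivative - (1 / (c * (t - eps)^2))) (at t)"
 proof -
  have "((%s. (1 / c) * inverse (s - eps)) has_real_derivative (1 / c) * - (1 * inverse ((t - eps) ^ Suc (Suc 0)))) (at t)"
   by (intro DERIV_cmult DERIV_inverse_fun) (use t in \<open>auto intro!: derivative_eq_intros\<close>)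
  thus ?thesis by (simp add: divide_inverse power2_eq_square mult.commute)
 qed
 hence "(?ph has_real_derivative Qt t y - - (1 / (c * (t - eps)^2))) (at t)" using t by (intro DERIV_diff time_Q y) auto
 hence d: "(?ph has_real_derivative Qt t y + 1 / (c * (t - eps)^2)) (at (t - 0))" by simp
 have "((%s. t - s) has_real_derivative - 1) (at 0)" by (auto intro!: derivative_eq_intros)
 from DERIV_chain2[where f="?ph", OF d this]
 have "((%s. ?ph (t - s)) has_real_derivative - (Qt t y + 1 / (c * (t - eps)^2))) (at 0 within {0..t - t0})"
  by (simp add: has_field_derivative_at_within)
 hence "- (Qt t y + 1 / (c * (t - eps)^2)) <= 0" by (rule derivative_right_max[rotated]) (use t max in auto)
 thus ?thesis by simp
qed

context heat_mfd
begin

abbreviation "cc \<equiv> 2 * (1 - be) / m"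

lemma cc_pos: "0 < cc"
proof -
 have "0 < m" using m by (meson of_nat_0_le_iff order_le_less_trans)
 thus ?thesis using be by simp
qed

lemma bounded_Qm:
 assumes "compact K" "0 < eps" obtains M where "M > 0" "!!x s. x : K ==> s : {eps..T} ==> Qm s x <= M"
proof -
 have "compact ((%(x, t). Qm t x) ` (K \<times> {eps..T}))"
  by (intro compact_continuous_image compact_Times assms compact_Icc continuous_on_subset[OF continuous_Qm]) (use assms(2) in auto)
 then obtain M where "!!z. z : (%(x, t). Qm t x) ` (K \<times> {eps..T}) ==> \<bar>z\<bar> <= M" using compact_imp_bounded bounded_real by metis
 hence "Qm s x <= max M 1" if "x : K" "s : {eps..T}" for x s using that by fastforce
 thus ?thesis using that[of "max M 1"] by simp
qed

text \<open>The barrier blows up at time \<open>eps\<close> while \<open>Qm\<close> is bounded above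
  on compact sets, so the maximum over K and the times from t0 to T is not attained at t0.\<close>

lemma barrier_maximum:
 assumes K: "compact K" "x1 : K" and B: "continuous_on K B" "!!x. x : K ==> 0 <= B x"
  and eps: "0 < eps" "eps < T" and above: "1 / (cc * (T - eps)) + B x1 <= Qm T x1"
 obtains t0 t x where "eps < t0" "t0 < t" "t <= T" "x : K" "1 / (cc * (t - eps)) + B x <= Qm t x"
  "!!y. y : K ==> Qm t y - B y <= Qm t x - B x" "!!s. s : {t0..t} ==> Qm s x - 1 / (cc * (s - eps)) <= Qm t x - 1 / (cc * (t - eps))"
proof -
 obtain M where M: "M > 0" "!!x s. x : K ==> s : {eps..T} ==> Qm s x <= M" by (rule bounded_Qm[OF K(1) eps(1)]) blast
 define c where "c = cc"
 have c: "c > 0" using cc_pos by (simp add: c_def)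
 \<comment> \<open>So small that the time part of the barrier at t0 = eps + e is at least 2 M, hence
   above every value of \<open>Qm\<close>.\<close>
 define e where "e = min ((T - eps) / 2) (1 / (2 * c * M))"
 have "e <= (T - eps) / 2" unfolding e_def by (rule min.cobounded1)
 hence e: "0 < e" "e < T - eps" "e <= 1 / (2 * c * M)" using eps c M(1) by (auto simp: e_def)
 define t0 where "t0 = eps + e"
 have t0: "eps < t0" "t0 < T" using e by (auto simp: t0_def)
 have big: "M < 1 / (c * (t0 - eps))"
 proof -
  have "e * (2 * c * M) <= 1" using e(3) c M(1) by (simp add: field_simps)
  hence "M * (c * e) <= 1 / 2" by (simp add: algebra_simps)
  hence "M * (c * e) < 1" by simp
  thus ?thesis using c e(1) by (simp add: t0_def field_simps)
 qed
 let ?Ps = "%(x, s). Qm s x - 1 / (c * (s - eps)) - B x"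
 have "continuous_on (K \<times> {t0..T}) (%z. (case z of (x, t) => Qm t x) - 1 / (c * (snd z - eps)) - B (fst z))"
  by (intro continuous_intros continuous_on_subset[OF continuous_Qm] continuous_on_compose2[OF B(1)]) (use t0 eps c in auto)
 hence "continuous_on (K \<times> {t0..T}) ?Ps" by (rule continuous_on_eq) auto
 moreover have "compact (K \<times> {t0..T})" by (intro compact_Times K compact_Icc)
 moreover have in1: "(x1, T) : K \<times> {t0..T}" using K t0 by simp
 ultimately obtain z where z: "z : K \<times> {t0..T}" "!!w. w : K \<times> {t0..T} ==> ?Ps w <= ?Ps z"
  using continuous_attains_sup[of "K \<times> {t0..T}" ?Ps] by blast
 obtain x t where xt: "z = (x, t)" by (cases z)
 have x: "x : K" and t: "t : {t0..T}" using z(1) xt by auto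
 have max: "Qm s y - 1 / (c * (s - eps)) - B y <= Qm t x - 1 / (c * (t - eps)) - B x" if "y : K" "s : {t0..T}" for y s
  using z(2)[of "(y, s)"] that xt by simp
 have ge: "0 <= Qm t x - 1 / (c * (t - eps)) - B x" using max[OF K(2), of T] t0 above by (simp add: c_def)
 have "t ~= t0"
 proof
  assume "t = t0"
  hence "Qm t x <= M" using M(2)[OF x] t0 by simp
  thus False using ge big B(2)[OF x] \<open>t = t0\<close> by simp
 qed
 hence tt: "t0 < t" "t <= T" using t by auto
 have m1: "Qm t y - B y <= Qm t x - B x" if "y : K" for y using max[OF that t] by linarith
 have m2: "Qm s x - 1 / (c * (s - eps)) <= Qm t x - 1 / (c * (t - eps))" if "s : {t0..t}" for s using max[OF x, of s] that tt by auto
 show ?thesis by (rule that[OF t0(1) tt x, folded c_def]) (use ge in simp, rule m1, assumption, rule m2)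
qed

end

lemma (in coord_metric) open_max:
 fixes F :: "real^'n => real"
 assumes S: "open S" and F: "Ck_on (Suc (Suc 0)) S F" and y: "y : S" and max: "!!z. z : S ==> F z <= F y"
 shows "dd S v F y = 0" "dd S v (dd S v F) y <= 0"
proof -
 have touch: "dd S v F y <= 0" "dd S v F y = 0 ==> dd S v (dd S v F) y <= 0" for v
 proof -
  obtain dl where dl: "dl > 0" "!!s. s : {0..dl} ==> y + s *\<^sub>R v : S" by (rule open_segment[OF S y]) blast
  from touching_above[OF F dl, of "%_. 0" "%_. 0" 0] max dl(2)
  show "dd S v F y <= 0" "dd S v F y = 0 ==> dd S v (dd S v F) y <= 0" by auto
 qed
 show z: "dd S v F y = 0" using touch(1)[of v] touch(1)[of "- v"] linear_neg[OF dd_linear[OF F y], of v] by simp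
 show "dd S v (dd S v F) y <= 0" by (rule touch(2)[OF z])
qed

lemma interior_half_space_pos:
 fixes z :: "real^'n"
 assumes "z : interior S" "S \<subseteq> half_space b" shows "0 < z $ b"
proof -
 obtain e where e: "e > 0" "ball z e \<subseteq> S" using assms(1) by (auto simp: mem_interior)
 have "z - (e / 2) *\<^sub>R axis b 1 : ball z e" using e(1) by (simp add: dist_norm)
 hence "z - (e / 2) *\<^sub>R axis b 1 : half_space b" using e(2) assms(2) by blast
 thus ?thesis using e(1) by (simp add: half_space_def)
qed

lemma (in heat_mfd) compact_bound:
 assumes comp: "compact (UNIV :: 'a set)" and conv: "convex_boundary b A g" and neu: "!!t. 0 < t ==> neumann b A g (%z. u z t)"
  and eps: "0 < eps" "eps < T" shows "Qm T x1 <= 1 / (cc * (T - eps))"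
proof (rule field_le_epsilon, rule ccontr)
 fix dl :: real assume dl: "0 < dl" and "\<not> Qm T x1 <= 1 / (cc * (T - eps)) + dl"
 hence above: "1 / (cc * (T - eps)) + dl <= Qm T x1" by simp
 obtain t0 t x where t: "eps < t0" "t0 < t" "t <= T" and ge: "1 / (cc * (t - eps)) + dl <= Qm t x"
  and mx: "!!y. y : UNIV ==> Qm t y - dl <= Qm t x - dl"
  and mt: "!!s. s : {t0..t} ==> Qm s x - 1 / (cc * (s - eps)) <= Qm t x - 1 / (cc * (t - eps))"
  by (rule barrier_maximum[OF comp UNIV_I continuous_on_const _ eps above]) (use dl in auto)
 have t0: "0 < t0" "0 < t" using t eps by auto
 obtain c where c: "c : A" "x : cdom c" using chart_cover by blast
 interpret H: heat_chart "cimg c" "g c" "V c" "fc c" m be N a p by (rule heat[OF c(1)])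
 let ?y = "cmap c x"
 have y: "?y : cimg c" by (rule cmap_in[OF c(2)])
 have Q: "Qm s x = H.Q s ?y" if "0 < s" for s using Qm_eq[OF c that] by (simp add: Qc_def)
 have max: "H.Q t z <= H.Q t ?y" if z: "z : cimg c" for z
  using mx[of "cinv c z"] Qm_eq[OF c(1) cinv_in[OF c(1) z] t0(2)] Q[OF t0(2)] by (simp add: Qc_def cmap_cinv[OF c(1) z])
 have F: "Ck_on (Suc (Suc 0)) (cimg c) (H.Q t)" by (rule H.Q_Ck[OF t0(2)])
 have "dd (cimg c) v (H.Q t) ?y = 0 & dd (cimg c) v (dd (cimg c) v (H.Q t)) ?y <= 0" for v
 proof (cases "open (cimg c)")
  case True
  thus ?thesis using H.open_max[OF True F y max] by blast
 next
  case False
  hence S: "openin (top_of_set (half_space b)) (cimg c)" using chart(3)[OF c(1)] by blast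
  have bd: "cinv c z : mfd_boundary A" "c : charts_at A (cinv c z)" if "z : cimg c" "z $ b = 0" for z
  proof -
   show ch: "c : charts_at A (cinv c z)" using c(1) cinv_in[OF c(1) that(1)] by (simp add: charts_at_def)
   have "z ~: interior (cimg c)" using interior_half_space_pos[OF _ openin_imp_subset[OF S]] that(2) by force
   thus "cinv c z : mfd_boundary A" unfolding mfd_boundary_def by (intro CollectI bexI[OF _ ch]) (simp add: cmap_cinv[OF c(1) that(1)])
  qed
  \<comment> \<open>The condition is given for u; the chain rule for u = exp f passes it to f, since
    the exponential is never 0.\<close>
  have neu': "dd (cimg c) (outer_normal b (g c) z) (%y. fc c (y, s)) z = 0" if z: "z : cimg c" "z $ b = 0" and s: "0 < s" for z s
  proof -
   let ?U = "%y. exp (fc c (y, s))"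
   have U: "(%x. u x s) \<circ> cinv c = ?U" using pos[OF s] by (auto simp: fc_def)
   have CU: "Ck_on k (cimg c) ?U" for k
    using smooth_onD[OF smooth_on_slice[OF H.thick open_greaterThan smooth_u[OF c(1)]], of s] U s by (simp add: o_def)
   have "normal_deriv b g c (%x. u x s) (cinv c z) = 0" using neu[OF s] bd[OF z] by (simp add: neumann_def)
   hence "dd (cimg c) (outer_normal b (g c) z) ?U z = 0"
    unfolding normal_deriv_def U cmap_cinv[OF c(1) z(1)] H.dd_expand[OF CU z(1), of "outer_normal b (g c) z"] H.pd_dd by simp
   thus ?thesis using H.laplacian_V_chain(2)[OF H.f_Ck[OF s] z(1) DERIV_exp DERIV_exp CU] by simp
  qed
  have "dd (cimg c) (outer_normal b (g c) ?y) (H.Q t) ?y <= 0" if y0: "?y $ b = 0"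
  proof (rule H.normal_derivative_Q[OF S y y0 t0(2) neu'])
   fix \<xi> :: "real^'n" assume "\<xi> $ b = 0"
   thus "0 <= second_ff b (cimg c) (g c) ?y \<xi> \<xi>" using conv bd[OF y y0] cinv_cmap[OF c] by (simp add: convex_boundary_def)
  qed
  thus ?thesis using H.boundary_max[OF S F y max] by blast
 qed
 hence d1: "dd (cimg c) v (H.Q t) ?y = 0" and d2: "dd (cimg c) v (dd (cimg c) v (H.Q t)) ?y <= 0" for v by blast+
 have time: "- (1 / (cc * (t - eps)^2)) <= H.Qt t ?y"
 proof (rule H.time_bound[OF y t(1) t0(1) t(2) cc_pos])
  fix s assume s: "s : {t0..t}"
  thus "H.Q s ?y - 1 / (cc * (s - eps)) <= H.Q t ?y - 1 / (cc * (t - eps))" using mt[OF s] Q[of s] Q[OF t0(2)] t0 by simp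
 qed
 have m0: "0 < m" using m by (meson of_nat_0_le_iff order_le_less_trans)
 show False
 \<comment> \<open>A spatially constant barrier: b1 = b2 = 0 with the zero jet, so the required
   strict inequality is just 0 < cc dl^2.\<close>
 proof (rule H.barrier_contradiction[of ?y t "t - eps" dl 0 0 "%_. 0" "%_ _. 0" 0 cc])
  show "- (1 / (cc * (t - eps)^2)) <= H.Qt t ?y" by (rule time)
  show "1 / (cc * (t - eps)) + dl <= H.Q t ?y" using ge Q[OF t0(2)] by simp
  show "0 * (2 * m) + 0 * (4 * 0) + 0\<^sup>2 * (4 * 0) / (2 * cc * be * dl) < cc * dl\<^sup>2" using mult_pos_pos[OF cc_pos, of "dl\<^sup>2"] dl by simp
  show "dd (cimg c) v (dd (cimg c) v (H.Q t)) ?y <= 0 * 0 + 0 * 0\<^sup>2" for v using d2 by simp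
 qed (use y t t0 dl d1 m0 in \<open>auto simp: H.gtr_def linear_zero\<close>)
qed

section \<open>The spatial barrier and the localised estimate\<close>

definition bar :: "real => real => real => real" where "bar R k r = k * R\<^sup>2 * inverse (R\<^sup>2 - r) ^ 2"
definition bar' :: "real => real => real => real" where "bar' R k r = 2 * k * R\<^sup>2 * inverse (R\<^sup>2 - r) ^ 3"
definition bar'' :: "real => real => real => real" where "bar'' R k r = 6 * k * R\<^sup>2 * inverse (R\<^sup>2 - r) ^ 4"

lemma bar_derivative:
 assumes "r < R\<^sup>2" shows "(bar R k has_real_derivative bar' R k r) (at r)" "(bar' R k has_real_derivative bar'' R k r) (at r)"
proof -
 have i: "((%r. inverse (R\<^sup>2 - r)) has_real_derivative inverse (R\<^sup>2 - r) ^ 2) (at r)"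
 proof -
  have "((%r. R\<^sup>2 - r) has_real_derivative - 1) (at r)" by (auto intro!: derivative_eq_intros)
  from DERIV_inverse_fun[OF this] assms show ?thesis by (simp add: power2_eq_square)
 qed
 from DERIV_cmult[OF DERIV_power[OF i, of 2], of "k * R\<^sup>2"] show "(bar R k has_real_derivative bar' R k r) (at r)"
  unfolding bar_def[abs_def] bar'_def by (rule DERIV_cong) (simp add: power2_eq_square power3_eq_cube)
 from DERIV_cmult[OF DERIV_power[OF i, of 3], of "2 * k * R\<^sup>2"] show "(bar' R k has_real_derivative bar'' R k r) (at r)"
  unfolding bar'_def[abs_def] bar''_def by (rule DERIV_cong) (simp add: power2_eq_square power4_eq_xxxx)
qed

lemma bar_mono:
 assumes "0 <= k" "r <= r'" "r' < R\<^sup>2" shows "bar R k r <= bar R k r'"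
proof -
 have "inverse (R\<^sup>2 - r) <= inverse (R\<^sup>2 - r')" using assms by (intro le_imp_inverse_le) auto
 hence "inverse (R\<^sup>2 - r) ^ 2 <= inverse (R\<^sup>2 - r') ^ 2" using assms by (intro power_mono) auto
 thus ?thesis unfolding bar_def using assms(1) by (intro mult_left_mono) auto
qed

lemma bar_pos:
 assumes "0 < k" "0 < R" "r < R\<^sup>2" shows "0 < bar R k r" "0 < bar' R k r" "0 < bar'' R k r"
 using assms by (simp_all add: bar_def bar'_def bar''_def)

text \<open>With D = R^2 - r and Z = k R^2 / D^4, the three terms on the left are at most 4 m, 24
  and 8 / (c be) times Z R^2, and the right side is c k Z R^2. The exponent 2 in \<open>bar\<close>
  makes these orders agree; 25 is 24 plus 1 for strictness.\<close>

lemma bar_inequality: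
 assumes R: "0 < R" "0 <= r" "r < R\<^sup>2" and c: "0 < c" "0 < be" "0 < m" and k: "c * k = 4 * m + 25 + 8 / (c * be)"
 shows "bar' R k r * (2 * m) + bar'' R k r * (4 * r) + (bar' R k r)^2 * (4 * r) / (2 * c * be * bar R k r) < c * (bar R k r)^2"
proof -
 define D where "D = R\<^sup>2 - r"
 have D: "0 < D" "D <= R\<^sup>2" using R by (auto simp: D_def)
 have k0: "0 < k" using k c by (metis add_pos_pos divide_pos_pos mult_pos_pos zero_less_mult_pos zero_less_numeral)
 define Z where "Z = k * R\<^sup>2 / D ^ 4"
 have Z: "0 < Z" using k0 R(1) D by (simp add: Z_def)
 have "bar' R k r * (2 * m) = 4 * m * Z * D" using D(1) by (simp add: bar'_def Z_def D_def[symmetric] field_simps power3_eq_cube power4_eq_xxxx)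
 also have "... <= 4 * m * Z * R\<^sup>2" using D Z c by (intro mult_left_mono) auto
 finally have 1: "bar' R k r * (2 * m) <= 4 * m * (Z * R\<^sup>2)" by (simp add: mult.assoc)
 have "bar'' R k r * (4 * r) = 24 * Z * r" using D(1) by (simp add: bar''_def Z_def D_def[symmetric] field_simps)
 also have "... <= 24 * Z * R\<^sup>2" using R Z by (intro mult_left_mono) auto
 finally have 2: "bar'' R k r * (4 * r) <= 24 * (Z * R\<^sup>2)" by simp
 have "(bar' R k r)^2 * (4 * r) / (2 * c * be * bar R k r) = 8 / (c * be) * Z * r"
  using D(1) c k0 R(1) unfolding bar'_def bar_def Z_def D_def[symmetric] by (simp add: field_simps power2_eq_square power3_eq_cube power4_eq_xxxx)
 also have "... <= 8 / (c * be) * Z * R\<^sup>2" using R Z c by (intro mult_left_mono) auto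
 finally have 3: "(bar' R k r)^2 * (4 * r) / (2 * c * be * bar R k r) <= 8 / (c * be) * (Z * R\<^sup>2)" by (simp add: mult.assoc)
 have "c * (bar R k r)^2 = c * k * (Z * R\<^sup>2)" using D(1) unfolding bar_def Z_def D_def[symmetric]
  by (simp add: field_simps power2_eq_square power4_eq_xxxx)
 also have "... = 4 * m * (Z * R\<^sup>2) + 24 * (Z * R\<^sup>2) + 8 / (c * be) * (Z * R\<^sup>2) + Z * R\<^sup>2" unfolding k by (simp add: algebra_simps)
 finally have "c * (bar R k r)^2 = 4 * m * (Z * R\<^sup>2) + 24 * (Z * R\<^sup>2) + 8 / (c * be) * (Z * R\<^sup>2) + Z * R\<^sup>2" .
 moreover have "0 < Z * R\<^sup>2" using Z R(1) by simp
 ultimately show ?thesis using 1 2 3 by linarith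
qed

locale heat_open = heat_mfd b A g V m be N a p u + riem_pointed b A g x0
 for b :: "'n::finite" and A :: "('a::{t2_space,second_countable_topology}, 'n) chart set" and g V m be N a p u x0
begin

text \<open>The barrier increases with the squared distance, so replacing the latter by its
  quadratic upper bound along a segment preserves the touching and makes the barrier smooth.
  Directions v and - v together give the first order equality; the error \<open>ka\<close> affects
  only the second order bound and is sent to 0.\<close>

lemma barrier_derivatives:
 assumes c: "c : A" "x : cdom c" and x: "x : comp0" "rd x0 x < R'" and R': "R'\<^sup>2 < R\<^sup>2" and k: "0 < k" and R: "0 < R" and t: "0 < t"
  and mx: "!!y. y : comp0 ==> rd x0 y < R' ==> Qm t y - bar R k ((rd x0 y)^2) <= Qm t x - bar R k ((rd x0 x)^2)"
  and jet: "superjet (%y. (rd x0 (cinv c y))^2) (cmap c x) q H"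
 defines "rh \<equiv> (rd x0 x)\<^sup>2"
 shows "dd (cimg c) v (Qc c t) (cmap c x) = bar' R k rh * q v"
  "dd (cimg c) v (dd (cimg c) v (Qc c t)) (cmap c x) <= bar' R k rh * H v v + bar'' R k rh * (q v)^2"
proof -
 interpret H: heat_chart "cimg c" "g c" "V c" "fc c" m be N a p by (rule heat[OF c(1)])
 let ?y = "cmap c x"
 have y: "?y : cimg c" by (rule cmap_in[OF c(2)])
 have Qc: "Qc c = H.Q" by (simp add: Qc_def)
 have F: "Ck_on (Suc (Suc 0)) (cimg c) (Qc c t)" unfolding Qc by (rule H.Q_Ck[OF t])
 have q: "linear q" and lH: "linear (%u. H u w)" "linear (H u)" for u w using jet by (auto simp: superjet_def)
 have rhR: "rh < R\<^sup>2" using power_strict_mono[OF x(2) rd_nonneg, of 2] R' by (simp add: rh_def)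
 have "open (comp0 \<inter> rd x0 -` {..<R'})" by (rule continuous_open_preimage[OF continuous_rd[OF x0_comp0] open_comp0 open_lessThan])
 hence W: "open (cimg c \<inter> cinv c -` (comp0 \<inter> rd x0 -` {..<R'}))" (is "open ?W")
  by (rule continuous_open_preimage[OF continuous_cinv[OF c(1)] open_cimg[OF c(1)]])
 have yW: "?y : ?W" using y x cinv_cmap[OF c] by simp
 have both: "dd (cimg c) v (Qc c t) ?y <= bar' R k rh * q v"
  "dd (cimg c) v (Qc c t) ?y = bar' R k rh * q v ==>
   dd (cimg c) v (dd (cimg c) v (Qc c t)) ?y <= bar' R k rh * (H v v + 2 * ka * (norm v)^2) + bar'' R k rh * (q v)^2" if ka: "0 < ka" for v ka
 proof -
  define al where "al = (%s. rh + (s * q v + s\<^sup>2 * (H v v / 2 + ka * (norm v)^2)))"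
  define al' where "al' = (%s. q v + 2 * s * (H v v / 2 + ka * (norm v)^2))"
  have dal: "(al has_real_derivative al' s) (at s within X)" for s X unfolding al_def al'_def by (auto intro!: derivative_eq_intros)
  have dal': "(al' has_real_derivative 2 * (H v v / 2 + ka * (norm v)^2)) (at s within X)" for s X
   unfolding al'_def by (auto intro!: derivative_eq_intros)
  have al0: "al 0 = rh" "al' 0 = q v" by (simp_all add: al_def al'_def)
  obtain dl1 where dl1: "dl1 > 0" "!!s. s : {0..dl1} ==> ?y + s *\<^sub>R v : ?W" by (rule open_segment[OF W yW]) blast
  obtain dl2 where dl2: "dl2 > 0" "!!w. norm w < dl2 ==> (rd x0 (cinv c (?y + w)))\<^sup>2 <= (rd x0 (cinv c ?y))^2 + q w + H w w / 2 + ka * (norm w)^2"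
   using jet ka unfolding superjet_def by blast
  have "isCont al 0" using dal[of 0 UNIV] by (rule DERIV_isCont)
  hence "al \<midarrow>0\<rightarrow> al 0" by (simp add: isCont_def)
  from order_tendstoD(2)[OF this, of "R\<^sup>2"] rhR al0 have "\<forall>\<^sub>F s in at 0. al s < R\<^sup>2" by simp
  then obtain dl3 where dl3: "dl3 > 0" "!!s. s ~= 0 ==> \<bar>s\<bar> < dl3 ==> al s < R\<^sup>2" unfolding eventually_at by (auto simp: dist_real_def)
  define dl where "dl = min dl1 (min (dl2 / (2 * (norm v + 1))) (dl3 / 2))"
  have np: "0 < norm v + 1" by (simp add: add_nonneg_pos)
  have dl: "dl > 0" "dl <= dl1" "dl <= dl2 / (2 * (norm v + 1))" "dl < dl3"
   using dl1(1) dl3(1) divide_pos_pos[OF dl2(1), of "2 * (norm v + 1)"] np unfolding dl_def by (auto simp del: distrib_left_numeral)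
  have alR: "al s < R\<^sup>2" if "s : {0..dl}" for s using dl3(2)[of s] that dl(4) al0 rhR by (cases "s = 0") auto
  have seg: "?y + s *\<^sub>R v : cimg c" if "s : {0..dl}" for s using dl1(2)[of s] that dl(2) by auto
  have d1: "((%s. bar R k (al s)) has_real_derivative bar' R k (al s) * al' s) (at s within {0..dl})" if "s : {0..dl}" for s
   by (rule DERIV_chain2[OF bar_derivative(1)[OF alR[OF that]] dal])
  have "((%s. bar' R k (al s)) has_real_derivative bar'' R k (al 0) * al' 0) (at 0 within {0..dl})"
   by (rule DERIV_chain2[OF bar_derivative(2)[OF alR] dal]) (use dl(1) in auto)
  from DERIV_mult[OF this dal'[of 0 "{0..dl}"]]
  have d2: "((%s. bar' R k (al s) * al' s) has_real_derivative
   (bar' R k rh * (H v v + 2 * ka * (norm v)^2) + bar'' R k rh * (q v)^2)) (at 0 within {0..dl})"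
   by (rule DERIV_cong) (simp add: al0 power2_eq_square algebra_simps)
  have le: "Qc c t (?y + s *\<^sub>R v) - bar R k (al s) <= Qc c t ?y - bar R k (al 0)" if s: "s : {0..dl}" for s
  proof -
   let ?z = "?y + s *\<^sub>R v"
   have z: "?z : cimg c" "cinv c ?z : comp0" "rd x0 (cinv c ?z) < R'" using dl1(2)[of s] s dl(2) by auto
   have "s * norm v <= dl2 / (2 * (norm v + 1)) * (norm v + 1)" using s dl(3) by (intro mult_mono) auto
   also have "... = dl2 / 2"
   proof -
    have "z / (2 * w) * w = z / 2" if "0 < w" for z w :: real using that by simp
    from this[OF np] show ?thesis .
   qed
   also have "... < dl2" using dl2(1) by simp
   finally have "norm (s *\<^sub>R v) < dl2" using s by simp
   from dl2(2)[OF this] have "(rd x0 (cinv c ?z))^2 <= al s"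
    using s by (simp add: al_def rh_def cinv_cmap[OF c] linear_cmul[OF q] linear_cmul[OF lH(1)] linear_cmul[OF lH(2)] power_mult_distrib power2_eq_square algebra_simps)
   hence "bar R k ((rd x0 (cinv c ?z))^2) <= bar R k (al s)" using k by (intro bar_mono alR[OF s]) auto
   thus ?thesis using mx[OF z(2,3)] Qm_eq[OF c(1) cinv_in[OF c(1) z(1)] t] Qm_eq[OF c t] by (simp add: cmap_cinv[OF c(1) z(1)] al0 rh_def)
  qed
  note T = H.touching_above[OF F dl(1) seg d1 d2 le]
  show "dd (cimg c) v (Qc c t) ?y <= bar' R k rh * q v" using T(1) by (simp add: al0)
  show "dd (cimg c) v (dd (cimg c) v (Qc c t)) ?y <= bar' R k rh * (H v v + 2 * ka * (norm v)^2) + bar'' R k rh * (q v)^2"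
   if "dd (cimg c) v (Qc c t) ?y = bar' R k rh * q v" using T(2) that by (simp add: al0)
 qed
 show first: "dd (cimg c) v (Qc c t) ?y = bar' R k rh * q v" for v
  using both(1)[OF zero_less_one, of v] both(1)[OF zero_less_one, of "- v"] linear_neg[OF dd_linear[OF F y], of v] linear_neg[OF q, of v] by simp
 show "dd (cimg c) v (dd (cimg c) v (Qc c t)) ?y <= bar' R k rh * H v v + bar'' R k rh * (q v)^2"
 proof (rule field_le_epsilon)
  fix e :: real assume e: "0 < e"
  define ka where "ka = e / (2 * (bar' R k rh * (norm v)^2 + 1))"
  have b0: "0 <= bar' R k rh * (norm v)^2" using bar_pos(2)[OF k R rhR] by simp
  hence ka: "0 < ka" using e by (simp add: ka_def)
  have "2 * (z / (2 * w)) = z / w" for z w :: real by simp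
  hence "2 * ka = e / (bar' R k rh * (norm v)^2 + 1)" unfolding ka_def .
  hence "bar' R k rh * (2 * ka * (norm v)^2) = e * ((bar' R k rh * (norm v)^2) / (bar' R k rh * (norm v)^2 + 1))" by simp
  also have "... <= e * 1" using e b0 by (intro mult_left_mono) (auto simp: divide_le_eq)
  finally show "dd (cimg c) v (dd (cimg c) v (Qc c t)) ?y <= bar' R k rh * H v v + bar'' R k rh * (q v)^2 + e"
   using both(2)[OF ka first[of v]] by (simp add: distrib_left)
 qed
qed

text \<open>The balls are centred at the point where the bound is wanted, so the barrier there
  contributes only k / R^2.\<close>

lemma open_bound:
 assumes R: "0 < R" and eps: "0 < eps" "eps < T" shows "Qm T x0 <= 1 / (cc * (T - eps)) + (4 * m + 25 + 8 / (cc * be)) / cc / R\<^sup>2"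
proof (rule ccontr)
 assume neg: "\<not> ?thesis"
 have m0: "0 < m" using m by (meson of_nat_0_le_iff order_le_less_trans)
 define k where "k = (4 * m + 25 + 8 / (cc * be)) / cc"
 have "0 < 4 * m + 25 + 8 / (cc * be)" using m0 divide_nonneg_pos[OF _ mult_pos_pos[OF cc_pos be(1)], of 8] by linarith
 hence k: "0 < k" "cc * k = 4 * m + 25 + 8 / (cc * be)" using cc_pos unfolding k_def by (metis divide_pos_pos, metis nonzero_mult_div_cancel_left less_irrefl times_divide_eq_right)
 obtain M where M: "M > 0" "!!x s. x : cb0 R ==> s : {eps..T} ==> Qm s x <= M"
  by (rule bounded_Qm[where T=T, OF compact_cb0[OF less_imp_le[OF R]] eps(1)]) blast
 \<comment> \<open>D = R^2 - R'^2 is small enough for the barrier at distance R' to exceed the bound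
   M for \<open>Qm\<close>. The maximum over the compact R'-ball therefore lies at distance less
   than R'.\<close>
 define D where "D = min (R\<^sup>2 / 2) (sqrt (k * R\<^sup>2 / (2 * M)))"
 have pos2: "0 < k * R\<^sup>2 / (2 * M)" using k R M by simp
 have D: "0 < D" "D <= R\<^sup>2 / 2" "D <= sqrt (k * R\<^sup>2 / (2 * M))" using R pos2 by (auto simp: D_def)
 define R' where "R' = sqrt (R\<^sup>2 - D)"
 have "D < R\<^sup>2" using D(1,2) by simp
 hence R': "0 < R'" "R'\<^sup>2 = R\<^sup>2 - D" by (auto simp: R'_def)
 have R'R: "R'\<^sup>2 < R\<^sup>2" "R' <= R" using R' D(1) R power2_le_imp_le[of R' R] by auto
 have big: "M < bar R k (R'\<^sup>2)"
 proof -
  have "D\<^sup>2 <= k * R\<^sup>2 / (2 * M)" using power_mono[OF D(3), of 2] D(1) pos2 by simp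
  hence "2 * M * D\<^sup>2 <= k * R\<^sup>2" using M(1) by (simp add: field_simps)
  moreover have "M * D\<^sup>2 < 2 * M * D\<^sup>2" using M(1) D(1) by simp
  ultimately have "M * D\<^sup>2 < k * R\<^sup>2" by simp
  thus ?thesis unfolding bar_def R'(2) using D(1) by (simp add: field_simps)
 qed
 let ?B = "%x. bar R k ((rd x0 x)^2)"
 have cb: "x : comp0 & rd x0 x <= R'" if "x : cb0 R'" for x using cb0_iff[of R' x] that R'(1) by simp
 have sq: "(rd x0 x)^2 < R\<^sup>2" if "rd x0 x <= R'" for x using power_mono[OF that rd_nonneg, of 2] R'R(1) by simp
 have x00: "x0 : cb0 R'" using cb0_iff[of R' x0] x0_comp0 rd_self R'(1) by simp
 have "continuous_on (cb0 R') (rd x0)" by (rule continuous_on_subset[OF continuous_rd[OF x0_comp0]]) (use cb in blast)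
 hence cB: "continuous_on (cb0 R') ?B" unfolding bar_def by (intro continuous_intros) (use sq cb in force)+
 have B0: "0 <= ?B x" if "x : cb0 R'" for x using bar_pos(1)[OF k(1) R sq] cb[OF that] by (simp add: less_imp_le)
 have "?B x0 = k / R\<^sup>2" using R by (simp add: bar_def rd_self field_simps power2_eq_square)
 hence above: "1 / (cc * (T - eps)) + ?B x0 <= Qm T x0" using neg by (simp add: k_def)
 have cK: "compact (cb0 R')" using compact_cb0 R'(1) by simp
 obtain t0 t x where t: "eps < t0" "t0 < t" "t <= T" and xK: "x : cb0 R'" and ge: "1 / (cc * (t - eps)) + ?B x <= Qm t x"
  and mx: "!!y. y : cb0 R' ==> Qm t y - ?B y <= Qm t x - ?B x"
  and mt: "!!s. s : {t0..t} ==> Qm s x - 1 / (cc * (s - eps)) <= Qm t x - 1 / (cc * (t - eps))"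
  by (rule barrier_maximum[OF cK x00 cB B0 eps above]) blast+
 have t0: "0 < t0" "0 < t" using t eps by auto
 have x: "x : comp0" "rd x0 x <= R'" using cb[OF xK] by auto
 have "rd x0 x < R'"
 proof (rule ccontr)
  assume "\<not> rd x0 x < R'"
  hence "?B x = bar R k (R'\<^sup>2)" using x by simp
  moreover have "0 < 1 / (cc * (t - eps))" by (intro divide_pos_pos mult_pos_pos[OF cc_pos]) (use t in auto)
  moreover have "Qm t x <= M" using cb0_iff[of R x] x R R'R(2) t by (intro M(2)) auto
  ultimately show False using ge big by linarith
 qed
 note xR = this
 obtain c q H where c: "c : A" "x : cdom c" and jet: "superjet (%y. (rd x0 (cinv c y))^2) (cmap c x) q H"
  and lam: "coord_metric_open.Lam (cimg c) (g c) (cmap c x) q H (V c) <= 2 * m"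
  and gr: "coord_metric.gtr (g c) (cmap c x) (%u v. q u * q v) = 4 * (rd x0 x)^2" using superjet_exists[OF V m ric x(1)] by blast
 interpret H: heat_chart "cimg c" "g c" "V c" "fc c" m be N a p by (rule heat[OF c(1)])
 interpret O: coord_metric_open "cimg c" "g c" by (rule coord_open[OF c(1)])
 let ?y = "cmap c x"
 have Qc: "Qc c = H.Q" by (simp add: Qc_def)
 have Q: "Qm s x = H.Q s ?y" if "0 < s" for s using Qm_eq[OF c that] by (simp add: Qc)
 have mx': "Qm t y - ?B y <= Qm t x - ?B x" if "y : comp0" "rd x0 y < R'" for y using mx[of y] cb0_iff[of R' y] that R'(1) by simp
 note bd = barrier_derivatives[OF c x(1) xR R'R(1) k(1) R t0(2) mx' jet, unfolded Qc]
 have y: "?y : cimg c" by (rule cmap_in[OF c(2)])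
 have time: "- (1 / (cc * (t - eps)^2)) <= H.Qt t ?y"
 proof (rule H.time_bound[OF y t(1) t0(1) t(2) cc_pos])
  fix s assume s: "s : {t0..t}"
  thus "H.Q s ?y - 1 / (cc * (s - eps)) <= H.Q t ?y - 1 / (cc * (t - eps))" using mt[OF s] Q[of s] Q[OF t0(2)] t0 by simp
 qed
 note bp = bar_pos[OF k(1) R sq[OF x(2)]]
 have lin: "linear q" "!!v. linear (%u. H u v)" "!!u. linear (H u)" using jet by (auto simp: superjet_def)
 show False
  by (rule H.barrier_contradiction[OF y t0(2) _ bp(1) less_imp_le[OF bp(2)] less_imp_le[OF bp(3)] lin bd lam[unfolded O.Lam_def] _ refl time _
     bar_inequality[OF R zero_le_power2 sq[OF x(2)] cc_pos be(1) m0 k(2)]]) (use t ge gr Q[OF t0(2)] in auto)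
qed

text \<open>R = sqrt (K / e) turns the error K / R^2 of the localised estimate into e.\<close>

lemma open_bound_limit:
 assumes eps: "0 < eps" "eps < T" shows "Qm T x0 <= 1 / (cc * (T - eps))"
proof (rule field_le_epsilon)
 fix e :: real assume e: "0 < e"
 let ?K = "(4 * m + 25 + 8 / (cc * be)) / cc"
 have "0 < m" using m by (meson of_nat_0_le_iff order_le_less_trans)
 hence "0 < 4 * m + 25 + 8 / (cc * be)" using divide_nonneg_pos[OF _ mult_pos_pos[OF cc_pos be(1)], of 8] by linarith
 hence K0: "0 < ?K" by (rule divide_pos_pos[OF _ cc_pos])
 hence K: "0 < ?K / e" by (rule divide_pos_pos[OF _ e])
 have "z / (sqrt (z / e))^2 = e" if "0 < z" for z using that e by simp
 from this[OF K0] show "Qm T x0 <= 1 / (cc * (T - eps)) + e" using open_bound[OF real_sqrt_gt_zero[OF K] eps] by metis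
qed

end

text \<open>The limit eps -> 0 at fixed \<open>be\<close>; the gradient term from the definition of
  \<open>Q\<close> remains and is removed only when \<open>be\<close> tends to 0.\<close>

lemma (in heat_mfd) Delta_bound:
 assumes T: "0 < T" and c: "c : A" "x : cdom c" and bound: "!!eps. 0 < eps ==> eps < T ==> Qm T x <= 1 / (cc * (T - eps))"
 shows "- (m / (2 * (1 - be) * T)) - be * coord_metric.nsq (cimg c) (g c) (%y. ln (u (cinv c y) T)) (cmap c x)
  <= Delta_V g V c (%z. ln (u z T)) x"
proof -
 interpret H: heat_chart "cimg c" "g c" "V c" "fc c" m be N a p by (rule heat[OF c(1)])
 have lim: "((%eps. 1 / (cc * (T - eps))) \<longlongrightarrow> 1 / (cc * (T - 0))) (at_right 0)"
  using mult_pos_pos[OF cc_pos T] by (intro tendsto_intros) (metis diff_zero less_irrefl)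
 have "Qm T x <= 1 / (cc * (T - 0))" by (rule tendsto_lowerbound[OF lim eventually_at_rightI[of 0 T]]) (use bound T in auto)
 also have "1 / (cc * (T - 0)) = m / (2 * (1 - be) * T)" by simp
 finally have "H.Q T (cmap c x) <= m / (2 * (1 - be) * T)" unfolding Qm_eq[OF c T] Qc_def .
 thus ?thesis unfolding H.Q_eq[OF cmap_in[OF c(2)] T] Delta_V_def by (simp add: fc_def o_def)
qed

theorem theorem2p6:
  fixes b :: "'n::finite"
    and A :: "('a::{t2_space,second_countable_topology}, 'n) chart set"
    and g :: "('a, 'n) tensor2"
    and V :: "('a, 'n) vfield"
    and m :: real
    and N :: nat
    and p a :: "nat \<Rightarrow> real"
    and u :: "'a \<Rightarrow> real \<Rightarrow> real"
  assumes "riemannian_manifold b A g"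
    and "riem_complete A g"
    and "C1_vector_field A V"
    and "m > real CARD('n)"
    and "nonneg_ricci_V_m m A g V"
    and "strict_mono_on {1..N} p"
    and "\<And>i. i \<in> {1..N} \<Longrightarrow> p i \<le> 1"
    and "\<And>i. i \<in> {1..N} \<Longrightarrow> a i \<ge> 0"
    and "smooth_in_space_time A u"
    and "\<And>x t. t > 0 \<Longrightarrow> u x t > 0"
    and "\<And>x t c. t > 0 \<Longrightarrow> c \<in> charts_at A x \<Longrightarrow>
           ((\<lambda>s. u x s) has_real_derivative
              Delta_V g V c (\<lambda>z. u z t) x + (\<Sum>i=1..N. a i * u x t powr p i)) (at t)"
    and "mfd_boundary A = {} \<or>
         compact (UNIV :: 'a set) \<and> convex_boundary b A g \<and> (\<forall>t>0. neumann b A g (\<lambda>z. u z t))"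
  shows "\<forall>x. \<forall>t>0. \<forall>c\<in>charts_at A x. Delta_V g V c (\<lambda>z. ln (u z t)) x + m / (2 * t) \<ge> 0"
proof (intro allI impI ballI)
 fix x :: 'a and T :: real and c assume T: "0 < T" and cx: "c : charts_at A x"
 have c: "c : A" "x : cdom c" using cx by (auto simp: charts_at_def)
 let ?w = "coord_metric.nsq (cimg c) (g c) (%y. ln (u (cinv c y) T)) (cmap c x)"
 let ?F = "Delta_V g V c (%z. ln (u z T)) x"
 \<comment> \<open>\<open>?w\<close> and \<open>?F\<close> are fixed numbers independent of
   \<open>be\<close>, so the limit be -> 0 can be taken afterwards at this one point and
   time.\<close>
 have good: "- (m / (2 * (1 - be) * T)) - be * ?w <= ?F" if be: "0 < be" "be < 1" "ALL i:{1..N}. p i = 1 \<or> be <= 1 - p i" for be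
 proof -
  interpret heat_mfd b A g V m be N a p u
  proof (unfold_locales)
   show "p i = 1 \<or> be <= 1 - p i" if "i : {1..N}" for i using be(3) that by blast
   show "((%s. u x s) has_real_derivative Delta_V g V c (%z. u z t) x + (SUM i=1..N. a i * u x t powr p i)) (at t)"
    if "t > 0" "c : charts_at A x" for x t c using assms(11) that by blast
  qed (use assms(1,3-5,8-10) be in blast)+
  show ?thesis
  proof (rule Delta_bound[OF T c])
   fix eps assume eps: "0 < eps" "eps < T"
   from assms(12) show "Qm T x <= 1 / (cc * (T - eps))"
   proof
    assume "mfd_boundary A = {}"
    \<comment> \<open>The manifold is pointed at x itself, the centre of the balls in the localised
      estimate.\<close>
    then interpret heat_open b A g V m be N a p u x by unfold_locales (use assms(2) in blast)+
    show ?thesis by (rule open_bound_limit[OF eps])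
   next
    assume "compact (UNIV :: 'a set) & convex_boundary b A g & (ALL t>0. neumann b A g (%z. u z t))"
    thus ?thesis by (intro compact_bound eps) auto
   qed
  qed
 qed
 have "\<forall>\<^sub>F be in at_right (0::real). ALL i:{1..N}. p i = 1 \<or> be <= 1 - p i"
 proof (rule eventually_ball_finite[OF _ ballI])
  \<comment> \<open>There are finitely many exponents, so the condition on \<open>be\<close> need
    only hold eventually for each one separately.\<close>
  fix i assume i: "i : {1..N}"
  show "\<forall>\<^sub>F be in at_right (0::real). p i = 1 \<or> be <= 1 - p i"
  proof (cases "p i = 1")
   case False
   hence "0 < 1 - p i" using assms(7)[OF i] by simp
   thus ?thesis by (intro eventually_at_rightI[of 0 "1 - p i"]) auto
  qed simp
 qed simp
 moreover have "\<forall>\<^sub>F be in at_right (0::real). 0 < be & be < 1" by (rule eventually_at_rightI[of 0 1]) auto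
 ultimately have ev: "\<forall>\<^sub>F be in at_right 0. - (m / (2 * (1 - be) * T)) - be * ?w <= ?F" by eventually_elim (use good in blast)
 have "((%be. - (m / (2 * (1 - be) * T)) - be * ?w) \<longlongrightarrow> - (m / (2 * (1 - 0) * T)) - 0 * ?w) (at_right 0)"
  by (intro tendsto_intros) (use T in simp)
 from tendsto_upperbound[OF this ev] have "- (m / (2 * T)) <= ?F" by simp
 thus "0 <= ?F + m / (2 * T)" by simp
qed

end
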